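(* The following statements are equivalent. (1) $({}^\bot\mathcal{GI})^\bot=\mathcal{GI}$ (that is, $({}^\bot\mathcal{GI},\mathcal{GI})$ forms a cotorsion pair in $\mathrm{mod}\,\Lambda$). (2) Every module in $({}^\bot\mathcal{GI})^\bot$ is 1-cotorsionfree. (3) Every module in $({}^\bot\mathcal{GI})^\bot$ is $\infty$-cotorsionfree.
   Context: $\Lambda$ is an artin $R$-algebra over a commutative artin ring $R$; $\mathrm{Mod}\,\Lambda$ is the class of left $\Lambda$-modules and $\mathrm{mod}\,\Lambda$ the class of finitely generated left $\Lambda$-modules. $D=\mathrm{Hom}_R(-,I^0(R/J(R)))$ is the Matlis duality between $\mathrm{mod}\,\Lambda^{op}$ and $\mathrm{mod}\,\Lambda$, where $J(R)$ is the Jacobson radical of $R$ and $I^0(R/J(R))$ is the injective envelope of $R/J(R)$; $D(\Lambda)$ is a $(\Lambda,\Lambda)$-bimodule. A module $M\in\mathrm{Mod}\,\Lambda$ is Gorenstein injective if there is an exact sequence $\cdots\to I_1\to I_0\to I^0\to I^1\to\cdots$ of injective left $\Lambda$-modules which remains exact under $\mathrm{Hom}_\Lambda(E,-)$ and $\mathrm{Hom}_\Lambda(-,E)$ for every injective module $E$, with $M\cong\mathrm{Im}(I_0\to I^0)$. $\mathcal{GI}$ denotes the class of finitely generated Gorenstein injective left $\Lambda$-modules. Put ${}^\bot\mathcal{GI}=\{M\in\mathrm{mod}\,\Lambda\mid \mathrm{Ext}^{i}_\Lambda(M,X)=0 \text{ for all } i\ge1, X\in\mathcal{GI}\}$ and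 $({}^\bot\mathcal{GI})^\bot=\{M\in\mathrm{mod}\,\Lambda\mid \mathrm{Ext}^{i}_\Lambda(Y,M)=0\text{ for all } i\ge1, Y\in{}^\bot\mathcal{GI}\}$. A pair $(\mathcal X,\mathcal Y)$ of subcategories of $\mathrm{mod}\,\Lambda$ is a cotorsion pair if $\mathcal X={}^\bot\mathcal Y$ and $\mathcal Y=\mathcal X^\bot$, where orthogonals are taken in $\mathrm{mod}\,\Lambda$ with respect to all $\mathrm{Ext}^i$, $i\ge1$. For $A\in\mathrm{mod}\,\Lambda$ with minimal injective resolution $0\to A\to I^0(A)\xrightarrow{f^0}I^1(A)\to\cdots$, put $\mathrm{cTr}\,A:=\mathrm{Coker}\big(\mathrm{Hom}_\Lambda(D(\Lambda),f^0)\big)$. $A$ is $n$-cotorsionfree ($n\ge1$) if $\mathrm{Tor}^\Lambda_i(D(\Lambda),\mathrm{cTr}\,A)=0$ for all $1\le i\le n$, and $\infty$-cotorsionfree if this holds for all $n$. *)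

theory Defs
  imports "HOL-Algebra.Algebra" "HOL-Library.Equipollence"
begin

section \<open>Modules over a not necessarily commutative ring\<close>

text \<open>
  The locale \<^locale>\<open>module\<close> of the library requires commutative scalars.  The following locale has the
  same axioms over an arbitrary ring.  Modules are records of type \<^typ>\<open>('a, 'u) module\<close>; the
  ring fields \<open>mult\<close> and \<open>one\<close> of such a record are never used when it serves as a module.

  The category Mod of a ring is represented by the left modules whose elements have type \<^typ>\<open>'u\<close>
  (a universe).  For an infinite type \<^typ>\<open>'u\<close> into which the ring embeds, every finitely generated
  module has a copy in the universe, and the universe is closed under submodules, quotients and
  finite (even countable) direct sums.
\<close>

locale left_module = R?: ring R + M?: abelian_group M
  for R :: "('a, 'x) ring_scheme" (structure) and M :: "('a, 'u) module" (structure) +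
  assumes smult_closed:
      "\<lbrakk>a \<in> carrier R; x \<in> carrier M\<rbrakk> \<Longrightarrow> a \<odot>\<^bsub>M\<^esub> x \<in> carrier M"
    and smult_l_distr:
      "\<lbrakk>a \<in> carrier R; b \<in> carrier R; x \<in> carrier M\<rbrakk> \<Longrightarrow>
        (a \<oplus> b) \<odot>\<^bsub>M\<^esub> x = a \<odot>\<^bsub>M\<^esub> x \<oplus>\<^bsub>M\<^esub> b \<odot>\<^bsub>M\<^esub> x"
    and smult_r_distr:
      "\<lbrakk>a \<in> carrier R; x \<in> carrier M; y \<in> carrier M\<rbrakk> \<Longrightarrow>
        a \<odot>\<^bsub>M\<^esub> (x \<oplus>\<^bsub>M\<^esub> y) = a \<odot>\<^bsub>M\<^esub> x \<oplus>\<^bsub>M\<^esub> a \<odot>\<^bsub>M\<^esub> y"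
    and smult_assoc1:
      "\<lbrakk>a \<in> carrier R; b \<in> carrier R; x \<in> carrier M\<rbrakk> \<Longrightarrow>
        (a \<otimes> b) \<odot>\<^bsub>M\<^esub> x = a \<odot>\<^bsub>M\<^esub> (b \<odot>\<^bsub>M\<^esub> x)"
    and smult_one:
      "x \<in> carrier M \<Longrightarrow> \<one> \<odot>\<^bsub>M\<^esub> x = x"

definition regular_module :: "('a, 'x) ring_scheme \<Rightarrow> ('a, 'a) module"
  where "regular_module R =
    \<lparr>carrier = carrier R, monoid.mult = monoid.mult R, one = one R,
     ring.zero = ring.zero R, add = add R, smult = monoid.mult R\<rparr>"

definition quot_module :: "('a, 'u) module \<Rightarrow> 'u set \<Rightarrow> ('a, 'u set) module"
  where "quot_module M N =
    \<lparr>carrier = a_rcosets\<^bsub>M\<^esub> N, monoid.mult = undefined, one = undefined,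
     ring.zero = N, add = set_add M,
     smult = (\<lambda>a C. \<Union>x\<in>C. N +>\<^bsub>M\<^esub> (a \<odot>\<^bsub>M\<^esub> x))\<rparr>"

text \<open>Homomorphisms are extensional, so that equal homomorphisms are equal functions.\<close>

definition module_hom ::
    "('a, 'x) ring_scheme \<Rightarrow> ('a, 'm) module \<Rightarrow> ('a, 'n) module \<Rightarrow> ('m \<Rightarrow> 'n) set"
  where "module_hom R M N = {f \<in> carrier M \<rightarrow>\<^sub>E carrier N.
    (\<forall>x\<in>carrier M. \<forall>y\<in>carrier M. f (x \<oplus>\<^bsub>M\<^esub> y) = f x \<oplus>\<^bsub>N\<^esub> f y) \<and>
    (\<forall>a\<in>carrier R. \<forall>x\<in>carrier M. f (a \<odot>\<^bsub>M\<^esub> x) = a \<odot>\<^bsub>N\<^esub> f x)}"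

definition module_isomorphic ::
    "('a, 'x) ring_scheme \<Rightarrow> ('a, 'm) module \<Rightarrow> ('a, 'n) module \<Rightarrow> bool"
  where "module_isomorphic R M N \<longleftrightarrow> (\<exists>f\<in>module_hom R M N. bij_betw f (carrier M) (carrier N))"

definition fg_module :: "('a, 'x) ring_scheme \<Rightarrow> ('a, 'u) module \<Rightarrow> bool"
  where "fg_module R M \<longleftrightarrow> left_module R M \<and>
    (\<exists>S. finite S \<and> S \<subseteq> carrier M \<and>
      (\<forall>x\<in>carrier M. \<exists>c\<in>S \<rightarrow> carrier R. x = (\<Oplus>\<^bsub>M\<^esub>s\<in>S. c s \<odot>\<^bsub>M\<^esub> s)))"

definition fg_modules :: "('a, 'x) ring_scheme \<Rightarrow> ('a, 'u) module set"
  where "fg_modules R = {M. fg_module R M}"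

text \<open>Exactness of \<open>A \<rightarrow> B \<rightarrow> C\<close> at \<open>B\<close>, for groups in multiplicative and in additive notation.\<close>

definition exact_at ::
    "('a, 'x) monoid_scheme \<Rightarrow> ('a \<Rightarrow> 'b) \<Rightarrow> ('b, 'y) monoid_scheme \<Rightarrow> ('b \<Rightarrow> 'c) \<Rightarrow>
     ('c, 'z) monoid_scheme \<Rightarrow> bool"
  where "exact_at A f B g C \<longleftrightarrow> f ` carrier A = kernel B C g"

definition a_exact_at ::
    "('a, 'm) module \<Rightarrow> ('m \<Rightarrow> 'n) \<Rightarrow> ('a, 'n) module \<Rightarrow> ('n \<Rightarrow> 'p) \<Rightarrow> ('a, 'p) module \<Rightarrow> bool"
  where "a_exact_at A f B g C \<longleftrightarrow> f ` carrier A = a_kernel B C g"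

definition homology ::
    "('a, 'x) monoid_scheme \<Rightarrow> ('a \<Rightarrow> 'b) \<Rightarrow> 'b monoid \<Rightarrow> ('b \<Rightarrow> 'c) \<Rightarrow>
     ('c, 'z) monoid_scheme \<Rightarrow> 'b set monoid"
  where "homology A f B g C = (B\<lparr>carrier := kernel B C g\<rparr>) Mod (f ` carrier A)"


section \<open>Injective and projective modules, resolutions\<close>

text \<open>Test modules range over the universe in which the given module lives.\<close>

definition injective_module :: "('a, 'x) ring_scheme \<Rightarrow> ('a, 'u) module \<Rightarrow> bool"
  where "injective_module R I \<longleftrightarrow> left_module R I \<and>
    (\<forall>(A :: ('a, 'u) module) (B :: ('a, 'u) module) f g.
       left_module R A \<and> left_module R B \<and>
       f \<in> module_hom R A B \<and> inj_on f (carrier A) \<and> g \<in> module_hom R A I \<longrightarrow>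
       (\<exists>h\<in>module_hom R B I. \<forall>x\<in>carrier A. h (f x) = g x))"

definition projective_module :: "('a, 'x) ring_scheme \<Rightarrow> ('a, 'u) module \<Rightarrow> bool"
  where "projective_module R P \<longleftrightarrow> left_module R P \<and>
    (\<forall>(A :: ('a, 'u) module) (B :: ('a, 'u) module) f g.
       left_module R A \<and> left_module R B \<and>
       f \<in> module_hom R A B \<and> f ` carrier A = carrier B \<and> g \<in> module_hom R P B \<longrightarrow>
       (\<exists>h\<in>module_hom R P A. \<forall>x\<in>carrier P. f (h x) = g x))"

definition essential_submodule :: "('a, 'x) ring_scheme \<Rightarrow> 'u set \<Rightarrow> ('a, 'u) module \<Rightarrow> bool"
  where "essential_submodule R N M \<longleftrightarrow> submodule N R M \<and>
    (\<forall>L. submodule L R M \<and> L \<inter> N = {\<zero>\<^bsub>M\<^esub>} \<longrightarrow> L = {\<zero>\<^bsub>M\<^esub>})"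

definition injective_envelope ::
    "('a, 'x) ring_scheme \<Rightarrow> ('a, 'm) module \<Rightarrow> ('a, 'u) module \<Rightarrow> ('m \<Rightarrow> 'u) \<Rightarrow> bool"
  where "injective_envelope R M I \<iota> \<longleftrightarrow> injective_module R I \<and>
    \<iota> \<in> module_hom R M I \<and> inj_on \<iota> (carrier M) \<and> essential_submodule R (\<iota> ` carrier M) I"

text \<open>A projective resolution \<open>\<dots> \<rightarrow> P 1 \<rightarrow> P 0 \<rightarrow> M \<rightarrow> 0\<close> with \<open>d n : P (n + 1) \<rightarrow> P n\<close> and augmentation
  \<open>\<epsilon> : P 0 \<rightarrow> M\<close>.  Only the modules \<open>P n\<close>, not \<open>M\<close>, need to lie in the universe \<^typ>\<open>'u\<close>.\<close>

definition projective_resolution ::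
    "('a, 'x) ring_scheme \<Rightarrow> ('a, 'm) module \<Rightarrow>
     (nat \<Rightarrow> ('a, 'u) module) \<Rightarrow> (nat \<Rightarrow> 'u \<Rightarrow> 'u) \<Rightarrow> ('u \<Rightarrow> 'm) \<Rightarrow> bool"
  where "projective_resolution R M P d \<epsilon> \<longleftrightarrow>
    (\<forall>n. projective_module R (P n)) \<and>
    (\<forall>n. d n \<in> module_hom R (P (Suc n)) (P n)) \<and>
    \<epsilon> \<in> module_hom R (P 0) M \<and> \<epsilon> ` carrier (P 0) = carrier M \<and>
    a_exact_at (P 1) (d 0) (P 0) \<epsilon> M \<and>
    (\<forall>n. a_exact_at (P (Suc (Suc n))) (d (Suc n)) (P (Suc n)) (d n) (P n))"

definition chosen_proj_res ::
    "('a, 'x) ring_scheme \<Rightarrow> ('a, 'm) module \<Rightarrow>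
     (nat \<Rightarrow> ('a, 'u) module) \<times> (nat \<Rightarrow> 'u \<Rightarrow> 'u) \<times> ('u \<Rightarrow> 'm)"
  where "chosen_proj_res R M = (SOME (P, d, \<epsilon>). projective_resolution R M P d \<epsilon>)"

text \<open>A minimal injective resolution \<open>0 \<rightarrow> A \<rightarrow> I 0 \<rightarrow> I 1 \<rightarrow> \<dots>\<close> with \<open>f n : I n \<rightarrow> I (n + 1)\<close>:
  each term is an injective envelope of the image of the preceding map.\<close>

definition minimal_injective_resolution ::
    "('a, 'x) ring_scheme \<Rightarrow> ('a, 'm) module \<Rightarrow>
     ('m \<Rightarrow> 'u) \<Rightarrow> (nat \<Rightarrow> ('a, 'u) module) \<Rightarrow> (nat \<Rightarrow> 'u \<Rightarrow> 'u) \<Rightarrow> bool"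
  where "minimal_injective_resolution R A \<iota> I f \<longleftrightarrow>
    injective_envelope R A (I 0) \<iota> \<and>
    (\<forall>n. injective_module R (I n)) \<and>
    (\<forall>n. f n \<in> module_hom R (I n) (I (Suc n))) \<and>
    a_exact_at A \<iota> (I 0) (f 0) (I 1) \<and>
    (\<forall>n. a_exact_at (I n) (f n) (I (Suc n)) (f (Suc n)) (I (Suc (Suc n)))) \<and>
    (\<forall>n. essential_submodule R (f n ` carrier (I n)) (I (Suc n)))"

definition chosen_min_inj_res ::
    "('a, 'x) ring_scheme \<Rightarrow> ('a, 'm) module \<Rightarrow>
     ('m \<Rightarrow> 'u) \<times> (nat \<Rightarrow> ('a, 'u) module) \<times> (nat \<Rightarrow> 'u \<Rightarrow> 'u)"
  where "chosen_min_inj_res R A = (SOME (\<iota>, I, f). minimal_injective_resolution R A \<iota> I f)"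


section \<open>Hom, tensor product, Ext and Tor\<close>

definition hom_group ::
    "('a, 'x) ring_scheme \<Rightarrow> ('a, 'm) module \<Rightarrow> ('a, 'n) module \<Rightarrow> ('m \<Rightarrow> 'n) monoid"
  where "hom_group R M N =
    \<lparr>carrier = module_hom R M N,
     monoid.mult = (\<lambda>f g. \<lambda>x\<in>carrier M. f x \<oplus>\<^bsub>N\<^esub> g x),
     one = (\<lambda>x\<in>carrier M. \<zero>\<^bsub>N\<^esub>)\<rparr>"

text \<open>\<open>Hom(M, g)\<close> is \<^term>\<open>\<lambda>f. compose (carrier M) g f\<close>, and \<open>Hom(f, N)\<close> for \<open>f\<close> with
  source \<open>M\<close> is \<^term>\<open>\<lambda>g. compose (carrier M) g f\<close>.\<close>

text \<open>Scalars from a second ring acting on \<open>M\<close> from the right through \<open>act\<close> (\<open>act b x\<close> stands for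
  \<open>x b\<close>) make \<open>Hom(M, N)\<close> a left module over that ring by \<open>(b f) x = f (x b)\<close>.  Likewise a left
  action \<open>act b x = b x\<close> gives a right module structure \<open>(f b) x = f (b x)\<close>, recorded
  with \<open>smult b f\<close> standing for \<open>f b\<close>.\<close>

definition hom_module ::
    "('r, 'x) ring_scheme \<Rightarrow> ('r, 'm) module \<Rightarrow> ('r, 'n) module \<Rightarrow> ('b \<Rightarrow> 'm \<Rightarrow> 'm) \<Rightarrow>
     ('b, 'm \<Rightarrow> 'n) module"
  where "hom_module R M N act =
    \<lparr>carrier = module_hom R M N, monoid.mult = undefined, one = undefined,
     ring.zero = one (hom_group R M N), add = monoid.mult (hom_group R M N),
     smult = (\<lambda>b f. \<lambda>x\<in>carrier M. f (act b x))\<rparr>"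

text \<open>The tensor product of a right module \<open>N\<close> (a record with \<open>smult a x\<close> standing for \<open>x a\<close>) and a
  left module \<open>M\<close>.\<close>

definition tensor_relations ::
    "('a, 'x) ring_scheme \<Rightarrow> ('a, 'n) module \<Rightarrow> ('a, 'm) module \<Rightarrow> ('n \<times> 'm \<Rightarrow>\<^sub>0 int) set"
  where "tensor_relations R N M =
    {frag_of (x \<oplus>\<^bsub>N\<^esub> x', y) - frag_of (x, y) - frag_of (x', y) | x x' y.
       x \<in> carrier N \<and> x' \<in> carrier N \<and> y \<in> carrier M} \<union>
    {frag_of (x, y \<oplus>\<^bsub>M\<^esub> y') - frag_of (x, y) - frag_of (x, y') | x y y'.
       x \<in> carrier N \<and> y \<in> carrier M \<and> y' \<in> carrier M} \<union>
    {frag_of (a \<odot>\<^bsub>N\<^esub> x, y) - frag_of (x, a \<odot>\<^bsub>M\<^esub> y) | a x y.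
       a \<in> carrier R \<and> x \<in> carrier N \<and> y \<in> carrier M}"

definition tensor_kernel ::
    "('a, 'x) ring_scheme \<Rightarrow> ('a, 'n) module \<Rightarrow> ('a, 'm) module \<Rightarrow> ('n \<times> 'm \<Rightarrow>\<^sub>0 int) set"
  where "tensor_kernel R N M =
    generate (free_Abelian_group (carrier N \<times> carrier M)) (tensor_relations R N M)"

definition tensor ::
    "('a, 'x) ring_scheme \<Rightarrow> ('a, 'n) module \<Rightarrow> ('a, 'm) module \<Rightarrow> ('n \<times> 'm \<Rightarrow>\<^sub>0 int) set monoid"
  where "tensor R N M =
    free_Abelian_group (carrier N \<times> carrier M) Mod tensor_kernel R N M"

text \<open>The map \<open>N \<otimes> g\<close> into \<open>N \<otimes> M'\<close>, on cosets; the union is over identical cosets.\<close>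

definition tensor_map ::
    "('a, 'x) ring_scheme \<Rightarrow> ('a, 'n) module \<Rightarrow> ('a, 'm2) module \<Rightarrow> ('m \<Rightarrow> 'm2) \<Rightarrow>
     ('n \<times> 'm \<Rightarrow>\<^sub>0 int) set \<Rightarrow> ('n \<times> 'm2 \<Rightarrow>\<^sub>0 int) set"
  where "tensor_map R N M' g U =
    (\<Union>u\<in>U. tensor_kernel R N M' #>\<^bsub>free_Abelian_group (carrier N \<times> carrier M')\<^esub>
       frag_extend (\<lambda>(x, y). frag_of (x, g y)) u)"

text \<open>Ext and Tor are computed from a chosen projective resolution of \<open>M\<close>.  Both definitions are meant
  for degrees \<open>i \<ge> 1\<close> only; the values at \<open>i = 0\<close> have no significance.\<close>

definition Ext ::
    "('a, 'x) ring_scheme \<Rightarrow> nat \<Rightarrow> ('a, 'u) module \<Rightarrow> ('a, 'u) module \<Rightarrow> ('u \<Rightarrow> 'u) set monoid"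
  where "Ext R i M N =
    (let (P :: nat \<Rightarrow> ('a, 'u) module, d, \<epsilon>) = chosen_proj_res R M in
     homology
       (hom_group R (P (i - 1)) N)
       (\<lambda>g. compose (carrier (P i)) g (d (i - 1)))
       (hom_group R (P i) N)
       (\<lambda>g. compose (carrier (P (i + 1))) g (d i))
       (hom_group R (P (i + 1)) N))"

definition Tor ::
    "('a, 'x) ring_scheme \<Rightarrow> nat \<Rightarrow> ('a, 'n) module \<Rightarrow> ('a, 'm) module \<Rightarrow>
     ('n \<times> 'u \<Rightarrow>\<^sub>0 int) set set monoid"
  where "Tor R i N M =
    (let (P :: nat \<Rightarrow> ('a, 'u) module, d, \<epsilon>) = chosen_proj_res R M in
     homology
       (tensor R N (P (i + 1)))
       (tensor_map R N (P i) (d i))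
       (tensor R N (P i))
       (tensor_map R N (P (i - 1)) (d (i - 1)))
       (tensor R N (P (i - 1))))"


section \<open>Orthogonal classes and cotorsion pairs of finitely generated modules\<close>

definition left_orthogonal ::
    "('a, 'x) ring_scheme \<Rightarrow> ('a, 'u) module set \<Rightarrow> ('a, 'u) module set"
  where "left_orthogonal R \<D> =
    {M \<in> fg_modules R. \<forall>i\<ge>1. \<forall>N\<in>\<D>. trivial_group (Ext R i M N)}"

definition right_orthogonal ::
    "('a, 'x) ring_scheme \<Rightarrow> ('a, 'u) module set \<Rightarrow> ('a, 'u) module set"
  where "right_orthogonal R \<C> =
    {M \<in> fg_modules R. \<forall>i\<ge>1. \<forall>Y\<in>\<C>. trivial_group (Ext R i Y M)}"

definition cotorsion_pair ::
    "('a, 'x) ring_scheme \<Rightarrow> ('a, 'u) module set \<Rightarrow> ('a, 'u) module set \<Rightarrow> bool"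
  where "cotorsion_pair R \<C> \<D> \<longleftrightarrow>
    \<C> \<subseteq> fg_modules R \<and> \<D> \<subseteq> fg_modules R \<and>
    \<C> = left_orthogonal R \<D> \<and> \<D> = right_orthogonal R \<C>"


section \<open>Gorenstein injective modules\<close>

text \<open>The complex \<open>\<dots> \<rightarrow> I\<^sub>1 \<rightarrow> I\<^sub>0 \<rightarrow> I\<^sup>0 \<rightarrow> I\<^sup>1 \<rightarrow> \<dots>\<close> is indexed by the integers, with \<open>I k\<close> for \<open>I\<^sup>k\<close> and
  \<open>I (- 1 - k)\<close> for \<open>I\<^sub>k\<close>, and differentials \<open>d k : I k \<rightarrow> I (k + 1)\<close>.\<close>

definition Gorenstein_injective :: "('a, 'x) ring_scheme \<Rightarrow> ('a, 'u) module \<Rightarrow> bool"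
  where "Gorenstein_injective R M \<longleftrightarrow> left_module R M \<and>
    (\<exists>(I :: int \<Rightarrow> ('a, 'u) module) d.
      (\<forall>k. injective_module R (I k)) \<and>
      (\<forall>k. d k \<in> module_hom R (I k) (I (k + 1))) \<and>
      (\<forall>k. a_exact_at (I k) (d k) (I (k + 1)) (d (k + 1)) (I (k + 2))) \<and>
      (\<forall>(E :: ('a, 'u) module) k. injective_module R E \<longrightarrow>
        exact_at
          (hom_group R E (I k)) (compose (carrier E) (d k))
          (hom_group R E (I (k + 1))) (compose (carrier E) (d (k + 1)))
          (hom_group R E (I (k + 2)))) \<and>
      (\<forall>(E :: ('a, 'u) module) k. injective_module R E \<longrightarrow>
        exact_at
          (hom_group R (I (k + 2)) E) (\<lambda>g. compose (carrier (I (k + 1))) g (d (k + 1)))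
          (hom_group R (I (k + 1)) E) (\<lambda>g. compose (carrier (I k)) g (d k))
          (hom_group R (I k) E)) \<and>
      module_isomorphic R M ((I 0)\<lparr>carrier := d (- 1) ` carrier (I (- 1))\<rparr>))"

definition GI :: "('a, 'x) ring_scheme \<Rightarrow> ('a, 'u) module set"
  where "GI R = {M \<in> fg_modules R. Gorenstein_injective R M}"


section \<open>Artin algebras and the bimodule \<open>D(\<Lambda>)\<close>\<close>

definition artinian_ring :: "('r, 'x) ring_scheme \<Rightarrow> bool"
  where "artinian_ring R \<longleftrightarrow> cring R \<and>
    (\<forall>I. (\<forall>n::nat. ideal (I n) R \<and> I (Suc n) \<subseteq> I n) \<longrightarrow> (\<exists>m. \<forall>n\<ge>m. I n = I m))"

definition artin_algebra :: "('r, 'x) ring_scheme \<Rightarrow> ('r, 'a) module \<Rightarrow> bool"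
  where "artin_algebra R \<Lambda> \<longleftrightarrow>
    artinian_ring R \<and> ring \<Lambda> \<and> module R \<Lambda> \<and>
    (\<forall>r\<in>carrier R. \<forall>x\<in>carrier \<Lambda>. \<forall>y\<in>carrier \<Lambda>.
       (r \<odot>\<^bsub>\<Lambda>\<^esub> x) \<otimes>\<^bsub>\<Lambda>\<^esub> y = r \<odot>\<^bsub>\<Lambda>\<^esub> (x \<otimes>\<^bsub>\<Lambda>\<^esub> y) \<and>
       x \<otimes>\<^bsub>\<Lambda>\<^esub> (r \<odot>\<^bsub>\<Lambda>\<^esub> y) = r \<odot>\<^bsub>\<Lambda>\<^esub> (x \<otimes>\<^bsub>\<Lambda>\<^esub> y)) \<and>
    fg_module R \<Lambda>"

definition jacobson_radical :: "('r, 'x) ring_scheme \<Rightarrow> 'r set"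
  where "jacobson_radical R = carrier R \<inter> \<Inter>{I. maximalideal I R}"

definition residue_module :: "('r, 'x) ring_scheme \<Rightarrow> ('r, 'r set) module"
  where "residue_module R = quot_module (regular_module R) (jacobson_radical R)"

text \<open>With \<open>E\<close> the injective envelope of \<open>R/J(R)\<close>, \<open>D(\<Lambda>) = Hom\<^sub>R(\<Lambda>, E)\<close> has the left action
  \<open>(a f) x = f (x a)\<close> and the right action \<open>(f a) x = f (a x)\<close>.\<close>

definition dual_left ::
    "('r, 'x) ring_scheme \<Rightarrow> ('r, 'a) module \<Rightarrow> ('r, 'e) module \<Rightarrow> ('a, 'a \<Rightarrow> 'e) module"
  where "dual_left R \<Lambda> E = hom_module R \<Lambda> E (\<lambda>a x. x \<otimes>\<^bsub>\<Lambda>\<^esub> a)"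

definition dual_right ::
    "('r, 'x) ring_scheme \<Rightarrow> ('r, 'a) module \<Rightarrow> ('r, 'e) module \<Rightarrow> ('a, 'a \<Rightarrow> 'e) module"
  where "dual_right R \<Lambda> E = hom_module R \<Lambda> E (\<lambda>a x. a \<otimes>\<^bsub>\<Lambda>\<^esub> x)"


section \<open>The cotranspose and cotorsionfree modules\<close>

definition Hom_dual ::
    "('r, 'x) ring_scheme \<Rightarrow> ('r, 'a) module \<Rightarrow> ('r, 'e) module \<Rightarrow> ('a, 'u) module \<Rightarrow>
     ('a, ('a \<Rightarrow> 'e) \<Rightarrow> 'u) module"
  where "Hom_dual R \<Lambda> E N =
    hom_module \<Lambda> (dual_left R \<Lambda> E) N (smult (dual_right R \<Lambda> E))"

definition cTr ::
    "('r, 'x) ring_scheme \<Rightarrow> ('r, 'a) module \<Rightarrow> ('r, 'e) module \<Rightarrow> ('a, 'u) module \<Rightarrow>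
     ('a, (('a \<Rightarrow> 'e) \<Rightarrow> 'u) set) module"
  where "cTr R \<Lambda> E A =
    (let (\<iota>, I :: nat \<Rightarrow> ('a, 'u) module, f) = chosen_min_inj_res \<Lambda> A in
     quot_module (Hom_dual R \<Lambda> E (I 1))
       (compose (carrier (dual_left R \<Lambda> E)) (f 0) ` carrier (Hom_dual R \<Lambda> E (I 0))))"

definition cotorsionfree ::
    "('r, 'x) ring_scheme \<Rightarrow> ('r, 'a) module \<Rightarrow> ('r, 'e) module \<Rightarrow> nat \<Rightarrow> ('a, 'u) module \<Rightarrow> bool"
  where "cotorsionfree R \<Lambda> E n A \<longleftrightarrow>
    (\<forall>i. 1 \<le> i \<and> i \<le> n \<longrightarrow>
      trivial_group
        (Tor \<Lambda> i (dual_right R \<Lambda> E) (cTr R \<Lambda> E A) :: (('a \<Rightarrow> 'e) \<times> 'u \<Rightarrow>\<^sub>0 int) set set monoid))"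

definition infinity_cotorsionfree ::
    "('r, 'x) ring_scheme \<Rightarrow> ('r, 'a) module \<Rightarrow> ('r, 'e) module \<Rightarrow> ('a, 'u) module \<Rightarrow> bool"
  where "infinity_cotorsionfree R \<Lambda> E A \<longleftrightarrow> (\<forall>n\<ge>1. cotorsionfree R \<Lambda> E n A)"

end

theory Submission
 imports Defs
begin

text \<open>The key notion is a \<^emph>\<open>biresolving\<close> class: one in which every module has an injective cover and an
 injective embedding with kernel and cokernel in the class, and \<open>Ext\<^sup>1(J, -)\<close> vanishes on it for injective \<open>J\<close>.
 A finitely generated module is Gorenstein injective iff it belongs to a biresolving class of finitely generated
 modules: lifting homomorphisms from arbitrary injective modules reduces to finitely generated ones by Zorn's lemma,
 and conversely the cycles of a complete resolution can be replaced by finitely generated ones up to injective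
 summands.  If \<open>A\<close> is 1-cotorsionfree then \<open>Tor\<^sub>1(D\<Lambda>, cTr A) = 0\<close> makes the evaluation
 \<open>D\<Lambda> \<otimes> Hom(D\<Lambda>, A) \<rightarrow> A\<close> surjective, so \<open>A\<close> is a quotient of a power of \<open>D\<Lambda>\<close>; if all modules in
 \<open>(\<^sup>\<bottom>GI)\<^sup>\<bottom>\<close> have this property, that class is biresolving and hence contained in \<open>GI\<close>.  For \<open>A\<close> in
 \<open>GI\<close> the functor \<open>Hom(D\<Lambda>, -)\<close> turns the left half of a complete resolution into a resolution of \<open>cTr A\<close> by
 summands of powers of \<open>\<Lambda>\<close>, and tensoring with \<open>D\<Lambda>\<close> recovers the exact complex, so that all \<open>Tor\<close> vanish.\<close>

text \<open>The main obstacle is one of size. The complexes defining Gorenstein injectivity range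
  over all injective modules of the universe, whereas the orthogonal classes and Matlis duality are
  controlled on finitely generated modules only. A biresolving class therefore carries a size
  predicate, and \<open>GI_iff_biresolving\<close> trades \<open>left_module\<close> for
  \<open>fg_module\<close>. For the double orthogonal class the critical axiom is the injective
  cover: its kernel stays in the class because the left orthogonal of \<open>GI\<close> is closed
  under cosyzygies. A second obstacle is typing. Quotients, powers, duals and Hom modules leave the
  universe in which injectivity and projectivity are tested; they are moved back by cardinality, or
  handled by explicit finite bases that give lifting against modules of every type. Finally,
  \<open>Ext\<close>, \<open>Tor\<close> and \<open>cTr\<close> are computed from chosen resolutions
  of which only the defining properties are known, so comparison maps and homotopies have to be
  constructed.\<close>

no_notation BNF_Cardinal_Order_Relation.card_of (\<open>(\<open>open_block notation=\<open>mixfix card_of\<close>\<close>|_|)\<close>)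
abbreviation zero_sub ("0\<^sub>_" [1000] 1000) where "0\<^sub>M \<equiv> \<zero>\<^bsub>M\<^esub>"
abbreviation add_sub ("_ +\<^sub>_ _" [65, 1000, 66] 65) where "x +\<^sub>M y \<equiv> x \<oplus>\<^bsub>M\<^esub> y"
abbreviation minus_sub ("_ -\<^sub>_ _" [65, 1000, 66] 65) where "x -\<^sub>M y \<equiv> x \<ominus>\<^bsub>M\<^esub> y"
abbreviation a_inv_sub ("-\<^sub>_ _" [1000, 81] 80) where "-\<^sub>M x \<equiv> \<ominus>\<^bsub>M\<^esub> x"
abbreviation smult_sub ("_ *\<^sub>_ _" [70, 1000, 71] 70) where "r *\<^sub>M x \<equiv> r \<odot>\<^bsub>M\<^esub> x"
abbreviation mult_sub ("_ \<otimes>\<^sub>_ _" [70, 1000, 71] 70) where "x \<otimes>\<^sub>R y \<equiv> x \<otimes>\<^bsub>R\<^esub> y"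

abbreviation (input) lmod where "lmod \<equiv> left_module"
abbreviation (input) injm where "injm \<equiv> injective_module"
abbreviation (input) reg where "reg \<equiv> regular_module"
abbreviation (input) iff_short (infixr "<->" 25) where "A <-> B \<equiv> A = (B :: bool)"
abbreviation (input) Hom where "Hom \<equiv> module_hom"
abbreviation (input) carr ("|_|") where "|M| \<equiv> carrier M"

section \<open>Modules and homomorphisms\<close>

lemma hom_cl:
 "f:Hom R M N ==> x\<in>|M| ==> f x\<in>|N|"
 by (auto simp: module_hom_def)

lemma hom_add:
 "f:Hom R M N ==> x\<in>|M| ==> y\<in>|M| ==> f (x+\<^sub>M y) = f x+\<^sub>N f y"
 by (auto simp: module_hom_def)

lemma hom_smult:
 "f:Hom R M N ==> a\<in>|R| ==> x\<in>|M| ==> f (a*\<^sub>M x) = a*\<^sub>N f x"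
 by (auto simp: module_hom_def)

lemma hom_eqI:
 assumes "f:Hom R M N" "g:Hom R M N'" "!!x. x\<in>|M| ==> f x = g x"
 shows "f = g"
 using assms by (auto simp: module_hom_def PiE_def intro!: extensionalityI[of f "|M|" g])

lemma module_homI:
 assumes "!!x. x\<in>|M| ==> f x\<in>|N|"
  and "!!x y. x\<in>|M| ==> y\<in>|M| ==> f (x+\<^sub>M y) = f x+\<^sub>N f y"
  and "!!a x. a\<in>|R| ==> x\<in>|M| ==> f (a*\<^sub>M x) = a*\<^sub>N f x"
  and "lmod R M"
 shows "restrict f |M|:Hom R M N"
proof -
 interpret left_module R M by fact
 show ?thesis using assms(1-3) by (auto simp: module_hom_def smult_closed)
qed

lemma left_moduleI:
 fixes R (structure) and M (structure)
 assumes "ring R" "abelian_group M"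
  and "!!a x. a\<in>|R| ==> x\<in>|M| ==> a*\<^sub>M x\<in>|M|"
  and "!!a b x. a\<in>|R| ==> b\<in>|R| ==> x\<in>|M| ==>
    (a\<oplus> b)*\<^sub>M x = a*\<^sub>M x+\<^sub>M b*\<^sub>M x"
  and "!!a x y. a\<in>|R| ==> x\<in>|M| ==> y\<in>|M| ==>
    a*\<^sub>M (x+\<^sub>M y) = a*\<^sub>M x+\<^sub>M a*\<^sub>M y"
  and "!!a b x. a\<in>|R| ==> b\<in>|R| ==> x\<in>|M| ==>
    (a\<otimes> b)*\<^sub>M x = a*\<^sub>M (b*\<^sub>M x)"
  and "!!x. x\<in>|M| ==> \<one> *\<^sub>M x = x"
 shows "lmod R M"
 using assms by (intro left_module.intro left_module_axioms.intro) auto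

section \<open>Scalar arithmetic, submodules and the modules they carry\<close>

context left_module
begin

lemmas sclosed [simp, intro] = smult_closed

lemma smult_l_null [simp]:
 assumes "x\<in>|M|" shows "\<zero> *\<^sub>M x = 0\<^sub>M"
proof -
 have "\<zero> *\<^sub>M x+\<^sub>M \<zero> *\<^sub>M x = \<zero> *\<^sub>M x"
  using smult_l_distr[of \<zero> \<zero> x] assms by simp
 thus ?thesis using assms by (metis M.add.r_cancel_one' R.zero_closed smult_closed)
qed

lemma smult_r_null [simp]:
 assumes "a\<in>|R|" shows "a*\<^sub>M 0\<^sub>M = 0\<^sub>M"
proof -
 have "a*\<^sub>M 0\<^sub>M+\<^sub>M a*\<^sub>M 0\<^sub>M = a*\<^sub>M 0\<^sub>M"
  using smult_r_distr[of a "0\<^sub>M" "0\<^sub>M"] assms by simp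
 thus ?thesis using assms by (metis M.add.r_cancel_one' M.zero_closed smult_closed)
qed

lemma smult_l_minus:
 assumes "a\<in>|R|" "x\<in>|M|" shows "(\<ominus> a)*\<^sub>M x = -\<^sub>M (a*\<^sub>M x)"
proof -
 have "(\<ominus> a)*\<^sub>M x+\<^sub>M a*\<^sub>M x = 0\<^sub>M"
  using smult_l_distr[of "\<ominus> a" a x] assms by (simp add: R.l_neg)
 thus ?thesis using assms by (metis M.minus_equality R.a_inv_closed smult_closed)
qed

lemma smult_r_minus:
 assumes "a\<in>|R|" "x\<in>|M|" shows "a*\<^sub>M (-\<^sub>M x) = -\<^sub>M (a*\<^sub>M x)"
proof -
 have "a*\<^sub>M (-\<^sub>M x)+\<^sub>M a*\<^sub>M x = 0\<^sub>M"
  using smult_r_distr[of a "-\<^sub>M x" x] assms by (simp add: M.l_neg)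
 thus ?thesis using assms by (metis M.minus_equality M.a_inv_closed smult_closed)
qed

text \<open>Negation is multiplication by -1, so closure under scalars yields the closure under
  inverses that \<open>subgroup\<close> asks for.\<close>

lemma submoduleI:
 assumes "H <= |M|" "0\<^sub>M\<in>H"
  and "!!a b. a\<in>H ==> b\<in>H ==> a+\<^sub>M b\<in>H"
  and "!!a x. a\<in>|R| ==> x\<in>H ==> a*\<^sub>M x\<in>H"
 shows "submodule H R M"
proof -
 have "-\<^sub>M a\<in>H" if "a\<in>H" for a
 proof -
  have "a\<in>|M|" using assms that by blast
  hence "-\<^sub>M a = (\<ominus> \<one>)*\<^sub>M a" by (simp add: smult_l_minus smult_one)
  thus ?thesis using assms(4) that by simp
 qed
 thus ?thesis
  using assms by (intro submodule.intro subgroup.intro) (auto simp: submodule_axioms_def a_inv_def)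
qed

lemma submoduleD:
 assumes "submodule H R M"
 shows "H <= |M|" "x\<in>H ==> x\<in>|M|" "0\<^sub>M\<in>H"
  "x\<in>H ==> y\<in>H ==> x+\<^sub>M y\<in>H"
  "x\<in>H ==> -\<^sub>M x\<in>H"
  "x\<in>H ==> y\<in>H ==> x-\<^sub>M y\<in>H"
  "a\<in>|R| ==> x\<in>H ==> a*\<^sub>M x\<in>H"
proof -
 interpret H: submodule H R M by fact
 show "H <= |M|" "x\<in>H ==> x\<in>|M|" "0\<^sub>M\<in>H"
  "x\<in>H ==> y\<in>H ==> x+\<^sub>M y\<in>H" "a\<in>|R| ==> x\<in>H ==> a*\<^sub>M x\<in>H"
  using H.subset H.one_closed H.m_closed H.smult_closed by auto
 show *: "x\<in>H ==> -\<^sub>M x\<in>H" for x using H.m_inv_closed by (simp add: a_inv_def)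
 show "x\<in>H ==> y\<in>H ==> x-\<^sub>M y\<in>H"
  using * H.m_closed by (simp add: a_minus_def)
qed

lemma sub_left_module:
 assumes "submodule H R M"
 shows "lmod R (M(|carrier := H|))"
proof -
 note D = submoduleD[OF assms]
 have "abelian_group (M(|carrier := H|))"
 proof (rule abelian_groupI)
  show "EX y:|M(|carrier := H|)|. y\<oplus>\<^bsub>M(|carrier := H|)\<^esub> x = \<zero>\<^bsub>M(|carrier := H|)\<^esub>"
   if "x\<in>|M(|carrier := H|)|" for x
   using that D(2,5) M.l_neg by auto
 qed (use D in \<open>auto intro: M.a_assoc M.a_comm\<close>)
 thus ?thesis
  using R.ring_axioms D(2,7) by (intro left_moduleI)
   (auto simp: smult_l_distr smult_r_distr smult_assoc1 smult_one)
qed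

lemma incl_hom:
 assumes "submodule H R M"
 shows "(\<lambda>x\<in>H. x):Hom R (M(|carrier := H|)) M"
 using submoduleD[OF assms] by (auto simp: module_hom_def)

lemma submodule_zero: "submodule {0\<^sub>M} R M"
 by (rule submoduleI) auto

lemma submodule_carrier: "submodule |M| R M"
 by (rule submoduleI) auto

lemma add_diff_cancel [simp]:
 assumes "x\<in>|M|" "y\<in>|M|"
 shows "x+\<^sub>M (y-\<^sub>M x) = y" "(y-\<^sub>M x)+\<^sub>M x = y"
  "(x+\<^sub>M y)-\<^sub>M y = x" "(x+\<^sub>M y)-\<^sub>M x = y"
proof -
 show 1: "(y-\<^sub>M x)+\<^sub>M x = y"
  using assms by (simp add: a_minus_def M.a_assoc M.l_neg)
 thus "x+\<^sub>M (y-\<^sub>M x) = y" using assms by (simp add: M.a_comm)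
 show 2: "(x+\<^sub>M y)-\<^sub>M y = x"
  using assms by (simp add: a_minus_def M.a_assoc M.r_neg)
 show "(x+\<^sub>M y)-\<^sub>M x = y"
  using assms by (simp add: a_minus_def M.a_assoc M.r_neg M.a_comm[of x y])
qed

lemma diff_eq_zero_iff:
 assumes "x\<in>|M|" "y\<in>|M|"
 shows "x-\<^sub>M y = 0\<^sub>M <-> x = y"
 by (metis M.r_neg a_minus_def assms add_diff_cancel(2) M.l_zero)

end

lemma left_module_regular: "ring R ==> lmod R (reg R)"
proof -
 assume "ring R"
 then interpret ring R .
 have "abelian_group (reg R)"
 proof (rule abelian_groupI)
  show "EX y:|reg R|. y+\<^sub>(reg R) x = 0\<^sub>(reg R)"
   if "x\<in>|reg R|" for x
   using that l_neg by (auto simp: regular_module_def)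
 qed (auto simp: regular_module_def a_ac)
 thus ?thesis
  by (intro left_moduleI) (auto simp: ring_axioms regular_module_def l_distr r_distr m_assoc)
qed

section \<open>Homomorphisms: arithmetic, images, preimages and kernels\<close>

lemma hom_zero:
 assumes "lmod R M" "lmod R N" "f:Hom R M N"
 shows "f 0\<^sub>M = 0\<^sub>N"
proof -
 interpret M: left_module R M by fact
 interpret N: left_module R N by fact
 have "f 0\<^sub>M = 0\<^sub>R*\<^sub>N f 0\<^sub>M"
  using hom_smult[OF assms(3), of "0\<^sub>R" "0\<^sub>M"] by simp
 thus ?thesis using hom_cl[OF assms(3)] by simp
qed

lemma module_hom_neg:
 assumes "lmod R M" "lmod R N" "f:Hom R M N" "x\<in>|M|"
 shows "f (-\<^sub>M x) = -\<^sub>N f x"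
proof -
 interpret M: left_module R M by fact
 interpret N: left_module R N by fact
 have "-\<^sub>M x = (-\<^sub>R \<one>\<^bsub>R\<^esub>)*\<^sub>M x" "-\<^sub>N f x = (-\<^sub>R \<one>\<^bsub>R\<^esub>)*\<^sub>N f x"
  using assms(4) hom_cl[OF assms(3)]
  by (simp_all add: M.smult_l_minus N.smult_l_minus M.smult_one N.smult_one)
 thus ?thesis using hom_smult[OF assms(3)] assms(4) by simp
qed

lemma hom_minus:
 assumes "lmod R M" "lmod R N" "f:Hom R M N" "x\<in>|M|" "y\<in>|M|"
 shows "f (x-\<^sub>M y) = f x-\<^sub>N f y"
proof -
 interpret M: left_module R M by fact
 show ?thesis using module_hom_neg[OF assms(1-3)] hom_add[OF assms(3)] assms(4,5)
  by (simp add: a_minus_def)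
qed

lemma compose_hom:
 assumes "lmod R A" "f:Hom R A B" "g:Hom R B C"
 shows "compose |A| g f:Hom R A C"
 unfolding compose_def using assms
 by (intro module_homI) (auto simp: hom_add hom_smult hom_cl)

lemma id_hom: "lmod R A ==> (\<lambda>x\<in>|A|. x):Hom R A A"
 by (intro module_homI) auto

lemma zero_hom:
 assumes "lmod R A" "lmod R B"
 shows "(\<lambda>x\<in>|A|. 0\<^sub>B):Hom R A B"
proof -
 interpret A: left_module R A by fact
 interpret B: left_module R B by fact
 show ?thesis by (intro module_homI assms) auto
qed

lemma add_hom:
 assumes "lmod R A" "lmod R B" "f:Hom R A B" "g:Hom R A B"
 shows "(\<lambda>x\<in>|A|. f x+\<^sub>B g x):Hom R A B"
proof -
 interpret A: left_module R A by fact
 interpret B: left_module R B by fact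
 show ?thesis using assms
  by (intro module_homI assms)
   (auto simp: hom_cl hom_add hom_smult B.smult_r_distr B.M.a_ac)
qed

lemma neg_hom:
 assumes "lmod R A" "lmod R B" "f:Hom R A B"
 shows "(\<lambda>x\<in>|A|. -\<^sub>B f x):Hom R A B"
proof -
 interpret A: left_module R A by fact
 interpret B: left_module R B by fact
 show ?thesis using assms
  by (intro module_homI assms)
   (auto simp: hom_cl hom_add hom_smult B.smult_r_minus B.M.minus_add)
qed

lemma minus_hom:
 assumes "lmod R A" "lmod R B" "f:Hom R A B" "g:Hom R A B"
 shows "(\<lambda>x\<in>|A|. f x-\<^sub>B g x):Hom R A B"
proof -
 interpret A: left_module R A by fact
 have "(\<lambda>x\<in>|A|. f x-\<^sub>B g x) =
   (\<lambda>x\<in>|A|. f x+\<^sub>B (\<lambda>x\<in>|A|. -\<^sub>B g x) x)"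
  by (auto simp: a_minus_def)
 thus ?thesis using add_hom[OF assms(1,2,3) neg_hom[OF assms(1,2,4)]] by simp
qed

lemma sum_hom:
 assumes "lmod R A" "lmod R B" "finite S" "!!s. s\<in>S ==> f s:Hom R A B"
 shows "(\<lambda>x\<in>|A|. \<Oplus>\<^bsub>B\<^esub>s\<in>S. f s x):Hom R A B"
 using assms(3,4)
proof (induction S)
 case empty
 interpret B: left_module R B by fact
 show ?case using zero_hom[OF assms(1,2)] by (simp only: B.finsum_empty)
next
 case (insert t S)
 interpret B: left_module R B by fact
 have "f s x\<in>|B|" if "s\<in>insert t S" "x\<in>|A|" for s x
  using insert.prems[OF that(1)] that(2) by (rule hom_cl)
 hence "(\<lambda>x\<in>|A|. \<Oplus>\<^bsub>B\<^esub>s\<in>insert t S. f s x) =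
   (\<lambda>x\<in>|A|. f t x+\<^sub>B (\<lambda>x\<in>|A|. \<Oplus>\<^bsub>B\<^esub>s\<in>S. f s x) x)"
  using insert.hyps by (auto simp: Pi_def intro!: restrict_ext)
 thus ?case
  using add_hom[OF assms(1,2) insert.prems[OF insertI1] insert.IH[OF insert.prems[OF insertI2]]]
  by (simp only:)
qed

lemma submodule_image:
 assumes "lmod R A" "lmod R B" "f:Hom R A B" "submodule S R A"
 shows "submodule (f ` S) R B"
proof -
 interpret A: left_module R A by fact
 interpret B: left_module R B by fact
 note D = A.submoduleD[OF assms(4)]
 show ?thesis
 proof (rule B.submoduleI)
  show "f ` S <= |B|" using D hom_cl[OF assms(3)] by auto
  show "0\<^sub>B\<in>f ` S" using D(3) hom_zero[OF assms(1-3)] by force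
  show "a+\<^sub>B b\<in>f ` S" if "a\<in>f ` S" "b\<in>f ` S" for a b
   using that D(2,4) hom_add[OF assms(3), symmetric] by auto
  show "r*\<^sub>B a\<in>f ` S" if "r\<in>|R|" "a\<in>f ` S" for r a
   using that D(2,7) hom_smult[OF assms(3), symmetric] by auto
 qed
qed

lemma submodule_vimage:
 assumes "lmod R A" "lmod R B" "f:Hom R A B" "submodule S R B"
 shows "submodule {x\<in>|A|. f x\<in>S} R A"
proof -
 interpret A: left_module R A by fact
 interpret B: left_module R B by fact
 note D = B.submoduleD[OF assms(4)]
 show ?thesis using D hom_zero[OF assms(1-3)] hom_add[OF assms(3)] hom_smult[OF assms(3)]
  by (intro A.submoduleI) auto
qed

lemma submodule_kernel:
 assumes "lmod R A" "lmod R B" "f:Hom R A B"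
 shows "submodule (a_kernel A B f) R A"
proof -
 interpret B: left_module R B by fact
 show ?thesis using submodule_vimage[OF assms B.submodule_zero] by (simp add: a_kernel_def')
qed

lemma inj_on_hom_iff:
 assumes "lmod R A" "lmod R B" "f:Hom R A B"
 shows "inj_on f |A| <-> (ALL x:|A|. f x = 0\<^sub>B --> x = 0\<^sub>A)"
proof -
 interpret A: left_module R A by fact
 interpret B: left_module R B by fact
 show ?thesis
 proof
  assume "inj_on f |A|"
  thus "ALL x:|A|. f x = 0\<^sub>B --> x = 0\<^sub>A"
   using hom_zero[OF assms] by (auto simp: inj_on_def)
 next
  assume *: "ALL x:|A|. f x = 0\<^sub>B --> x = 0\<^sub>A"
  show "inj_on f |A|"
  proof (rule inj_onI)
   fix x y assume xy: "x\<in>|A|" "y\<in>|A|" "f x = f y"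
   hence "f (x-\<^sub>A y) = 0\<^sub>B"
    using hom_minus[OF assms] B.diff_eq_zero_iff hom_cl[OF assms(3)] by simp
   thus "x = y" using * xy A.diff_eq_zero_iff[OF xy(1,2)] by simp
  qed
 qed
qed

lemma hom_into_sub:
 assumes "f:Hom R A B" "f ` |A| <= S"
 shows "f:Hom R A (B(|carrier := S|))"
 using assms by (auto simp: module_hom_def PiE_iff)

lemma hom_from_sub:
 assumes "f:Hom R A (B(|carrier := S|))" "S <= |B|"
 shows "f:Hom R A B"
 using assms by (auto simp: module_hom_def PiE_iff)

lemma restrict_hom:
 assumes "lmod R A" "f:Hom R A B" "submodule S R A"
 shows "restrict f S:Hom R (A(|carrier := S|)) B"
proof -
 interpret A: left_module R A by fact
 note D = A.submoduleD[OF assms(3)]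
 show ?thesis using assms(2) D by (auto simp: module_hom_def)
qed

section \<open>Factorization, exact sequences, quotients, products and copies\<close>

text \<open>Elements with the same image under \<open>p\<close> differ by an element of its kernel,
  which \<open>f\<close> kills; hence \<open>f\<close> composed with a set-theoretic section of
  \<open>p\<close> is a homomorphism, although the section itself need not be one.\<close>

lemma factor_surj:
 assumes "lmod R B" "lmod R L" "lmod R N"
  and p: "p:Hom R B L" "p ` |B| = |L|"
  and f: "f:Hom R B N"
  and ker: "!!x. x\<in>|B| ==> p x = 0\<^sub>L ==> f x = 0\<^sub>N"
 shows "EX g:Hom R L N. ALL x:|B|. g (p x) = f x"
proof -
 interpret B: left_module R B by fact
 interpret L: left_module R L by fact
 interpret N: left_module R N by fact
 define s where "s = inv_into |B| p"
 have s: "s y\<in>|B|" "p (s y) = y" if "y\<in>|L|" for y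
  using inv_into_into[of y p "|B|"] f_inv_into_f[of y p "|B|"] that
  unfolding s_def p(2) by auto
 note clf = hom_cl[OF f] and clp = hom_cl[OF p(1)]
 have eq: "f x = f y" if "x\<in>|B|" "y\<in>|B|" "p x = p y" for x y
 proof -
  have "p (x-\<^sub>B y) = p x-\<^sub>L p y"
   by (rule hom_minus[OF assms(1,2) p(1) that(1,2)])
  also have "... = 0\<^sub>L"
   using L.diff_eq_zero_iff[OF clp clp] that by blast
  finally have "f (x-\<^sub>B y) = 0\<^sub>N"
   using that by (intro ker) auto
  hence "f x-\<^sub>N f y = 0\<^sub>N"
   using hom_minus[OF assms(1,3) f that(1,2)] by (simp only:)
  thus ?thesis using N.diff_eq_zero_iff[OF clf clf] that by blast
 qed
 let ?a = "\<lambda>y\<in>|L|. f (s y)"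
 have "?a:Hom R L N"
 proof (rule module_homI)
  fix x y assume *: "x\<in>|L|" "y\<in>|L|"
  have "f (s (x+\<^sub>L y)) = f (s x+\<^sub>B s y)"
   using * by (intro eq) (simp_all only: hom_add[OF p(1)] s L.M.a_closed B.M.a_closed)
  thus "f (s (x+\<^sub>L y)) = f (s x)+\<^sub>N f (s y)"
   by (simp only: hom_add[OF f] s *)
 next
  fix a x assume *: "a\<in>|R|" "x\<in>|L|"
  have "f (s (a*\<^sub>L x)) = f (a*\<^sub>B s x)"
   using * by (intro eq) (simp_all only: hom_smult[OF p(1)] s L.smult_closed B.smult_closed)
  thus "f (s (a*\<^sub>L x)) = a*\<^sub>N f (s x)"
   by (simp only: hom_smult[OF f] s *)
 qed (simp_all add: assms clf s)
 moreover have "?a (p x) = f x" if "x\<in>|B|" for x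
  using eq[OF s(1)[OF clp[OF that]] that s(2)[OF clp[OF that]]] clp[OF that] by simp
 ultimately show ?thesis by blast
qed

text \<open>Dual to \<open>factor_surj\<close>: \<open>i\<close> is invertible as a function on its
  image, and its injectivity turns each homomorphism law into an identity that can be checked after
  applying \<open>i\<close>.\<close>

lemma factor_mono:
 assumes "lmod R A" "lmod R Y"
  and i: "i:Hom R A B" "inj_on i |A|"
  and f: "f:Hom R Y B" "!!x. x\<in>|Y| ==> f x\<in>i ` |A|"
 shows "EX g:Hom R Y A. ALL x:|Y|. i (g x) = f x"
proof -
 interpret A: left_module R A by fact
 interpret Y: left_module R Y by fact
 define s where "s = inv_into |A| i"
 have s: "s y\<in>|A|" "i (s y) = y" if "y\<in>i ` |A|" for y
  using that by (auto simp: s_def inv_into_into f_inv_into_f)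
 have "(\<lambda>x\<in>|Y|. s (f x)):Hom R Y A"
 proof (rule module_homI)
  fix x y assume *: "x\<in>|Y|" "y\<in>|Y|"
  hence "f x+\<^sub>B f y\<in>i ` |A|" using f(2)[of "x+\<^sub>Y y"] by (simp add: hom_add[OF f(1)])
  thus "s (f (x+\<^sub>Y y)) = s (f x)+\<^sub>A s (f y)"
   using * s(1)[OF f(2)] s by (intro inj_onD[OF i(2)])
    (simp_all add: hom_add[OF i(1)] hom_add[OF f(1)] s(2) f(2))
 next
  fix a x assume *: "a\<in>|R|" "x\<in>|Y|"
  hence "a*\<^sub>B f x\<in>i ` |A|" using f(2)[of "a*\<^sub>Y x"] by (simp add: hom_smult[OF f(1)])
  thus "s (f (a*\<^sub>Y x)) = a*\<^sub>A s (f x)"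
   using * s(1)[OF f(2)] s by (intro inj_onD[OF i(2)])
    (simp_all add: hom_smult[OF i(1)] hom_smult[OF f(1)] s(2) f(2))
 qed (use s f(2) assms in auto)
 thus ?thesis using s f(2) by (intro bexI) auto
qed

text \<open>The three terms may have different element types, since kernels, quotients and products
  leave the universe. The rules \<open>sesD\<close> and \<open>sesI\<close> make exactness in the
  middle available elementwise.\<close>

definition ses ::
  "('a, 'x) ring_scheme => ('a, 'k) module => ('k => 'b) => ('a, 'b) module => ('b => 'c) =>
   ('a, 'c) module => bool"
 where "ses R A i B p C <-> lmod R A & lmod R B & lmod R C &
  i:Hom R A B & p:Hom R B C & inj_on i |A| &
  p ` |B| = |C| & a_exact_at A i B p C"

lemma sesD:
 assumes "ses R A i B p C"
 shows "lmod R A" "lmod R B" "lmod R C" "i:Hom R A B"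
  "p:Hom R B C" "inj_on i |A|" "p ` |B| = |C|"
  "i ` |A| = {x\<in>|B|. p x = 0\<^sub>C}"
  "x\<in>|A| ==> p (i x) = 0\<^sub>C"
  "y\<in>|B| ==> p y = 0\<^sub>C ==> EX x:|A|. y = i x"
proof -
 show *: "i ` |A| = {x\<in>|B|. p x = 0\<^sub>C}"
  using assms by (simp add: ses_def a_exact_at_def a_kernel_def')
 show "p (i x) = 0\<^sub>C" if "x\<in>|A|"
  using imageI[OF that, of i] unfolding * by simp
 show "EX x:|A|. y = i x" if "y\<in>|B|" "p y = 0\<^sub>C"
  using that unfolding image_iff[symmetric] * by simp
qed (use assms in \<open>simp_all add: ses_def\<close>)

lemma sesI:
 assumes "lmod R A" "lmod R B" "lmod R C" "i:Hom R A B"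
  "p:Hom R B C" "inj_on i |A|" "p ` |B| = |C|"
  "!!x. x\<in>|A| ==> p (i x) = 0\<^sub>C"
  "!!y. y\<in>|B| ==> p y = 0\<^sub>C ==> EX x:|A|. y = i x"
 shows "ses R A i B p C"
proof -
 have "i ` |A| = a_kernel B C p"
  using assms(8,9) hom_cl[OF assms(4)] unfolding a_kernel_def' by blast
 thus ?thesis using assms by (auto simp: ses_def a_exact_at_def)
qed

lemma ses_kernel:
 assumes "lmod R A" "lmod R B" "p:Hom R A B" "p ` |A| = |B|"
 shows "ses R (A(|carrier := a_kernel A B p|)) (\<lambda>x\<in>a_kernel A B p. x) A p B"
proof -
 interpret A: left_module R A by fact
 note K = submodule_kernel[OF assms(1-3)]
 show ?thesis
 proof (rule sesI[OF A.sub_left_module[OF K] assms(1,2) A.incl_hom[OF K] assms(3) _ assms(4)])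
  show "inj_on (\<lambda>x\<in>a_kernel A B p. x) |A(|carrier := a_kernel A B p|)|"
   by (simp add: inj_on_def)
 qed (simp_all add: a_kernel_def')
qed

lemma left_module_quot:
 assumes "lmod R M" "submodule N R M"
 shows "lmod R (quot_module M N)"
  "(\<lambda>x\<in>|M|. N +>\<^bsub>M\<^esub> x):Hom R M (quot_module M N)"
  "(\<lambda>x\<in>|M|. N +>\<^bsub>M\<^esub> x) ` |M| = |quot_module M N|"
  "!!x. x\<in>|M| ==> N +>\<^bsub>M\<^esub> x = 0\<^sub>(quot_module M N) <-> x\<in>N"
proof -
 interpret M: left_module R M by fact
 note D = M.submoduleD[OF assms(2)]
 have "additive_subgroup N M"
  using assms(2) by (auto simp: additive_subgroup_def submodule_def)
 hence "abelian_subgroup N M"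
  using M.abelian_group_axioms by (metis abelian_subgroupI3)
 then interpret N: abelian_subgroup N M .
 let ?Q = "quot_module M N"
 have carr: "|?Q| = (%x. N +>\<^bsub>M\<^esub> x) ` |M|"
  by (auto simp: quot_module_def A_RCOSETS_def')
 have eq: "N +>\<^bsub>M\<^esub> x = N +>\<^bsub>M\<^esub> y <-> x-\<^sub>M y\<in>N" if "x\<in>|M|" "y\<in>|M|" for x y
 proof
  assume "N +>\<^bsub>M\<^esub> x = N +>\<^bsub>M\<^esub> y"
  hence "x\<in>N +>\<^bsub>M\<^esub> y" using N.a_rcos_self[OF that(1)] by simp
  thus "x-\<^sub>M y\<in>N"
   using N.a_rcos_module_imp[OF that(2)] by (simp add: a_minus_def)
 next
  assume "x-\<^sub>M y\<in>N"
  hence "x\<in>N +>\<^bsub>M\<^esub> y"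
   using N.a_rcos_module_rev[OF that(2,1)] by (simp add: a_minus_def)
  thus "N +>\<^bsub>M\<^esub> x = N +>\<^bsub>M\<^esub> y" using N.a_repr_independence'[OF _ that(2)] by simp
 qed
 have add: "(N +>\<^bsub>M\<^esub> x)+\<^sub>?Q (N +>\<^bsub>M\<^esub> y) = N +>\<^bsub>M\<^esub> (x+\<^sub>M y)"
  if "x\<in>|M|" "y\<in>|M|" for x y
  using N.a_rcos_sum[OF that] by (simp add: quot_module_def)
 \<comment> \<open>By definition the scalar multiple of a coset is a union over all its
   representatives. The union collapses because multiples of two representatives differ by a
   multiple of an element of \<open>N\<close>.\<close>
 have smul: "a*\<^sub>?Q (N +>\<^bsub>M\<^esub> x) = N +>\<^bsub>M\<^esub> (a*\<^sub>M x)"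
  if "a\<in>|R|" "x\<in>|M|" for a x
 proof -
  have "N +>\<^bsub>M\<^esub> (a*\<^sub>M y) = N +>\<^bsub>M\<^esub> (a*\<^sub>M x)" if y: "y\<in>N +>\<^bsub>M\<^esub> x" for y
  proof -
   obtain n where n: "n\<in>N" "y = n+\<^sub>M x" using y by (auto simp: a_r_coset_def')
   have nM: "n\<in>|M|" using D(2) n by blast
   have "a*\<^sub>M y-\<^sub>M a*\<^sub>M x = a*\<^sub>M n"
    using nM n(2) \<open>a \<in> carrier R\<close> \<open>x \<in> carrier M\<close> by (simp add: M.smult_r_distr)
   hence "a*\<^sub>M y-\<^sub>M a*\<^sub>M x\<in>N" using D(7)[OF \<open>a \<in> carrier R\<close> n(1)] by simp
   moreover have "a*\<^sub>M y\<in>|M|" using nM n(2) \<open>a \<in> carrier R\<close> \<open>x \<in> carrier M\<close> by simp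
   ultimately show ?thesis using eq \<open>a \<in> carrier R\<close> \<open>x \<in> carrier M\<close> by blast
  qed
  moreover have "x\<in>N +>\<^bsub>M\<^esub> x" using N.a_rcos_self[OF that(2)] .
  ultimately have "(\<Union>y\<in>N +>\<^bsub>M\<^esub> x. N +>\<^bsub>M\<^esub> (a*\<^sub>M y)) = N +>\<^bsub>M\<^esub> (a*\<^sub>M x)" by blast
  thus ?thesis by (simp add: quot_module_def)
 qed
 have zero: "0\<^sub>?Q = N +>\<^bsub>M\<^esub> 0\<^sub>M"
  using D(1) by (simp add: quot_module_def)
 have "abelian_group ?Q"
 proof (rule abelian_groupI)
  show "EX y:|?Q|. y+\<^sub>?Q x = 0\<^sub>?Q" if "x\<in>|?Q|" for x
  proof -
   obtain m where m: "m\<in>|M|" "x = N +>\<^bsub>M\<^esub> m" using \<open>x \<in> _\<close> carr by auto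
   hence "(N +>\<^bsub>M\<^esub> (-\<^sub>M m))+\<^sub>?Q x = 0\<^sub>?Q" by (simp add: add zero M.M.l_neg)
   thus ?thesis using m carr by auto
  qed
 qed (auto simp: carr zero add M.M.a_ac)
 thus mod: "lmod R ?Q"
  by (intro left_moduleI)
    (auto simp: carr add smul M.R.ring_axioms M.smult_l_distr M.smult_r_distr M.smult_assoc1 M.smult_one)
 let ?a = "\<lambda>x\<in>|M|. N +>\<^bsub>M\<^esub> x"
 show "?a:Hom R M ?Q"
  by (rule module_homI) (auto simp: carr add smul assms)
 show "?a ` |M| = |?Q|"
  by (auto simp: carr)
 show "N +>\<^bsub>M\<^esub> x = 0\<^sub>?Q <-> x\<in>N" if "x\<in>|M|" for x
 proof -
  have "x-\<^sub>M 0\<^sub>M = x" using that by (metis M.M.r_zero M.M.zero_closed M.add_diff_cancel(3))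
  thus ?thesis using eq[OF that, of "0\<^sub>M"] by (simp add: zero)
 qed
qed

definition prod_module :: "('a, 'm) module => ('a, 'n) module => ('a, 'm\<times>'n) module"
 where "prod_module A B =
  (|carrier = |A|\<times>|B|, monoid.mult = undefined, one = undefined,
   ring.zero = (0\<^sub>A, 0\<^sub>B), add = (%x y. (fst x+\<^sub>A fst y, snd x+\<^sub>B snd y)),
   smult = (%a x. (a*\<^sub>A fst x, a*\<^sub>B snd x))|)"

lemma prod_module_simps [simp]:
 "|prod_module A B| = |A|\<times>|B|"
 "0\<^sub>(prod_module A B) = (0\<^sub>A, 0\<^sub>B)"
 "x+\<^sub>(prod_module A B) y = (fst x+\<^sub>A fst y, snd x+\<^sub>B snd y)"
 "a*\<^sub>(prod_module A B) x = (a*\<^sub>A fst x, a*\<^sub>B snd x)"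
 by (simp_all add: prod_module_def)

lemma left_module_prod:
 assumes "lmod R A" "lmod R B"
 shows "lmod R (prod_module A B)"
proof -
 interpret A: left_module R A by fact
 interpret B: left_module R B by fact
 let ?a = "prod_module A B"
 have "abelian_group ?a"
 proof (rule abelian_groupI)
  fix x assume "x\<in>|?a|"
  hence "(-\<^sub>A fst x, -\<^sub>B snd x)+\<^sub>?a x = 0\<^sub>?a"
   "(-\<^sub>A fst x, -\<^sub>B snd x)\<in>|?a|"
   by (auto simp: A.M.l_neg B.M.l_neg)
  thus "EX y:|?a|. y+\<^sub>?a x = 0\<^sub>?a"
   by blast
 qed (auto simp: A.M.a_ac B.M.a_ac)
 thus ?thesis
  by (intro left_moduleI)
    (auto simp: A.ring_axioms A.smult_l_distr A.smult_r_distr A.smult_assoc1 A.smult_one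
     B.smult_l_distr B.smult_r_distr B.smult_assoc1 B.smult_one)
qed

lemma hom_to_prod:
 assumes "lmod R Y" "lmod R A" "lmod R B"
  and "f:Hom R Y A" "g:Hom R Y B"
 shows "(\<lambda>x\<in>|Y|. (f x, g x)):Hom R Y (prod_module A B)"
 using hom_cl[OF assms(4)] hom_cl[OF assms(5)]
 by (intro module_homI assms(1))
   (auto simp: hom_add[OF assms(4)] hom_add[OF assms(5)]
    hom_smult[OF assms(4)] hom_smult[OF assms(5)])

lemma hom_from_prod:
 assumes "lmod R Y" "lmod R A" "lmod R B"
  and "f:Hom R A Y" "g:Hom R B Y"
 shows "(\<lambda>x\<in>|A|\<times>|B|. f (fst x)+\<^sub>Y g (snd x)):Hom R (prod_module A B) Y"
proof -
 interpret Y: left_module R Y by fact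
 note cl = hom_cl[OF assms(4)] hom_cl[OF assms(5)]
 have "restrict (%x. f (fst x)+\<^sub>Y g (snd x)) |prod_module A B|:Hom R (prod_module A B) Y"
  using cl
  by (intro module_homI left_module_prod assms)
   (auto simp: hom_add[OF assms(4)] hom_add[OF assms(5)] Y.M.a_ac
    hom_smult[OF assms(4)] hom_smult[OF assms(5)] Y.smult_r_distr)
 thus ?thesis by simp
qed

text \<open>Both directions are carried as explicit homomorphisms, so that data can be transported
  either way by composition.\<close>

definition module_iso ::
  "('a, 'x) ring_scheme => ('a, 'm) module => ('a, 'n) module => ('m => 'n) => ('n => 'm) => bool"
 where "module_iso R M N f g <-> lmod R M & lmod R N &
  f:Hom R M N & g:Hom R N M &
  (ALL x:|M|. g (f x) = x) & (ALL y:|N|. f (g y) = y)"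

lemma module_isoD:
 assumes "module_iso R M N f g"
 shows "lmod R M" "lmod R N" "f:Hom R M N" "g:Hom R N M"
  "x\<in>|M| ==> g (f x) = x" "y\<in>|N| ==> f (g y) = y"
  "inj_on f |M|" "inj_on g |N|" "f ` |M| = |N|" "g ` |N| = |M|"
  "x\<in>|M| ==> f x\<in>|N|" "y\<in>|N| ==> g y\<in>|M|"
proof -
 show h: "lmod R M" "lmod R N" "f:Hom R M N" "g:Hom R N M"
  and 1: "x\<in>|M| ==> g (f x) = x" and 2: "y\<in>|N| ==> f (g y) = y" for x y
  using assms by (auto simp: module_iso_def)
 show 3: "x\<in>|M| ==> f x\<in>|N|" and 4: "y\<in>|N| ==> g y\<in>|M|" for x y
  by (rule hom_cl[OF h(3)] hom_cl[OF h(4)]; assumption)+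
 show "inj_on f |M|" by (rule inj_on_inverseI[of _ g]) (rule 1)
 show "inj_on g |N|" by (rule inj_on_inverseI[of _ f]) (rule 2)
 show "f ` |M| = |N|" using 2 3 4 by force
 show "g ` |N| = |M|" using 1 3 4 by force
qed

lemma module_iso_of_bij:
 assumes "lmod R M" "lmod R N" "f:Hom R M N"
  "inj_on f |M|" "f ` |M| = |N|"
 shows "EX g. module_iso R M N f g"
proof -
 have "(\<lambda>y\<in>|N|. y) x\<in>f ` |M|" if "x\<in>|N|" for x
  using assms(5) that by simp
 then obtain g where g: "g:Hom R N M" "ALL y:|N|. f (g y) = (\<lambda>y\<in>|N|. y) y"
  using factor_mono[OF assms(1,2,3,4) id_hom[OF assms(2)]] by blast
 have "g (f x) = x" if "x\<in>|M|" for x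
  using g that assms(4) hom_cl[OF g(1)] hom_cl[OF assms(3)]
  by (intro inj_onD[OF assms(4)]) auto
 hence "module_iso R M N f g" using g assms by (auto simp: module_iso_def)
 thus ?thesis by blast
qed

text \<open>Transport of structure: modules of small cardinality have isomorphic copies in the universe.\<close>

lemma ex_module_copy:
 fixes M :: "('a, 'm) module"
 assumes "lmod R M" "|M|\<lesssim>(UNIV :: 'u set)"
 shows "\<exists>(N :: ('a, 'u) module) f g. module_iso R M N f g"
proof -
 interpret M: left_module R M by fact
 obtain h :: "'m => 'u" where h: "inj_on h |M|"
  using assms(2) by (auto simp: lepoll_def)
 define k where "k = inv_into |M| h"
 have k: "k (h x) = x" if "x\<in>|M|" for x
  using that h by (simp add: k_def inv_into_f_f)
 define N :: "('a, 'u) module" where "N = (|carrier = h ` |M|, monoid.mult = undefined, one = undefined,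
   ring.zero = h 0\<^sub>M, add = (%x y. h (k x+\<^sub>M k y)), smult = (%a x. h (a*\<^sub>M k x))|)"
 have carr: "|N| = h ` |M|" and zero: "0\<^sub>N = h 0\<^sub>M" by (simp_all add: N_def)
 have add: "h x+\<^sub>N h y = h (x+\<^sub>M y)" if "x\<in>|M|" "y\<in>|M|" for x y
  using that by (simp add: N_def k)
 have smul: "a*\<^sub>N h x = h (a*\<^sub>M x)" if "x\<in>|M|" for a x
  using that by (simp add: N_def k)
 have "abelian_group N"
 proof (rule abelian_groupI)
  fix x assume "x\<in>|N|"
  then obtain m where m: "m\<in>|M|" "x = h m" by (auto simp: carr)
  have "h (-\<^sub>M m)\<in>|N|" using m by (simp add: carr)
  moreover have "h (-\<^sub>M m)+\<^sub>N x = 0\<^sub>N" using m by (simp add: add zero M.M.l_neg)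
  ultimately show "EX y:|N|. y+\<^sub>N x = 0\<^sub>N" by blast
 qed (auto simp: carr zero add M.M.a_ac)
 hence N: "lmod R N"
  by (intro left_moduleI)
   (auto simp: carr add smul M.ring_axioms M.smult_l_distr M.smult_r_distr M.smult_assoc1 M.smult_one)
 have "restrict h |M|:Hom R M N"
  by (rule module_homI) (auto simp: carr add smul assms)
 then obtain g where "module_iso R M N (restrict h |M| ) g"
  using module_iso_of_bij[OF assms(1) N, of "restrict h |M|"] h
  by (auto simp: carr inj_on_def)
 thus ?thesis by blast
qed

section \<open>Finitely generated and noetherian modules\<close>

lemma (in left_module) smult_finsum:
 assumes "finite S" "a\<in>|R|" "f\<in>S \<rightarrow> |M|"
 shows "a*\<^sub>M (\<Oplus>\<^bsub>M\<^esub>s\<in>S. f s) = (\<Oplus>\<^bsub>M\<^esub>s\<in>S. a*\<^sub>M f s)"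
 using assms(1,3)
proof (induction S)
 case empty
 show ?case using assms(2) by simp
next
 case (insert t S)
 hence "f t\<in>|M|" "f\<in>S \<rightarrow> |M|" by auto
 thus ?case using insert assms(2) by (simp add: smult_r_distr Pi_def)
qed

lemma hom_finsum:
 assumes "lmod R M" "lmod R N" "f:Hom R M N" "finite S" "g\<in>S \<rightarrow> |M|"
 shows "f (\<Oplus>\<^bsub>M\<^esub>s\<in>S. g s) = (\<Oplus>\<^bsub>N\<^esub>s\<in>S. f (g s))"
proof -
 interpret M: left_module R M by fact
 interpret N: left_module R N by fact
 note cl = hom_cl[OF assms(3)]
 show ?thesis using assms(4,5)
 proof (induction S)
  case empty
  show ?case using hom_zero[OF assms(1-3)] by simp
 next
  case (insert t S)
  hence *: "g t\<in>|M|" "g\<in>S \<rightarrow> |M|" by auto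
  moreover have "(\<Oplus>\<^bsub>M\<^esub>s\<in>S. g s)\<in>|M|" using * by (intro M.M.finsum_closed) auto
  ultimately have "f (g t+\<^sub>M (\<Oplus>\<^bsub>M\<^esub>s\<in>S. g s)) = f (g t)+\<^sub>N (\<Oplus>\<^bsub>N\<^esub>s\<in>S. f (g s))"
   using insert.IH by (simp add: hom_add[OF assms(3)])
  moreover have "(%s. f (g s))\<in>S \<rightarrow> |N|" "f (g t)\<in>|N|" using * cl by auto
  ultimately show ?case using insert.hyps * by simp
 qed
qed

text \<open>Generation as leastness among submodules instead of linear combinations;
  \<open>fg_module_iff\<close> identifies the two. The ambient \<open>M\<close> is fixed while
  \<open>N\<close> varies, so that generation passes to submodules, images and restricted scalars
  without computing sums.\<close>

definition generates :: "('a, 'x) ring_scheme => ('a, 'u) module => 'u set => 'u set => bool"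
 where "generates R M S N <-> S <= N & (ALL N'. submodule N' R M & S <= N' --> N <= N')"

lemma (in left_module) submodule_combinations:
 assumes "finite S" "S <= |M|"
 defines "C \<equiv> {\<Oplus>\<^bsub>M\<^esub>s\<in>S. c s*\<^sub>M s | c. c\<in>S \<rightarrow> |R| }"
 shows "submodule C R M" "S <= C"
proof -
 have cl: "(%s. c s*\<^sub>M s)\<in>S \<rightarrow> |M|" if "c\<in>S \<rightarrow> |R|" for c
  using that assms(2) by auto
 show "submodule C R M"
 proof (rule submoduleI)
  show "C <= |M|" using cl by (auto simp: C_def)
  let ?a = "\<Oplus>\<^bsub>M\<^esub>s\<in>S. \<zero> *\<^sub>M s"
  have "0\<^sub>M = ?a"
  proof -
   have "?a = (\<Oplus>\<^bsub>M\<^esub>s\<in>S. 0\<^sub>M)"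
    using assms(2) by (intro M.finsum_cong') auto
   thus ?thesis by simp
  qed
  thus "0\<^sub>M\<in>C" by (auto simp: C_def)
 next
  fix a b assume "a\<in>C" "b\<in>C"
  then obtain c d where c: "c\<in>S \<rightarrow> |R|" "a = (\<Oplus>\<^bsub>M\<^esub>s\<in>S. c s*\<^sub>M s)"
   and d: "d\<in>S \<rightarrow> |R|" "b = (\<Oplus>\<^bsub>M\<^esub>s\<in>S. d s*\<^sub>M s)" by (auto simp: C_def)
  have "a+\<^sub>M b = (\<Oplus>\<^bsub>M\<^esub>s\<in>S. c s*\<^sub>M s+\<^sub>M d s*\<^sub>M s)"
   using cl[OF c(1)] cl[OF d(1)] by (simp add: c d M.finsum_addf)
  also have "... = (\<Oplus>\<^bsub>M\<^esub>s\<in>S. (c s\<oplus> d s)*\<^sub>M s)"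
   using assms(2) c d by (intro M.finsum_cong') (auto simp: Pi_iff subset_iff smult_l_distr)
  finally show "a+\<^sub>M b\<in>C" unfolding C_def using c d by (intro CollectI exI[of _ "%s. c s\<oplus> d s"]) auto
 next
  fix r a assume r: "r\<in>|R|" and "a\<in>C"
  then obtain c where c: "c\<in>S \<rightarrow> |R|" "a = (\<Oplus>\<^bsub>M\<^esub>s\<in>S. c s*\<^sub>M s)" by (auto simp: C_def)
  have "r*\<^sub>M a = (\<Oplus>\<^bsub>M\<^esub>s\<in>S. r*\<^sub>M (c s*\<^sub>M s))"
   unfolding c(2) by (rule smult_finsum[OF assms(1) r cl[OF c(1)]])
  also have "... = (\<Oplus>\<^bsub>M\<^esub>s\<in>S. (r\<otimes> c s)*\<^sub>M s)"
   using assms(2) c r by (intro M.finsum_cong') (auto simp: Pi_iff subset_iff smult_assoc1)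
  finally show "r*\<^sub>M a\<in>C" unfolding C_def using c r by (intro CollectI exI[of _ "%s. r\<otimes> c s"]) auto
 qed
 show "S <= C"
 proof
  fix t assume t: "t\<in>S"
  hence tM: "t\<in>|M|" using assms(2) by blast
  have "(\<Oplus>\<^bsub>M\<^esub>s\<in>S. (if s = t then \<one> else \<zero>)*\<^sub>M s) = (\<Oplus>\<^bsub>M\<^esub>s\<in>S. if t = s then s else 0\<^sub>M)"
   using assms(2) by (intro M.finsum_cong') (auto simp: smult_one subset_iff)
  also have "... = t" using M.finsum_singleton[OF t assms(1), of "%s. s"] assms(2) by auto
  finally show "t\<in>C" unfolding C_def
   by (intro CollectI exI[of _ "%s. if s = t then \<one> else \<zero>"]) auto
 qed
qed

lemma (in left_module) submodule_finsum:
 assumes "submodule N R M" "finite S" "f\<in>S \<rightarrow> N"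
 shows "(\<Oplus>\<^bsub>M\<^esub>s\<in>S. f s)\<in>N"
 using assms(2,3)
proof (induction S)
 case empty
 show ?case using submoduleD[OF assms(1)] by simp
next
 case (insert t S)
 have N: "f t\<in>N" "f\<in>S \<rightarrow> N" using insert.prems by auto
 hence "f t\<in>|M|" "f\<in>S \<rightarrow> |M|"
  using submoduleD(1)[OF assms(1)] by auto
 thus ?case using insert submoduleD(4)[OF assms(1)] N by simp
qed

lemma fg_module_iff:
 "fg_module R M <-> lmod R M & (EX S. finite S & generates R M S |M| )"
proof
 assume "fg_module R M"
 then obtain S where M: "lmod R M" and S: "finite S" "S <= |M|"
  "!!x. x\<in>|M| ==> EX c:S \<rightarrow> |R|. x = (\<Oplus>\<^bsub>M\<^esub>s\<in>S. c s*\<^sub>M s)"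
  by (auto simp: fg_module_def)
 interpret left_module R M by fact
 have "generates R M S |M|"
  unfolding generates_def
 proof (intro conjI allI impI subsetI)
  fix N x assume N: "submodule N R M & S <= N" and x: "x\<in>|M|"
  obtain c where c: "c\<in>S \<rightarrow> |R|" "x = (\<Oplus>\<^bsub>M\<^esub>s\<in>S. c s*\<^sub>M s)" using S(3)[OF x] by blast
  show "x\<in>N" unfolding c(2)
   using N c(1) submoduleD(7)[of N] by (intro submodule_finsum S) (auto simp: Pi_iff subset_iff)
 qed (use S in auto)
 thus "lmod R M & (EX S. finite S & generates R M S |M| )" using M S by blast
next
 assume "lmod R M & (EX S. finite S & generates R M S |M| )"
 then obtain S where M: "lmod R M" and S: "finite S" "generates R M S |M|" by blast
 interpret left_module R M by fact
 have SM: "S <= |M|" using S by (simp add: generates_def)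
 note C = submodule_combinations[OF S(1) SM]
 have "|M| <= {\<Oplus>\<^bsub>M\<^esub>s\<in>S. c s*\<^sub>M s | c. c\<in>S \<rightarrow> |R| }"
  using S(2) C by (simp add: generates_def)
 thus "fg_module R M" unfolding fg_module_def using M S(1) SM by blast
qed

lemma (in left_module) submodule_sub_iff:
 assumes "submodule N R M"
 shows "submodule K R (M(|carrier := N|)) <-> submodule K R M & K <= N"
proof -
 interpret N: left_module R "M(|carrier := N|)" by (rule sub_left_module[OF assms])
 note D = submoduleD[OF assms]
 let ?a = "submodule K R (M(|carrier := N|))"
 show ?thesis
 proof
  assume K: "?a"
  hence "K <= N" using N.submoduleD(1) by simp
  moreover have "submodule K R M"
   using N.submoduleD[OF K] D(1) \<open>K \<subseteq> N\<close> by (intro submoduleI) auto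
  ultimately show "submodule K R M & K <= N" by blast
 next
  assume K: "submodule K R M & K <= N"
  thus "?a"
   using submoduleD[of K] by (intro N.submoduleI) auto
 qed
qed

text \<open>A submodule of \<open>M\<close> above \<open>S\<close> may be cut down to its
  intersection with \<open>N\<close>, so leastness inside \<open>N\<close> and leastness inside
  \<open>M\<close> coincide.\<close>

lemma (in left_module) fg_sub_iff:
 assumes "submodule N R M"
 shows "fg_module R (M(|carrier := N|)) <-> (EX S. finite S & generates R M S N)"
proof -
 let ?a = "M(|carrier := N|)"
 have "generates R ?a S N <-> generates R M S N" for S
 proof
  assume g: "generates R ?a S N"
  have "N <= K" if K: "submodule K R M" "S <= K" for K
  proof -
   have "submodule (K \<inter> N) R M"
    using submoduleD[OF K(1)] submoduleD[OF assms] by (intro submoduleI) auto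
   hence "submodule (K \<inter> N) R ?a" by (simp add: submodule_sub_iff[OF assms])
   hence "N <= K \<inter> N" using g K(2) by (auto simp: generates_def)
   thus ?thesis by blast
  qed
  thus "generates R M S N" using g by (auto simp: generates_def)
 next
  assume "generates R M S N"
  thus "generates R ?a S N"
   by (auto simp: generates_def submodule_sub_iff[OF assms])
 qed
 thus ?thesis by (simp add: fg_module_iff sub_left_module[OF assms])
qed

lemma fg_image:
 assumes "fg_module R M" "lmod R N" "f:Hom R M N" "f ` |M| = |N|"
 shows "fg_module R N"
proof -
 have M: "lmod R M" using assms(1) by (simp add: fg_module_def)
 obtain S where S: "finite S" "generates R M S |M|" using assms(1) by (auto simp: fg_module_iff)
 have "generates R N (f ` S) |N|"
  unfolding generates_def
 proof (intro conjI allI impI)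
  show "f ` S <= |N|" using S(2) assms(4) by (auto simp: generates_def)
  fix K assume K: "submodule K R N & f ` S <= K"
  have "S <= {x\<in>|M|. f x\<in>K}" using S(2) K by (auto simp: generates_def)
  hence "|M| <= {x\<in>|M|. f x\<in>K}"
   using S(2) submodule_vimage[OF M assms(2,3)] K by (auto simp: generates_def)
  thus "|N| <= K" using assms(4) by force
 qed
 thus ?thesis using S(1) assms(2) by (auto simp: fg_module_iff)
qed

text \<open>Generators of \<open>A\<close> together with preimages of generators of \<open>C\<close>
  generate \<open>B\<close>: modulo the image of \<open>A\<close>, every \<open>b\<close> agrees
  with an element of any submodule containing the preimages.\<close>

lemma fg_ses:
 assumes "ses R A i B p C" "fg_module R A" "fg_module R C"
 shows "fg_module R B"
proof -
 note D = sesD[OF assms(1)]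
 interpret B: left_module R B by (rule D)
 obtain S where S: "finite S" "generates R A S |A|" using assms(2) by (auto simp: fg_module_iff)
 obtain T where T: "finite T" "generates R C T |C|" using assms(3) by (auto simp: fg_module_iff)
 have "T <= p ` |B|" using T(2) D(7) by (simp add: generates_def)
 then obtain T' where T': "T' <= |B|" "finite T'" "p ` T' = T"
  using T(1) finite_subset_image[of T p "|B|"] by auto
 have "generates R B (i ` S \<union> T') |B|"
  unfolding generates_def
 proof (intro conjI allI impI subsetI)
  fix x assume "x\<in>i ` S \<union> T'"
  thus "x\<in>|B|" using T' S(2) hom_cl[OF D(4)] by (auto simp: generates_def)
 next
  fix K b assume K: "submodule K R B & i ` S \<union> T' <= K" and b: "b\<in>|B|"
  note KD = B.submoduleD[OF K[THEN conjunct1]]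
  have "S <= {x\<in>|A|. i x\<in>K}" using K S(2) by (auto simp: generates_def)
  hence iK: "|A| <= {x\<in>|A|. i x\<in>K}"
   using S(2) submodule_vimage[OF D(1,2,4)] K by (auto simp: generates_def)
  have "T <= p ` K" using T' K by auto
  hence "|C| <= p ` K"
   using T(2) submodule_image[OF D(2,3,5)] K by (auto simp: generates_def)
  then obtain k where k: "k\<in>K" "p b = p k" using b D(7) by blast
  hence "p (b-\<^sub>B k) = p k-\<^sub>C p k"
   using hom_minus[OF D(2,3,5) b KD(2)[OF k(1)]] by simp
  also have "... = 0\<^sub>C"
   using left_module.diff_eq_zero_iff[OF D(3)] hom_cl[OF D(5) KD(2)[OF k(1)]] by blast
  finally obtain x where x: "x\<in>|A|" "b-\<^sub>B k = i x"
   using D(10)[of "b-\<^sub>B k"] b KD(2)[OF k(1)] by auto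
  hence "b-\<^sub>B k\<in>K" using iK by auto
  hence "b-\<^sub>B k+\<^sub>B k\<in>K" using KD(4) k(1) by blast
  thus "b\<in>K" using b KD(2)[OF k(1)] by simp
 qed
 moreover have "finite (i ` S \<union> T')" using S(1) T'(2) by simp
 ultimately show ?thesis using D(2) unfolding fg_module_iff by blast
qed

section \<open>Noetherian modules: submodules, images and extensions\<close>

definition noetherian_module :: "('a, 'x) ring_scheme => ('a, 'u) module => bool"
 where "noetherian_module R M <-> lmod R M &
  (ALL N. submodule N R M --> fg_module R (M(|carrier := N|)))"

lemma noetherian_fg: "noetherian_module R M ==> fg_module R M"
 using left_module.submodule_carrier[of R M] by (force simp: noetherian_module_def)

lemma noetherian_mono:
 assumes "noetherian_module R N" "lmod R M" "f:Hom R M N" "inj_on f |M|"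
 shows "noetherian_module R M"
 unfolding noetherian_module_def
proof (intro conjI allI impI)
 have N: "lmod R N" using assms(1) by (simp add: noetherian_module_def)
 interpret M: left_module R M by fact
 interpret N: left_module R N by fact
 fix K assume K: "submodule K R M"
 note fK = submodule_image[OF assms(2) N assms(3) K]
 have KM: "K <= |M|" by (rule M.submoduleD[OF K])
 let ?a = "N(|carrier := f ` K|)"
 let ?b = "M(|carrier := K|)"
 have "restrict f K:Hom R ?b ?a"
  using restrict_hom[OF assms(2,3) K] by (rule hom_into_sub) auto
 then obtain g where "module_iso R ?b ?a (restrict f K) g"
  using module_iso_of_bij[OF M.sub_left_module[OF K] N.sub_left_module[OF fK], of "restrict f K"]
   inj_on_subset[OF assms(4) KM] by (auto simp: inj_on_def)
 note I = module_isoD[OF this]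
 have "fg_module R ?a" using assms(1) fK by (simp add: noetherian_module_def)
 thus "fg_module R ?b" by (rule fg_image[OF _ I(1,4,10)])
qed (rule assms)

lemma noetherian_image:
 assumes "noetherian_module R M" "lmod R N" "f:Hom R M N" "f ` |M| = |N|"
 shows "noetherian_module R N"
 unfolding noetherian_module_def
proof (intro conjI allI impI)
 have M: "lmod R M" using assms(1) by (simp add: noetherian_module_def)
 interpret N: left_module R N by fact
 fix K assume K: "submodule K R N"
 define L where "L = {x\<in>|M|. f x\<in>K}"
 have L: "submodule L R M" unfolding L_def by (rule submodule_vimage[OF M assms(2,3) K])
 let ?a = "restrict f L"
 let ?b = "M(|carrier := L|)"
 let ?c = "N(|carrier := K|)"
 have "?a:Hom R ?b ?c"
  using restrict_hom[OF M assms(3) L] by (rule hom_into_sub) (auto simp: L_def)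
 moreover have "?a ` L = K"
 proof
  show "K <= ?a ` L"
  proof
   fix y assume y: "y\<in>K"
   hence "y\<in>f ` |M|" using N.submoduleD(1)[OF K] assms(4) by blast
   then obtain x where "x\<in>|M|" "y = f x" by blast
   thus "y\<in>?a ` L" using y by (intro image_eqI[of _ _ x]) (auto simp: L_def)
  qed
 qed (auto simp: L_def)
 moreover have "fg_module R ?b" using assms(1) L by (simp add: noetherian_module_def)
 ultimately show "fg_module R ?c"
  using fg_image[OF _ N.sub_left_module[OF K], of "M(|carrier := L|)" "?a"] by simp
qed (rule assms)

text \<open>A submodule \<open>K\<close> of \<open>B\<close> is an extension of its image in
  \<open>C\<close> by its preimage in \<open>A\<close>, so \<open>fg_ses\<close> applies to
  it.\<close>

lemma noetherian_ses:
 assumes "ses R A i B p C" "noetherian_module R A" "noetherian_module R C"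
 shows "noetherian_module R B"
 unfolding noetherian_module_def
proof (intro conjI allI impI)
 note D = sesD[OF assms(1)]
 interpret A: left_module R A by (rule D)
 interpret B: left_module R B by (rule D)
 interpret C: left_module R C by (rule D)
 fix K assume K: "submodule K R B"
 note KD = B.submoduleD[OF K]
 define L where "L = {x\<in>|A|. i x\<in>K}"
 have L: "submodule L R A" unfolding L_def by (rule submodule_vimage[OF D(1,2,4) K])
 note pK = submodule_image[OF D(2,3,5) K]
 let ?a = "B(|carrier := K|)"
 let ?b = "C(|carrier := p ` K|)"
 let ?c = "A(|carrier := L|)"
 have "ses R ?c (restrict i L) ?a (restrict p K) ?b"
 proof (rule sesI)
  show "restrict i L:Hom R ?c ?a"
   using restrict_hom[OF D(1,4) L] by (rule hom_into_sub) (auto simp: L_def)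
  show "restrict p K:Hom R ?a ?b"
   using restrict_hom[OF D(2,5) K] by (rule hom_into_sub) auto
  show "inj_on (restrict i L) |A(|carrier := L|)|"
   using D(6) by (simp add: inj_on_def L_def)
  fix y assume "y\<in>|B(|carrier := K|)|" "restrict p K y = \<zero>\<^bsub>C(|carrier := p ` K|)\<^esub>"
  hence y: "y\<in>K" "p y = 0\<^sub>C" by auto
  obtain x where "x\<in>|A|" "y = i x" using D(10)[OF KD(2)[OF y(1)] y(2)] ..
  thus "EX x:|A(|carrier := L|)|. y = restrict i L x"
   using y by (auto simp: L_def)
 next
  fix x assume "x\<in>|A(|carrier := L|)|"
  hence "x\<in>|A|" "x\<in>L" "i x\<in>K" by (auto simp: L_def)
  thus "restrict p K (restrict i L x) = \<zero>\<^bsub>C(|carrier := p ` K|)\<^esub>"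
   using D(9)[of x] by simp
 qed (auto intro: A.sub_left_module B.sub_left_module C.sub_left_module L K pK)
 moreover have "fg_module R ?c" "fg_module R ?b"
  using assms(2,3) L pK by (simp_all add: noetherian_module_def)
 ultimately show "fg_module R ?a" by (rule fg_ses)
qed (rule sesD[OF assms(1)])

section \<open>Finite powers, dual bases and projective resolutions\<close>

definition pow_module :: "'s set => ('a, 'm) module => ('a, 's => 'm) module"
 where "pow_module S M =
  (|carrier = S \<rightarrow>\<^sub>E |M|, monoid.mult = undefined, one = undefined,
   ring.zero = (\<lambda>s\<in>S. 0\<^sub>M), add = (%x y. \<lambda>s\<in>S. x s+\<^sub>M y s),
   smult = (%a x. \<lambda>s\<in>S. a*\<^sub>M x s)|)"

lemma pow_module_simps [simp]:
 "|pow_module S M| = S \<rightarrow>\<^sub>E |M|"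
 "0\<^sub>(pow_module S M) = (\<lambda>s\<in>S. 0\<^sub>M)"
 "x+\<^sub>(pow_module S M) y = (\<lambda>s\<in>S. x s+\<^sub>M y s)"
 "a*\<^sub>(pow_module S M) x = (\<lambda>s\<in>S. a*\<^sub>M x s)"
 by (simp_all add: pow_module_def)

lemma PiE_const: "x\<in>S \<rightarrow>\<^sub>E A ==> s\<in>S ==> x s\<in>A"
 by auto

lemma left_module_pow:
 assumes "lmod R M"
 shows "lmod R (pow_module S M)"
proof -
 interpret M: left_module R M by fact
 let ?a = "pow_module S M"
 have "abelian_group ?a"
 proof (rule abelian_groupI)
  fix x assume x: "x\<in>|?a|"
  hence xc: "x s\<in>|M|" if "s\<in>S" for s using that by auto
  let ?b = "\<lambda>s\<in>S. -\<^sub>M x s"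
  have "?b+\<^sub>?a x = 0\<^sub>?a"
   by (auto simp: M.M.l_neg[OF xc] intro!: restrict_ext)
  moreover have "?b\<in>|?a|" using x by auto
  ultimately show "EX y:|?a|. y+\<^sub>?a x = 0\<^sub>?a" by blast
  show "0\<^sub>?a+\<^sub>?a x = x"
   using x by (intro extensionalityI[of _ S]) (auto simp: PiE_const PiE_iff)
 qed (auto simp: M.M.a_ac PiE_const intro!: restrict_ext)
 thus ?thesis
 proof (rule left_moduleI[OF M.ring_axioms])
  fix x assume x: "x\<in>|?a|"
  show "\<one>\<^bsub>R\<^esub> *\<^sub>?a x = x"
   using x by (intro extensionalityI[of _ S]) (auto simp: PiE_const PiE_iff M.smult_one)
 qed (auto simp: M.smult_l_distr M.smult_r_distr M.smult_assoc1 PiE_const intro!: restrict_ext)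
qed

lemma pow_module_homs:
 assumes "lmod R M" "t\<in>S"
 shows "(\<lambda>x\<in>S \<rightarrow>\<^sub>E |M|. x t):Hom R (pow_module S M) M"
  "(\<lambda>x\<in>|M|. \<lambda>s\<in>S. if s = t then x else 0\<^sub>M):Hom R M (pow_module S M)"
proof -
 interpret M: left_module R M by fact
 show "(\<lambda>x\<in>S \<rightarrow>\<^sub>E |M|. x t):Hom R (pow_module S M) M"
  using module_homI[of "pow_module S M" "%x. x t" M R] left_module_pow[OF assms(1)] assms(2)
  by (auto simp: PiE_const)
 show "(\<lambda>x\<in>|M|. \<lambda>s\<in>S. if s = t then x else 0\<^sub>M):Hom R M (pow_module S M)"
  by (rule module_homI) (auto simp: assms intro!: restrict_ext)
qed

lemma hom_to_pow:
 assumes "lmod R Y" "!!s. s\<in>S ==> f s:Hom R Y M"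
 shows "(\<lambda>x\<in>|Y|. \<lambda>s\<in>S. f s x):Hom R Y (pow_module S M)"
proof (rule module_homI[OF _ _ _ assms(1)])
 show "(\<lambda>s\<in>S. f s x)\<in>|pow_module S M|" if "x\<in>|Y|" for x
  using hom_cl[OF assms(2)] that by auto
 show "(\<lambda>s\<in>S. f s (x+\<^sub>Y y)) = (\<lambda>s\<in>S. f s x)+\<^sub>(pow_module S M) (\<lambda>s\<in>S. f s y)"
  if "x\<in>|Y|" "y\<in>|Y|" for x y
  using hom_add[OF assms(2)] that by (auto intro!: restrict_ext)
 show "(\<lambda>s\<in>S. f s (a*\<^sub>Y x)) = a*\<^sub>(pow_module S M) (\<lambda>s\<in>S. f s x)"
  if "a\<in>|R|" "x\<in>|Y|" for a x
  using hom_smult[OF assms(2)] that by (auto intro!: restrict_ext)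
qed

lemma hom_from_pow:
 assumes "lmod R M" "lmod R Y" "finite S" "!!s. s\<in>S ==> f s:Hom R M Y"
 shows "(\<lambda>x\<in>S \<rightarrow>\<^sub>E |M|. \<Oplus>\<^bsub>Y\<^esub>s\<in>S. f s (x s)):Hom R (pow_module S M) Y"
proof -
 interpret Y: left_module R Y by fact
 let ?a = "S \<rightarrow>\<^sub>E |M| "
 have "compose ?a (f s) (\<lambda>x\<in>S \<rightarrow>\<^sub>E |M|. x s):Hom R (pow_module S M) Y" if "s\<in>S" for s
  using compose_hom[OF left_module_pow[OF assms(1)] pow_module_homs(1)[OF assms(1) that] assms(4)[OF that]]
  by simp
 from sum_hom[OF left_module_pow[OF assms(1)] assms(2,3) this]
 have "(\<lambda>x\<in>S \<rightarrow>\<^sub>E |M|. \<Oplus>\<^bsub>Y\<^esub>s\<in>S. compose ?a (f s) (\<lambda>x\<in>S \<rightarrow>\<^sub>E |M|. x s) x)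
:Hom R (pow_module S M) Y" by simp
 moreover have "(\<Oplus>\<^bsub>Y\<^esub>s\<in>S. compose ?a (f s) (\<lambda>x\<in>S \<rightarrow>\<^sub>E |M|. x s) x) =
   (\<Oplus>\<^bsub>Y\<^esub>s\<in>S. f s (x s))" if "x\<in>S \<rightarrow>\<^sub>E |M|" for x
  using that hom_cl[OF assms(4)] by (intro Y.M.finsum_cong') (auto simp: compose_def PiE_const)
 hence "(\<lambda>x\<in>S \<rightarrow>\<^sub>E |M|. \<Oplus>\<^bsub>Y\<^esub>s\<in>S. compose ?a (f s) (\<lambda>x\<in>S \<rightarrow>\<^sub>E |M|. x s) x) =
   (\<lambda>x\<in>S \<rightarrow>\<^sub>E |M|. \<Oplus>\<^bsub>Y\<^esub>s\<in>S. f s (x s))" by (rule restrict_ext)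
 ultimately show ?thesis by (simp only:)
qed

text \<open>Every tuple is the sum of its one-coordinate tuples. The claim is proved for tuples
  supported in a subset \<open>T\<close> of \<open>S\<close>, so that the induction can remove one
  coordinate at a time.\<close>

lemma hom_from_pow_decomp:
 assumes "lmod R M" "lmod R Y" "finite S" "h:Hom R (pow_module S M) Y"
  and "y\<in>S \<rightarrow>\<^sub>E |M|"
 shows "h y = (\<Oplus>\<^bsub>Y\<^esub>t\<in>S. h (\<lambda>s\<in>S. if s = t then y t else 0\<^sub>M))"
proof -
 interpret M: left_module R M by fact
 interpret Y: left_module R Y by fact
 note cl = hom_cl[OF assms(4)]
 have "finite T ==> T <= S ==> y\<in>S \<rightarrow>\<^sub>E |M| ==> (!!s. s\<in>S - T ==> y s = 0\<^sub>M) ==>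
   h y = (\<Oplus>\<^bsub>Y\<^esub>t\<in>T. h (\<lambda>s\<in>S. if s = t then y t else 0\<^sub>M))" for T y
 proof (induction T arbitrary: y rule: finite_induct)
  case empty
  hence "y = 0\<^sub>(pow_module S M)" by (auto simp: PiE_def intro!: extensionalityI[of _ S])
  hence "h y = 0\<^sub>Y" using hom_zero[OF left_module_pow[OF assms(1)] assms(2,4)] by (simp only:)
  thus ?case by simp
 next
  case (insert t T)
  define y' where "y' = (\<lambda>s\<in>S. if s = t then 0\<^sub>M else y s)"
  have t: "t\<in>S" and TS: "T <= S" using insert.prems by auto
  have yc: "y s\<in>|M|" if "s\<in>S" for s using insert.prems(2) that by auto
  have y': "y'\<in>S \<rightarrow>\<^sub>E |M|" using yc by (auto simp: y'_def)
  have single: "(\<lambda>s\<in>S. if s = u then y u else 0\<^sub>M)\<in>S \<rightarrow>\<^sub>E |M|" if "u\<in>S" for u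
   using yc that by auto
  have "y = (\<lambda>s\<in>S. if s = t then y t else 0\<^sub>M)+\<^sub>(pow_module S M) y'"
   using insert.prems(2) yc by (intro extensionalityI[of _ S]) (auto simp: y'_def PiE_def)
  hence "h y = h (\<lambda>s\<in>S. if s = t then y t else 0\<^sub>M)+\<^sub>Y h y'"
   using hom_add[OF assms(4), of "\<lambda>s\<in>S. if s = t then y t else 0\<^sub>M" y'] single[OF t] y' by simp
  also have "h y' = (\<Oplus>\<^bsub>Y\<^esub>u\<in>T. h (\<lambda>s\<in>S. if s = u then y' u else 0\<^sub>M))"
   using insert.prems(3) TS y' by (intro insert.IH) (auto simp: y'_def)
  also have "... = (\<Oplus>\<^bsub>Y\<^esub>u\<in>T. h (\<lambda>s\<in>S. if s = u then y u else 0\<^sub>M))"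
  proof (rule Y.M.finsum_cong')
   show "(%u. h (\<lambda>s\<in>S. if s = u then y u else 0\<^sub>M))\<in>T \<rightarrow> |Y|"
    using single TS cl by auto
   fix u assume "u\<in>T"
   hence "y' u = y u" using insert.hyps TS by (auto simp: y'_def)
   thus "h (\<lambda>s\<in>S. if s = u then y' u else 0\<^sub>M) = h (\<lambda>s\<in>S. if s = u then y u else 0\<^sub>M)" by (simp only:)
  qed simp
  also have "h (\<lambda>s\<in>S. if s = t then y t else 0\<^sub>M)+\<^sub>Y ... =
    (\<Oplus>\<^bsub>Y\<^esub>u\<in>insert t T. h (\<lambda>s\<in>S. if s = u then y u else 0\<^sub>M))"
   using single t TS cl insert.hyps by (intro Y.M.finsum_insert[symmetric]) auto
  finally show ?case .
 qed
 from this[OF assms(3) subset_refl assms(5)] show ?thesis by simp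
qed

section \<open>Cardinality bounds and free covers\<close>

lemma times_lepoll_UNIV:
 assumes "infinite (UNIV :: 'u set)" "A\<lesssim>(UNIV :: 'u set)" "B\<lesssim>(UNIV :: 'u set)"
 shows "A\<times>B\<lesssim>(UNIV :: 'u set)"
proof -
 have "A\<times>B\<lesssim>(UNIV :: 'u set)\<times>(UNIV :: 'u set)"
  using assms(2,3) by (rule times_lepoll_mono)
 also have "(UNIV :: 'u set)\<times>(UNIV :: 'u set) \<approx> (UNIV :: 'u set)"
  unfolding eqpoll_iff_card_of_ordIso by (rule card_of_Times_same_infinite[OF assms(1)])
 finally show ?thesis .
qed

lemma funcset_lepoll_UNIV:
 assumes "infinite (UNIV :: 'u set)" "finite S" "A\<lesssim>(UNIV :: 'u set)"
 shows "(S \<rightarrow>\<^sub>E A)\<lesssim>(UNIV :: 'u set)"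
 using assms(2)
proof (induction S)
 case empty
 have "{%_. undefined}\<lesssim>(UNIV :: 'u set)"
  using finite_lepoll_infinite[OF assms(1)] by blast
 thus ?case by simp
next
 case (insert t S)
 let ?d = "insert t S"
 let ?a = "?d \<rightarrow>\<^sub>E A"
 let ?b = "S \<rightarrow>\<^sub>E A"
 have "inj_on (%x. (x t, restrict x S)) ?a"
 proof (rule inj_onI)
  fix x y assume x: "x\<in>?d \<rightarrow>\<^sub>E A" and y: "y\<in>?d \<rightarrow>\<^sub>E A"
   and eq: "(x t, restrict x S) = (y t, restrict y S)"
  show "x = y"
  proof (rule extensionalityI[of _ "?d"])
   show "x u = y u" if "u\<in>?d" for u
   proof (cases "u = t")
    case False
    hence "u\<in>S" using that by simp
    moreover have "restrict x S u = restrict y S u" using eq by (simp only: prod.inject)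
    ultimately show ?thesis by simp
   qed (use eq in simp)
  qed (use x y in \<open>auto simp: PiE_def\<close>)
 qed
 moreover have "(%x. (x t, restrict x S)) ` ?a <= A\<times>?b" by auto
 ultimately have "?a\<lesssim>A\<times>?b" unfolding lepoll_def by blast
 also have "A\<times>?b\<lesssim>(UNIV :: 'u set)"
  by (rule times_lepoll_UNIV[OF assms(1,3) insert.IH])
 finally show ?case .
qed

lemma regular_module_simps [simp]:
 "|reg R| = |R|" "a*\<^sub>(reg R) x = a\<otimes>\<^sub>R x"
 "0\<^sub>(reg R) = 0\<^sub>R" "x+\<^sub>(reg R) y = x+\<^sub>R y"
 by (simp_all add: regular_module_def)

lemma (in left_module) orbit_hom:
 assumes "x\<in>|M|"
 shows "(\<lambda>a\<in>|R|. a*\<^sub>M x):Hom R (reg R) M"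
 using module_homI[of "reg R" "%a. a*\<^sub>M x" M R] assms left_module_regular[OF R.ring_axioms]
 by (simp add: smult_l_distr smult_assoc1)

text \<open>The generators themselves index the free module, so no enumeration of them has to be
  chosen.\<close>

lemma fg_free_cover:
 assumes "fg_module R M"
 obtains S f where "finite S" "S <= |M|" "f:Hom R (pow_module S (reg R)) M"
  "f ` (S \<rightarrow>\<^sub>E |R| ) = |M|"
proof -
 obtain S where M: "lmod R M" and S: "finite S" "S <= |M|"
  "!!x. x\<in>|M| ==> EX c:S \<rightarrow> |R|. x = (\<Oplus>\<^bsub>M\<^esub>s\<in>S. c s*\<^sub>M s)"
  using assms by (auto simp: fg_module_def)
 interpret left_module R M by fact
 have "(\<lambda>a\<in>|R|. a*\<^sub>M s):Hom R (reg R) M" if "s\<in>S" for s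
  by (rule orbit_hom[OF subsetD[OF S(2) that]])
 from hom_from_pow[OF left_module_regular[OF R.ring_axioms] M S(1) this]
 have f: "(\<lambda>x\<in>S \<rightarrow>\<^sub>E |R|. \<Oplus>\<^bsub>M\<^esub>s\<in>S. (\<lambda>a\<in>|R|. a*\<^sub>M s) (x s))
:Hom R (pow_module S (reg R)) M" (is "?f\<in>_")
  unfolding pow_module_simps regular_module_simps .
 let ?a = "S \<rightarrow>\<^sub>E |R| "
 have "|M| <= ?f ` ?a"
 proof
  fix x assume "x\<in>|M|"
  then obtain c where c: "c\<in>S \<rightarrow> |R|" "x = (\<Oplus>\<^bsub>M\<^esub>s\<in>S. c s*\<^sub>M s)" using S(3) by blast
  have m: "restrict c S\<in>S \<rightarrow>\<^sub>E |R|" using c(1) by auto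
  have "(\<Oplus>\<^bsub>M\<^esub>s\<in>S. (\<lambda>a\<in>|R|. a*\<^sub>M s) (restrict c S s)) = x"
   unfolding c(2) using c(1) S(2) by (intro M.finsum_cong') (auto simp: Pi_iff subset_iff)
  hence "x = ?f (restrict c S)" by (subst restrict_apply'[OF m]) (rule sym)
  thus "x\<in>?f ` ?a" using m by (rule image_eqI)
 qed
 moreover have "?f ` ?a <= |M|" using hom_cl[OF f] unfolding pow_module_simps regular_module_simps by blast
 ultimately have "?f ` ?a = |M|" by (intro equalityI)
 with S(1,2) f show ?thesis by (rule that)
qed

lemma fg_lepoll_UNIV:
 assumes "fg_module R M" "infinite (UNIV :: 'u set)" "|R|\<lesssim>(UNIV :: 'u set)"
 shows "|M|\<lesssim>(UNIV :: 'u set)"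
proof -
 obtain S f where S: "finite S" "S <= |M|" "f:Hom R (pow_module S (reg R)) M"
  "f ` (S \<rightarrow>\<^sub>E |R| ) = |M|"
  by (rule fg_free_cover[OF assms(1)])
 have "|M|\<lesssim>(S \<rightarrow>\<^sub>E |R| )" using image_lepoll[of f "S \<rightarrow>\<^sub>E |R|"] S(4) by simp
 also have "(S \<rightarrow>\<^sub>E |R| )\<lesssim>(UNIV :: 'u set)" by (rule funcset_lepoll_UNIV[OF assms(2) S(1) assms(3)])
 finally show ?thesis .
qed

text \<open>Splitting off the coordinate \<open>t\<close> gives an exact sequence from
  \<open>M\<close> through the power over \<open>insert t S\<close> to the power over
  \<open>S\<close>, and noetherian modules are closed under extensions.\<close>

lemma noetherian_pow:
 assumes "noetherian_module R M" "finite S"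
 shows "noetherian_module R (pow_module S M)"
 using assms(2)
proof (induction S)
 have M: "lmod R M" using assms(1) by (simp add: noetherian_module_def)
 case empty
 interpret P: left_module R "pow_module ({} :: 's set) M" by (rule left_module_pow[OF M])
 show ?case
  by (rule noetherian_mono[OF assms(1) P.left_module_axioms zero_hom[OF P.left_module_axioms M]]) simp
next
 case (insert t S)
 have M: "lmod R M" using assms(1) by (simp add: noetherian_module_def)
 interpret M: left_module R M by fact
 let ?d = "insert t S"
 note P = left_module_pow[OF M, of "?d"] left_module_pow[OF M, of S]
 let ?i = "\<lambda>x\<in>|M|. \<lambda>s\<in>?d. if s = t then x else 0\<^sub>M"
 let ?a = "pow_module ?d M"
 let ?p = "\<lambda>x\<in>|?a|. \<lambda>s\<in>S. (\<lambda>x\<in>?d \<rightarrow>\<^sub>E |M|. x s) x"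
 let ?b = "pow_module S M"
 have "ses R M ?i ?a ?p ?b"
 proof (rule sesI[OF M P(1,2)])
  show "?i:Hom R M ?a" by (rule pow_module_homs[OF M]) simp
  show "?p:Hom R ?a ?b"
   by (rule hom_to_pow[OF P(1) pow_module_homs(1)[OF M]]) simp
  show "inj_on ?i |M|"
   by (rule inj_on_inverseI[of _ "%x. x t"]) simp
  show "?p ` |?a| = |?b|"
  proof
   show "|?b| <= ?p ` |?a|"
   proof
    fix y assume y: "y\<in>|?b|"
    let ?y = "\<lambda>s\<in>?d. if s = t then 0\<^sub>M else y s"
    have y': "?y\<in>|?a|" using y by auto
    have "y = ?p ?y"
     using y y' insert.hyps by (intro extensionalityI[of _ S]) (auto simp: PiE_def)
    thus "y\<in>?p ` |?a|" using y' by blast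
   qed
  qed auto
  show "?p (?i x) = 0\<^sub>?b" if "x\<in>|M|" for x
   using that insert.hyps by (auto intro!: restrict_ext)
  fix y assume y: "y\<in>|?a|" "?p y = 0\<^sub>?b"
  have "y s = 0\<^sub>M" if "s\<in>S" for s
   using fun_cong[OF y(2), of s] that y(1) by simp
  hence "y = ?i (y t)" using y(1) insert.hyps by (intro extensionalityI[of _ "?d"]) (auto simp: PiE_def)
  thus "EX x:|M|. y = ?i x" using y(1) by (intro bexI[of _ "y t"]) auto
 qed
 thus ?case by (rule noetherian_ses[OF _ assms(1) insert.IH])
qed

lemma noetherian_of_fg:
 assumes "noetherian_module R (reg R)" "fg_module R M"
 shows "noetherian_module R M"
proof -
 obtain S f where S: "finite S" "S <= |M|" "f:Hom R (pow_module S (reg R)) M"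
  "f ` (S \<rightarrow>\<^sub>E |R| ) = |M|"
  by (rule fg_free_cover[OF assms(2)])
 show ?thesis
  using assms(2) S(3,4) by (intro noetherian_image[OF noetherian_pow[OF assms(1) S(1)]]) (auto simp: fg_module_def)
qed

text \<open>The dual basis form of finitely generated projectivity: the vectors \<open>a s\<close>
  and the functionals \<open>l s\<close> exhibit \<open>P\<close> as a retract of a finite free
  module. While \<open>projective_module\<close> tests only modules over the element type of
  \<open>P\<close>, the resulting \<open>dual_basis_lift\<close> applies to test modules of every
  type.\<close>

definition dual_basis ::
  "('a, 'x) ring_scheme => ('a, 'm) module => 's set => ('s => 'm) => ('s => 'm => 'a) => bool"
 where "dual_basis R P S a l <-> lmod R P & finite S & a\<in>S \<rightarrow> |P| &
  (ALL s:S. l s:Hom R P (reg R)) &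
  (ALL x:|P|. x = (\<Oplus>\<^bsub>P\<^esub>s\<in>S. l s x*\<^sub>P a s))"

lemma dual_basis_lift:
 assumes "dual_basis R P S a l" "lmod R A" "lmod R B"
  and f: "f:Hom R A B" "f ` |A| = |B|" and g: "g:Hom R P B"
 shows "EX h:Hom R P A. ALL x:|P|. f (h x) = g x"
proof -
 have P: "lmod R P" and S: "finite S" and a: "a\<in>S \<rightarrow> |P|"
  and l: "!!s. s\<in>S ==> l s:Hom R P (reg R)"
  and dec: "!!x. x\<in>|P| ==> x = (\<Oplus>\<^bsub>P\<^esub>s\<in>S. l s x*\<^sub>P a s)"
  using assms(1) by (auto simp: dual_basis_def)
 interpret P: left_module R P by fact
 interpret A: left_module R A by fact
 interpret B: left_module R B by fact
 have ac: "a s\<in>|P|" if "s\<in>S" for s using a that by auto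
 have lc: "l s x\<in>|R|" if "s\<in>S" "x\<in>|P|" for s x
  using hom_cl[OF l[OF that(1)] that(2)] by simp
 have "EX c. c\<in>|A| & f c = g (a s)" if "s\<in>S" for s
 proof -
  have "g (a s)\<in>f ` |A|" using f(2) hom_cl[OF g] ac[OF that] by blast
  thus ?thesis by auto
 qed
 then obtain c where c: "!!s. s\<in>S ==> c s\<in>|A|" "!!s. s\<in>S ==> f (c s) = g (a s)" by metis
 \<comment> \<open>Only the images of the finitely many \<open>a s\<close> are lifted, to
   \<open>c s\<close>; the functionals \<open>l s\<close> extend this choice linearly.\<close>
 define h where "h = (\<lambda>x\<in>|P|. \<Oplus>\<^bsub>A\<^esub>s\<in>S. compose |P| (\<lambda>r\<in>|R|. r*\<^sub>A c s) (l s) x)"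
 have "h:Hom R P A"
  unfolding h_def by (rule sum_hom[OF P assms(2) S compose_hom[OF P l A.orbit_hom[OF c(1)]]])
 moreover have "f (h x) = g x" if x: "x\<in>|P|" for x
 proof -
  have "h x = (\<Oplus>\<^bsub>A\<^esub>s\<in>S. l s x*\<^sub>A c s)"
   unfolding h_def using lc[OF _ x] c(1) unfolding restrict_apply'[OF x] compose_eq[OF x]
   by (intro A.M.finsum_cong') auto
  also have "f ... = (\<Oplus>\<^bsub>B\<^esub>s\<in>S. f (l s x*\<^sub>A c s))"
   using x lc c(1) by (intro hom_finsum[OF assms(2,3) f(1) S]) auto
  also have "... = (\<Oplus>\<^bsub>B\<^esub>s\<in>S. g (l s x*\<^sub>P a s))"
   using x lc c ac hom_cl[OF g] by (intro B.M.finsum_cong')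
    (auto simp: hom_smult[OF f(1)] hom_smult[OF g])
  also have "... = g (\<Oplus>\<^bsub>P\<^esub>s\<in>S. l s x*\<^sub>P a s)"
   using x lc ac by (intro hom_finsum[OF P assms(3) g S, symmetric]) auto
  also have "... = g x" using dec[OF x] by simp
  finally show ?thesis .
 qed
 ultimately show ?thesis by blast
qed

lemma dual_basis_projective:
 fixes P :: "('a, 'm) module"
 shows "dual_basis R P S a l ==> projective_module R P"
 unfolding projective_module_def
proof (intro conjI allI impI; (elim conjE)?)
 assume db: "dual_basis R P S a l"
 show "lmod R P" using db by (simp add: dual_basis_def)
 fix A B :: "('a, 'm) module" and f g
 assume "lmod R A" "lmod R B" "f:Hom R A B" "f ` |A| = |B|" "g:Hom R P B"
 thus "EX h:Hom R P A. ALL x:|P|. f (h x) = g x" by (rule dual_basis_lift[OF db])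
qed

lemma dual_basis_fg: "dual_basis R P S a l ==> fg_module R P"
proof -
 assume "dual_basis R P S a l"
 hence P: "lmod R P" and S: "finite S" and a: "a\<in>S \<rightarrow> |P|"
  and l: "!!s. s\<in>S ==> l s:Hom R P (reg R)"
  and dec: "!!x. x\<in>|P| ==> x = (\<Oplus>\<^bsub>P\<^esub>s\<in>S. l s x*\<^sub>P a s)"
  by (auto simp: dual_basis_def)
 interpret P: left_module R P by fact
 have "generates R P (a ` S) |P|"
  unfolding generates_def
 proof (intro conjI allI impI subsetI)
  fix K x assume K: "submodule K R P & a ` S <= K" and x: "x\<in>|P|"
  have "(\<Oplus>\<^bsub>P\<^esub>s\<in>S. l s x*\<^sub>P a s)\<in>K"
   using K hom_cl[OF l _ ] x P.submoduleD(7)[OF K[THEN conjunct1]]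
   by (intro P.submodule_finsum S) (auto simp: image_subset_iff)
  thus "x\<in>K" using dec[OF x] by simp
 qed (use a in auto)
 thus ?thesis using S P by (auto simp: fg_module_iff)
qed

lemma dual_basis_iso:
 assumes "dual_basis R P S a l" "module_iso R P Q f g"
 shows "dual_basis R Q S (%s. f (a s)) (%s. compose |Q| (l s) g)"
proof -
 have P: "lmod R P" and S: "finite S" and a: "a\<in>S \<rightarrow> |P|"
  and l: "!!s. s\<in>S ==> l s:Hom R P (reg R)"
  and dec: "!!x. x\<in>|P| ==> x = (\<Oplus>\<^bsub>P\<^esub>s\<in>S. l s x*\<^sub>P a s)"
  using assms(1) by (auto simp: dual_basis_def)
 note I = module_isoD[OF assms(2)]
 interpret P: left_module R P by fact
 interpret Q: left_module R Q by (rule I)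
 have lc: "l s x\<in>|R|" if "s\<in>S" "x\<in>|P|" for s x
  using hom_cl[OF l[OF that(1)] that(2)] by simp
 have "y = (\<Oplus>\<^bsub>Q\<^esub>s\<in>S. compose |Q| (l s) g y*\<^sub>Q f (a s))" if y: "y\<in>|Q|" for y
 proof -
  have "y = f (\<Oplus>\<^bsub>P\<^esub>s\<in>S. l s (g y)*\<^sub>P a s)"
   using dec[OF I(12)[OF y]] I(6)[OF y] by simp
  also have "... = (\<Oplus>\<^bsub>Q\<^esub>s\<in>S. f (l s (g y)*\<^sub>P a s))"
   using lc a I(12)[OF y] by (intro hom_finsum[OF I(1,2,3) S]) auto
  also have "... = (\<Oplus>\<^bsub>Q\<^esub>s\<in>S. compose |Q| (l s) g y*\<^sub>Q f (a s))"
   using lc a I(12)[OF y] I(11) y by (intro Q.M.finsum_cong') (auto simp: hom_smult[OF I(3)] Pi_iff compose_def)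
  finally show ?thesis .
 qed
 thus ?thesis
  using S a I(2,11) compose_hom[OF I(2) I(4) l] by (auto simp: dual_basis_def)
qed

lemma dual_basis_free:
 assumes "ring R" "finite S"
 shows "dual_basis R (pow_module S (reg R)) S
  (%t. \<lambda>s\<in>S. if s = t then \<one>\<^bsub>R\<^esub> else 0\<^sub>R) (%t. \<lambda>x\<in>S \<rightarrow>\<^sub>E |R|. x t)"
proof -
 interpret ring R by fact
 note M = left_module_regular[OF assms(1)]
 note P = left_module_pow[OF M, of S]
 let ?b = "pow_module S (reg R)"
 interpret P: left_module R "?b" by (rule P)
 have "y = (\<Oplus>\<^bsub>?b\<^esub>t\<in>S. (\<lambda>x\<in>S \<rightarrow>\<^sub>E |R|. x t) y
   *\<^sub>?b (\<lambda>s\<in>S. if s = t then \<one>\<^bsub>R\<^esub> else 0\<^sub>R))"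
  if y: "y\<in>S \<rightarrow>\<^sub>E |R|" for y
 proof -
  have 1: "(\<lambda>s\<in>S. if s = t then y t else 0\<^sub>R)\<in>S \<rightarrow>\<^sub>E |R|" if "t\<in>S" for t
   using y that by auto
  let ?a = "\<lambda>x\<in>|?b|. x"
  have "y = ?a y" using y by simp
  also have "... = (\<Oplus>\<^bsub>?b\<^esub>t\<in>S.
    ?a (\<lambda>s\<in>S. if s = t then y t else 0\<^sub>R))"
   using hom_from_pow_decomp[OF M P assms(2) id_hom[OF P], of y] y unfolding regular_module_simps by blast
  also have "... = (\<Oplus>\<^bsub>?b\<^esub>t\<in>S. (\<lambda>x\<in>S \<rightarrow>\<^sub>E |R|. x t) y
   *\<^sub>?b (\<lambda>s\<in>S. if s = t then \<one>\<^bsub>R\<^esub> else 0\<^sub>R))"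
  proof (rule P.M.finsum_cong')
   show "(%t. (\<lambda>x\<in>S \<rightarrow>\<^sub>E |R|. x t) y
   *\<^sub>?b (\<lambda>s\<in>S. if s = t then \<one>\<^bsub>R\<^esub> else 0\<^sub>R))\<in>S \<rightarrow> |?b|"
    using PiE_const[OF y] y by auto
   fix t assume t: "t\<in>S"
   hence "y t\<in>|R|" using y by auto
   thus "?a (\<lambda>s\<in>S. if s = t then y t else 0\<^sub>R) =
     (\<lambda>x\<in>S \<rightarrow>\<^sub>E |R|. x t) y
   *\<^sub>?b (\<lambda>s\<in>S. if s = t then \<one>\<^bsub>R\<^esub> else 0\<^sub>R)"
    using 1[OF t] y by (auto intro!: restrict_ext)
  qed simp
  finally show ?thesis .
 qed
 moreover have "(\<lambda>x\<in>S \<rightarrow>\<^sub>E |R|. x t):Hom R ?b (reg R)" if "t\<in>S" for t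
  using pow_module_homs(1)[OF M that] by simp
 ultimately show ?thesis using P assms(2) unfolding dual_basis_def by auto
qed

text \<open>Since free modules of finite rank have copies in the universe, finitely generated modules over
 a noetherian ring have projective resolutions there.\<close>

lemma fg_projective_cover:
 assumes "fg_module R M" "infinite (UNIV :: 'u set)" "|R|\<lesssim>(UNIV :: 'u set)"
 shows "\<exists>(P :: ('a, 'u) module) f. fg_module R P & projective_module R P &
  f:Hom R P M & f ` |P| = |M|"
proof -
 have M: "lmod R M" using assms(1) by (simp add: fg_module_def)
 interpret left_module R M by fact
 obtain S f where S: "finite S" "S <= |M|" and f: "f:Hom R (pow_module S (reg R)) M"
  "f ` (S \<rightarrow>\<^sub>E |R| ) = |M|"
  by (rule fg_free_cover[OF assms(1)])
 note db = dual_basis_free[OF R.ring_axioms S(1)]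
 note P = left_module_pow[OF left_module_regular[OF R.ring_axioms], of S]
 obtain Q :: "('a, 'u) module" and i j where I: "module_iso R (pow_module S (reg R)) Q i j"
  using ex_module_copy[OF P] funcset_lepoll_UNIV[OF assms(2) S(1) assms(3)] by auto
 note ID = module_isoD[OF I]
 note db' = dual_basis_iso[OF db I]
 have "compose |Q| f j:Hom R Q M" by (rule compose_hom[OF ID(2,4) f(1)])
 moreover have "compose |Q| f j ` |Q| = |M|"
  using f(2) ID(10) by (simp add: compose_def image_image[symmetric])
 ultimately show ?thesis using dual_basis_projective[OF db'] dual_basis_fg[OF db'] by blast
qed

lemma ex_projective_resolution:
 assumes "noetherian_module R (reg R)" "fg_module R M"
  "infinite (UNIV :: 'u set)" "|R|\<lesssim>(UNIV :: 'u set)"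
 shows "\<exists>(P :: nat => ('a, 'u) module) d w. projective_resolution R M P d w"
proof -
 have M: "lmod R M" using assms(2) by (simp add: fg_module_def)
 \<comment> \<open>The state of the recursion is a projective module together with the submodule
   that the next differential has to cover; noetherianity keeps that submodule finitely
   generated.\<close>
 define ok where "ok = (\<lambda>(P :: ('a, 'u) module, Z). fg_module R P & projective_module R P & submodule Z R P)"
 define step where "step = (\<lambda>(P :: ('a, 'u) module, Z) (P' :: ('a, 'u) module, Z').
  EX d:Hom R P' P. d ` |P'| = Z & Z' = a_kernel P' P d)"
 obtain P0 :: "('a, 'u) module" and w where P0: "fg_module R P0" "projective_module R P0"
  "w:Hom R P0 M" "w ` |P0| = |M|"
  using fg_projective_cover[OF assms(2-4)] by blast
 let ?a = "a_kernel P0 M w"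
 have "EX x. (ALL n. ok (x n)) & (ALL n. step (x n) (x (Suc n))) & x 0 = (P0, ?a)"
 proof -
  have "EX f. ALL n. (ok (f n) & (n = 0 --> f n = (P0, ?a))) & step (f n) (f (Suc n))"
  proof (rule dependent_nat_choice)
   have "submodule ?a R P0"
    using P0 M by (intro submodule_kernel) (auto simp: fg_module_def)
   thus "EX x. ok x & (0 = (0::nat) --> x = (P0, ?a))"
    using P0 by (auto simp: ok_def)
  next
   fix x and n :: nat
   assume x: "ok x & (n = 0 --> x = (P0, ?a))"
   obtain P Z where PZ: "x = (P, Z)" by (cases x)
   let ?b = "P(|carrier := Z|)"
   have P: "fg_module R P" "submodule Z R P" using x by (auto simp: ok_def PZ)
   hence "fg_module R ?b"
    using noetherian_of_fg[OF assms(1) P(1)] by (simp add: noetherian_module_def)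
   then obtain P' :: "('a, 'u) module" and d where P': "fg_module R P'" "projective_module R P'"
    "d:Hom R P' ?b" "d ` |P'| = Z"
    using fg_projective_cover[OF _ assms(3,4), of "P(|carrier := Z|)"] by auto
   have lm: "lmod R P" "lmod R P'" using P P' by (auto simp: fg_module_def)
   have d: "d:Hom R P' P"
    using hom_from_sub[OF P'(3) left_module.submoduleD(1)[OF lm(1) P(2)]] .
   have "ok (P', a_kernel P' P d)" using P' submodule_kernel[OF lm(2,1) d] by (simp add: ok_def)
   moreover have "step x (P', a_kernel P' P d)" using d P'(4) by (auto simp: step_def PZ)
   ultimately show "EX y. (ok y & (Suc n = 0 --> y = (P0, ?a))) & step x y" by blast
  qed
  thus ?thesis by blast
 qed
 then obtain x where x: "!!n. ok (x n)" "!!n. step (x n) (x (Suc n))" "x 0 = (P0, ?a)" by blast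
 define P where "P n = fst (x n)" for n
 have "EX d:Hom R (P (Suc n)) (P n). d ` |P (Suc n)| = snd (x n) &
   snd (x (Suc n)) = a_kernel (P (Suc n)) (P n) d" for n
  using x(2)[of n] by (simp add: step_def P_def split: prod.splits)
 then obtain d where d: "!!n. d n:Hom R (P (Suc n)) (P n)"
  "!!n. d n ` |P (Suc n)| = snd (x n)" "!!n. snd (x (Suc n)) = a_kernel (P (Suc n)) (P n) (d n)"
  by metis
 have "projective_module R (P n)" for n using x(1)[of n] by (simp add: ok_def P_def split: prod.splits)
 moreover have "P 0 = P0" "snd (x 0) = ?a" by (simp_all add: P_def x(3))
 ultimately have "projective_resolution R M P d w"
  using d P0 by (simp add: projective_resolution_def a_exact_at_def)
 thus ?thesis by blast
qed

section \<open>Vanishing of Ext\<close>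

lemma injectiveD:
 fixes A B I :: "('a, 'u) module"
 assumes "injm R I" "lmod R A" "lmod R B" "f:Hom R A B"
  "inj_on f |A|" "g:Hom R A I"
 obtains h where "h:Hom R B I" "!!x. x\<in>|A| ==> h (f x) = g x"
proof -
 have "EX h:Hom R B I. ALL x:|A|. h (f x) = g x"
  using assms(1)[unfolded injective_module_def, THEN conjunct2, rule_format, OF conjI, OF assms(2) conjI, OF assms(3) conjI, OF assms(4) conjI, OF assms(5,6)] .
 thus ?thesis using that by blast
qed

lemma projectiveD:
 fixes A B P :: "('a, 'u) module"
 assumes "projective_module R P" "lmod R A" "lmod R B" "f:Hom R A B"
  "f ` |A| = |B|" "g:Hom R P B"
 obtains h where "h:Hom R P A" "!!x. x\<in>|P| ==> f (h x) = g x"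
proof -
 have "EX h:Hom R P A. ALL x:|P|. f (h x) = g x"
  using assms(1)[unfolded projective_module_def, THEN conjunct2, rule_format, OF conjI, OF assms(2) conjI, OF assms(3) conjI, OF assms(4) conjI, OF assms(5,6)] .
 thus ?thesis using that by blast
qed

text \<open>\<open>injective_module\<close> tests only modules of the same element type; replacing
  \<open>A\<close> and \<open>B\<close> by copies in the universe extends the property to all small
  modules.\<close>

lemma injective_extend:
 fixes J :: "('a, 'u) module"
 assumes "injm R J" "lmod R A" "lmod R B"
  and "f:Hom R A B" "inj_on f |A|" "g:Hom R A J"
  and "|A|\<lesssim>(UNIV :: 'u set)" "|B|\<lesssim>(UNIV :: 'u set)"
 shows "EX h:Hom R B J. ALL x:|A|. h (f x) = g x"
proof -
 obtain A' :: "('a, 'u) module" and a a' where a: "module_iso R A A' a a'"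
  using ex_module_copy[OF assms(2,7)] by blast
 obtain B' :: "('a, 'u) module" and b b' where b: "module_iso R B B' b b'"
  using ex_module_copy[OF assms(3,8)] by blast
 note aD = module_isoD[OF a] and bD = module_isoD[OF b]
 let ?f = "compose |A'| b (compose |A'| f a')"
 note fa = compose_hom[OF aD(2,4) assms(4)]
 note f = compose_hom[OF aD(2) fa bD(3)]
 have "inj_on ?f |A'|"
 proof (rule inj_onI)
  fix x y assume xy: "x\<in>|A'|" "y\<in>|A'|" "?f x = ?f y"
  hence "b (f (a' x)) = b (f (a' y))" by (simp add: compose_eq)
  hence "f (a' x) = f (a' y)"
   by (rule inj_onD[OF bD(7)]) (intro hom_cl[OF assms(4)] aD(12) xy(1,2))+
  hence "a' x = a' y" by (rule inj_onD[OF assms(5)]) (intro aD(12) xy(1,2))+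
  thus "x = y" by (rule inj_onD[OF aD(8)]) (rule xy)+
 qed
 moreover have "compose |A'| g a':Hom R A' J" by (rule compose_hom[OF aD(2,4) assms(6)])
 ultimately obtain h where h: "h:Hom R B' J" "!!x. x\<in>|A'| ==> h (?f x) = compose |A'| g a' x"
  by (rule injectiveD[OF assms(1) aD(2) bD(2) f]) blast
 have "compose |B| h b:Hom R B J" by (rule compose_hom[OF bD(1,3) h(1)])
 moreover have "compose |B| h b (f x) = g x" if x: "x\<in>|A|" for x
  using h(2)[OF aD(11)[OF x]] hom_cl[OF assms(4) x] aD(5,11)[OF x]
  by (simp add: compose_eq)
 ultimately show ?thesis by blast
qed

lemma projective_lift:
 fixes P :: "('a, 'u) module"
 assumes "projective_module R P" "lmod R A" "lmod R B"
  and "f:Hom R A B" "f ` |A| = |B|" "g:Hom R P B"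
  and "|A|\<lesssim>(UNIV :: 'u set)" "|B|\<lesssim>(UNIV :: 'u set)"
 shows "EX h:Hom R P A. ALL x:|P|. f (h x) = g x"
proof -
 obtain A' :: "('a, 'u) module" and a a' where a: "module_iso R A A' a a'"
  using ex_module_copy[OF assms(2,7)] by blast
 obtain B' :: "('a, 'u) module" and b b' where b: "module_iso R B B' b b'"
  using ex_module_copy[OF assms(3,8)] by blast
 have P: "lmod R P" using assms(1) by (simp add: projective_module_def)
 note aD = module_isoD[OF a] and bD = module_isoD[OF b]
 let ?f = "compose |A'| b (compose |A'| f a')"
 note fa = compose_hom[OF aD(2,4) assms(4)]
 note f = compose_hom[OF aD(2) fa bD(3)]
 have feq: "?f x = b (f (a' x))" if "x\<in>|A'|" for x using that by (simp add: compose_eq)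
 have "?f ` |A'| = b ` (f ` (a' ` |A'| ))"
  unfolding image_image by (rule image_cong[OF refl feq])
 also have "... = |B'|" unfolding aD(10) assms(5) bD(9) ..
 finally have surj: "?f ` |A'| = |B'|" .
 have "compose |P| b g:Hom R P B'" by (rule compose_hom[OF P assms(6) bD(3)])
 then obtain h where h: "h:Hom R P A'" "!!x. x\<in>|P| ==> ?f (h x) = compose |P| b g x"
  by (rule projectiveD[OF assms(1) aD(2) bD(2) f surj]) blast
 have "compose |P| a' h:Hom R P A" by (rule compose_hom[OF P h(1) aD(4)])
 moreover have "f (compose |P| a' h x) = g x" if x: "x\<in>|P|" for x
 proof -
  note hx = hom_cl[OF h(1) x]
  have "b (f (a' (h x))) = b (g x)"
   using h(2)[OF x] feq[OF hx] x by (simp add: compose_eq)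
  hence "f (a' (h x)) = g x"
   by (rule inj_onD[OF bD(7)]) (intro hom_cl[OF assms(4)] hom_cl[OF assms(6)] aD(12) hx x)+
  thus ?thesis using x by (simp add: compose_eq)
 qed
 ultimately show ?thesis by blast
qed

text \<open>\<open>ext1_zero R L N\<close> expresses \<open>Ext\<^sup>1(L, N) = 0\<close> without reference to a resolution.\<close>

definition ext1_zero :: "('a, 'x) ring_scheme => ('a, 'u) module => ('a, 'u) module => bool"
 where "ext1_zero R L N <->
  (\<forall>(A :: ('a, 'u) module) (B :: ('a, 'u) module) i p. ses R A i B p L -->
   (ALL f:Hom R A N. EX g:Hom R B N. ALL x:|A|. g (i x) = f x))"

lemma ext1_zeroD:
 fixes A B L N :: "('a, 'u) module"
 assumes "ext1_zero R L N" "ses R A i B p L" "f:Hom R A N"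
 obtains g where "g:Hom R B N" "!!x. x\<in>|A| ==> g (i x) = f x"
 using assms unfolding ext1_zero_def by blast

text \<open>One extension with projective middle term decides the vanishing. In any other extension,
  \<open>B\<close> is a pushout along the comparison map \<open>t\<close>, realised as a quotient of
  the product of \<open>P\<close> and \<open>A\<close>. The extension \<open>h\<close> of
  \<open>f t\<close> to \<open>P\<close> and the map \<open>f\<close> on \<open>A\<close> together
  kill the kernel of that quotient and descend to \<open>B\<close>.\<close>

lemma ext1_zero_of_projective:
 fixes K P L N :: "('a, 'u) module"
 assumes "projective_module R P" "ses R K i P p L" "lmod R N"
  and ext: "!!f. f:Hom R K N ==> EX g:Hom R P N. ALL x:|K|. g (i x) = f x"
 shows "ext1_zero R L N"
 unfolding ext1_zero_def
proof (intro allI impI ballI)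
 fix A B :: "('a, 'u) module" and j q f
 assume AB: "ses R A j B q L" and f: "f:Hom R A N"
 note S = sesD[OF assms(2)] and T = sesD[OF AB]
 interpret A: left_module R A by (rule T)
 interpret B: left_module R B by (rule T)
 interpret L: left_module R L by (rule T)
 interpret N: left_module R N by fact
 obtain s where s: "s:Hom R P B" "!!x. x\<in>|P| ==> q (s x) = p x"
  by (rule projectiveD[OF assms(1) T(2,3,5,7) S(5)]) blast
 note sc = hom_cl[OF s(1)] and ic = hom_cl[OF S(4)] and jc = hom_cl[OF T(4)]
 note si = compose_hom[OF S(1,4) s(1)]
 have "compose |K| s i x\<in>j ` |A|" if x: "x\<in>|K|" for x
  using T(10)[OF sc[OF ic[OF x]]] s(2)[OF ic[OF x]] S(9)[OF x] x by (auto simp: compose_eq)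
 then obtain t where t: "t:Hom R K A" "ALL x:|K|. j (t x) = compose |K| s i x"
  using factor_mono[OF T(1) S(1) T(4,6) si] by blast
 hence jt: "j (t x) = s (i x)" if "x\<in>|K|" for x using that by (simp add: compose_eq)
 obtain h where h: "h:Hom R P N" "!!x. x\<in>|K| ==> h (i x) = f (t x)"
  using ext[OF compose_hom[OF S(1) t(1) f]] by (auto simp: compose_eq)
 note fc = hom_cl[OF f] and hc = hom_cl[OF h(1)] and tc = hom_cl[OF t(1)]
 let ?S = "\<lambda>x\<in>|P|\<times>|A|. s (fst x)+\<^sub>B j (snd x)"
 let ?H = "\<lambda>x\<in>|P|\<times>|A|. h (fst x)+\<^sub>N f (snd x)"
 note PA = left_module_prod[OF S(2) T(1)]
 note SH = hom_from_prod[OF T(2) S(2) T(1) s(1) T(4)]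
 note HH = hom_from_prod[OF assms(3) S(2) T(1) h(1) f]
 let ?a = "prod_module P A"
 have surj: "?S ` |?a| = |B|"
 proof
  show "?S ` |?a| <= |B|" using hom_cl[OF SH] by blast
  show "|B| <= ?S ` |?a|"
  proof
   fix b assume b: "b\<in>|B|"
   hence "q b\<in>p ` |P|" using S(7) hom_cl[OF T(5)] by simp
   then obtain x where x: "x\<in>|P|" "q b = p x" by blast
   have "q (b-\<^sub>B s x) = 0\<^sub>L"
    using hom_minus[OF T(2,3,5) b sc[OF x(1)]] s(2)[OF x(1)] x(2)
     L.diff_eq_zero_iff[OF hom_cl[OF T(5) b] hom_cl[OF S(5) x(1)]] by simp
   then obtain a where a: "a\<in>|A|" "b-\<^sub>B s x = j a"
    using T(10)[of "b-\<^sub>B s x"] b sc[OF x(1)] by auto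
   hence "b = ?S (x, a)" using x(1) b sc[OF x(1)] B.add_diff_cancel(1)[OF sc[OF x(1)] b] by simp
   thus "b\<in>?S ` |?a|"
    by (rule image_eqI) (simp add: x a)
  qed
 qed
 have ker: "?H z = 0\<^sub>N" if "z\<in>|?a|" "?S z = 0\<^sub>B" for z
 proof -
  obtain x a where z: "z = (x, a)" "x\<in>|P|" "a\<in>|A|" using \<open>z \<in> _\<close> by auto
  have sa: "s x+\<^sub>B j a = 0\<^sub>B" using that z by simp
  have "0\<^sub>L = q (s x+\<^sub>B j a)" unfolding sa using hom_zero[OF T(2,3,5)] by simp
  also have "... = p x"
   using z s(2) T(9) sc jc hom_cl[OF S(5)] by (simp add: hom_add[OF T(5)])
  finally obtain k where k: "k\<in>|K|" "x = i k" using S(10)[OF z(2)] by auto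
  have "j (t k+\<^sub>A a) = 0\<^sub>B" using sa jt k tc z by (simp add: hom_add[OF T(4)])
  hence "t k+\<^sub>A a = 0\<^sub>A"
   using inj_on_hom_iff[OF T(1,2,4)] T(6) tc[OF k(1)] z(3) A.M.a_closed by blast
  hence "f (t k)+\<^sub>N f a = 0\<^sub>N"
   using hom_zero[OF T(1) assms(3) f] hom_add[OF f tc[OF k(1)] z(3)] by simp
  thus ?thesis using h(2)[OF k(1)] z k by simp
 qed
 obtain g where g: "g:Hom R B N" "ALL z:|?a|. g (?S z) = ?H z"
  using factor_surj[OF PA T(2) assms(3) SH surj HH ker] by blast
 have "g (j a) = f a" if a: "a\<in>|A|" for a
 proof -
  interpret P: left_module R P by (rule S)
  have z: "(0\<^sub>P, a)\<in>|?a|" using a by simp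
  have "?S (0\<^sub>P, a) = j a" "?H (0\<^sub>P, a) = f a"
   using a jc fc hom_zero[OF S(2) T(2) s(1)] hom_zero[OF S(2) assms(3) h(1)] by simp_all
  thus ?thesis using g(2)[rule_format, OF z] by simp
 qed
 thus "EX g:Hom R B N. ALL x:|A|. g (j x) = f x" using g(1) by blast
qed

text \<open>The pullback of \<open>q\<close> along \<open>g\<close> is an extension of
  \<open>L\<close> by \<open>N\<close>. A retraction of it onto \<open>N\<close> gives the lift, by
  subtracting from the second component of a pair its part in \<open>N\<close>. The pullback has to
  be copied into the universe, whence the infinite universe.\<close>

lemma ext1_zero_lift:
 fixes L N J Q :: "('a, 'u) module"
 assumes "ext1_zero R L N" "ses R N j J q Q" "g:Hom R L Q" "lmod R L"
  and inf: "infinite (UNIV :: 'u set)"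
 shows "EX h:Hom R L J. ALL x:|L|. q (h x) = g x"
proof -
 note S = sesD[OF assms(2)]
 interpret L: left_module R L by fact
 interpret J: left_module R J by (rule S)
 interpret Q: left_module R Q by (rule S)
 note LJ = left_module_prod[OF assms(4) S(2)]
 interpret LJ: left_module R "prod_module L J" by (rule LJ)
 note qc = hom_cl[OF S(5)] and jc = hom_cl[OF S(4)] and gc = hom_cl[OF assms(3)]
 define T where "T = {z\<in>|L|\<times>|J|. g (fst z) = q (snd z)}"
 have Tsub: "submodule T R (prod_module L J)"
  by (rule LJ.submoduleI)
   (auto simp: T_def hom_zero[OF assms(4) S(3) assms(3)] hom_zero[OF S(2,3,5)]
    hom_add[OF assms(3)] hom_add[OF S(5)] hom_smult[OF assms(3)] hom_smult[OF S(5)])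
 let ?T = "(prod_module L J)(|carrier := T|)"
 note TM = LJ.sub_left_module[OF Tsub]
 have "|?T|\<lesssim>|L|\<times>|J|" by (rule subset_imp_lepoll) (auto simp: T_def)
 also have "|L|\<times>|J|\<lesssim>(UNIV :: 'u set)"
  by (rule times_lepoll_UNIV[OF inf]; rule subset_imp_lepoll; simp)
 finally obtain B :: "('a, 'u) module" and b b' where I: "module_iso R ?T B b b'"
  using ex_module_copy[OF TM] by blast
 note B = module_isoD[OF I]
 let ?d = "restrict fst T"
 have proj: "?d:Hom R ?T L" "restrict snd T:Hom R ?T J"
  using module_homI[of ?T fst L R] module_homI[of ?T snd J R] TM by (auto simp: T_def)
 note pB = compose_hom[OF B(2,4) proj(1)]
 have inT: "(0\<^sub>L, j n)\<in>T" if "n\<in>|N|" for n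
  using that S(9) jc hom_zero[OF assms(4) S(3) assms(3)] by (simp add: T_def)
 let ?a = "\<lambda>n\<in>|N|. (0\<^sub>L, j n)"
 have iT: "?a:Hom R N ?T"
  by (rule module_homI) (auto simp: inT hom_add[OF S(4)] hom_smult[OF S(4)] S(1))
 note iB = compose_hom[OF S(1) iT B(3)]
 have ieq: "compose |N| b ?a n = b (0\<^sub>L, j n)" if "n\<in>|N|" for n
  using that by (simp add: compose_eq)
 have b'T: "b' y\<in>T" if "y\<in>|B|" for y using B(12)[OF that] by simp
 let ?b = "compose |B| ?d b'"
 have peq: "?b y = fst (b' y)" if "y\<in>|B|" for y
  using that b'T by (simp add: compose_eq)
 have "ses R N (compose |N| b ?a) B ?b L"
 proof (rule sesI[OF S(1) B(2) assms(4) iB pB])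
  show "inj_on (compose |N| b ?a) |N|"
  proof (rule inj_onI)
   fix x y assume xy: "x\<in>|N|" "y\<in>|N|"
    "compose |N| b ?a x = compose |N| b ?a y"
   hence "b (0\<^sub>L, j x) = b (0\<^sub>L, j y)" by (simp only: ieq)
   hence "(0\<^sub>L, j x) = (0\<^sub>L, j y)"
    by (rule inj_onD[OF B(7)]) (simp_all add: inT xy(1,2))
   thus "x = y" using inj_onD[OF S(6) _ xy(1,2)] by simp
  qed
  show "?b ` |B| = |L|"
  proof
   show "?b ` |B| <= |L|"
    using hom_cl[OF pB] by blast
   show "|L| <= ?b ` |B|"
   proof
    fix l assume l: "l\<in>|L|"
    have "g l\<in>q ` |J|" using gc[OF l] S(7) by simp
    then obtain y where y: "y\<in>|J|" "g l = q y" by blast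
    hence m: "(l, y)\<in>|?T|" using l by (simp add: T_def)
    have "l = ?b (b (l, y))"
     using peq[OF B(11)[OF m]] B(5)[OF m] by simp
    thus "l\<in>?b ` |B|" using B(11)[OF m] by (rule image_eqI)
   qed
  qed
  show "?b (compose |N| b ?a n) = 0\<^sub>L"
   if n: "n\<in>|N|" for n
  proof -
   have m: "(0\<^sub>L, j n)\<in>|?T|" using inT[OF n] by simp
   show ?thesis unfolding ieq[OF n] peq[OF B(11)[OF m]] B(5)[OF m] by simp
  qed
  fix y assume y: "y\<in>|B|" "?b y = 0\<^sub>L"
  hence fst0: "fst (b' y) = 0\<^sub>L" by (simp only: peq)
  have "snd (b' y)\<in>|J|" "q (snd (b' y)) = 0\<^sub>Q"
   using b'T[OF y(1)] fst0 hom_zero[OF assms(4) S(3) assms(3)] by (auto simp: T_def)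
  then obtain n where n: "n\<in>|N|" "snd (b' y) = j n" using S(10) by blast
  hence "b' y = (0\<^sub>L, j n)" using fst0 by (simp add: prod_eq_iff)
  hence "y = b (0\<^sub>L, j n)" using B(6)[OF y(1)] by simp
  thus "EX x:|N|. y = compose |N| b ?a x"
   using ieq[OF n(1)] n(1) by metis
 qed
 then obtain r where r: "r:Hom R B N"
  "!!n. n\<in>|N| ==> r (compose |N| b ?a n) = (\<lambda>n\<in>|N|. n) n"
  by (rule ext1_zeroD[OF assms(1) _ id_hom[OF S(1)]]) blast
 hence rn: "r (b (0\<^sub>L, j n)) = n" if "n\<in>|N|" for n using that by (simp add: ieq)
 have rb: "compose T r b:Hom R ?T N" using compose_hom[OF TM B(3) r(1)] by simp
 have jrb: "compose T j (compose T r b):Hom R ?T J" using compose_hom[OF TM rb S(4)] by simp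
 let ?c = "\<lambda>x\<in>T. restrict snd T x-\<^sub>J compose T j (compose T r b) x"
 have H: "?c:Hom R ?T J"
  using minus_hom[OF TM S(2) proj(2) jrb] by simp
 have Heq: "?c z = snd z-\<^sub>J j (r (b z))"
  if "z\<in>T" for z using that by (simp add: compose_eq)
 have surj: "?d ` |?T| = |L|"
 proof
  show "?d ` |?T| <= |L|" by (auto simp: T_def)
  show "|L| <= ?d ` |?T|"
  proof
   fix l assume l: "l\<in>|L|"
   have "g l\<in>q ` |J|" using gc[OF l] S(7) by simp
   then obtain y where y: "y\<in>|J|" "g l = q y" by blast
   hence m: "(l, y)\<in>T" using l by (simp add: T_def)
   thus "l\<in>?d ` |?T|" by (intro image_eqI[of _ _ "(l, y)"]) auto
  qed
 qed
 have ker: "?c z = 0\<^sub>J"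
  if z: "z\<in>|?T|" "?d z = 0\<^sub>L" for z
 proof -
  have zT: "z\<in>T" and f0: "fst z = 0\<^sub>L" using z by auto
  have sz: "snd z\<in>|J|" "q (snd z) = 0\<^sub>Q"
   using zT f0 hom_zero[OF assms(4) S(3) assms(3)] by (auto simp: T_def)
  then obtain n where n: "n\<in>|N|" "snd z = j n" using S(10) by blast
  hence "z = (0\<^sub>L, j n)" using f0 by (simp add: prod_eq_iff)
  thus ?thesis using Heq[OF zT] rn[OF n(1)] jc[OF n(1)] by (simp add: J.diff_eq_zero_iff)
 qed
 obtain h where h: "h:Hom R L J"
  "ALL z:|?T|. h (?d z) = ?c z"
  using factor_surj[OF TM assms(4) S(2) proj(1) surj H ker] by blast
 have "q (h l) = g l" if l: "l\<in>|L|" for l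
 proof -
  have "l\<in>?d ` |?T|" using surj l by simp
  then obtain z where z: "z\<in>T" "l = fst z" by auto
  have zJ: "snd z\<in>|J|" "g l = q (snd z)" using z by (auto simp: T_def)
  have rz: "r (b z)\<in>|N|" using hom_cl[OF r(1)] B(11) z(1) by simp
  have "h l = snd z-\<^sub>J j (r (b z))" using h(2) z Heq[OF z(1)] by simp
  hence "q (h l) = q (snd z)-\<^sub>Q q (j (r (b z)))"
   using hom_minus[OF S(2,3,5) zJ(1) jc[OF rz]] by simp
  also have "... = q (snd z)"
   using S(9)[OF rz] qc[OF zJ(1)] by (metis Q.M.r_zero Q.M.zero_closed Q.add_diff_cancel(3))
  finally show ?thesis using zJ(2) by simp
 qed
 thus ?thesis using h(1) by blast
qed

text \<open>Converse of \<open>ext1_zero_lift\<close> for injective \<open>J\<close>: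
  \<open>f\<close> extends to a map \<open>F\<close> with values in \<open>J\<close>, the composite
  of \<open>F\<close> with \<open>q\<close> factors through \<open>L\<close>, and subtracting a lift
  of that factor moves the values of \<open>F\<close> into \<open>N\<close>.\<close>

lemma ext1_zero_of_injective:
 fixes L N J Q :: "('a, 'u) module"
 assumes "injm R J" "ses R N j J q Q" "lmod R L"
  and lift: "!!g. g:Hom R L Q ==> EX h:Hom R L J. ALL x:|L|. q (h x) = g x"
 shows "ext1_zero R L N"
 unfolding ext1_zero_def
proof (intro allI impI ballI)
 fix A B :: "('a, 'u) module" and i p f
 assume AB: "ses R A i B p L" and f: "f:Hom R A N"
 note S = sesD[OF assms(2)] and T = sesD[OF AB]
 interpret J: left_module R J by (rule S)
 interpret Q: left_module R Q by (rule S)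
 note jc = hom_cl[OF S(4)] and pc = hom_cl[OF T(5)]
 note jf = compose_hom[OF T(1) f S(4)]
 obtain F where F: "F:Hom R B J" "!!x. x\<in>|A| ==> F (i x) = j (f x)"
  using injectiveD[OF assms(1) T(1,2,4,6) jf] by (metis compose_eq)
 note qF = compose_hom[OF T(2) F(1) S(5)]
 have ker: "compose |B| q F x = 0\<^sub>Q" if x: "x\<in>|B|" "p x = 0\<^sub>L" for x
 proof -
  obtain a where a: "a\<in>|A|" "x = i a" using T(10)[OF x] by blast
  thus ?thesis using F(2)[OF a(1)] S(9)[OF hom_cl[OF f a(1)]] x(1) by (simp add: compose_eq)
 qed
 obtain g where g: "g:Hom R L Q" "ALL x:|B|. g (p x) = compose |B| q F x"
  using factor_surj[OF T(2,3) S(3) T(5,7) qF ker] by blast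
 obtain h where h: "h:Hom R L J" "!!x. x\<in>|L| ==> q (h x) = g x"
  using lift[OF g(1)] by blast
 note hp = compose_hom[OF T(2,5) h(1)]
 let ?D = "\<lambda>x\<in>|B|. F x-\<^sub>J compose |B| h p x"
 note D = minus_hom[OF T(2) S(2) F(1) hp]
 have Deq: "?D x = F x-\<^sub>J h (p x)" if "x\<in>|B|" for x using that by (simp add: compose_eq)
 have "?D x\<in>j ` |N|" if x: "x\<in>|B|" for x
 proof -
  have c: "F x\<in>|J|" "h (p x)\<in>|J|"
   using hom_cl[OF F(1) x] hom_cl[OF h(1) pc[OF x]] by auto
  have "q (?D x) = q (F x)-\<^sub>Q q (h (p x))"
   unfolding Deq[OF x] by (rule hom_minus[OF S(2,3,5) c])
  also have "... = 0\<^sub>Q"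
   using h(2)[OF pc[OF x]] g(2) x hom_cl[OF S(5) c(1)] by (simp add: compose_eq Q.diff_eq_zero_iff)
  finally show ?thesis using S(10)[OF hom_cl[OF D x]] by blast
 qed
 then obtain k where k: "k:Hom R B N" "ALL x:|B|. j (k x) = ?D x"
  using factor_mono[OF S(1) T(2) S(4,6) D] by blast
 have "k (i a) = f a" if a: "a\<in>|A|" for a
 proof -
  note ia = hom_cl[OF T(4) a]
  note fa = hom_cl[OF f a]
  have "j (k (i a)) = F (i a)-\<^sub>J h (p (i a))" using k(2)[rule_format, OF ia] Deq[OF ia] by simp
  also have "h (p (i a)) = 0\<^sub>J" using T(9)[OF a] hom_zero[OF T(3) S(2) h(1)] by simp
  also have "F (i a)-\<^sub>J 0\<^sub>J = j (f a)"
   using F(2)[OF a] jc[OF fa] by (metis J.M.r_zero J.M.zero_closed J.add_diff_cancel(3))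
  finally show ?thesis
   using inj_onD[OF S(6)] hom_cl[OF k(1) ia] fa by blast
 qed
 thus "EX g:Hom R B N. ALL x:|A|. g (i x) = f x" using k(1) by blast
qed

text \<open>Both sides express that the second Ext group of \<open>L\<close> and \<open>N\<close>
  vanishes, once through a syzygy of \<open>L\<close> and once through a cosyzygy of
  \<open>N\<close>.\<close>

lemma ext1_zero_shift:
 fixes K P L N J N' :: "('a, 'u) module"
 assumes "projective_module R P" "ses R K i P p L" "injm R J" "ses R N j J q N'"
  and inf: "infinite (UNIV :: 'u set)"
 shows "ext1_zero R K N <-> ext1_zero R L N'"
proof -
 note S = sesD[OF assms(2)] and T = sesD[OF assms(4)]
 have "ext1_zero R L N'" if KN: "ext1_zero R K N"
  proof (rule ext1_zero_of_projective[OF assms(1,2) T(3)])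
   fix f assume f: "f:Hom R K N'"
   obtain h where h: "h:Hom R K J" "ALL x:|K|. q (h x) = f x"
    using ext1_zero_lift[OF KN assms(4) f S(1) inf] by blast
   obtain H where H: "H:Hom R P J" "!!x. x\<in>|K| ==> H (i x) = h x"
    by (rule injectiveD[OF assms(3) S(1,2,4,6) h(1)]) blast
   have "compose |P| q H:Hom R P N'" by (rule compose_hom[OF S(2) H(1) T(5)])
   moreover have "ALL x:|K|. compose |P| q H (i x) = f x"
    using h(2) H(2) hom_cl[OF S(4)] by (simp add: compose_eq)
   ultimately show "EX g:Hom R P N'. ALL x:|K|. g (i x) = f x" by blast
  qed
 moreover have "ext1_zero R K N" if LN: "ext1_zero R L N'"
  proof (rule ext1_zero_of_injective[OF assms(3,4) S(1)])
   fix f assume f: "f:Hom R K N'"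
   obtain g where g: "g:Hom R P N'" "!!x. x\<in>|K| ==> g (i x) = f x"
    by (rule ext1_zeroD[OF LN assms(2) f]) blast
   obtain H where H: "H:Hom R P J" "!!x. x\<in>|P| ==> q (H x) = g x"
    by (rule projectiveD[OF assms(1) T(2,3,5,7) g(1)]) blast
   have "compose |K| H i:Hom R K J" by (rule compose_hom[OF S(1,4) H(1)])
   moreover have "ALL x:|K|. q (compose |K| H i x) = f x"
    using g(2) H(2) hom_cl[OF S(4)] by (simp add: compose_eq)
   ultimately show "EX h:Hom R K J. ALL x:|K|. q (h x) = f x" by blast
  qed
 ultimately show ?thesis by blast
qed

text \<open>The piece of the long exact sequence from Hom(\<open>E\<close>, \<open>G\<close>) over
  Hom(\<open>Y\<close>, \<open>G\<close>) and Ext^1(\<open>Z\<close>, \<open>G\<close>) to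
  Ext^1(\<open>E\<close>, \<open>G\<close>), in terms of lifts: a lift found on \<open>E\<close> is
  corrected by an extension of its restriction to \<open>Y\<close>.\<close>

lemma ext1_zero_quotient:
 fixes Y E Z G J Q :: "('a, 'u) module"
 assumes "ses R Y i E p Z" "ext1_zero R E G" "injm R J" "ses R G j J q Q"
  and ext: "!!f. f:Hom R Y G ==> EX g:Hom R E G. ALL x:|Y|. g (i x) = f x"
  and inf: "infinite (UNIV :: 'u set)"
 shows "ext1_zero R Z G"
proof -
 note S = sesD[OF assms(1)] and T = sesD[OF assms(4)]
 interpret J: left_module R J by (rule T)
 interpret Q: left_module R Q by (rule T)
 show ?thesis
 proof (rule ext1_zero_of_injective[OF assms(3,4) S(3)])
  fix g assume g: "g:Hom R Z Q"
  note gp = compose_hom[OF S(2,5) g]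
  obtain h where h: "h:Hom R E J" "!!x. x\<in>|E| ==> q (h x) = g (p x)"
   using ext1_zero_lift[OF assms(2,4) gp S(2) inf] by (auto simp: compose_eq)
  note hc = hom_cl[OF h(1)] and ic = hom_cl[OF S(4)] and jc = hom_cl[OF T(4)]
  note hi = compose_hom[OF S(1,4) h(1)]
  have "compose |Y| h i y\<in>j ` |G|" if y: "y\<in>|Y|" for y
  proof -
   have "q (h (i y)) = 0\<^sub>Q"
    using h(2)[OF ic[OF y]] S(9)[OF y] hom_zero[OF S(3) T(3) g] by simp
   thus ?thesis using T(10)[OF hc[OF ic[OF y]]] y by (auto simp: compose_eq)
  qed
  then obtain f where f: "f:Hom R Y G" "ALL y:|Y|. j (f y) = compose |Y| h i y"
   using factor_mono[OF T(1) S(1) T(4,6) hi] by blast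
  obtain e where e: "e:Hom R E G" "!!y. y\<in>|Y| ==> e (i y) = f y" using ext[OF f(1)] by blast
  note ec = hom_cl[OF e(1)]
  note je = compose_hom[OF S(2) e(1) T(4)]
  let ?D = "\<lambda>x\<in>|E|. h x-\<^sub>J compose |E| j e x"
  note D = minus_hom[OF S(2) T(2) h(1) je]
  have Deq: "?D x = h x-\<^sub>J j (e x)" if "x\<in>|E|" for x using that by (simp add: compose_eq)
  have ker: "?D x = 0\<^sub>J" if x: "x\<in>|E|" "p x = 0\<^sub>Z" for x
  proof -
   obtain y where y: "y\<in>|Y|" "x = i y" using S(10)[OF x] by blast
   have "h x = j (e x)" using y e(2)[OF y(1)] f(2)[rule_format, OF y(1)] by (simp add: compose_eq)
   thus ?thesis unfolding Deq[OF x(1)] using J.diff_eq_zero_iff[OF hc[OF x(1)] jc[OF ec[OF x(1)]]] by simp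
  qed
  obtain H where H: "H:Hom R Z J" "ALL x:|E|. H (p x) = ?D x"
   using factor_surj[OF S(2,3) T(2) S(5,7) D ker] by blast
  have "q (H z) = g z" if z: "z\<in>|Z|" for z
  proof -
   have "z\<in>p ` |E|" using z S(7) by simp
   then obtain x where x: "x\<in>|E|" "z = p x" by blast
   have "q (H z) = q (h x-\<^sub>J j (e x))" using H(2)[rule_format, OF x(1)] Deq[OF x(1)] x(2) by simp
   also have "... = q (h x)-\<^sub>Q q (j (e x))" by (rule hom_minus[OF T(2,3,5) hc[OF x(1)] jc[OF ec[OF x(1)]]])
   also have "... = q (h x)"
    using T(9)[OF ec[OF x(1)]] hom_cl[OF T(5) hc[OF x(1)]]
    by (metis Q.M.r_zero Q.M.zero_closed Q.add_diff_cancel(3))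
   finally show ?thesis using h(2)[OF x(1)] x(2) by simp
  qed
  thus "EX h:Hom R Z J. ALL x:|Z|. q (h x) = g x" using H(1) by blast
 qed
qed

text \<open>Commutativity of \<open>B\<close> makes the image normal in the kernel; the factor group
  is trivial exactly when the image is its only coset.\<close>

lemma trivial_homology_iff:
 assumes "group A" "comm_group B" "group C" "f\<in>hom A B" "g\<in>hom B C"
  and "!!x. x\<in>|A| ==> g (f x) = \<one>\<^bsub>C\<^esub>"
 shows "trivial_group (homology A f B g C) <-> exact_at A f B g C"
proof -
 interpret B: comm_group B by fact
 interpret f: group_hom A B f using assms B.group_axioms by (simp add: group_hom_def group_hom_axioms_def)
 interpret g: group_hom B C g using assms B.group_axioms by (simp add: group_hom_def group_hom_axioms_def)
 let ?a = "kernel B C g"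
 let ?K = "B(|carrier := ?a|)"
 let ?N = "f ` |A|"
 have K: "subgroup ?a B" by (rule g.subgroup_kernel)
 interpret K: comm_group ?K
  by (rule group.group_comm_groupI[OF subgroup.subgroup_is_group[OF K B.group_axioms]])
   (use subgroup.subset[OF K] B.m_comm in auto)
 have NK: "?N <= ?a" using assms(6) f.hom_closed by (auto simp: kernel_def)
 have "subgroup ?N B" by (rule f.img_is_subgroup)
 hence "subgroup ?N ?K" using B.subgroup_incl[OF _ K] NK by blast
 hence N: "?N \<lhd> ?K" by (rule K.subgroup_imp_normal)
 interpret N: normal ?N ?K by (rule N)
 let ?b = "?K Mod ?N"
 have grp: "group ?b" by (rule N.factorgroup_is_group)
 have "trivial_group ?b <-> |?b| = {?N}"
  using grp by (auto simp: trivial_group_def FactGroup_def)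
 also have "... <-> ?N = ?a"
 proof
  assume *: "|?b| = {?N}"
  have "x\<in>?N" if x: "x\<in>?a" for x
  proof -
   have "?N #>\<^bsub>?K\<^esub> x\<in>|?b|" using x by (auto simp: FactGroup_def RCOSETS_def)
   hence "?N #>\<^bsub>?K\<^esub> x = ?N" using * by blast
   moreover have "x\<in>?N #>\<^bsub>?K\<^esub> x" using K.rcos_self[OF _ N.subgroup_axioms, of x] x by simp
   ultimately show ?thesis by simp
  qed
  thus "?N = ?a" using NK by blast
 next
  assume *: "?N = ?a"
  have "?N #>\<^bsub>?K\<^esub> x = ?N" if "x\<in>?a" for x
   using that * K.coset_join2[OF _ N.subgroup_axioms, of x] by simp
  hence "|?b| <= {?N}" by (auto simp: FactGroup_def RCOSETS_def)
  moreover have "|?b| ~= {}" using group.is_monoid[OF grp] monoid.one_closed by blast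
  ultimately show "|?b| = {?N}" by blast
 qed
 finally show ?thesis by (simp add: homology_def exact_at_def)
qed

lemma comm_group_hom_group:
 assumes "lmod R M" "lmod R N"
 shows "comm_group (hom_group R M N)"
proof -
 interpret M: left_module R M by fact
 interpret N: left_module R N by fact
 have ext: "f = g" if "f:Hom R M N" "g:Hom R M N" "!!x. x\<in>|M| ==> f x = g x" for f g
  using hom_eqI[OF that] .
 show ?thesis
 proof (rule comm_groupI)
  let ?a = "hom_group R M N"
  show "x\<otimes>\<^sub>?a y\<in>|?a|"
   if "x\<in>|?a|" "y\<in>|?a|" for x y
   using that add_hom[OF assms] by (simp add: hom_group_def)
  show "\<one>\<^bsub>?a\<^esub>\<in>|?a|"
   using zero_hom[OF assms] by (simp add: hom_group_def)
  show "x\<otimes>\<^sub>?a y\<otimes>\<^sub>?a z = x\<otimes>\<^sub>?a (y\<otimes>\<^sub>?a z)"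
   if "x\<in>|?a|" "y\<in>|?a|" "z\<in>|?a|" for x y z
   using that by (auto simp: hom_group_def N.M.a_assoc hom_cl[of _ R M N] intro!: restrict_ext)
  show "x\<otimes>\<^sub>?a y = y\<otimes>\<^sub>?a x"
   if "x\<in>|?a|" "y\<in>|?a|" for x y
   using that by (auto simp: hom_group_def N.M.a_comm hom_cl[of _ R M N] intro!: restrict_ext)
  show "\<one>\<^bsub>?a\<^esub>\<otimes>\<^sub>?a x = x" if "x\<in>|?a|" for x
  proof -
   have x: "x:Hom R M N" using that by (simp add: hom_group_def)
   show ?thesis
    using add_hom[OF assms zero_hom[OF assms] x] x
    by (intro ext) (auto simp: hom_group_def hom_cl[OF x])
  qed
  show "EX y:|?a|. y\<otimes>\<^sub>?a x = \<one>\<^bsub>?a\<^esub>"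
   if "x\<in>|?a|" for x
  proof -
   have x: "x:Hom R M N" using that by (simp add: hom_group_def)
   show ?thesis
    using neg_hom[OF assms x] hom_cl[OF x]
    by (intro bexI[of _ "\<lambda>y\<in>|M|. -\<^sub>N x y"])
     (auto simp: hom_group_def N.M.l_neg intro!: restrict_ext)
  qed
 qed
qed

lemma hom_group_precompose:
 assumes "lmod R M" "lmod R M'" "lmod R N" "f:Hom R M M'"
 shows "(%g. compose |M| g f)\<in>hom (hom_group R M' N) (hom_group R M N)"
proof (rule homI)
 show "compose |M| g f\<in>|hom_group R M N|" if "g\<in>|hom_group R M' N|" for g
  using that compose_hom[OF assms(1,4)] by (simp add: hom_group_def)
 show "compose |M| (g\<otimes>\<^sub>(hom_group R M' N) h) f =
   compose |M| g f\<otimes>\<^sub>(hom_group R M N) compose |M| h f" for g h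
  using hom_cl[OF assms(4)] by (auto simp: hom_group_def compose_def intro!: restrict_ext)
qed

text \<open>Dimension shifting along a resolution: \<open>Om n\<close> is the \<open>n\<close>-th syzygy in the chosen resolution.\<close>

lemma ext_zero_syzygies:
 fixes M :: "('a, 'u) module"
 assumes M: "lmod R M"
  and ex: "\<exists>(P :: nat => ('a, 'u) module) d v. projective_resolution R M P d v"
 obtains Om P :: "nat => ('a, 'u) module" and i p where "Om 0 = M"
  "!!n. ses R (Om (Suc n)) (i n) (P n) (p n) (Om n)" "!!n. projective_module R (P n)"
  "!!N. lmod R N ==>
   (\<forall>k\<ge>1. trivial_group (Ext R k M N)) <-> (ALL n. ext1_zero R (Om n) N)"
proof -
 obtain P :: "nat => ('a, 'u) module" and d v where c: "chosen_proj_res R M = (P, d, v)"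
  by (cases "chosen_proj_res R M :: (nat => ('a, 'u) module)\<times>_") auto
 have "projective_resolution R M P d v"
  using someI_ex[of "\<lambda>(P :: nat => ('a, 'u) module, d, v). projective_resolution R M P d v"] ex c
  by (auto simp: chosen_proj_res_def)
 hence pr: "!!n. projective_module R (P n)" and d: "!!n. d n:Hom R (P (Suc n)) (P n)"
  and e: "v:Hom R (P 0) M" "v ` |P 0| = |M|"
  and ex0: "d 0 ` |P (Suc 0)| = a_kernel (P 0) M v"
  and exn: "!!n. d (Suc n) ` |P (Suc (Suc n))| = a_kernel (P (Suc n)) (P n) (d n)"
  by (auto simp: projective_resolution_def a_exact_at_def)
 have P: "lmod R (P n)" for n using pr[of n] by (simp add: projective_module_def)
 define Z where "Z n = d n ` |P (Suc n)|" for n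
 have Z: "submodule (Z n) R (P n)" for n
  unfolding Z_def by (rule submodule_image[OF P P d left_module.submodule_carrier[OF P]])
 \<comment> \<open>Positive syzygies are the images of the differentials as submodules, so the same
   \<open>d m\<close> serves as differential and as projective cover map of
   \<open>Om (Suc m)\<close>.\<close>
 define Om where "Om n = (case n of 0 => M | Suc m => (P m)(|carrier := Z m|))" for n
 define p where "p n = (case n of 0 => v | Suc m => d m)" for n
 have pS: "d n:Hom R (P (Suc n)) ((P n)(|carrier := Z n|))" for n
  by (rule hom_into_sub[OF d]) (simp add: Z_def)
 have ses: "ses R (Om (Suc n)) (\<lambda>x\<in>Z n. x) (P n) (p n) (Om n)" for n
 proof (cases n)
  case 0
  show ?thesis using ses_kernel[OF P M e] ex0 by (simp add: 0 Om_def p_def Z_def)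
 next
  case (Suc m)
  have "a_kernel (P (Suc m)) ((P m)(|carrier := Z m|)) (d m) = Z (Suc m)"
   using exn[of m] by (simp add: Z_def a_kernel_def')
  thus ?thesis
   using ses_kernel[OF P left_module.sub_left_module[OF P Z] pS, of m] Suc by (simp add: Om_def p_def) (simp add: Z_def)
 qed
 have main: "(\<forall>k\<ge>1. trivial_group (Ext R k M N)) <-> (ALL n. ext1_zero R (Om n) N)" if N: "lmod R N" for N :: "('a, 'u) module"
 proof -
  interpret N: left_module R N by fact
  have "trivial_group (Ext R (Suc n) M N) <-> ext1_zero R (Om n) N" for n
  proof -
   let ?f = "%g. compose |P (Suc n)| g (d n)"
   let ?g = "%g. compose |P (Suc (Suc n))| g (d (Suc n))"
   have dd: "d n (d (Suc n) x) = 0\<^sub>(P n)" if "x\<in>|P (Suc (Suc n))|" for x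
    using exn[of n] that by (auto simp: a_kernel_def')
   let ?a = "Hom R (P n) N"
   let ?b = "Hom R (Om (Suc n)) N"
   let ?c = "hom_group R (P (Suc (Suc n))) N"
   let ?d = "exact_at (hom_group R (P n) N) ?f (hom_group R (P (Suc n)) N) ?g ?c"
   have "?g (?f g) = \<one>\<^bsub>?c\<^esub>" if g: "g\<in>|hom_group R (P n) N|" for g
   proof -
    have "g\<in>?a" using g by (simp add: hom_group_def)
    from hom_zero[OF P N this] show ?thesis
     using dd hom_cl[OF d] by (auto simp: hom_group_def compose_def intro!: restrict_ext)
   qed
   hence "trivial_group (Ext R (Suc n) M N) <->
     ?d"
    unfolding Ext_def c
    using trivial_homology_iff[OF comm_group.axioms(2)[OF comm_group_hom_group[OF P N]]
      comm_group_hom_group[OF P N] comm_group.axioms(2)[OF comm_group_hom_group[OF P N]]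
      hom_group_precompose[OF P P N d] hom_group_precompose[OF P P N d]]
    by simp
   \<comment> \<open>Cocycles vanish on the image of the next differential and hence are
     homomorphisms on \<open>Om (Suc n)\<close>; coboundaries are those that extend to
     \<open>P n\<close>.\<close>
   also have "... <-> (ALL f:?b. EX g:?a. ALL x:|Om (Suc n)|. g ((\<lambda>x\<in>Z n. x) x) = f x)"
   proof
    assume ex: "?d"
    show "ALL f:?b. EX g:?a. ALL x:|Om (Suc n)|. g ((\<lambda>x\<in>Z n. x) x) = f x"
    proof
     fix f assume "f\<in>?b"
     hence f: "f:Hom R ((P n)(|carrier := Z n|)) N" by (simp add: Om_def)
     note fd = compose_hom[OF P pS f]
     have f0: "f 0\<^sub>(P n) = 0\<^sub>N" using hom_zero[OF left_module.sub_left_module[OF P Z] N f] by simp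
     have "compose |P (Suc n)| f (d n)\<in>kernel (hom_group R (P (Suc n)) N) ?c ?g"
      using fd dd f0 hom_cl[OF d] by (auto simp: kernel_def hom_group_def compose_def intro!: restrict_ext)
     hence "compose |P (Suc n)| f (d n)\<in>?f ` ?a"
      using ex by (simp add: exact_at_def hom_group_def)
     then obtain g where g: "g\<in>?a" "compose |P (Suc n)| f (d n) = ?f g" by blast
     have "g y = f y" if "y\<in>Z n" for y
     proof -
      obtain x where x: "x\<in>|P (Suc n)|" "y = d n x" using \<open>y \<in> Z n\<close> by (auto simp: Z_def)
      show ?thesis using fun_cong[OF g(2), of x] x by (simp add: compose_eq)
     qed
     thus "EX g:?a. ALL x:|Om (Suc n)|. g ((\<lambda>x\<in>Z n. x) x) = f x"
      using g(1) by (auto simp: Om_def)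
    qed
   next
    assume ext: "ALL f:?b. EX g:?a. ALL x:|Om (Suc n)|. g ((\<lambda>x\<in>Z n. x) x) = f x"
    let ?e = "\<lambda>x\<in>|P (Suc (Suc n))|. 0\<^sub>N"
    have "w\<in>?f ` ?a" if w: "w:Hom R (P (Suc n)) N" "?g w = ?e" for w
    proof -
     have w0: "w x = 0\<^sub>N" if x: "x\<in>|P (Suc n)|" "d n x = \<zero>\<^bsub>(P n)(|carrier := Z n|)\<^esub>" for x
     proof -
      have "x\<in>d (Suc n) ` |P (Suc (Suc n))|" using x exn[of n] by (simp add: a_kernel_def')
      then obtain y where y: "y\<in>|P (Suc (Suc n))|" "x = d (Suc n) y" by blast
      show ?thesis using fun_cong[OF w(2), of y] y by (simp add: compose_eq)
     qed
     obtain f where f: "f:Hom R ((P n)(|carrier := Z n|)) N" "ALL x:|P (Suc n)|. f (d n x) = w x"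
      using factor_surj[OF P left_module.sub_left_module[OF P Z] N pS _ w(1) w0] by (simp add: Z_def) blast
     have "f\<in>?b" using f(1) by (simp add: Om_def)
     from bspec[OF ext this] obtain g where g: "g\<in>?a" "ALL x:Z n. g x = f x"
      by (auto simp: Om_def)
     have "?f g = w"
      by (rule hom_eqI[OF compose_hom[OF P d g(1)] w(1)]) (use f(2) g(2) in \<open>simp add: compose_eq Z_def\<close>)
     thus ?thesis using g(1) by blast
    qed
    moreover have "?f g:Hom R (P (Suc n)) N" "?g (?f g) = ?e"
     if g: "g\<in>?a" for g
     using compose_hom[OF P d g] dd hom_zero[OF P N g] hom_cl[OF d]
     by (auto simp: compose_def intro!: restrict_ext)
    ultimately have "?f ` ?a =
      {w\<in>Hom R (P (Suc n)) N. ?g w = ?e}" by blast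
    thus "?d"
     by (simp only: exact_at_def kernel_def hom_group_def partial_object.simps monoid.simps)
   qed
   also have "... <-> ext1_zero R (Om n) N"
   proof
    assume "ALL f:?b. EX g:?a. ALL x:|Om (Suc n)|. g ((\<lambda>x\<in>Z n. x) x) = f x"
    from ext1_zero_of_projective[OF pr ses N, OF bspec[OF this]] show "ext1_zero R (Om n) N" .
   next
    assume e: "ext1_zero R (Om n) N"
    show "ALL f:?b. EX g:?a. ALL x:|Om (Suc n)|. g ((\<lambda>x\<in>Z n. x) x) = f x"
    proof
     fix f assume "f\<in>?b"
     obtain g where "g\<in>?a" "ALL x:|Om (Suc n)|. g ((\<lambda>x\<in>Z n. x) x) = f x"
      by (rule ext1_zeroD[OF e ses \<open>f \<in> _\<close>]) blast
     thus "EX g:?a. ALL x:|Om (Suc n)|. g ((\<lambda>x\<in>Z n. x) x) = f x"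
      by blast
    qed
   qed
   finally show ?thesis .
  qed
  moreover have "(\<forall>k\<ge>1. Q k) <-> (ALL n. Q (Suc n))" for Q
   by (auto simp: Suc_le_eq gr0_conv_Suc)
  ultimately show ?thesis by simp
 qed
 show ?thesis
  by (rule that[of Om "%n. \<lambda>x\<in>Z n. x" P p, OF _ ses pr main]) (simp add: Om_def)
qed

definition ext_zero :: "('a, 'x) ring_scheme => ('a, 'u) module => ('a, 'u) module => bool"
 where "ext_zero R M N <-> (\<forall>i\<ge>1. trivial_group (Ext R i M N))"

text \<open>Passing from \<open>N\<close> to its cosyzygy lowers every degree by one, so the Ext
  groups of \<open>M\<close> and \<open>N'\<close> account for those of \<open>M\<close> and
  \<open>N\<close> in all degrees except the first.\<close>

lemma ext_zero_shift:
 fixes M N J N' :: "('a, 'u) module"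
 assumes "lmod R M" "\<exists>(P :: nat => ('a, 'u) module) d w. projective_resolution R M P d w"
  and "injm R J" "ses R N j J q N'" "infinite (UNIV :: 'u set)"
 shows "ext_zero R M N <-> ext1_zero R M N & ext_zero R M N'"
proof -
 obtain Om P :: "nat => ('a, 'u) module" and i p where Om: "Om 0 = M"
  "!!n. ses R (Om (Suc n)) (i n) (P n) (p n) (Om n)" "!!n. projective_module R (P n)"
  "!!N. lmod R N ==>
   (\<forall>k\<ge>1. trivial_group (Ext R k M N)) <-> (ALL n. ext1_zero R (Om n) N)"
  by (rule ext_zero_syzygies[OF assms(1,2)], rule that, assumption+)
 note N = sesD(1,3)[OF assms(4)]
 have "ext1_zero R (Om (Suc n)) N <-> ext1_zero R (Om n) N'" for n
  by (rule ext1_zero_shift[OF Om(3,2) assms(3,4,5)])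
 thus ?thesis unfolding ext_zero_def Om(4)[OF N(1)] Om(4)[OF N(2)]
  using Om(1) not0_implies_Suc by metis
qed

text \<open>The \<open>n\<close>-th syzygy of \<open>M\<close> is exchanged for \<open>n\<close>
  cosyzygies of \<open>N\<close>, which can be kept inside \<open>C\<close>; what remains are first
  Ext groups of \<open>M\<close> itself.\<close>

lemma ext_zero_coinduct:
 fixes M :: "('a, 'u) module"
 assumes "lmod R M" "\<exists>(P :: nat => ('a, 'u) module) d w. projective_resolution R M P d w"
  and "infinite (UNIV :: 'u set)" "C N"
  and step: "!!N. C N ==> ext1_zero R M N &
   (\<exists>(J :: ('a, 'u) module) j q N'. injm R J & ses R N j J q N' & C N')"
 shows "ext_zero R M N"
proof -
 obtain Om P :: "nat => ('a, 'u) module" and i p where Om: "Om 0 = M"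
  "!!n. ses R (Om (Suc n)) (i n) (P n) (p n) (Om n)" "!!n. projective_module R (P n)"
  "!!N. lmod R N ==>
   (\<forall>k\<ge>1. trivial_group (Ext R k M N)) <-> (ALL n. ext1_zero R (Om n) N)"
  by (rule ext_zero_syzygies[OF assms(1,2)], rule that, assumption+)
 have "C N ==> ext1_zero R (Om n) N" for n N
 proof (induction n arbitrary: N)
  case 0
  thus ?case using step Om(1) by simp
 next
  case (Suc n)
  obtain J :: "('a, 'u) module" and j q N' where J: "injm R J" "ses R N j J q N'" "C N'"
   using step[OF Suc.prems] by blast
  show ?case using ext1_zero_shift[OF Om(3,2) J(1,2) assms(3)] Suc.IH[OF J(3)] by (rule iffD2)
 qed
 hence "ALL n. ext1_zero R (Om n) N" using assms(4) by simp
 moreover have "lmod R N"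
  using step[OF assms(4)] by (elim conjE exE, rule_tac sesD(1))
 ultimately show ?thesis unfolding ext_zero_def by (subst Om(4))
qed

section \<open>Commutative artinian rings\<close>

lemma left_module_of_module: "module R M ==> lmod R M"
proof -
 assume "module R M"
 then interpret module R M .
 show ?thesis
  by (rule left_moduleI)
   (auto simp: R.ring_axioms M.abelian_group_axioms smult_l_distr smult_r_distr smult_assoc1)
qed

section \<open>Ideals, maximal ideals and the descending chain condition\<close>

context cring
begin

lemma idealD:
 assumes "ideal I R"
 shows "I <= |R|" "x\<in>I ==> x\<in>|R|" "\<zero>\<in>I"
  "x\<in>I ==> y\<in>I ==> x\<oplus> y\<in>I" "x\<in>I ==> y\<in>I ==> x\<ominus> y\<in>I"
  "a\<in>|R| ==> x\<in>I ==> a\<otimes> x\<in>I" "a\<in>|R| ==> x\<in>I ==> x\<otimes> a\<in>I"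
proof -
 interpret ideal I R by fact
 show "I <= |R|" "x\<in>I ==> x\<in>|R|" "\<zero>\<in>I"
  "x\<in>I ==> y\<in>I ==> x\<oplus> y\<in>I" "x\<in>I ==> y\<in>I ==> x\<ominus> y\<in>I"
  "a\<in>|R| ==> x\<in>I ==> a\<otimes> x\<in>I" "a\<in>|R| ==> x\<in>I ==> x\<otimes> a\<in>I"
  using a_subset Icarr zero_closed a_closed I_l_closed I_r_closed by (auto simp: a_minus_def)
qed

lemma idealI':
 assumes "I <= |R|" "\<zero>\<in>I" "!!x y. x\<in>I ==> y\<in>I ==> x\<oplus> y\<in>I"
  "!!a x. a\<in>|R| ==> x\<in>I ==> a\<otimes> x\<in>I"
 shows "ideal I R"
proof (rule idealI[OF ring_axioms])
 have inv: "\<ominus> x\<in>I" if "x\<in>I" for x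
  using assms(4)[of "\<ominus> \<one>" x] that assms(1) by (auto simp: l_minus)
 show "subgroup I (add_monoid R)"
  using assms(1-3) inv by (intro subgroup.intro) (auto simp: a_inv_def)
 show "a\<otimes> x\<in>I" if "a\<in>I" "x\<in>|R|" for a x
  using assms(1) assms(4)[OF that(2,1)] that by (metis m_comm subsetD)
qed (rule assms(4))

lemma ideal_adjoin:
 assumes "ideal I R" "x\<in>|R|"
 shows "ideal {i\<oplus> r\<otimes> x | i r. i\<in>I & r\<in>|R| } R"
proof (rule idealI')
 note D = idealD[OF assms(1)]
 show "{i\<oplus> r\<otimes> x | i r. i\<in>I & r\<in>|R| } <= |R|" using D(2) assms(2) by auto
 have "\<zero> = \<zero>\<oplus> \<zero>\<otimes> x" using assms(2) by simp
 thus "\<zero>\<in>{i\<oplus> r\<otimes> x | i r. i\<in>I & r\<in>|R| }" using D(3) by blast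
 fix a b assume "a\<in>{i\<oplus> r\<otimes> x | i r. i\<in>I & r\<in>|R| }" "b\<in>{i\<oplus> r\<otimes> x | i r. i\<in>I & r\<in>|R| }"
 then obtain i r j s where a: "a = i\<oplus> r\<otimes> x" "i\<in>I" "r\<in>|R|"
  and b: "b = j\<oplus> s\<otimes> x" "j\<in>I" "s\<in>|R|" by blast
 have "a\<oplus> b = (i\<oplus> j)\<oplus> (r\<oplus> s)\<otimes> x"
  using a b D(2) assms(2) by (simp add: l_distr a_ac)
 moreover have "i\<oplus> j\<in>I" "r\<oplus> s\<in>|R|" using a b D(4) by auto
 ultimately show "a\<oplus> b\<in>{i\<oplus> r\<otimes> x | i r. i\<in>I & r\<in>|R| }" by blast
next
 note D = idealD[OF assms(1)]
 fix c a assume c: "c\<in>|R|" and "a\<in>{i\<oplus> r\<otimes> x | i r. i\<in>I & r\<in>|R| }"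
 then obtain i r where a: "a = i\<oplus> r\<otimes> x" "i\<in>I" "r\<in>|R|" by blast
 have "c\<otimes> a = c\<otimes> i\<oplus> (c\<otimes> r)\<otimes> x" using a c D(2) assms(2) by (simp add: r_distr m_assoc)
 moreover have "c\<otimes> i\<in>I" "c\<otimes> r\<in>|R|" using a c D(6) by auto
 ultimately show "c\<otimes> a\<in>{i\<oplus> r\<otimes> x | i r. i\<in>I & r\<in>|R| }" by blast
qed

lemma mem_adjoin:
 assumes "ideal I R" "x\<in>|R|"
 shows "I <= {i\<oplus> r\<otimes> x | i r. i\<in>I & r\<in>|R| }" "x\<in>{i\<oplus> r\<otimes> x | i r. i\<in>I & r\<in>|R| }"
proof -
 note D = idealD[OF assms(1)]
 show "I <= {i\<oplus> r\<otimes> x | i r. i\<in>I & r\<in>|R| }"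
 proof
  fix i assume "i\<in>I"
  hence "i = i\<oplus> \<zero>\<otimes> x" using D(2) assms(2) by simp
  thus "i\<in>{i\<oplus> r\<otimes> x | i r. i\<in>I & r\<in>|R| }" using \<open>i \<in> I\<close> by blast
 qed
 have "x = \<zero>\<oplus> \<one>\<otimes> x" using assms(2) by simp
 thus "x\<in>{i\<oplus> r\<otimes> x | i r. i\<in>I & r\<in>|R| }" using D(3) by blast
qed

text \<open>Invertibility of \<open>r\<close> in the residue field, stated as an equation in
  \<open>R\<close>; later arguments over residue fields take this form, so that the fields are never
  formed.\<close>

lemma maximalideal_unit:
 assumes "maximalideal m R" "r\<in>|R|" "r\<notin>m"
 obtains s a where "s\<in>|R|" "a\<in>m" "\<one> = s\<otimes> r\<oplus> a"
proof -
 interpret m: maximalideal m R by fact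
 have m: "ideal m R" by (rule m.is_ideal)
 let ?J = "{i\<oplus> s\<otimes> r | i s. i\<in>m & s\<in>|R| }"
 have "ideal ?J R" by (rule ideal_adjoin[OF m assms(2)])
 moreover have "m <= ?J" "r\<in>?J" using mem_adjoin[OF m assms(2)] by auto
 ultimately have "?J = |R|" using m.I_maximal[of ?J] idealD(1)[of ?J] assms(3) by blast
 hence "\<one>\<in>?J" by simp
 then obtain a s where as: "a\<in>m" "s\<in>|R|" "\<one> = a\<oplus> s\<otimes> r" by blast
 hence "\<one> = s\<otimes> r\<oplus> a" using idealD(2)[OF m as(1)] assms(2) by (simp add: a_comm)
 thus ?thesis using that as by blast
qed

lemma maximalideal_eq:
 assumes "maximalideal m R" "maximalideal m' R" "m <= m'"
 shows "m = m'"
proof -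
 have "ideal m' R" "ideal m R" using assms(1,2) by (auto simp: maximalideal_def)
 thus ?thesis
  using maximalideal.I_maximal[OF assms(1), of m'] maximalideal.I_notcarr[OF assms(2)] assms(3) idealD(1) by blast
qed

lemma maximalideal_primeD:
 assumes "maximalideal m R" "a\<in>|R|" "b\<in>|R|" "a\<otimes> b\<in>m"
 shows "a\<in>m \<or> b\<in>m"
 using primeideal.I_prime[OF maximalideal_prime[OF assms(1)] assms(2-4)] .

lemma ideal_one_imp: "ideal I R ==> \<one>\<in>I ==> I = |R|"
 using idealD(6)[of I _ \<one>] idealD(1)[of I] by force

lemma ex_maximalideal:
 assumes "ideal I R" "\<one>\<notin>I"
 obtains m where "maximalideal m R" "I <= m"
proof -
 have "EX M:{J. ideal J R & I <= J & \<one>\<notin>J}. ALL J:{J. ideal J R & I <= J & \<one>\<notin>J}. M <= J --> J = M"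
 proof (rule subset_Zorn_nonempty)
  show "{J. ideal J R & I <= J & \<one>\<notin>J} ~= {}" using assms by blast
  fix C assume C: "C ~= {}" "subset.chain {J. ideal J R & I <= J & \<one>\<notin>J} C"
  hence "subset.chain {J. ideal J R} C" by (auto simp: subset.chain_def)
  from chain_Union_is_ideal[OF this] have "ideal (\<Union>C) R" using C(1) by simp
  thus "\<Union>C\<in>{J. ideal J R & I <= J & \<one>\<notin>J}" using C by (auto simp: subset.chain_def)
 qed
 then obtain M where M0: "M\<in>{J. ideal J R & I <= J & \<one>\<notin>J}"
  and max0: "ALL J:{J. ideal J R & I <= J & \<one>\<notin>J}. M <= J --> J = M" by (rule bexE)
 have M: "ideal M R" "I <= M" "\<one>\<notin>M" using M0 by simp_all
 have max: "J = M" if "ideal J R" "I <= J" "\<one>\<notin>J" "M <= J" for J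
  using max0 that by simp
 have "maximalideal M R"
 proof (rule maximalidealI[OF M(1)])
  show "|R| ~= M" using M(3) by auto
  show "J = M \<or> J = |R|" if "ideal J R" "M <= J" "J <= |R|" for J
  proof (cases "\<one>\<in>J")
   case True
   thus ?thesis using ideal_one_imp[OF that(1)] by simp
  next
   case False
   thus ?thesis using max[OF that(1) subset_trans[OF M(2) that(2)] False that(2)] by simp
  qed
 qed
 thus ?thesis using M(2) by (rule that)
qed

text \<open>Without a minimal member, dependent choice would produce a strictly decreasing sequence
  of ideals, contradicting stabilisation.\<close>

lemma artinian_min:
 assumes "artinian_ring R" "I\<in>F" "!!J. J\<in>F ==> ideal J R"
 obtains W where "W\<in>F" "ALL J:F. J <= W --> J = W"
proof -
 have "EX W:F. ALL J:F. J <= W --> J = W"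
 proof (rule ccontr)
  assume "~ ?thesis"
  hence *: "ALL W:F. EX J:F. J \<subset> W" by blast
  have "EX f. \<forall>n::nat. f n\<in>F & f (Suc n) \<subset> f n"
  proof (rule dependent_nat_choice)
   show "EX x. x\<in>F" using assms(2) by blast
   show "EX y. y\<in>F & y \<subset> x" if "x\<in>F" for x and n :: nat using bspec[OF * that] by blast
  qed
  then obtain f where f: "\<forall>n::nat. f n\<in>F & f (Suc n) \<subset> f n" by (rule exE)
  hence "ALL n. ideal (f n) R & f (Suc n) <= f n" using assms(3) by (simp add: psubset_imp_subset)
  then obtain k where k: "\<forall>n\<ge>k. f n = f k" using assms(1)[unfolded artinian_ring_def, THEN conjunct2] by meson
  have "f (Suc k) = f k" by (rule k[THEN spec, THEN mp]) simp
  moreover have "f (Suc k) \<subset> f k" using f by simp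
  ultimately show False by simp
 qed
 thus ?thesis using that by (rule bexE)
qed

text \<open>The unit ideal enters as the empty product; it makes the family nonempty before any
  maximal ideal has been found.\<close>

inductive_set max_products :: "'a set set" where
 base: "|R|\<in>max_products"
| step: "I\<in>max_products ==> maximalideal m R ==> ideal_prod R I m\<in>max_products"

lemma max_products_ideal: "I\<in>max_products ==> ideal I R"
 by (induction rule: max_products.induct) (auto intro: oneideal ideal_prod_is_ideal simp: maximalideal_def)

lemma ideal_prod_le:
 assumes "ideal A R" "!!i j. i\<in>I ==> j\<in>J ==> i\<otimes> j\<in>A"
 shows "ideal_prod R I J <= A"
proof
 fix x assume "x\<in>ideal_prod R I J"
 thus "x\<in>A" by (induction rule: ideal_prod.induct) (use assms idealD(4)[OF assms(1)] in auto)
qed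

text \<open>A minimal product \<open>I\<close> of maximal ideals satisfies \<open>I m = I\<close> for all maximal \<open>m\<close>, hence \<open>I I = I\<close>;
 if \<open>I \<noteq> 0\<close>, a minimal ideal \<open>L\<close> with \<open>I L \<noteq> 0\<close> violates Nakayama's lemma.\<close>

lemma zero_max_product:
 assumes "artinian_ring R"
 shows "{\<zero>}\<in>max_products"
proof -
 obtain I where I: "I\<in>max_products" "ALL J:max_products. J <= I --> J = I"
  by (rule artinian_min[OF assms max_products.base max_products_ideal])
 note Ii = max_products_ideal[OF I(1)]
 note ID = idealD[OF Ii]
 have Im: "ideal_prod R I m = I" "I <= m" if m: "maximalideal m R" for m
 proof -
  have mi: "ideal m R" using m by (simp add: maximalideal_def)
  note inter = ideal_prod_inter[OF Ii mi]
  show "ideal_prod R I m = I" using I(2)[rule_format, OF max_products.step[OF I(1) m]] inter by simp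
  thus "I <= m" using inter by blast
 qed
 \<comment> \<open>If \<open>I\<close> times a product \<open>J\<close> of maximal ideals lies in
   \<open>A\<close>, then so does \<open>I\<close>, because \<open>I\<close> absorbs the factors of
   \<open>J\<close> one at a time. The case \<open>J = I\<close> is idempotency of \<open>I\<close>
   in the form used below.\<close>
 have key: "J\<in>max_products ==> ideal A R ==> (!!i j. i\<in>I ==> j\<in>J ==> i\<otimes> j\<in>A) ==> I <= A" for J A
 proof (induction arbitrary: A rule: max_products.induct)
  case base
  thus ?case using ID(2) r_one one_closed by (metis subsetI)
 next
  case (step J m)
  have mi: "ideal m R" using step by (simp add: maximalideal_def)
  note mD = idealD[OF mi] and JD = idealD[OF max_products_ideal[OF step.hyps(1)]] and AD = idealD[OF step.prems(1)]
  let ?A = "{r\<in>|R|. ALL a:m. r\<otimes> a\<in>A}"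
  have "I <= ?A"
  proof (rule step.IH)
   show "ideal ?A R"
    by (rule idealI') (use AD mD(2) in \<open>auto simp: l_distr m_assoc\<close>)
   fix i j assume ij: "i\<in>I" "j\<in>J"
   have "i\<otimes> j\<otimes> a\<in>A" if "a\<in>m" for a
    using step.prems(2)[OF ij(1) ideal_prod.prod[OF ij(2) that]] ID(2)[OF ij(1)] JD(2)[OF ij(2)] mD(2)[OF that]
    by (simp add: m_assoc)
   thus "i\<otimes> j\<in>?A" using ID(2)[OF ij(1)] JD(2)[OF ij(2)] by simp
  qed
  hence "ideal_prod R I m <= A" by (intro ideal_prod_le[OF step.prems(1)]) auto
  thus ?case using Im(1)[OF step.hyps(2)] by simp
 qed
 have "I = {\<zero>}"
 proof (rule ccontr)
  assume "I ~= {\<zero>}"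
  let ?F = "{L. ideal L R & (EX i:I. EX l:L. i\<otimes> l ~= \<zero>)}"
  have "I\<in>?F"
  proof (rule ccontr)
   assume "I\<notin>?F"
   hence "I <= {\<zero>}" using key[OF I(1) zeroideal] Ii by auto
   thus False using \<open>I \<noteq> {\<zero>}\<close> ID(3) by blast
  qed
  then obtain L where L: "L\<in>?F" "ALL J:?F. J <= L --> J = L"
   by (rule artinian_min[OF assms]) simp_all
  \<comment> \<open>Minimality of \<open>L\<close> will make it equal to \<open>I x\<close>, so that
    \<open>x = y x\<close> with \<open>y\<close> in \<open>I\<close>. As \<open>I\<close> lies in
    every maximal ideal, \<open>1 - y\<close> is a unit and \<open>x\<close> vanishes.\<close>
  then obtain i x where ix: "i\<in>I" "x\<in>L" "i\<otimes> x ~= \<zero>" and Li: "ideal L R" by blast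
  note LD = idealD[OF Li]
  note x = LD(2)[OF ix(2)]
  let ?L = "{i\<otimes> x | i. i\<in>I}"
  have "ideal ?L R"
  proof (rule idealI')
   show "?L <= |R|" using ID(2) x by auto
   have "\<zero> = \<zero>\<otimes> x" using x by simp
   thus "\<zero>\<in>?L" using ID(3) by blast
   fix a b assume "a\<in>?L" "b\<in>?L"
   then obtain i j where ij: "i\<in>I" "j\<in>I" "a = i\<otimes> x" "b = j\<otimes> x" by blast
   hence "a\<oplus> b = (i\<oplus> j)\<otimes> x" using ID(2) x by (simp add: l_distr)
   thus "a\<oplus> b\<in>?L" using ID(4) ij by blast
  next
   fix c a assume c: "c\<in>|R|" "a\<in>?L"
   then obtain i where i: "i\<in>I" "a = i\<otimes> x" by blast
   hence "c\<otimes> a = (c\<otimes> i)\<otimes> x" using ID(2) x c by (simp add: m_assoc)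
   thus "c\<otimes> a\<in>?L" using ID(6) i c by blast
  qed
  moreover have "EX j:I. EX l:?L. j\<otimes> l ~= \<zero>"
  proof (rule ccontr)
   assume c: "~ ?thesis"
   let ?A = "{r\<in>|R|. r\<otimes> x = \<zero>}"
   have "ideal ?A R" by (rule idealI') (use x in \<open>auto simp: l_distr m_assoc\<close>)
   moreover have "j\<otimes> k\<in>?A" if "j\<in>I" "k\<in>I" for j k
    using c that ID(2) x by (auto simp: m_assoc)
   ultimately have "I <= ?A" using key[OF I(1)] by blast
   thus False using ix by blast
  qed
  ultimately have LF: "?L\<in>?F" by blast
  have LL: "?L <= L" using LD(6) ix(2) ID(2) by blast
  have "?L = L" by (rule mp[OF bspec[OF L(2) LF] LL])
  hence "x\<in>?L" using ix(2) by simp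
  then obtain y where y: "y\<in>I" "x = y\<otimes> x" by blast
  have yR: "y\<in>|R|" by (rule ID(2)[OF y(1)])
  let ?a = "\<one>\<ominus> y"
  have "PIdl ?a = |R|"
  proof (rule ccontr)
   assume "PIdl ?a ~= |R|"
   moreover have P: "ideal (PIdl ?a) R" using yR by (simp add: cgenideal_ideal)
   ultimately have "\<one>\<notin>PIdl ?a" using ideal_one_imp by blast
   then obtain m where m: "maximalideal m R" "PIdl ?a <= m" using ex_maximalideal[OF P] by blast
   have mi: "ideal m R" using m by (simp add: maximalideal_def)
   have "\<one>\<ominus> y\<in>m" using m(2) cgenideal_self[of "\<one>\<ominus> y"] yR by auto
   moreover have "y\<in>m" using Im(2)[OF m(1)] y(1) by blast
   ultimately have "?a\<oplus> y\<in>m" using idealD(4)[OF mi] by blast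
   moreover have "?a\<oplus> y = \<one>" using yR by (simp add: a_minus_def a_assoc l_neg)
   ultimately show False using ideal_one_imp[OF mi] maximalideal.I_notcarr[OF m(1)] by simp
  qed
  then obtain s where s: "s\<in>|R|" "\<one> = s\<otimes> ?a" unfolding cgenideal_def using one_closed by blast
  have "?a\<otimes> x = x\<ominus> y\<otimes> x" using x yR by (simp add: a_minus_def l_distr l_minus)
  also have "... = \<zero>" using y(2) x by (simp add: a_minus_def r_neg)
  finally have "s\<otimes> (?a\<otimes> x) = \<zero>" using s by simp
  hence "x = \<zero>" using s x yR by (metis l_one m_assoc minus_closed one_closed)
  thus False using ix ID(2) by simp
 qed
 thus ?thesis using I(1) by simp
qed

text \<open>As \<open>m\<close> carries \<open>W\<close> into \<open>I\<close>, the quotient of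
  \<open>W\<close> by \<open>I\<close> is a vector space over the residue field. Zorn's lemma gives
  a subspace maximal among those missing a vector \<open>x\<close>, and such a subspace has
  codimension one.\<close>

lemma hyperplane:
 assumes "ideal I R" "ideal W R" "I <= W" "I ~= W" "maximalideal m R"
  and mW: "!!a w. a\<in>m ==> w\<in>W ==> a\<otimes> w\<in>I"
 obtains W' x where "ideal W' R" "I <= W'" "W' <= W" "W' ~= W" "x\<in>W"
  "W = {i\<oplus> r\<otimes> x | i r. i\<in>W' & r\<in>|R| }"
proof -
 note WD = idealD[OF assms(2)]
 obtain x where x: "x\<in>W" "x\<notin>I" using assms(3,4) by blast
 let ?A = "{J. ideal J R & I <= J & J <= W & x\<notin>J}"
 have "EX M:?A. ALL J:?A. M <= J --> J = M"
 proof (rule subset_Zorn_nonempty)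
  show "?A ~= {}" using assms x by blast
  fix C assume C: "C ~= {}" "subset.chain ?A C"
  hence "subset.chain {J. ideal J R} C" by (auto simp: subset.chain_def)
  from chain_Union_is_ideal[OF this] have "ideal (\<Union>C) R" using C(1) by simp
  thus "\<Union>C\<in>?A" using C by (auto simp: subset.chain_def)
 qed
 then obtain W' where W0: "W'\<in>?A" and max0: "ALL J:?A. W' <= J --> J = W'" by (rule bexE)
 have W': "ideal W' R" "I <= W'" "W' <= W" "x\<notin>W'" using W0 by simp_all
 have max: "J = W'" if "ideal J R" "I <= J" "J <= W" "x\<notin>J" "W' <= J" for J
  using max0 that by simp
 note D' = idealD[OF W'(1)]
 note xR = WD(2)[OF x(1)]
 have "W <= {i\<oplus> r\<otimes> x | i r. i\<in>W' & r\<in>|R| }"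
 proof
  fix y assume y: "y\<in>W"
  note yR = WD(2)[OF y]
  show "y\<in>{i\<oplus> r\<otimes> x | i r. i\<in>W' & r\<in>|R| }"
  proof (cases "y\<in>W'")
   case True
   thus ?thesis using mem_adjoin(1)[OF W'(1) xR] by blast
  next
   case False
   let ?J = "{i\<oplus> r\<otimes> y | i r. i\<in>W' & r\<in>|R| }"
   have "ideal ?J R" by (rule ideal_adjoin[OF W'(1) yR])
   moreover have "W' <= ?J" "y\<in>?J" using mem_adjoin[OF W'(1) yR] by auto
   moreover have "?J <= W"
   proof
    fix z assume "z\<in>?J"
    then obtain i r where "i\<in>W'" "r\<in>|R|" "z = i\<oplus> r\<otimes> y" by blast
    thus "z\<in>W" using W'(3) WD(4,6) y by blast
   qed
   ultimately have "x\<in>?J" using max[of ?J] False subset_trans[OF W'(2)] by blast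
   then obtain w r where wr: "w\<in>W'" "r\<in>|R|" "x = w\<oplus> r\<otimes> y" by blast
   have wR: "w\<in>|R|" by (rule D'(2)[OF wr(1)])
   have "r\<notin>m"
   proof
    assume "r\<in>m"
    hence "r\<otimes> y\<in>W'" using mW y W'(2) by blast
    thus False using wr D'(4) W'(4) by blast
   qed
   then obtain s a where sa: "s\<in>|R|" "a\<in>m" "\<one> = s\<otimes> r\<oplus> a"
    using maximalideal_unit[OF assms(5) wr(2)] by blast
   have aR: "a\<in>|R|" using sa(2) assms(5) idealD(2) by (auto simp: maximalideal_def)
   have ry: "r\<otimes> y = x\<ominus> w" using wr wR yR by (simp add: a_minus_def a_assoc a_comm[of w] r_neg)
   let ?a = "a\<otimes> y\<ominus> s\<otimes> w"
   have "y = (s\<otimes> r\<oplus> a)\<otimes> y" using yR by (simp add: sa(3)[symmetric])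
   also have "... = s\<otimes> (r\<otimes> y)\<oplus> a\<otimes> y" using sa wr yR aR by (simp add: l_distr m_assoc)
   also have "... = ?a\<oplus> s\<otimes> x"
    unfolding ry using sa(1) aR yR xR wR by (simp add: a_minus_def r_distr r_minus a_ac)
   finally have "y = ?a\<oplus> s\<otimes> x" .
   moreover have "a\<otimes> y\<ominus> s\<otimes> w\<in>W'"
    using mW[OF sa(2) y] W'(2) D'(5,6) wr(1) sa(1) by blast
   ultimately show ?thesis using sa(1) by blast
  qed
 qed
 moreover have "{i\<oplus> r\<otimes> x | i r. i\<in>W' & r\<in>|R| } <= W"
  using W'(3) WD(4,6) x(1) by blast
 ultimately have eq: "W = {i\<oplus> r\<otimes> x | i r. i\<in>W' & r\<in>|R| }" by (rule equalityI)
 have "W' ~= W" using x(1) W'(4) by blast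
 with W'(1-3) show ?thesis using x(1) eq by (rule that)
qed

text \<open>Submodules reached from \<open>0\<close> by adjoining finitely many elements, each killed by a maximal ideal
 modulo the preceding ones.\<close>

inductive fin_length :: "('a, 'm) module => 'm set => bool" for M where
 zero: "fin_length M {0\<^sub>M}"
| adjoin: "fin_length M N ==> x\<in>|M| ==> maximalideal m R ==> (!!a. a\<in>m ==> a*\<^sub>M x\<in>N) ==>
  fin_length M {n+\<^sub>M r*\<^sub>M x | n r. n\<in>N & r\<in>|R| }"

lemma adjoin_submodule:
 assumes "lmod R M" "submodule N R M" "x\<in>|M|"
 shows "submodule {n+\<^sub>M r*\<^sub>M x | n r. n\<in>N & r\<in>|R| } R M"
  "N <= {n+\<^sub>M r*\<^sub>M x | n r. n\<in>N & r\<in>|R| }"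
  "x\<in>{n+\<^sub>M r*\<^sub>M x | n r. n\<in>N & r\<in>|R| }"
proof -
 let ?A = "{n+\<^sub>M r*\<^sub>M x | n r. n\<in>N & r\<in>|R| }"
 interpret M: left_module R M by fact
 note D = M.submoduleD[OF assms(2)]
 show "submodule ?A R M"
 proof (rule M.submoduleI)
  show "?A <= |M|" using D(2) assms(3) by auto
  have "0\<^sub>M = 0\<^sub>M+\<^sub>M \<zero> *\<^sub>M x" using assms(3) by simp
  thus "0\<^sub>M\<in>?A" using D(3) by blast
  fix a b assume "a\<in>?A" "b\<in>?A"
  then obtain i r j s where a: "a = i+\<^sub>M r*\<^sub>M x" "i\<in>N" "r\<in>|R|"
   and b: "b = j+\<^sub>M s*\<^sub>M x" "j\<in>N" "s\<in>|R|" by blast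
  have "a+\<^sub>M b = (i+\<^sub>M j)+\<^sub>M (r\<oplus> s)*\<^sub>M x"
   using a b D(2) assms(3) by (simp add: M.smult_l_distr M.M.a_ac)
  moreover have "i+\<^sub>M j\<in>N" "r\<oplus> s\<in>|R|" using a b D(4) by auto
  ultimately show "a+\<^sub>M b\<in>?A" by blast
 next
  fix c a assume c: "c\<in>|R|" and "a\<in>?A"
  then obtain i r where a: "a = i+\<^sub>M r*\<^sub>M x" "i\<in>N" "r\<in>|R|" by blast
  have "c*\<^sub>M a = c*\<^sub>M i+\<^sub>M (c\<otimes> r)*\<^sub>M x"
   using a c D(2) assms(3) by (simp add: M.smult_r_distr M.smult_assoc1)
  moreover have "c*\<^sub>M i\<in>N" "c\<otimes> r\<in>|R|" using a c D(7) by auto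
  ultimately show "c*\<^sub>M a\<in>?A" by blast
 qed
 show "N <= ?A"
 proof
  fix i assume "i\<in>N"
  hence "i = i+\<^sub>M \<zero> *\<^sub>M x" using D(2) assms(3) by simp
  thus "i\<in>?A" using \<open>i \<in> N\<close> by blast
 qed
 have "x = 0\<^sub>M+\<^sub>M \<one> *\<^sub>M x" using assms(3) by (simp add: M.smult_one)
 thus "x\<in>?A" using D(3) by blast
qed

lemma fin_length_submodule:
 assumes "lmod R M" "fin_length M N"
 shows "submodule N R M"
 using assms(2)
proof induction
 case zero
 show ?case by (rule left_module.submodule_zero[OF assms(1)])
next
 case (adjoin N x m)
 thus ?case by (intro adjoin_submodule(1)[OF assms(1)])
qed

text \<open>Each step from a product \<open>I\<close> to its product with \<open>m\<close> is
  refined by hyperplanes. What is carried downwards is an implication, from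
  \<open>fin_length\<close> of the smaller ideal to \<open>fin_length\<close> of \<open>R\<close>,
  because \<open>fin_length\<close> grows upwards from 0 while the artinian condition works
  downwards.\<close>

lemma fin_length_regular:
 assumes "artinian_ring R"
 shows "fin_length (reg R) |R|"
proof -
 let ?d = "reg R"
 let ?b = "fin_length ?d |R|"
 let ?c = "%W. fin_length ?d W --> ?b"
 have "J\<in>max_products ==> ?c J" for J
 proof (induction rule: max_products.induct)
  case base
  show ?case by simp
 next
  case (step I m)
  note Ii = max_products_ideal[OF step(1)]
  have mi: "ideal m R" using step by (simp add: maximalideal_def)
  note Pi = ideal_prod_is_ideal[OF Ii mi]
  let ?a = "ideal_prod R I m"
  let ?F = "{W. ideal W R & ?a <= W & W <= I & ?c W}"
  have "I\<in>?F" using Ii ideal_prod_inter[OF Ii mi] step.IH by blast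
  then obtain W where W: "W\<in>?F" "ALL J:?F. J <= W --> J = W"
   by (rule artinian_min[OF assms]) simp_all
  have "?a = W"
  proof (rule ccontr)
   assume ne: "?a ~= W"
   have mW: "a\<otimes> w\<in>?a" if "a\<in>m" "w\<in>W" for a w
   proof -
    have "w\<in>I" using that W(1) by blast
    thus ?thesis
     using ideal_prod.prod[OF \<open>w \<in> I\<close> that(1), of R] m_comm[OF idealD(2)[OF Ii] idealD(2)[OF mi]] that(1) by simp
   qed
   have Wi: "ideal W R" and PW: "?a <= W" and cW: "?c W" using W(1) by auto
   obtain W' x where W': "ideal W' R" "?a <= W'" "W' <= W" "W' ~= W" "x\<in>W"
    "W = {i\<oplus> r\<otimes> x | i r. i\<in>W' & r\<in>|R| }"
    by (rule hyperplane[OF Pi Wi PW ne step.hyps(2) mW])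
   have "?c W'"
   proof
    assume f: "fin_length ?d W'"
    have "fin_length ?d {n+\<^sub>?d r*\<^sub>?d x | n r. n\<in>W' & r\<in>|R| }"
    proof (rule fin_length.adjoin[OF f _ step.hyps(2)])
     show "x\<in>|reg R|" using idealD(2)[OF Wi W'(5)] by simp
     show "a*\<^sub>?d x\<in>W'" if "a\<in>m" for a
      using mW[OF that W'(5)] W'(2) by auto
    qed
    hence "fin_length ?d W" using W'(6) by simp
    thus "?b" using cW by blast
   qed
   hence "W'\<in>?F" using W' W(1) by blast
   thus False using W(2) W'(3,4) by blast
  qed
  thus ?case using W(1) by blast
 qed
 from this[OF zero_max_product[OF assms]] show ?thesis
  using fin_length.zero[of "reg R"] by simp
qed

text \<open>For each generator \<open>x\<close>, the chain of ideals exhausting \<open>R\<close>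
  yields a chain of submodules, adding to a given \<open>N\<close> the multiples of \<open>x\<close>
  with coefficients in these ideals. The generators are adjoined one after the other.\<close>

lemma fin_length_fg:
 assumes "artinian_ring R" "fg_module R M"
 shows "fin_length M |M|"
proof -
 have M: "lmod R M" using assms(2) by (simp add: fg_module_def)
 interpret M: left_module R M by fact
 let ?b = "reg R"
 have step: "fin_length ?b I ==> fin_length M N ==> x\<in>|M| ==>
   fin_length M {n+\<^sub>M i*\<^sub>M x | n i. n\<in>N & i\<in>I}" for I N x
 proof (induction rule: fin_length.induct)
  case zero
  have "N <= |M|" by (rule M.submoduleD[OF fin_length_submodule[OF M zero(1)]])
  hence "{n+\<^sub>M i*\<^sub>M x | n i. n\<in>N & i\<in>{\<zero>}} = N"
   using zero(2) by (auto simp: subset_iff) (metis M.M.r_zero)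
  thus ?case using zero(1) by simp
 next
  case (adjoin I y m)
  have NM: "n\<in>|M|" if "n\<in>N" for n
   using M.submoduleD(2)[OF fin_length_submodule[OF M adjoin.prems(1)] that] .
  have IR: "i\<in>|R|" if "i\<in>I" for i
   using left_module.submoduleD(2)[OF left_module_regular[OF ring_axioms]
     fin_length_submodule[OF left_module_regular[OF ring_axioms] adjoin.hyps(1)] that] by simp
  have y: "y\<in>|R|" using adjoin.hyps by simp
  have mR: "a\<in>|R|" if "a\<in>m" for a
   using idealD(2)[of m a] adjoin.hyps(3) that by (simp add: maximalideal_def)
  let ?N = "{n+\<^sub>M i*\<^sub>M x | n i. n\<in>N & i\<in>I}"
  note N0 = M.submoduleD[OF fin_length_submodule[OF M adjoin.prems(1)]]
  let ?a = "y*\<^sub>M x"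
  have "fin_length M {k+\<^sub>M r*\<^sub>M ?a | k r. k\<in>?N & r\<in>|R| }"
  proof (rule fin_length.adjoin[OF adjoin.IH[OF adjoin.prems] _ adjoin.hyps(3)])
   show "y*\<^sub>M x\<in>|M|" using y adjoin.prems by simp
   fix a assume a: "a\<in>m"
   have "a*\<^sub>M ?a = 0\<^sub>M+\<^sub>M (a\<otimes> y)*\<^sub>M x"
    using mR[OF a] y adjoin.prems by (simp add: M.smult_assoc1)
   moreover have "a\<otimes> y\<in>I" using adjoin.hyps(4)[OF a] by simp
   ultimately show "a*\<^sub>M ?a\<in>?N" using N0 by blast
  qed
  also have "{k+\<^sub>M r*\<^sub>M ?a | k r. k\<in>?N & r\<in>|R| } =
    {n+\<^sub>M i*\<^sub>M x | n i. n\<in>N & i\<in>{i+\<^sub>?b r*\<^sub>?b y | i r. i\<in>I & r\<in>|R| }}"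
   (is "?A = ?B")
  proof -
   have eq: "(n+\<^sub>M i*\<^sub>M x)+\<^sub>M r*\<^sub>M ?a = n+\<^sub>M (i\<oplus> r\<otimes> y)*\<^sub>M x"
    if "n\<in>N" "i\<in>I" "r\<in>|R|" for n i r
    using NM[OF that(1)] IR[OF that(2)] that(3) y adjoin.prems(2)
    by (simp add: M.smult_l_distr M.smult_assoc1 M.M.a_assoc)
   show ?thesis
   proof
    show "?A <= ?B"
    proof
     fix z assume "z\<in>?A"
     then obtain n i r where *: "n\<in>N" "i\<in>I" "r\<in>|R|"
      "z = (n+\<^sub>M i*\<^sub>M x)+\<^sub>M r*\<^sub>M ?a" by blast
     thus "z\<in>?B" using eq[OF *(1-3)] by (simp only: regular_module_simps) blast
    qed
    show "?B <= ?A"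
    proof
     fix z assume "z\<in>?B"
     then obtain n i r where *: "n\<in>N" "i\<in>I" "r\<in>|R|"
      "z = n+\<^sub>M (i\<oplus> r\<otimes> y)*\<^sub>M x" by (simp only: regular_module_simps) blast
     have "n+\<^sub>M i*\<^sub>M x\<in>?N" using *(1,2) by blast
     thus "z\<in>?A" unfolding *(4) eq[OF *(1-3), symmetric] using *(3) by blast
    qed
   qed
  qed
  finally show ?case .
 qed
 obtain S where S: "finite S" "generates R M S |M|" using assms(2) by (auto simp: fg_module_iff)
 have SM: "S <= |M|" using S(2) by (simp add: generates_def)
 have "EX N. fin_length M N & S <= N" using S(1) SM
 proof (induction S)
  case empty
  show ?case using fin_length.zero by blast
 next
  case (insert t S)
  then obtain N where N: "fin_length M N" "S <= N" by blast
  have t: "t\<in>|M|" using insert by blast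
  have "fin_length M {n+\<^sub>M i*\<^sub>M t | n i. n\<in>N & i\<in>|R| }"
   by (rule step[OF fin_length_regular[OF assms(1)] N(1) t])
  moreover have "insert t S <= {n+\<^sub>M i*\<^sub>M t | n i. n\<in>N & i\<in>|R| }"
   using adjoin_submodule(2,3)[OF M fin_length_submodule[OF M N(1)] t] N(2) by blast
  ultimately show ?case by blast
 qed
 then obtain N where N: "fin_length M N" "S <= N" by blast
 have "|M| <= N" using S(2) fin_length_submodule[OF M N(1)] N(2) by (simp add: generates_def)
 hence "N = |M|" using M.submoduleD(1)[OF fin_length_submodule[OF M N(1)]] by blast
 thus ?thesis using N(1) by simp
qed

text \<open>Each link of the chain costs at most one new generator. If \<open>K\<close> contains
  some \<open>y\<close> outside \<open>N\<close>, the coefficient of \<open>y\<close> at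
  \<open>x\<close> is a unit modulo \<open>m\<close>, so every element of \<open>K\<close> differs
  from a multiple of \<open>y\<close> by an element of the intersection of \<open>K\<close> and
  \<open>N\<close>.\<close>

lemma fin_length_generates:
 assumes "lmod R M" "fin_length M N" "submodule K R M" "K <= N"
 shows "EX S. finite S & generates R M S K"
 using assms(2-4)
proof (induction arbitrary: K)
 interpret M: left_module R M by fact
 case zero
 have "generates R M {} K"
  unfolding generates_def using zero M.submoduleD(3) by blast
 thus ?case by blast
next
 case (adjoin N x m)
 interpret M: left_module R M by fact
 note K = M.submoduleD[OF adjoin.prems(1)]
 note Ns = fin_length_submodule[OF assms(1) adjoin.hyps(1)]
 note N = M.submoduleD[OF Ns]
 have "submodule (K \<inter> N) R M" by (rule M.submoduleI) (use K N in auto)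
 then obtain S where S: "finite S" "generates R M S (K \<inter> N)" using adjoin.IH[of "K \<inter> N"] by blast
 show ?case
 proof (cases "K <= N")
  case True
  hence "K \<inter> N = K" by blast
  thus ?thesis using S by auto
 next
  case False
  then obtain y where y: "y\<in>K" "y\<notin>N" by blast
  then obtain n r where nr: "n\<in>N" "r\<in>|R|" "y = n+\<^sub>M r*\<^sub>M x" using adjoin.prems(2) by blast
  have nM: "n\<in>|M|" and yM: "y\<in>|M|" using N(2)[OF nr(1)] K(2)[OF y(1)] by auto
  note x = adjoin.hyps(2)
  have "r\<notin>m" using adjoin.hyps(4) nr N(4) y(2) by blast
  then obtain s a where sa: "s\<in>|R|" "a\<in>m" "\<one> = s\<otimes> r\<oplus> a"
   using maximalideal_unit[OF adjoin.hyps(3) nr(2)] by blast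
  have aR: "a\<in>|R|" using idealD(2)[of m a] adjoin.hyps(3) sa(2) by (simp add: maximalideal_def)
  have "generates R M (insert y S) K"
   unfolding generates_def
  proof (intro conjI allI impI)
   show "insert y S <= K" using S(2) y(1) by (auto simp: generates_def)
   fix L assume L: "submodule L R M & insert y S <= L"
   note LD = M.submoduleD[OF L[THEN conjunct1]]
   have KNL: "K \<inter> N <= L" using S(2) L by (auto simp: generates_def)
   show "K <= L"
   proof
    fix z assume z: "z\<in>K"
    then obtain n' r' where nr': "n'\<in>N" "r'\<in>|R|" "z = n'+\<^sub>M r'*\<^sub>M x" using adjoin.prems(2) by blast
    note n'M = N(2)[OF nr'(1)]
    let ?c = "r'\<otimes> s"
    have c: "?c\<in>|R|" using sa nr' by simp
    have "r' = ?c\<otimes> r\<oplus> r'\<otimes> a"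
    proof -
     have "r' = r'\<otimes> (s\<otimes> r\<oplus> a)" using nr'(2) by (simp add: sa(3)[symmetric])
     thus ?thesis using sa nr nr' aR by (simp add: r_distr m_assoc)
    qed
    hence "r'*\<^sub>M x = (?c\<otimes> r\<oplus> r'\<otimes> a)*\<^sub>M x" by simp
    also have "... = ?c*\<^sub>M (r*\<^sub>M x)+\<^sub>M r'*\<^sub>M (a*\<^sub>M x)"
     using c nr nr' aR x by (simp add: M.smult_l_distr M.smult_assoc1)
    finally have rx: "r'*\<^sub>M x = ?c*\<^sub>M (r*\<^sub>M x)+\<^sub>M r'*\<^sub>M (a*\<^sub>M x)" .
    let ?w = "(n'+\<^sub>M r'*\<^sub>M (a*\<^sub>M x))-\<^sub>M ?c*\<^sub>M n"
    have wN: "?w\<in>N"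
     by (intro N(6) N(4) N(7) nr'(1,2) nr(1) c adjoin.hyps(4)[OF sa(2)])
    note wM = N(2)[OF wN]
    have "z = ?w+\<^sub>M ?c*\<^sub>M y"
    proof -
     have "?w+\<^sub>M ?c*\<^sub>M y = (?w+\<^sub>M ?c*\<^sub>M n)+\<^sub>M ?c*\<^sub>M (r*\<^sub>M x)"
      using wM c nM nr x by (simp add: M.smult_r_distr M.M.a_assoc)
     also have "?w+\<^sub>M ?c*\<^sub>M n = n'+\<^sub>M r'*\<^sub>M (a*\<^sub>M x)"
      using n'M nr' aR x c nM by simp
     finally show ?thesis unfolding nr'(3) rx
      using n'M nr' aR x c nr nM by (simp add: M.M.a_ac)
    qed
    moreover have "?w\<in>K"
    proof -
     have "?w = z-\<^sub>M ?c*\<^sub>M y"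
      using \<open>z = ?w +\<^sub>M ?c *\<^sub>M y\<close> M.add_diff_cancel(3)[OF wM, of "?c*\<^sub>M y"] c yM by simp
     thus ?thesis using K(6,7) z y(1) c by simp
    qed
    ultimately show "z\<in>L" using KNL wN LD(4,7) L c by blast
   qed
  qed
  thus ?thesis using S(1) by blast
 qed
qed

text \<open>The commutative case of the Hopkins-Levitzki theorem, with the chain behind
  \<open>fin_length\<close> in the role of a composition series.\<close>

lemma artinian_noetherian:
 assumes "artinian_ring R"
 shows "noetherian_module R (reg R)"
 unfolding noetherian_module_def
proof (intro conjI allI impI)
 show M: "lmod R (reg R)" by (rule left_module_regular[OF ring_axioms])
 fix K assume K: "submodule K R (reg R)"
 have "K <= |R|" using left_module.submoduleD(1)[OF M K] by simp
 thus "fg_module R ((reg R)(|carrier := K|))"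
  using fin_length_generates[OF M fin_length_regular[OF assms] K] left_module.fg_sub_iff[OF M K] by blast
qed

end

section \<open>Matlis duality over a commutative artinian ring\<close>

lemma hom_module_simps [simp]:
 "|hom_module R M N act| = Hom R M N"
 "0\<^sub>(hom_module R M N act) = (\<lambda>x\<in>|M|. 0\<^sub>N)"
 "f+\<^sub>(hom_module R M N act) g = (\<lambda>x\<in>|M|. f x+\<^sub>N g x)"
 "b*\<^sub>(hom_module R M N act) f = (\<lambda>x\<in>|M|. f (act b x))"
 by (simp_all add: hom_module_def hom_group_def)

text \<open>\<open>act\<close> is a right action on \<open>M\<close>, which explains the order of
  \<open>b\<close> and \<open>c\<close> in the hypothesis on products; precomposition reverses it
  into a left action.\<close>

lemma left_module_hom_module:
 assumes M: "lmod R M" and N: "lmod R N" and B: "ring B"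
  and act: "!!b. b\<in>|B| ==> (\<lambda>x\<in>|M|. act b x):Hom R M M"
  and add: "!!b c x. b\<in>|B| ==> c\<in>|B| ==> x\<in>|M| ==> act (b+\<^sub>B c) x = act b x+\<^sub>M act c x"
  and mult: "!!b c x. b\<in>|B| ==> c\<in>|B| ==> x\<in>|M| ==> act (b\<otimes>\<^sub>B c) x = act c (act b x)"
  and one: "!!x. x\<in>|M| ==> act \<one>\<^bsub>B\<^esub> x = x"
 shows "lmod B (hom_module R M N act)"
proof -
 let ?H = "hom_module R M N act"
 have cl: "f x\<in>|N|" if "f:Hom R M N" "x\<in>|M|" for f x
  using hom_cl[OF that] .
 have ac: "act b x\<in>|M|" if "b\<in>|B|" "x\<in>|M|" for b x
  using hom_cl[OF act[OF that(1)] that(2)] that(2) by simp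
 let ?a = "hom_group R M N"
 interpret H: comm_group "?a" by (rule comm_group_hom_group[OF M N])
 have hc: "x\<in>|?a| <-> x\<in>|?H|" for x by (simp add: hom_group_def)
 have hm: "x\<otimes>\<^sub>?a y = x+\<^sub>?H y" for x y by (simp add: hom_group_def)
 have ho: "\<one>\<^bsub>?a\<^esub> = 0\<^sub>?H" by (simp add: hom_group_def)
 have "abelian_group ?H"
 proof (rule abelian_groupI)
  fix x y z assume xyz: "x\<in>|?H|" "y\<in>|?H|" "z\<in>|?H|"
  show "x+\<^sub>?H y\<in>|?H|" using H.m_closed[of x y, unfolded hc hm] xyz by blast
  show "x+\<^sub>?H y+\<^sub>?H z = x+\<^sub>?H (y+\<^sub>?H z)" using H.m_assoc[of x y z, unfolded hc hm] xyz by blast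
  show "x+\<^sub>?H y = y+\<^sub>?H x" using H.m_comm[of x y, unfolded hc hm] xyz by blast
  show "0\<^sub>?H+\<^sub>?H x = x" using H.l_one[of x, unfolded hc hm ho] xyz by blast
  show "EX y:|?H|. y+\<^sub>?H x = 0\<^sub>?H"
   using H.l_inv[of x, unfolded hc hm ho] H.inv_closed[of x, unfolded hc] xyz by blast
 qed (use H.one_closed[unfolded hc ho] in blast)
 thus ?thesis
 proof (rule left_moduleI[OF B])
  fix b f assume b: "b\<in>|B|" and f: "f\<in>|?H|"
  let ?b = "\<lambda>x\<in>|M|. act b x"
  have "compose |M| f ?b:Hom R M N"
   by (rule compose_hom[OF M act[OF b]]) (use f in simp)
  moreover have "b*\<^sub>?H f = compose |M| f ?b"
   by (auto simp: compose_def intro!: restrict_ext)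
  ultimately show "b*\<^sub>?H f\<in>|?H|" by simp
 next
  fix b c f assume b: "b\<in>|B|" and c: "c\<in>|B|" and f: "f\<in>|?H|"
  have f': "f:Hom R M N" using f by simp
  show "(b+\<^sub>B c)*\<^sub>?H f = b*\<^sub>?H f+\<^sub>?H c*\<^sub>?H f"
   using b c ac by (auto simp: add hom_add[OF f'] intro!: restrict_ext)
  show "(b\<otimes>\<^sub>B c)*\<^sub>?H f = b*\<^sub>?H (c*\<^sub>?H f)"
   using b c ac by (auto simp: mult intro!: restrict_ext)
 next
  fix b f g assume b: "b\<in>|B|" and "f\<in>|?H|" "g\<in>|?H|"
  show "b*\<^sub>?H (f+\<^sub>?H g) = b*\<^sub>?H f+\<^sub>?H b*\<^sub>?H g"
   using b ac by (auto intro!: restrict_ext)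
 next
  fix f assume "f\<in>|?H|"
  hence f: "f:Hom R M N" by simp
  thus "\<one>\<^bsub>B\<^esub> *\<^sub>?H f = f"
   by (intro extensionalityI[of _ "|M|"]) (auto simp: one module_hom_def PiE_def)
 qed
qed

definition module_dual :: "('r, 'x) ring_scheme => ('r, 'm) module => ('r, 'e) module => ('r, 'm => 'e) module"
 where "module_dual R M E = hom_module R M E (smult M)"

lemma module_dual_simps [simp]:
 "|module_dual R M E| = Hom R M E"
 "0\<^sub>(module_dual R M E) = (\<lambda>x\<in>|M|. 0\<^sub>E)"
 "f+\<^sub>(module_dual R M E) g = (\<lambda>x\<in>|M|. f x+\<^sub>E g x)"
 "b*\<^sub>(module_dual R M E) f = (\<lambda>x\<in>|M|. f (b*\<^sub>M x))"
 by (simp_all add: module_dual_def)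

context cring
begin

lemma smult_hom:
 assumes "lmod R M" "b\<in>|R|"
 shows "(\<lambda>x\<in>|M|. b*\<^sub>M x):Hom R M M"
proof -
 interpret M: left_module R M by fact
 show ?thesis
  using assms(2) by (intro module_homI assms(1))
   (auto simp: M.smult_r_distr M.smult_assoc1[symmetric] m_comm)
qed

lemma left_module_dual:
 assumes "lmod R M" "lmod R E"
 shows "lmod R (module_dual R M E)"
proof -
 interpret M: left_module R M by fact
 show ?thesis unfolding module_dual_def
  by (rule left_module_hom_module[OF assms ring_axioms smult_hom[OF assms(1)]])
   (auto simp: M.smult_l_distr M.smult_assoc1[symmetric] m_comm M.smult_one)
qed

lemma eval_hom:
 assumes "lmod R M" "lmod R E" "x\<in>|M|"
 shows "(\<lambda>f\<in>Hom R M E. f x):Hom R (module_dual R M E) E"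
proof -
 have "restrict (%f. f x) |module_dual R M E|:Hom R (module_dual R M E) E"
  using assms(3) by (intro module_homI left_module_dual assms(1,2))
   (auto simp: hom_cl[of _ R M E] hom_smult[of _ R M E])
 thus ?thesis by simp
qed

end

section \<open>The injective envelope of R/J(R), its socle, and duality\<close>

locale matlis = cring R for R :: "('r, 'x) ring_scheme" (structure) +
 fixes E :: "('r, 'u) module" and \<iota> :: "'r set => 'u"
 assumes artinian: "artinian_ring R"
  and infinite_universe: "infinite (UNIV :: 'u set)"
  and small_ring: "|R|\<lesssim>(UNIV :: 'u set)"
  and envelope: "injective_envelope R (residue_module R) E \<iota>"
begin

lemma E_injective: "injm R E" and E_module: "lmod R E"
 using envelope by (auto simp: injective_envelope_def injective_module_def)

sublocale E: left_module R E by (rule E_module)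

lemma jacobson_le: "maximalideal m R ==> jacobson_radical R <= m"
 by (auto simp: jacobson_radical_def)

lemma jacobson_submodule: "submodule (jacobson_radical R) R (reg R)"
proof (rule left_module.submoduleI[OF left_module_regular[OF ring_axioms]])
 have "ideal m R" if "maximalideal m R" for m using that by (simp add: maximalideal_def)
 note D = idealD[OF this]
 show "jacobson_radical R <= |reg R|" by (auto simp: jacobson_radical_def)
 let ?a = "reg R"
 show "0\<^sub>?a\<in>jacobson_radical R" using D(3) by (auto simp: jacobson_radical_def)
 show "a+\<^sub>?a b\<in>jacobson_radical R" if "a\<in>jacobson_radical R" "b\<in>jacobson_radical R" for a b
  using that D(4) by (auto simp: jacobson_radical_def)
 show "a*\<^sub>?a b\<in>jacobson_radical R" if "a\<in>|R|" "b\<in>jacobson_radical R" for a b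
  using that D(6) by (auto simp: jacobson_radical_def)
qed

text \<open>The canonical map from \<open>R\<close> through R/J(R) into the envelope. Its kernel is
  the Jacobson radical, and every nonzero submodule of \<open>E\<close> meets its image
  nontrivially; besides injectivity this is all that is used about the envelope.\<close>

definition eps :: "'r => 'u"
 where "eps = compose |R| \<iota> (\<lambda>x\<in>|R|. jacobson_radical R +>\<^bsub>reg R\<^esub> x)"

lemma eps_hom: "eps:Hom R (reg R) E"
 and eps_eq_zero_iff: "t\<in>|R| ==> eps t = 0\<^sub>E <-> t\<in>jacobson_radical R"
 and eps_essential: "submodule L R E ==> L ~= {0\<^sub>E} ==> EX t:|R|. eps t\<in>L & eps t ~= 0\<^sub>E"
proof -
 note reg = left_module_regular[OF ring_axioms]
 note Q = left_module_quot[OF reg jacobson_submodule, folded residue_module_def]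
 let ?a = "residue_module R"
 have \<iota>: "\<iota>:Hom R ?a E" "inj_on \<iota> |residue_module R|"
  "essential_submodule R (\<iota> ` |residue_module R| ) E"
  using envelope by (auto simp: injective_envelope_def)
 have Q2: "(\<lambda>x\<in>|R|. jacobson_radical R +>\<^bsub>reg R\<^esub> x):Hom R (reg R) ?a"
  using Q(2) by simp
 have Qc: "jacobson_radical R +>\<^bsub>reg R\<^esub> t\<in>|residue_module R|" if "t\<in>|R|" for t
  using hom_cl[OF Q2, of t] that by simp
 show "eps:Hom R (reg R) E"
  unfolding eps_def using compose_hom[OF reg Q2 \<iota>(1)] by simp
 show "eps t = 0\<^sub>E <-> t\<in>jacobson_radical R" if t: "t\<in>|R|"
 proof -
  have "eps t = \<iota> (jacobson_radical R +>\<^bsub>reg R\<^esub> t)" using t by (simp add: eps_def compose_eq)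
  also have "... = 0\<^sub>E <-> jacobson_radical R +>\<^bsub>reg R\<^esub> t = 0\<^sub>?a"
   using inj_on_hom_iff[OF Q(1) E_module \<iota>(1)] \<iota>(2) hom_zero[OF Q(1) E_module \<iota>(1)] Qc[OF t] by metis
  also have "... <-> t\<in>jacobson_radical R" using Q(4)[of t] t by simp
  finally show ?thesis .
 qed
 show "EX t:|R|. eps t\<in>L & eps t ~= 0\<^sub>E" if L: "submodule L R E" "L ~= {0\<^sub>E}"
 proof -
  have 1: "L \<inter> \<iota> ` |residue_module R| ~= {0\<^sub>E}" using L \<iota>(3) by (auto simp: essential_submodule_def)
  have "0\<^sub>E\<in>L" by (rule E.submoduleD[OF L(1)])
  moreover have "0\<^sub>E\<in>\<iota> ` |residue_module R|"
   using hom_zero[OF Q(1) E_module \<iota>(1)] left_module.submoduleD(3)[OF Q(1) left_module.submodule_carrier[OF Q(1)]]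
   by (metis image_eqI)
  ultimately obtain c where c: "c\<in>|residue_module R|" "\<iota> c\<in>L" "\<iota> c ~= 0\<^sub>E" using 1 by blast
  obtain t where t: "t\<in>|R|" "c = jacobson_radical R +>\<^bsub>reg R\<^esub> t"
   using c(1) unfolding Q(3)[symmetric] by auto
  hence "eps t = \<iota> c" by (simp add: eps_def compose_eq)
  thus ?thesis using c by (intro bexI[OF _ t(1)]) simp
 qed
qed

text \<open>The cyclic module on \<open>e\<close> is a copy of the residue field, so by essentiality
  it lies in the image of \<open>eps\<close>. The preimage \<open>t\<close> avoids some maximal
  ideal \<open>m'\<close>; since \<open>m\<close> times \<open>t\<close> lies in the radical,
  primeness forces \<open>m\<close> into \<open>m'\<close>, that is, \<open>m = m'\<close>.\<close>

lemma socle_element: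
 assumes m: "maximalideal m R" and e: "e\<in>|E|" "e ~= 0\<^sub>E" "!!a. a\<in>m ==> a*\<^sub>E e = 0\<^sub>E"
 obtains t where "t\<in>|R|" "e = eps t" "t\<notin>m" "!!a. a\<in>m ==> a\<otimes> t\<in>jacobson_radical R"
proof -
 note reg = left_module_regular[OF ring_axioms]
 have mi: "ideal m R" using m by (simp add: maximalideal_def)
 note mD = idealD[OF mi]
 let ?b = "\<lambda>a\<in>|R|. a*\<^sub>E e"
 let ?L = "?b ` |reg R|"
 have L: "submodule ?L R E"
  by (rule submodule_image[OF reg E_module E.orbit_hom[OF e(1)] left_module.submodule_carrier[OF reg]])
 have "e = ?b \<one>" using e(1) by (simp add: E.smult_one)
 hence "e\<in>?L" by (rule image_eqI) simp
 hence "?L ~= {0\<^sub>E}" using e(2) by blast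
 then obtain t0 where t0: "t0\<in>|R|" "eps t0\<in>?L" "eps t0 ~= 0\<^sub>E" using eps_essential[OF L] by blast
 obtain r where r: "r\<in>|R|" "eps t0 = r*\<^sub>E e" using t0(2) by auto
 have "r\<notin>m" using e(3) r t0(3) by auto
 then obtain s a where sa: "s\<in>|R|" "a\<in>m" "\<one> = s\<otimes> r\<oplus> a" using maximalideal_unit[OF m r(1)] by blast
 let ?a = "s\<otimes> t0"
 have "e = (s\<otimes> r\<oplus> a)*\<^sub>E e" using e(1) by (simp add: sa(3)[symmetric] E.smult_one)
 also have "... = s*\<^sub>E eps t0"
  using sa(1) r e mD(2)[OF sa(2)] e(3)[OF sa(2)] by (simp add: E.smult_l_distr E.smult_assoc1)
 also have "... = eps ?a" using hom_smult[OF eps_hom sa(1), of t0] t0(1) by simp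
 finally have et: "e = eps ?a" .
 have t: "s\<otimes> t0\<in>|R|" using sa t0 by simp
 have aJ: "a\<otimes> ?a\<in>jacobson_radical R" if a: "a\<in>m" for a
 proof -
  have "eps (a\<otimes> ?a) = a*\<^sub>E e" using hom_smult[OF eps_hom mD(2)[OF a], of "s\<otimes> t0"] t et by simp
  thus ?thesis using eps_eq_zero_iff[of "a\<otimes> ?a"] e(3)[OF a] mD(2)[OF a] t by simp
 qed
 have "s\<otimes> t0\<notin>jacobson_radical R" using eps_eq_zero_iff[OF t] et e(2) by simp
 then obtain m' where m': "maximalideal m' R" "s\<otimes> t0\<notin>m'" using t by (auto simp: jacobson_radical_def)
 have "m <= m'"
 proof
  fix a assume a: "a\<in>m"
  have "a\<otimes> ?a\<in>m'" using aJ[OF a] jacobson_le[OF m'(1)] by blast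
  thus "a\<in>m'" using maximalideal_primeD[OF m'(1) mD(2)[OF a] t] m'(2) by blast
 qed
 hence "m = m'" by (rule maximalideal_eq[OF m m'(1)])
 thus ?thesis using that[OF t et _ aJ] m'(2) by blast
qed

text \<open>Both elements come from elements \<open>t\<close> and \<open>t'\<close> of
  \<open>R\<close> under \<open>eps\<close>. As \<open>t\<close> is invertible modulo
  \<open>m\<close>, \<open>t'\<close> is a multiple of \<open>t\<close> up to the element
  \<open>a t'\<close> of the radical, which \<open>eps\<close> kills.\<close>

lemma socle_one_dimensional:
 assumes m: "maximalideal m R" and e: "e\<in>|E|" "e ~= 0\<^sub>E" "!!a. a\<in>m ==> a*\<^sub>E e = 0\<^sub>E"
  and e': "e'\<in>|E|" "!!a. a\<in>m ==> a*\<^sub>E e' = 0\<^sub>E"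
 obtains r where "r\<in>|R|" "e' = r*\<^sub>E e"
proof (cases "e' = 0\<^sub>E")
 case True
 thus ?thesis using that[of \<zero>] e(1) by simp
next
 case False
 have mi: "ideal m R" using m by (simp add: maximalideal_def)
 note mD = idealD[OF mi]
 obtain t where t: "t\<in>|R|" "e = eps t" "t\<notin>m" using socle_element[OF m e] by blast
 obtain t' where t': "t'\<in>|R|" "e' = eps t'" "!!a. a\<in>m ==> a\<otimes> t'\<in>jacobson_radical R"
  using socle_element[OF m e'(1) False e'(2)] by blast
 obtain s a where sa: "s\<in>|R|" "a\<in>m" "\<one> = s\<otimes> t\<oplus> a" using maximalideal_unit[OF m t(1,3)] by blast
 note aR = mD(2)[OF sa(2)]
 let ?a = "t'\<otimes> s"
 have "t' = (s\<otimes> t\<oplus> a)\<otimes> t'" using t'(1) by (simp add: sa(3)[symmetric])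
 also have "... = ?a\<otimes> t\<oplus> a\<otimes> t'" using sa(1) aR t(1) t'(1) by (simp add: l_distr r_distr m_ac)
 finally have "eps t' = eps (?a\<otimes> t)+\<^sub>E eps (a\<otimes> t')"
  using hom_add[OF eps_hom, of "?a\<otimes> t" "a\<otimes> t'"] sa(1) aR t(1) t'(1) by simp
 also have "eps (a\<otimes> t') = 0\<^sub>E" using eps_eq_zero_iff t'(3)[OF sa(2)] aR t'(1) by simp
 also have "eps (?a\<otimes> t) = ?a*\<^sub>E eps t"
  using hom_smult[OF eps_hom, of "t'\<otimes> s" t] sa(1) t(1) t'(1) by simp
 finally have "e' = ?a*\<^sub>E e" using t(2) t'(2,1) sa(1) e(1) by simp
 thus ?thesis using that t'(1) sa(1) by blast
qed

text \<open>What is needed is an element outside \<open>m\<close> but inside every other maximal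
  ideal. Since 0 is a product of maximal ideals, every maximal ideal occurs among the factors; the
  induction multiplies elements that lie in a factor different from \<open>m\<close> but not in
  \<open>m\<close>.\<close>

lemma socle_nonzero:
 assumes m: "maximalideal m R"
 obtains e where "e\<in>|E|" "e ~= 0\<^sub>E" "!!a. a\<in>m ==> a*\<^sub>E e = 0\<^sub>E"
proof -
 have mi: "ideal m R" using m by (simp add: maximalideal_def)
 note mD = idealD[OF mi]
 have "I\<in>max_products ==> EX r:|R|. r\<notin>m & (ALL m'. maximalideal m' R & I <= m' & m' ~= m --> r\<in>m')" for I
 proof (induction rule: max_products.induct)
  case base
  have "\<one>\<notin>m" using ideal_one_imp[OF mi] maximalideal.I_notcarr[OF m] by blast
  moreover have "\<one>\<in>m'" if "|R| <= m'" for m' using that by blast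
  ultimately show ?case by blast
 next
  case (step I m1)
  then obtain r where r: "r\<in>|R|" "r\<notin>m" "!!m'. maximalideal m' R ==> I <= m' ==> m' ~= m ==> r\<in>m'" by blast
  note Ii = max_products_ideal[OF step.hyps(1)]
  have m1i: "ideal m1 R" using step.hyps(2) by (simp add: maximalideal_def)
  let ?a = "ideal_prod R I m1"
  have split: "I <= m' \<or> m1 = m'" if m': "maximalideal m' R" "?a <= m'" for m'
  proof (rule disjCI)
   assume "m1 ~= m'"
   then obtain b where b: "b\<in>m1" "b\<notin>m'" using maximalideal_eq[OF step.hyps(2) m'(1)] by blast
   show "I <= m'"
   proof
    fix i assume i: "i\<in>I"
    have "i\<otimes> b\<in>m'" using ideal_prod.prod[OF i b(1), of R] m'(2) by blast
    thus "i\<in>m'" using maximalideal_primeD[OF m'(1) idealD(2)[OF Ii i] idealD(2)[OF m1i b(1)]] b(2) by blast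
   qed
  qed
  show ?case
  proof (cases "m1 = m")
   case True
   have "r\<in>m'" if "maximalideal m' R" "?a <= m'" "m' ~= m" for m'
    using split[OF that(1,2)] r(3)[OF that(1) _ that(3)] True that(3) by blast
   thus ?thesis using r(1,2) by blast
  next
   case False
   then obtain a where a: "a\<in>m1" "a\<notin>m" using maximalideal_eq[OF step.hyps(2) m] by blast
   note aR = idealD(2)[OF m1i a(1)]
   have "r\<otimes> a\<notin>m" using maximalideal_primeD[OF m r(1) aR] r(2) a(2) by blast
   moreover have "r\<otimes> a\<in>m'" if m': "maximalideal m' R" "?a <= m'" "m' ~= m" for m'
   proof -
    have m'i: "ideal m' R" using m'(1) by (simp add: maximalideal_def)
    from split[OF m'(1,2)] show ?thesis
    proof
     assume "I <= m'"
     thus ?thesis using r(3)[OF m'(1) _ m'(3)] idealD(7)[OF m'i aR] by blast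
    next
     assume "m1 = m'"
     thus ?thesis using a(1) idealD(6)[OF m'i r(1)] by blast
    qed
   qed
   moreover have "r\<otimes> a\<in>|R|" using r(1) aR by simp
   ultimately show ?thesis by blast
  qed
 qed
 from this[OF zero_max_product[OF artinian]]
 obtain r where r: "r\<in>|R|" "r\<notin>m" "!!m'. maximalideal m' R ==> m' ~= m ==> r\<in>m'"
  using idealD(3) unfolding maximalideal_def by (metis empty_subsetI insert_subset)
 have rJ: "r\<notin>jacobson_radical R" using r(2) jacobson_le[OF m] by blast
 have "a*\<^sub>E eps r = 0\<^sub>E" if a: "a\<in>m" for a
 proof -
  have "a\<otimes> r\<in>m'" if m': "maximalideal m' R" for m'
  proof (cases "m' = m")
   case True
   thus ?thesis using mD(7)[OF r(1) a] by simp
  next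
   case False
   have "ideal m' R" using m' by (simp add: maximalideal_def)
   thus ?thesis using r(3)[OF m' False] idealD(6) mD(2)[OF a] by blast
  qed
  hence "a\<otimes> r\<in>jacobson_radical R" using mD(2)[OF a] r(1) by (auto simp: jacobson_radical_def)
  thus ?thesis
   using eps_eq_zero_iff[of "a\<otimes> r"] hom_smult[OF eps_hom mD(2)[OF a], of r] r(1) mD(2)[OF a] by simp
 qed
 moreover have "eps r ~= 0\<^sub>E" using eps_eq_zero_iff[OF r(1)] rJ by simp
 moreover have "eps r\<in>|E|" using hom_cl[OF eps_hom, of r] r(1) by simp
 ultimately show ?thesis using that by blast
qed

text \<open>The annihilator of \<open>x\<close> lies in a maximal ideal \<open>m\<close>, so sending
  \<open>x\<close> to a nonzero element of \<open>E\<close> killed by \<open>m\<close> is well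
  defined on the cyclic submodule; injectivity of \<open>E\<close> extends it to
  \<open>M\<close>.\<close>

lemma E_cogenerator:
 assumes M: "lmod R M" and x: "x\<in>|M|" "x ~= 0\<^sub>M" and small: "|M|\<lesssim>(UNIV :: 'u set)"
 obtains f where "f:Hom R M E" "f x ~= 0\<^sub>E"
proof -
 interpret M: left_module R M by fact
 note reg = left_module_regular[OF ring_axioms]
 let ?A = "{r\<in>|R|. r*\<^sub>M x = 0\<^sub>M}"
 have "ideal ?A R" by (rule idealI') (use x in \<open>auto simp: M.smult_l_distr M.smult_assoc1\<close>)
 moreover have "\<one>\<notin>?A" using x by (simp add: M.smult_one)
 ultimately obtain m where m: "maximalideal m R" "?A <= m" using ex_maximalideal by blast
 obtain e where e: "e\<in>|E|" "e ~= 0\<^sub>E" "!!a. a\<in>m ==> a*\<^sub>E e = 0\<^sub>E"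
  by (rule socle_nonzero[OF m(1)]) blast
 let ?o = "\<lambda>a\<in>|R|. a*\<^sub>M x"
 let ?L = "?o ` |reg R|"
 note o = M.orbit_hom[OF x(1)]
 note L = submodule_image[OF reg M o left_module.submodule_carrier[OF reg]]
 let ?b = "M(|carrier := ?L|)"
 have oL: "?o:Hom R (reg R) ?b" by (rule hom_into_sub[OF o]) simp
 let ?a = "\<lambda>a\<in>|R|. a*\<^sub>E e"
 have ker: "?a y = 0\<^sub>E" if "y\<in>|reg R|" "?o y = \<zero>\<^bsub>M(|carrier := ?L|)\<^esub>" for y
  using that m(2) e(3) by auto
 obtain g where g: "g:Hom R ?b E"
  "ALL y:|reg R|. g (?o y) = ?a y"
  using factor_surj[OF reg M.sub_left_module[OF L] E_module oL _ E.orbit_hom[OF e(1)] ker] by auto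
 have gx: "g x = e" using g(2)[rule_format, of \<one>] x e(1) by (simp add: M.smult_one E.smult_one)
 have xo: "x = ?o \<one>" using x(1) by (simp add: M.smult_one)
 have xL: "x\<in>?L" using xo by (rule image_eqI[where x = "\<one>"]) simp
 note LM = M.submoduleD(1)[OF L]
 have "|M(|carrier := ?L|)|\<lesssim>(UNIV :: 'u set)"
  using lepoll_trans[OF subset_imp_lepoll[OF LM] small] by simp
 then obtain f where f: "f:Hom R M E" "ALL y:|M(|carrier := ?L|)|. f ((\<lambda>x\<in>?L. x) y) = g y"
  using injective_extend[OF E_injective M.sub_left_module[OF L] M M.incl_hom[OF L] _ g(1) _ small]
  by (auto simp: inj_on_def)
 have "f x = e" using f(2)[rule_format, of x] xL gx by simp
 thus ?thesis using that[OF f(1)] e(2) by simp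
qed

text \<open>The two statements about \<open>D(M) = Hom(M, E)\<close> are proved by induction along a composition series; in
 the inductive step the kernel of the restriction \<open>D(N + Rx) \<rightarrow> D(N)\<close> is cyclic because the part of
 \<open>E\<close> killed by a maximal ideal is one-dimensional.\<close>

lemma dual_step:
 assumes M: "lmod R M" and small: "|M|\<lesssim>(UNIV :: 'u set)" and N: "submodule N R M"
  and x: "x\<in>|M|" and m: "maximalideal m R" and mx: "ALL a:m. a*\<^sub>M x\<in>N"
 defines "N' \<equiv> {n+\<^sub>M r*\<^sub>M x | n r. n\<in>N & r\<in>|R| }"
 shows "(\<lambda>f\<in>Hom R (M(|carrier := N'|)) E. restrict f N)\<in>
   Hom R (module_dual R (M(|carrier := N'|)) E) (module_dual R (M(|carrier := N|)) E)" (is "?res\<in>_")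
  and "(\<lambda>f\<in>Hom R (M(|carrier := N'|)) E. restrict f N) ` Hom R (M(|carrier := N'|)) E =
   Hom R (M(|carrier := N|)) E"
  and "!!f a. f:Hom R (M(|carrier := N'|)) E ==> restrict f N = (\<lambda>n\<in>N. 0\<^sub>E) ==> a\<in>m ==> a*\<^sub>E f x = 0\<^sub>E"
  and "!!f n r. f:Hom R (M(|carrier := N'|)) E ==> restrict f N = (\<lambda>n\<in>N. 0\<^sub>E) ==> n\<in>N ==> r\<in>|R| ==>
    f (n+\<^sub>M r*\<^sub>M x) = r*\<^sub>E f x"
proof -
 interpret M: left_module R M by fact
 note A = adjoin_submodule[OF M N x, folded N'_def]
 note ND = M.submoduleD[OF N] and N'D = M.submoduleD[OF A(1)]
 note lmN = M.sub_left_module[OF N] and lmN' = M.sub_left_module[OF A(1)]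
 let ?a = "M(|carrier := N'|)"
 have NN': "submodule N R ?a" using M.submodule_sub_iff[OF A(1)] N A(2) by blast
 let ?b = "M(|carrier := N|)"
 let ?e = "Hom R ?a E"
 let ?g = "Hom R ?b E"
 have res: "restrict f N\<in>?g" if "f\<in>?e" for f
  using restrict_hom[OF lmN' that NN'] by simp
 let ?d = "Hom R (module_dual R ?a E) (module_dual R ?b E)"
 have "restrict (%f. restrict f N) |module_dual R ?a E|\<in>
   ?d"
  using A(2) ND(7) by (intro module_homI left_module_dual lmN' E_module) (auto simp: res subset_iff intro!: restrict_ext)
 thus "?res\<in>?d" by simp
 show "?res ` ?e = ?g"
 proof
  show "?res ` ?e <= ?g" using res by auto
  show "?g <= ?res ` ?e"
  proof
   fix f assume f: "f\<in>?g"
   let ?f = "\<lambda>x\<in>N. x"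
   have incl: "?f:Hom R ?b ?a"
    using hom_into_sub[OF M.incl_hom[OF N], of N'] A(2) by auto
   have "inj_on ?f |M(|carrier := N|)|" by (simp add: inj_on_def)
   moreover have "|M(|carrier := N|)|\<lesssim>(UNIV :: 'u set)" "|M(|carrier := N'|)|\<lesssim>(UNIV :: 'u set)"
    using lepoll_trans[OF subset_imp_lepoll[OF ND(1)] small] lepoll_trans[OF subset_imp_lepoll[OF N'D(1)] small] by simp_all
   ultimately obtain F where F: "F\<in>?e" "ALL x:|M(|carrier := N|)|. F (?f x) = f x"
    using injective_extend[OF E_injective lmN lmN' incl _ f] by blast
   have "f = restrict F N"
    by (rule hom_eqI[OF f res[OF F(1)]]) (use F(2) in simp)
   hence "f = ?res F" using F(1) by simp
   thus "f\<in>?res ` ?e" using F(1) by (rule image_eqI)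
  qed
 qed
 let ?c = "\<lambda>n\<in>N. 0\<^sub>E"
 have f0: "f n = 0\<^sub>E" if "restrict f N = ?c" "n\<in>N" for f n
  using fun_cong[OF that(1), of n] that(2) by simp
 show "a*\<^sub>E f x = 0\<^sub>E" if "f\<in>?e" "restrict f N = ?c" "a\<in>m" for f a
 proof -
  have "a\<in>|R|" using idealD(2)[of m a] m that(3) by (simp add: maximalideal_def)
  thus ?thesis using hom_smult[OF that(1), of a x] A(3) f0[OF that(2) bspec[OF mx that(3)]] by simp
 qed
 show "f (n+\<^sub>M r*\<^sub>M x) = r*\<^sub>E f x" if "f\<in>?e" "restrict f N = ?c" "n\<in>N" "r\<in>|R|" for f n r
 proof -
  have "f (n+\<^sub>M r*\<^sub>M x) = f n+\<^sub>E r*\<^sub>E f x"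
   using hom_add[OF that(1), of n "r*\<^sub>M x"] hom_smult[OF that(1,4), of x] A(2,3) N'D(7) that(3,4) by auto
  thus ?thesis using f0[OF that(2,3)] hom_cl[OF that(1), of x] A(3) that(4) by simp
 qed
qed

text \<open>A functional vanishing on \<open>N\<close> is determined by its value at
  \<open>x\<close>, and this value is killed by \<open>m\<close>. Any two such values are
  proportional because that part of \<open>E\<close> is one-dimensional.\<close>

lemma dual_proportional:
 assumes M: "lmod R M" and small: "|M|\<lesssim>(UNIV :: 'u set)" and N: "submodule N R M"
  and x: "x\<in>|M|" and m: "maximalideal m R" and mx: "ALL a:m. a*\<^sub>M x\<in>N"
  and N': "N' = {n+\<^sub>M r*\<^sub>M x | n r. n\<in>N & r\<in>|R| }"
  and f: "f:Hom R (M(|carrier := N'|)) E" "restrict f N = (\<lambda>n\<in>N. 0\<^sub>E)"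
  and g: "g:Hom R (M(|carrier := N'|)) E" "restrict g N = (\<lambda>n\<in>N. 0\<^sub>E)" "g x ~= 0\<^sub>E"
 obtains r where "r\<in>|R|" "f = r\<odot>\<^bsub>module_dual R (M(|carrier := N'|)) E\<^esub> g"
proof -
 interpret M: left_module R M by fact
 note A = adjoin_submodule[OF M N x, folded N']
 note ND = M.submoduleD[OF N] and N'D = M.submoduleD[OF A(1)]
 note st = dual_step[OF M small N x m mx, folded N']
 have c: "f x\<in>|E|" "g x\<in>|E|"
  using hom_cl[OF f(1), of x] hom_cl[OF g(1), of x] A(3) by auto
 obtain r where r: "r\<in>|R|" "f x = r*\<^sub>E g x"
  using socle_one_dimensional[OF m c(2) g(3) st(3)[OF g(1,2)] c(1) st(3)[OF f]] by blast
 let ?b = "M(|carrier := N'|)"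
 let ?a = "module_dual R ?b E"
 have "lmod R ?a"
  by (rule left_module_dual[OF M.sub_left_module[OF A(1)] E_module])
 then interpret D: left_module R "?a" .
 have rg: "r\<odot>\<^bsub>?a\<^esub> g:Hom R ?b E"
  using D.smult_closed[OF r(1), of g] g(1) by simp
 have "f y = (r\<odot>\<^bsub>?a\<^esub> g) y" if y: "y\<in>N'" for y
 proof -
  obtain n s where ns: "n\<in>N" "s\<in>|R|" "y = n+\<^sub>M s*\<^sub>M x" using y unfolding N' by blast
  have "f y = s*\<^sub>E (r*\<^sub>E g x)" using st(4)[OF f ns(1,2)] ns(3) r(2) by simp
  also have "... = r*\<^sub>E (s*\<^sub>E g x)" using c(2) r(1) ns(2) by (simp add: E.smult_assoc1[symmetric] m_comm)
  also have "... = r*\<^sub>E g y" using st(4)[OF g(1,2) ns(1,2)] ns(3) by simp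
  also have "... = g (r*\<^sub>M y)" using hom_smult[OF g(1) r(1), of y] y by simp
  finally show ?thesis using y by simp
 qed
 hence "f = r\<odot>\<^bsub>?a\<^esub> g"
  by (intro hom_eqI[OF f(1) rg]) simp
 thus ?thesis using that r(1) by blast
qed

lemma dual_zero_or_generator:
 assumes M: "lmod R M" and small: "|M|\<lesssim>(UNIV :: 'u set)" and N: "submodule N R M"
  and x: "x\<in>|M|" and m: "maximalideal m R" and mx: "ALL a:m. a*\<^sub>M x\<in>N"
  and N': "N' = {n+\<^sub>M r*\<^sub>M x | n r. n\<in>N & r\<in>|R| }"
  and f: "f:Hom R (M(|carrier := N'|)) E" "restrict f N = (\<lambda>n\<in>N. 0\<^sub>E)" "f x = 0\<^sub>E"
 shows "f = \<zero>\<^bsub>module_dual R (M(|carrier := N'|)) E\<^esub>"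
proof -
 interpret M: left_module R M by fact
 note A = adjoin_submodule[OF M N x, folded N']
 note st = dual_step[OF M small N x m mx, folded N']
 have "f y = 0\<^sub>E" if y: "y\<in>N'" for y
 proof -
  obtain n s where ns: "n\<in>N" "s\<in>|R|" "y = n+\<^sub>M s*\<^sub>M x" using y unfolding N' by blast
  thus ?thesis using st(4)[OF f(1,2) ns(1,2)] f(3) by simp
 qed
 thus ?thesis
  using zero_hom[OF M.sub_left_module[OF A(1)] E_module] by (intro hom_eqI[OF f(1)]) auto
qed

lemma dual_fg_aux:
 assumes M: "lmod R M" and small: "|M|\<lesssim>(UNIV :: 'u set)" and "fin_length M N"
 shows "fg_module R (module_dual R (M(|carrier := N|)) E)"
 using assms(3)
proof induction
 interpret M: left_module R M by fact
 case zero
 note D = left_module_dual[OF M.sub_left_module[OF M.submodule_zero] E_module]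
 let ?d = "M(|carrier := {0\<^sub>M}|)"
 let ?a = "module_dual R ?d E"
 interpret D: left_module R "?a" by (rule D)
 have "f = \<zero>\<^bsub>?a\<^esub>" if f: "f:Hom R ?d E" for f
 proof (rule hom_eqI[OF f])
  show "\<zero>\<^bsub>?a\<^esub>:Hom R ?d E"
   using D.M.zero_closed by simp
  show "f y = \<zero>\<^bsub>?a\<^esub> y" if "y\<in>|M(|carrier := {0\<^sub>M}|)|" for y
   using hom_zero[OF M.sub_left_module[OF M.submodule_zero] E_module f] that by simp
 qed
 hence "|?a| <= {\<zero>\<^bsub>?a\<^esub>}" by auto
 hence "generates R ?a {} |?a|"
  unfolding generates_def using D.submoduleD(3) by blast
 thus ?case unfolding fg_module_iff using D by blast
next
 interpret M: left_module R M by fact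
 case (adjoin N x m)
 note N = fin_length_submodule[OF M adjoin.hyps(1)]
 have mx: "ALL a:m. a*\<^sub>M x\<in>N" using adjoin.hyps(4) by blast
 define N' where "N' = {n+\<^sub>M r*\<^sub>M x | n r. n\<in>N & r\<in>|R| }"
 note A = adjoin_submodule[OF M N adjoin.hyps(2), folded N'_def]
 note st = dual_step[OF M small N adjoin.hyps(2,3) mx, folded N'_def]
 let ?f = "M(|carrier := N'|)"
 let ?D = "module_dual R (M(|carrier := N|)) E" and ?D' = "module_dual R ?f E"
 let ?e = "Hom R ?f E"
 let ?res = "\<lambda>f\<in>?e. restrict f N"
 have D: "lmod R ?D" "lmod R ?D'"
  using left_module_dual[OF M.sub_left_module[OF N] E_module] left_module_dual[OF M.sub_left_module[OF A(1)] E_module] by auto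
 interpret D': left_module R ?D' by (rule D)
 have surj: "?res ` |?D'| = |?D|" using st(2) by simp
 note K = submodule_kernel[OF D(2,1) st(1)]
 let ?b = "a_kernel ?D' ?D ?res"
 let ?g = "\<lambda>n\<in>N. 0\<^sub>E"
 have kerI: "f\<in>?e" "restrict f N = ?g" if "f\<in>?b" for f
 proof -
  have f: "f\<in>|?D'|" "?res f = 0\<^sub>?D" using that unfolding a_kernel_def' by blast+
  from f(1) show f1: "f\<in>?e" by simp
  have "restrict f N = 0\<^sub>?D" using f(2) unfolding restrict_apply'[OF f1] .
  thus "restrict f N = ?g" by simp
 qed
 have "EX S. finite S & generates R ?D' S ?b"
 proof (cases "EX g:?b. g x ~= 0\<^sub>E")
  case True
  then obtain g where g: "g\<in>?b" "g x ~= 0\<^sub>E" by blast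
  have "generates R ?D' {g} ?b"
   unfolding generates_def
  proof (intro conjI allI impI subsetI)
   fix L f assume L: "submodule L R ?D' & {g} <= L" and f: "f\<in>?b"
   obtain r where "r\<in>|R|" "f = r*\<^sub>?D' g"
    by (rule dual_proportional[OF M small N adjoin.hyps(2,3) mx N'_def kerI[OF f] kerI[OF g(1)] g(2)])
   thus "f\<in>L" using L D'.submoduleD(7)[of L r g] by simp
  qed (use g in auto)
  thus ?thesis by blast
 next
  case False
  have "f = 0\<^sub>?D'" if "f\<in>?b" for f
   using dual_zero_or_generator[OF M small N adjoin.hyps(2,3) mx N'_def kerI[OF that]] that False by blast
  hence "?b <= {0\<^sub>?D'}" by blast
  hence "generates R ?D' {} ?b"
   unfolding generates_def using D'.submoduleD(3) by blast
  thus ?thesis by blast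
 qed
 hence "fg_module R (?D'(|carrier := ?b|))" using D'.fg_sub_iff[OF K] by blast
 thus ?case
  using fg_ses[OF ses_kernel[OF D(2,1) st(1) surj] _ adjoin.IH] by (simp add: N'_def)
qed

text \<open>In the inductive step \<open>w\<close> is chosen to match \<open>v\<close> on the
  functionals that vanish on \<open>N\<close>. The difference of \<open>v\<close> and evaluation at
  \<open>w\<close> then factors through the dual of \<open>N\<close>, where it is evaluation at some
  \<open>n\<close> by induction, so \<open>n + w\<close> represents \<open>v\<close>.\<close>

lemma dual_eval_aux:
 assumes M: "lmod R M" and small: "|M|\<lesssim>(UNIV :: 'u set)" and "fin_length M N"
  and "v:Hom R (module_dual R (M(|carrier := N|)) E) E"
 shows "EX n:N. ALL f:Hom R (M(|carrier := N|)) E. v f = f n"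
 using assms(3,4)
proof (induction arbitrary: v)
 interpret M: left_module R M by fact
 case zero
 note Z = M.sub_left_module[OF M.submodule_zero]
 note D = left_module_dual[OF Z E_module]
 let ?g = "M(|carrier := {0\<^sub>M}|)"
 have "v f = f 0\<^sub>M" if f: "f:Hom R ?g E" for f
 proof -
  have f0: "f 0\<^sub>M = 0\<^sub>E" using hom_zero[OF Z E_module f] by simp
  let ?d = "module_dual R ?g E"
  have "\<zero>\<^bsub>?d\<^esub>:Hom R ?g E"
   using zero_hom[OF Z E_module] by simp
  hence e: "f = \<zero>\<^bsub>?d\<^esub>"
   using f0 by (intro hom_eqI[OF f]) auto
  have "v f = 0\<^sub>E" unfolding e by (rule hom_zero[OF D E_module zero])
  thus ?thesis using f0 by simp
 qed
 thus ?case by blast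
next
 interpret M: left_module R M by fact
 case (adjoin N x m)
 note N = fin_length_submodule[OF M adjoin.hyps(1)]
 have mx: "ALL a:m. a*\<^sub>M x\<in>N" using adjoin.hyps(4) by blast
 define N' where "N' = {n+\<^sub>M r*\<^sub>M x | n r. n\<in>N & r\<in>|R| }"
 note A = adjoin_submodule[OF M N adjoin.hyps(2), folded N'_def]
 note N'D = M.submoduleD[OF A(1)]
 note st = dual_step[OF M small N adjoin.hyps(2,3) mx, folded N'_def]
 let ?f = "M(|carrier := N|)"
 let ?h = "M(|carrier := N'|)"
 let ?D = "module_dual R ?f E" and ?D' = "module_dual R ?h E"
 let ?a = "Hom R ?h E"
 let ?res = "\<lambda>f\<in>?a. restrict f N"
 note lmN' = M.sub_left_module[OF A(1)]
 have D: "lmod R ?D" "lmod R ?D'"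
  using left_module_dual[OF M.sub_left_module[OF N] E_module] left_module_dual[OF lmN' E_module] by auto
 interpret D': left_module R ?D' by (rule D)
 have v: "v:Hom R ?D' E" using adjoin.prems by (simp add: N'_def)
 note vc = hom_cl[OF v]
 have surj: "?res ` |?D'| = |?D|" using st(2) by simp
 let ?b = "\<lambda>n\<in>N. 0\<^sub>E"
 have "EX w:N'. ALL f:?a. restrict f N = ?b --> v f = f w"
 proof (cases "EX g:?a. restrict g N = ?b & g x ~= 0\<^sub>E")
  case True
  then obtain g where g: "g\<in>?a" "restrict g N = ?b" "g x ~= 0\<^sub>E" by blast
  have gx: "g x\<in>|E|" using hom_cl[OF g(1), of x] A(3) by simp
  have mR: "a\<in>|R|" if "a\<in>m" for a
   using idealD(2)[of m a] adjoin.hyps(3) that by (simp add: maximalideal_def)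
  have "a*\<^sub>E v g = 0\<^sub>E" if a: "a\<in>m" for a
  proof -
   have ag: "a*\<^sub>?D' g\<in>?a"
    using D'.smult_closed[OF mR[OF a], of g] g(1) by simp
   let ?i = "a*\<^sub>?D' g"
   have "?i y = 0\<^sub>E" if y: "y\<in>N'" for y
   proof -
    obtain n s where ns: "n\<in>N" "s\<in>|R|" "y = n+\<^sub>M s*\<^sub>M x" using y unfolding N'_def by blast
    have "?i y = a*\<^sub>E g y" using hom_smult[OF g(1) mR[OF a], of y] y by simp
    also have "... = a*\<^sub>E (s*\<^sub>E g x)" using st(4)[OF g(1,2) ns(1,2)] ns(3) by simp
    also have "... = s*\<^sub>E (a*\<^sub>E g x)" using gx mR[OF a] ns(2) by (simp add: E.smult_assoc1[symmetric] m_comm)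
    finally show ?thesis using st(3)[OF g(1,2) a] ns(2) by simp
   qed
   hence "a*\<^sub>?D' g = 0\<^sub>?D'"
    using zero_hom[OF lmN' E_module] by (intro hom_eqI[OF ag]) auto
   hence "v ?i = 0\<^sub>E" using hom_zero[OF D(2) E_module v] by simp
   thus ?thesis using hom_smult[OF v mR[OF a], of g] g(1) by simp
  qed
  then obtain r where r: "r\<in>|R|" "v g = r*\<^sub>E g x"
   using socle_one_dimensional[OF adjoin.hyps(3) gx g(3) st(3)[OF g(1,2)], of "v g"] vc[of g] g(1) by auto
  have w: "r*\<^sub>M x\<in>N'" using N'D(7)[OF r(1) A(3)] .
  have "v f = f (r*\<^sub>M x)" if f: "f\<in>?a" "restrict f N = ?b" for f
  proof -
   obtain s where s: "s\<in>|R|" "f = s*\<^sub>?D' g"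
    by (rule dual_proportional[OF M small N adjoin.hyps(2,3) mx N'_def f g])
   have "v f = s*\<^sub>E (r*\<^sub>E g x)" using hom_smult[OF v s(1), of g] g(1) s(2) r(2) by simp
   also have "... = r*\<^sub>E (s*\<^sub>E g x)" using gx r(1) s(1) by (simp add: E.smult_assoc1[symmetric] m_comm)
   also have "s*\<^sub>E g x = f x" using hom_smult[OF g(1) s(1), of x] A(3) s(2) by simp
   also have "r*\<^sub>E f x = f (r*\<^sub>M x)" using hom_smult[OF f(1) r(1), of x] A(3) by simp
   finally show ?thesis .
  qed
  thus ?thesis using w by blast
 next
  case False
  have "v f = f 0\<^sub>M" if f: "f\<in>?a" "restrict f N = ?b" for f
  proof -
   have "f = 0\<^sub>?D'"
    using dual_zero_or_generator[OF M small N adjoin.hyps(2,3) mx N'_def f] f False by blast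
   hence "v f = 0\<^sub>E" using hom_zero[OF D(2) E_module v] by simp
   moreover have "f 0\<^sub>M = 0\<^sub>E" using hom_zero[OF lmN' E_module f(1)] by simp
   ultimately show ?thesis by simp
  qed
  thus ?thesis using N'D(3) by blast
 qed
 then obtain w where w: "w\<in>N'" "ALL f:?a. restrict f N = ?b --> v f = f w"
  by (rule bexE)
 let ?e = "\<lambda>f\<in>?a. f w"
 let ?u = "\<lambda>f\<in>|?D'|. v f-\<^sub>E ?e f"
 have "?e:Hom R ?D' E" using eval_hom[OF lmN' E_module, of w] w(1) by simp
 hence u: "?u:Hom R ?D' E" by (rule minus_hom[OF D(2) E_module v])
 have ueq: "?u f = v f-\<^sub>E f w" if "f\<in>?a" for f using that by simp
 have wc: "f w\<in>|E|" if "f\<in>?a" for f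
  using hom_cl[OF that, of w] w(1) by simp
 have ker: "?u f = 0\<^sub>E" if f: "f\<in>|?D'|" "?res f = 0\<^sub>?D" for f
 proof -
  have f': "f\<in>?a" using f(1) by simp
  have "restrict f N = 0\<^sub>?D" using f(2) unfolding restrict_apply'[OF f'] .
  hence "restrict f N = ?b" by simp
  thus ?thesis unfolding ueq[OF f'] using bspec[OF w(2) f'] wc[OF f'] by (simp add: E.diff_eq_zero_iff)
 qed
 obtain u' where u': "u':Hom R ?D E" "ALL f:|?D'|. u' (?res f) = ?u f"
  using factor_surj[OF D(2,1) E_module st(1) surj u ker] by blast
 obtain n where n: "n\<in>N" "ALL f:Hom R ?f E. u' f = f n"
  using adjoin.IH[OF u'(1)] by (rule bexE)
 have "v f = f (n+\<^sub>M w)" if f: "f\<in>?a" for f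
 proof -
  have rf: "?res f = restrict f N" using f by simp
  have "restrict f N:Hom R ?f E"
   using hom_cl[OF st(1), of f] f by simp
  hence "f n = ?u f" using u'(2)[rule_format, of f] bspec[OF n(2), of "restrict f N"] n(1) f unfolding rf by simp
  hence "f n+\<^sub>E f w = v f"
   unfolding ueq[OF f] using wc[OF f] vc[of f] f by simp
  thus ?thesis using hom_add[OF f, of n w] A(2) n(1) w(1) by auto
 qed
 moreover have "n+\<^sub>M w\<in>N'" using N'D(4) A(2) n(1) w(1) by blast
 ultimately show ?case unfolding N'_def by blast
qed

lemma dual_fg:
 assumes "fg_module R M"
 shows "fg_module R (module_dual R M E)"
proof -
 have M: "lmod R M" using assms by (simp add: fg_module_def)
 show ?thesis
  using dual_fg_aux[OF M fg_lepoll_UNIV[OF assms infinite_universe small_ring] fin_length_fg[OF artinian assms]] by simp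
qed

text \<open>Surjectivity of the biduality map; its injectivity is the content of
  \<open>E_cogenerator\<close>.\<close>

lemma dual_eval:
 assumes "fg_module R M" "w:Hom R (module_dual R M E) E"
 shows "EX x:|M|. ALL f:Hom R M E. w f = f x"
proof -
 have M: "lmod R M" using assms by (simp add: fg_module_def)
 show ?thesis
  using dual_eval_aux[OF M fg_lepoll_UNIV[OF assms(1) infinite_universe small_ring] fin_length_fg[OF artinian assms(1)], of w]
   assms(2) by simp
qed

end

section \<open>Artin algebras\<close>

lemma finite_subset_chain_Union:
 assumes "finite S" "S <= \<Union>C" "C ~= {}" "!!K L. K\<in>C ==> L\<in>C ==> K <= L \<or> L <= K"
 shows "EX K:C. S <= K"
 using assms(1,2)
proof (induction S rule: finite_induct)
 case empty
 thus ?case using assms(3) by blast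
next
 case (insert x S)
 then obtain K L where KL: "K\<in>C" "S <= K" "L\<in>C" "x\<in>L" by blast
 from assms(4)[OF KL(1,3)] show ?case
 proof
  assume "K <= L"
  hence "insert x S <= L" using KL by blast
  thus ?thesis using KL(3) by blast
 next
  assume "L <= K"
  hence "insert x S <= K" using KL by blast
  thus ?thesis using KL(1) by blast
 qed
qed

lemma (in left_module) submodule_chain_Union:
 assumes "C ~= {}" "!!K. K\<in>C ==> submodule K R M" "!!K L. K\<in>C ==> L\<in>C ==> K <= L \<or> L <= K"
 shows "submodule (\<Union>C) R M"
proof (rule submoduleI)
 note D = submoduleD[OF assms(2)]
 show "\<Union>C <= |M|" using D(1) by blast
 show "0\<^sub>M\<in>\<Union>C" using D(3) assms(1) by blast
 show "a+\<^sub>M b\<in>\<Union>C" if ab: "a\<in>\<Union>C" "b\<in>\<Union>C" for a b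
 proof -
  have "EX K:C. {a, b} <= K" by (rule finite_subset_chain_Union) (use ab assms(1,3) in auto)
  then obtain K where K: "K\<in>C" "a\<in>K" "b\<in>K" by blast
  show ?thesis using D(4)[OF K] K(1) by blast
 qed
 show "r*\<^sub>M a\<in>\<Union>C" if ra: "r\<in>|R|" "a\<in>\<Union>C" for r a
  using D(7) ra by blast
qed

text \<open>The union of a chain is finitely generated, so a member of the chain already contains
  the generators and equals the union; Zorn's lemma then applies.\<close>

lemma noetherian_maximal:
 assumes "noetherian_module R M" "N\<in>F" "!!K. K\<in>F ==> submodule K R M"
 shows "EX K:F. ALL L:F. K <= L --> L = K"
proof -
 have M: "lmod R M" using assms(1) by (simp add: noetherian_module_def)
 interpret M: left_module R M by fact
 show ?thesis
 proof (rule subset_Zorn_nonempty)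
  show "F ~= {}" using assms(2) by blast
  fix C assume C: "C ~= {}" "subset.chain F C"
  have CF: "K\<in>F" if "K\<in>C" for K using C(2) that by (auto simp: subset.chain_def)
  have tot: "K <= L \<or> L <= K" if "K\<in>C" "L\<in>C" for K L using C(2) that by (auto simp: subset.chain_def)
  have U: "submodule (\<Union>C) R M" by (rule M.submodule_chain_Union[OF C(1) assms(3)[OF CF] tot])
  hence "fg_module R (M(|carrier := \<Union>C|))" using assms(1) by (simp add: noetherian_module_def)
  then obtain S where S: "finite S" "generates R M S (\<Union>C)" using M.fg_sub_iff[OF U] by blast
  have "S <= \<Union>C" using S(2) by (simp add: generates_def)
  from finite_subset_chain_Union[OF S(1) this C(1) tot]
  obtain K where K: "K\<in>C" "S <= K" by blast
  have "\<Union>C <= K" using S(2) assms(3)[OF CF[OF K(1)]] K(2) by (simp add: generates_def)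
  hence "\<Union>C = K" using K(1) by blast
  thus "\<Union>C\<in>F" using CF[OF K(1)] by simp
 qed
qed

lemma injective_retract:
 fixes J F :: "('a, 'u) module"
 assumes "injm R F" "lmod R J" "s:Hom R J F" "r:Hom R F J"
  and "!!x. x\<in>|J| ==> r (s x) = x"
 shows "injm R J"
 unfolding injective_module_def
proof (intro conjI allI impI assms(2); elim conjE)
 fix A B :: "('a, 'u) module" and f g
 assume h: "lmod R A" "lmod R B" "f:Hom R A B" "inj_on f |A|" "g:Hom R A J"
 obtain k where k: "k:Hom R B F" "!!x. x\<in>|A| ==> k (f x) = compose |A| s g x"
  by (rule injectiveD[OF assms(1) h(1-4) compose_hom[OF h(1,5) assms(3)]]) blast
 have "compose |B| r k:Hom R B J" by (rule compose_hom[OF h(2) k(1) assms(4)])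
 moreover have "compose |B| r k (f x) = g x" if "x\<in>|A|" for x
  using that k(2) assms(5) hom_cl[OF h(3)] hom_cl[OF h(5)] by (simp add: compose_eq)
 ultimately show "EX h:Hom R B J. ALL x:|A|. h (f x) = g x" by blast
qed

text \<open>The kernel of \<open>h\<close> meets the image of \<open>j\<close> only in 0, and that
  image is essential.\<close>

lemma envelope_mono:
 assumes "lmod R M" "lmod R F" "injective_envelope R M I j" "h:Hom R I F"
  and "!!x. x\<in>|M| ==> h (j x) = 0\<^sub>F ==> x = 0\<^sub>M"
 shows "inj_on h |I|"
proof -
 have I: "injm R I" "j:Hom R M I" "essential_submodule R (j ` |M| ) I"
  using assms(3) by (auto simp: injective_envelope_def)
 have Im: "lmod R I" using I(1) by (simp add: injective_module_def)
 have K: "submodule (a_kernel I F h) R I" by (rule submodule_kernel[OF Im assms(2,4)])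
 have "a_kernel I F h \<inter> j ` |M| <= {0\<^sub>I}"
 proof
  fix y assume "y\<in>a_kernel I F h \<inter> j ` |M|"
  then obtain x where x: "x\<in>|M|" "y = j x" "h (j x) = 0\<^sub>F" by (auto simp: a_kernel_def')
  thus "y\<in>{0\<^sub>I}" using assms(5)[OF x(1,3)] hom_zero[OF assms(1) Im I(2)] by simp
 qed
 moreover have "0\<^sub>I\<in>a_kernel I F h" by (rule left_module.submoduleD(3)[OF Im K])
 moreover have "0\<^sub>I\<in>j ` |M|"
  by (rule left_module.submoduleD(3)[OF Im submodule_image[OF assms(1) Im I(2) left_module.submodule_carrier[OF assms(1)]]])
 ultimately have "a_kernel I F h \<inter> j ` |M| = {0\<^sub>I}" by blast
 hence "a_kernel I F h = {0\<^sub>I}" using I(3) K by (simp add: essential_submodule_def)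
 thus ?thesis unfolding inj_on_hom_iff[OF Im assms(2,4)] by (auto simp: a_kernel_def')
qed

locale artin_alg =
 fixes R :: "('r, 'x) ring_scheme" (structure) and La :: "('r, 'a) module"
  and E :: "('r, 'u) module" and \<iota> :: "'r set => 'u"
 assumes artin_algebra: "artin_algebra R La"
  and infinite_univ: "infinite (UNIV :: 'u set)"
  and small_R: "|R|\<lesssim>(UNIV :: 'u set)"
  and env: "injective_envelope R (residue_module R) E \<iota>"

sublocale artin_alg \<subseteq> matlis R E \<iota>
proof -
 have "artinian_ring R" using artin_algebra by (simp add: artin_algebra_def)
 thus "matlis R E \<iota>"
  using infinite_univ small_R env by (simp add: matlis_def matlis_axioms_def artinian_ring_def)
qed

context artin_alg
begin

lemma L_ring: "ring La" and L_Rmodule: "lmod R La" and L_fg: "fg_module R La"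
 and L_smult_left: "r\<in>|R| ==> x\<in>|La| ==> y\<in>|La| ==>
  (r*\<^sub>La x)\<otimes>\<^sub>La y = r*\<^sub>La (x\<otimes>\<^sub>La y)"
 and L_smult_right: "r\<in>|R| ==> x\<in>|La| ==> y\<in>|La| ==>
  x\<otimes>\<^sub>La (r*\<^sub>La y) = r*\<^sub>La (x\<otimes>\<^sub>La y)"
 using artin_algebra by (simp_all add: artin_algebra_def left_module_of_module)

end

sublocale artin_alg \<subseteq> L: ring La by (rule L_ring)
sublocale artin_alg \<subseteq> LR: left_module R La by (rule L_Rmodule)

context artin_alg
begin

lemma L_small: "|La|\<lesssim>(UNIV :: 'u set)"
 by (rule fg_lepoll_UNIV[OF L_fg infinite_univ small_R])

lemma fg_small: "fg_module La M ==> |M|\<lesssim>(UNIV :: 'u set)"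
 by (rule fg_lepoll_UNIV[OF _ infinite_univ L_small])

section \<open>Restriction of scalars from Lambda to R\<close>

definition rmod :: "('a, 'm) module => ('r, 'm) module"
 where "rmod M = (|carrier = |M|, monoid.mult = undefined, one = undefined,
  ring.zero = 0\<^sub>M, add = add M, smult = (%r x. (r*\<^sub>La \<one>\<^bsub>La\<^esub>)*\<^sub>M x)|)"

lemma rmod_simps [simp]:
 "|rmod M| = |M|" "0\<^sub>(rmod M) = 0\<^sub>M" "x+\<^sub>(rmod M) y = x+\<^sub>M y"
 "r*\<^sub>(rmod M) x = (r*\<^sub>La \<one>\<^bsub>La\<^esub>)*\<^sub>M x"
 by (simp_all add: rmod_def)

lemma scalar_closed: "r\<in>|R| ==> r*\<^sub>La \<one>\<^bsub>La\<^esub>\<in>|La|"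
 by simp

lemma scalar_mult: "r\<in>|R| ==> x\<in>|La| ==> (r*\<^sub>La \<one>\<^bsub>La\<^esub>)\<otimes>\<^sub>La x = r*\<^sub>La x"
 "r\<in>|R| ==> x\<in>|La| ==> x\<otimes>\<^sub>La (r*\<^sub>La \<one>\<^bsub>La\<^esub>) = r*\<^sub>La x"
 by (simp_all add: L_smult_left L_smult_right)

lemma left_module_rmod:
 assumes "lmod La M"
 shows "lmod R (rmod M)"
proof -
 interpret M: left_module La M by fact
 have "abelian_group (rmod M)"
 proof (rule abelian_groupI)
  show "EX y:|rmod M|. y+\<^sub>(rmod M) x = 0\<^sub>(rmod M)" if "x\<in>|rmod M|" for x
   using that M.M.l_neg by (intro bexI[of _ "-\<^sub>M x"]) auto
 qed (auto simp: M.M.a_ac)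
 thus ?thesis
 proof (rule left_moduleI[OF ring_axioms])
  fix a b x assume *: "a\<in>|R|" "b\<in>|R|" "x\<in>|rmod M|"
  show "(a\<otimes> b)*\<^sub>(rmod M) x = a*\<^sub>(rmod M) (b*\<^sub>(rmod M) x)"
  proof -
   have "(a\<otimes> b)*\<^sub>La \<one>\<^bsub>La\<^esub> = (a*\<^sub>La \<one>\<^bsub>La\<^esub>)\<otimes>\<^sub>La (b*\<^sub>La \<one>\<^bsub>La\<^esub>)"
    using * by (simp add: scalar_mult(1) LR.smult_assoc1)
   thus ?thesis using * by (simp add: M.smult_assoc1)
  qed
 qed (auto simp: LR.smult_l_distr M.smult_l_distr M.smult_r_distr LR.smult_one M.smult_one)
qed

lemma rmod_hom:
 "f:Hom La M N ==> f:Hom R (rmod M) (rmod N)"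
 by (auto simp: module_hom_def)

lemma rmod_submodule:
 assumes "lmod La M" "submodule N La M"
 shows "submodule N R (rmod M)"
proof -
 interpret M: left_module La M by fact
 note D = M.submoduleD[OF assms(2)]
 show ?thesis by (rule left_module.submoduleI[OF left_module_rmod[OF assms(1)]]) (use D in auto)
qed

lemma rmod_generates:
 assumes "lmod La M" "generates R (rmod M) S N"
 shows "generates La M S N"
 using assms(2) rmod_submodule[OF assms(1)] by (auto simp: generates_def)

lemma fg_of_rmod:
 assumes "lmod La M" "fg_module R (rmod M)"
 shows "fg_module La M"
proof -
 obtain S where "finite S" "generates R (rmod M) S |M|" using assms(2) by (auto simp: fg_module_iff)
 hence "finite S & generates La M S |M|" using rmod_generates[OF assms(1)] by blast
 thus ?thesis using assms(1) unfolding fg_module_iff by blast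
qed

text \<open>A finite power of \<open>La\<close> is noetherian over \<open>R\<close>, because
  \<open>La\<close> is finitely generated over an artinian ring. A free cover of \<open>M\<close>
  over \<open>La\<close> is also linear over \<open>R\<close> and transports finite generation to
  \<open>M\<close>.\<close>

lemma rmod_fg:
 assumes "fg_module La M"
 shows "fg_module R (rmod M)"
proof -
 have M: "lmod La M" using assms by (simp add: fg_module_def)
 obtain S f where S: "finite S" "S <= |M|" "f:Hom La (pow_module S (reg La)) M"
  "f ` (S \<rightarrow>\<^sub>E |La| ) = |M|"
  by (rule fg_free_cover[OF assms])
 have "f (r*\<^sub>(pow_module S La) x) = r*\<^sub>(rmod M) f x" if rx: "r\<in>|R|" "x\<in>S \<rightarrow>\<^sub>E |La|" for r x
 proof -
  have "r*\<^sub>(pow_module S La) x = (r*\<^sub>La \<one>\<^bsub>La\<^esub>)*\<^sub>(pow_module S (reg La)) x"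
   using rx by (auto simp: scalar_mult(1) PiE_const intro!: restrict_ext)
  thus ?thesis using hom_smult[OF S(3) scalar_closed[OF rx(1)], of x] rx(2) by simp
 qed
 hence "f:Hom R (pow_module S La) (rmod M)"
  using S(3) unfolding module_hom_def by simp
 moreover have "noetherian_module R (pow_module S La)"
  by (rule noetherian_pow[OF noetherian_of_fg[OF artinian_noetherian[OF artinian] L_fg] S(1)])
 ultimately show ?thesis
  using fg_image[OF noetherian_fg left_module_rmod[OF M], of "pow_module S La" f] S(4) by simp
qed

lemma noetherian_of_rmod:
 assumes "lmod La M" "noetherian_module R (rmod M)"
 shows "noetherian_module La M"
 unfolding noetherian_module_def
proof (intro conjI allI impI assms(1))
 fix N assume N: "submodule N La M"
 have "fg_module R ((rmod M)(|carrier := N|))"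
  using assms rmod_submodule[OF assms(1) N] by (simp add: noetherian_module_def)
 thus "fg_module La (M(|carrier := N|))"
  using left_module.fg_sub_iff[OF left_module_rmod[OF assms(1)] rmod_submodule[OF assms(1) N]]
   left_module.fg_sub_iff[OF assms(1) N] rmod_generates[OF assms(1)] by blast
qed

lemma fg_noetherian: "fg_module La M ==> noetherian_module La M"
 using noetherian_of_rmod noetherian_of_fg[OF artinian_noetherian[OF artinian] rmod_fg]
 by (auto simp: fg_module_def)

lemma fg_regular: "fg_module La (reg La)"
proof (rule fg_of_rmod[OF left_module_regular[OF L_ring]])
 have "(\<lambda>x\<in>|La|. x):Hom R La (rmod (reg La))"
  by (rule module_homI) (auto simp: scalar_mult L_Rmodule)
 thus "fg_module R (rmod (reg La))"
  using fg_image[OF L_fg left_module_rmod[OF left_module_regular[OF L_ring]]] by simp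
qed

lemma L_noetherian: "noetherian_module La (reg La)"
 by (rule fg_noetherian[OF fg_regular])

lemma ex_proj_res:
 "fg_module La M ==> \<exists>(P :: nat => ('a, 'u) module) d w. projective_resolution La M P d w"
 by (rule ex_projective_resolution[OF L_noetherian _ infinite_univ L_small])

section \<open>The bimodule D(Lambda): injectivity, endomorphisms and cogeneration\<close>

abbreviation DL :: "('a, 'a => 'u) module" where "DL \<equiv> dual_left R La E"
abbreviation DR :: "('a, 'a => 'u) module" where "DR \<equiv> dual_right R La E"

lemma DL_simps [simp]:
 "|DL| = Hom R La E" "0\<^sub>DL = (\<lambda>x\<in>|La|. 0\<^sub>E)"
 "f+\<^sub>DL g = (\<lambda>x\<in>|La|. f x+\<^sub>E g x)"
 "a*\<^sub>DL f = (\<lambda>x\<in>|La|. f (x\<otimes>\<^sub>La a))"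
 by (simp_all add: dual_left_def)

lemma DR_simps [simp]:
 "|DR| = Hom R La E" "0\<^sub>DR = (\<lambda>x\<in>|La|. 0\<^sub>E)"
 "f+\<^sub>DR g = (\<lambda>x\<in>|La|. f x+\<^sub>E g x)"
 "a*\<^sub>DR f = (\<lambda>x\<in>|La|. f (a\<otimes>\<^sub>La x))"
 by (simp_all add: dual_right_def)

lemma left_mult_hom: "a\<in>|La| ==> (\<lambda>x\<in>|La|. a\<otimes>\<^sub>La x):Hom R La La"
 by (rule module_homI) (auto simp: L.r_distr L_smult_right L_Rmodule)

lemma right_mult_hom: "a\<in>|La| ==> (\<lambda>x\<in>|La|. x\<otimes>\<^sub>La a):Hom R La La"
 by (rule module_homI) (auto simp: L.l_distr L_smult_left L_Rmodule)

lemma DL_module: "lmod La DL"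
 unfolding dual_left_def
 by (rule left_module_hom_module[OF L_Rmodule E_module L_ring right_mult_hom])
  (auto simp: L.r_distr L.m_assoc)

lemma DR_smult_closed:
 assumes "a\<in>|La|" "f:Hom R La E"
 shows "a*\<^sub>DR f:Hom R La E"
proof -
 have "a*\<^sub>DR f = compose |La| f (\<lambda>x\<in>|La|. a\<otimes>\<^sub>La x)"
  by (auto simp: compose_def intro!: restrict_ext)
 thus ?thesis using compose_hom[OF L_Rmodule left_mult_hom[OF assms(1)] assms(2)] by simp
qed

text \<open>Multiplying the argument on the left and on the right commute by associativity, so the
  right action is by endomorphisms of the left module.\<close>

lemma DR_smult_hom:
 assumes "a\<in>|La|"
 shows "(\<lambda>f\<in>Hom R La E. a*\<^sub>DR f):Hom La DL DL"
proof -
 interpret DL: left_module La DL by (rule DL_module)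
 have "restrict (smult DR a) |DL|:Hom La DL DL"
 proof (rule module_homI[OF _ _ _ DL_module])
  show "a*\<^sub>DR f\<in>|DL|" if "f\<in>|DL|" for f
   using DR_smult_closed[OF assms] that by simp
  show "a*\<^sub>DR (f+\<^sub>DL g) = a*\<^sub>DR f+\<^sub>DL a*\<^sub>DR g" for f g
   using assms by (auto intro!: restrict_ext)
  show "a*\<^sub>DR (b*\<^sub>DL f) = b*\<^sub>DL (a*\<^sub>DR f)" if "b\<in>|La|" for b f
   using assms that by (auto simp: L.m_assoc intro!: restrict_ext)
 qed
 thus ?thesis by (simp only: DL_simps)
qed

text \<open>\<open>Hom\<^sub>\<Lambda>(M, D\<Lambda>) = Hom\<^sub>R(M, E)\<close>: a homomorphism into \<open>D\<Lambda>\<close> is determined by its values at \<open>1\<close>.\<close>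

definition to_DL :: "('a, 'm) module => ('m => 'u) => 'm => 'a => 'u"
 where "to_DL M f = (\<lambda>x\<in>|M|. \<lambda>a\<in>|La|. f (a*\<^sub>M x))"

lemma to_DL_hom:
 assumes "lmod La M" "f:Hom R (rmod M) E"
 shows "to_DL M f:Hom La M DL"
proof -
 interpret M: left_module La M by fact
 show ?thesis unfolding to_DL_def
 proof (rule module_homI[OF _ _ _ assms(1)])
  fix x assume x: "x\<in>|M|"
  have "(\<lambda>a\<in>|La|. f (a*\<^sub>M x)):Hom R La E"
  proof (rule module_homI[OF _ _ _ L_Rmodule])
   show "f (a*\<^sub>M x)\<in>|E|" if "a\<in>|La|" for a
    using hom_cl[OF assms(2), of "a*\<^sub>M x"] that x by simp
   show "f ((a+\<^sub>La b)*\<^sub>M x) = f (a*\<^sub>M x)+\<^sub>E f (b*\<^sub>M x)"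
    if "a\<in>|La|" "b\<in>|La|" for a b
    using hom_add[OF assms(2), of "a*\<^sub>M x" "b*\<^sub>M x"] that x by (simp add: M.smult_l_distr)
   show "f ((r*\<^sub>La a)*\<^sub>M x) = r*\<^sub>E f (a*\<^sub>M x)"
    if "r\<in>|R|" "a\<in>|La|" for r a
    using hom_smult[OF assms(2) that(1), of "a*\<^sub>M x"] that x
    by (simp add: M.smult_assoc1[symmetric] scalar_mult)
  qed
  thus "(\<lambda>a\<in>|La|. f (a*\<^sub>M x))\<in>|DL|" by simp
 next
  fix x y assume "x\<in>|M|" "y\<in>|M|"
  thus "(\<lambda>a\<in>|La|. f (a*\<^sub>M (x+\<^sub>M y))) =
    (\<lambda>a\<in>|La|. f (a*\<^sub>M x))+\<^sub>DL (\<lambda>a\<in>|La|. f (a*\<^sub>M y))"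
   using hom_add[OF assms(2)] by (auto simp: M.smult_r_distr intro!: restrict_ext)
 next
  fix b x assume "b\<in>|La|" "x\<in>|M|"
  thus "(\<lambda>a\<in>|La|. f (a*\<^sub>M (b*\<^sub>M x))) = b*\<^sub>DL (\<lambda>a\<in>|La|. f (a*\<^sub>M x))"
   by (auto simp: M.smult_assoc1 intro!: restrict_ext)
 qed
qed

lemma DL_hom_at_one:
 assumes "lmod La M" "g:Hom La M DL"
 shows "(\<lambda>x\<in>|M|. g x \<one>\<^bsub>La\<^esub>):Hom R (rmod M) E"
  and "x\<in>|M| ==> a\<in>|La| ==> g x a = g (a*\<^sub>M x) \<one>\<^bsub>La\<^esub>"
proof -
 interpret M: left_module La M by fact
 have g: "g x:Hom R La E" if "x\<in>|M|" for x
  using hom_cl[OF assms(2) that] by simp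
 show *: "g x a = g (a*\<^sub>M x) \<one>\<^bsub>La\<^esub>" if "x\<in>|M|" "a\<in>|La|" for x a
  using hom_smult[OF assms(2) that(2,1)] that by simp
 have "restrict (%x. g x \<one>\<^bsub>La\<^esub>) |rmod M|:Hom R (rmod M) E"
 proof (rule module_homI[OF _ _ _ left_module_rmod[OF assms(1)]])
  show "g x \<one>\<^bsub>La\<^esub>\<in>|E|" if "x\<in>|rmod M|" for x
   using hom_cl[OF g, of x "\<one>\<^bsub>La\<^esub>"] that by simp
  show "g (x+\<^sub>(rmod M) y) \<one>\<^bsub>La\<^esub> = g x \<one>\<^bsub>La\<^esub> +\<^sub>E g y \<one>\<^bsub>La\<^esub>"
   if "x\<in>|rmod M|" "y\<in>|rmod M|" for x y
   using hom_add[OF assms(2), of x y] that by simp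
  show "g (r*\<^sub>(rmod M) x) \<one>\<^bsub>La\<^esub> = r*\<^sub>E g x \<one>\<^bsub>La\<^esub>" if "r\<in>|R|" "x\<in>|rmod M|" for r x
   using *[of x "r*\<^sub>La \<one>\<^bsub>La\<^esub>"] hom_smult[OF g, of x r "\<one>\<^bsub>La\<^esub>"] that by simp
 qed
 thus "(\<lambda>x\<in>|M|. g x \<one>\<^bsub>La\<^esub>):Hom R (rmod M) E" by simp
qed

text \<open>Injectivity of D(\<open>La\<close>) is reduced to that of \<open>E\<close> over
  \<open>R\<close>, by evaluating at 1 and returning with \<open>to_DL\<close>. It is stated as an
  extension property for small modules, since \<open>DL\<close> has elements outside the type
  \<open>'u\<close>.\<close>

lemma DL_extend:
 assumes "lmod La A" "lmod La B" "f:Hom La A B" "inj_on f |A|"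
  "g:Hom La A DL" "|A|\<lesssim>(UNIV :: 'u set)" "|B|\<lesssim>(UNIV :: 'u set)"
 obtains h where "h:Hom La B DL" "!!x. x\<in>|A| ==> h (f x) = g x"
proof -
 interpret A: left_module La A by fact
 obtain k where k: "k:Hom R (rmod B) E" "ALL x:|rmod A|. k (f x) = (\<lambda>x\<in>|A|. g x \<one>\<^bsub>La\<^esub>) x"
  using injective_extend[OF E_injective left_module_rmod[OF assms(1)] left_module_rmod[OF assms(2)] rmod_hom[OF assms(3)]
    _ DL_hom_at_one(1)[OF assms(1,5)]] assms(4,6,7) by auto
 have "to_DL B k (f x) = g x" if x: "x\<in>|A|" for x
 proof (rule hom_eqI)
  show "to_DL B k (f x):Hom R La E"
   using hom_cl[OF to_DL_hom[OF assms(2) k(1)] hom_cl[OF assms(3) x]] by simp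
  show "g x:Hom R La E" using hom_cl[OF assms(5) x] by simp
  fix a assume a: "a\<in>|La|"
  have "to_DL B k (f x) a = k (f (a*\<^sub>A x))"
   using a x hom_cl[OF assms(3) x] hom_smult[OF assms(3) a x] by (simp add: to_DL_def)
  also have "... = g (a*\<^sub>A x) \<one>\<^bsub>La\<^esub>" using k(2) a x by simp
  also have "... = g x a" using DL_hom_at_one(2)[OF assms(1,5) x a] by simp
  finally show "to_DL B k (f x) a = g x a" .
 qed
 thus ?thesis using that to_DL_hom[OF assms(2) k(1)] by blast
qed

lemma DL_fg: "fg_module La DL"
proof (rule fg_of_rmod[OF DL_module])
 have "restrict (%f. f) |module_dual R La E|:Hom R (module_dual R La E) (rmod DL)"
  by (rule module_homI[OF _ _ _ left_module_dual[OF L_Rmodule E_module]])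
   (auto simp: scalar_mult intro!: restrict_ext)
 thus "fg_module R (rmod DL)"
  using fg_image[OF dual_fg[OF L_fg] left_module_rmod[OF DL_module]] by simp
qed

lemma DL_small: "|DL|\<lesssim>(UNIV :: 'u set)"
 by (rule fg_small[OF DL_fg])

lemma DL_noetherian: "noetherian_module La DL"
 by (rule fg_noetherian[OF DL_fg])

text \<open>Evaluating the values of \<open>f\<close> at 1 gives a functional on the dual of
  \<open>La\<close>, which by biduality is evaluation at some \<open>c\<close>; linearity identifies
  \<open>f\<close> with the right action of \<open>c\<close>. With \<open>DL_faithful\<close>, the
  endomorphisms of D(\<open>La\<close>) are given by \<open>La\<close> and by nothing else.\<close>

lemma DL_endomorphism:
 assumes "f:Hom La DL DL"
 obtains c where "c\<in>|La|" "!!w. w:Hom R La E ==> f w = c*\<^sub>DR w"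
proof -
 interpret DL: left_module La DL by (rule DL_module)
 let ?c = "\<lambda>w. f w \<one>\<^bsub>La\<^esub>"
 let ?d = "Hom R La E"
 have one: "restrict ?c ?d:Hom R (rmod DL) E"
  using DL_hom_at_one(1)[OF DL_module assms] by simp
 let ?b = "module_dual R La E"
 let ?a = "?b"
 have "restrict ?c |?b|:Hom R ?a E"
 proof (rule module_homI[OF _ _ _ left_module_dual[OF L_Rmodule E_module]])
  show "f w \<one>\<^bsub>La\<^esub>\<in>|E|" if "w\<in>|?b|" for w
   using hom_cl[OF one, of w] that by simp
  show "f (w+\<^sub>?a v) \<one>\<^bsub>La\<^esub> = f w \<one>\<^bsub>La\<^esub> +\<^sub>E f v \<one>\<^bsub>La\<^esub>"
   if "w\<in>|?b|" "v\<in>|?b|" for w v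
   using hom_add[OF assms, of w v] that by simp
  show "f (r*\<^sub>?a w) \<one>\<^bsub>La\<^esub> = r*\<^sub>E f w \<one>\<^bsub>La\<^esub>"
   if r: "r\<in>|R|" "w\<in>|?b|" for r w
  proof -
   let ?e = "r*\<^sub>La \<one>\<^bsub>La\<^esub>"
   have "r*\<^sub>?a w = ?e*\<^sub>DL w"
    using r by (auto simp: scalar_mult intro!: restrict_ext)
   moreover have "?e*\<^sub>DL w\<in>?d"
    using DL.smult_closed[OF scalar_closed[OF r(1)], of w] r(2) by (simp only: DL_simps module_dual_simps)
   ultimately show ?thesis
    using hom_smult[OF one r(1), of w] r(2) by (simp only: rmod_simps DL_simps module_dual_simps restrict_apply')
  qed
 qed
 from dual_eval[OF L_fg this]
 obtain c where c: "c\<in>|La|"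
  "ALL w:?d. restrict ?c |?b| w = w c"
  by (rule bexE)
 have "f w = c*\<^sub>DR w" if w: "w\<in>?d" for w
 proof (rule hom_eqI)
  show "f w\<in>?d" using hom_cl[OF assms, of w] w by simp
  show "c*\<^sub>DR w\<in>?d" by (rule DR_smult_closed[OF c(1) w])
  fix a assume a: "a\<in>|La|"
  have aw: "a*\<^sub>DL w\<in>?d" using DL.smult_closed[OF a, of w] w by (simp only: DL_simps)
  have "f w a = f (a*\<^sub>DL w) \<one>\<^bsub>La\<^esub>" using DL_hom_at_one(2)[OF DL_module assms _ a, of w] w by (simp only: DL_simps)
  also have "... = (a*\<^sub>DL w) c" using bspec[OF c(2) aw] aw by (simp only: module_dual_simps restrict_apply')
  finally show "f w a = (c*\<^sub>DR w) a" using a c(1) by simp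
 qed
 thus ?thesis using that c(1) by blast
qed

lemma DL_faithful:
 assumes "c\<in>|La|" "d\<in>|La|" "!!w. w:Hom R La E ==> c*\<^sub>DR w = d*\<^sub>DR w"
 shows "c = d"
proof (rule ccontr)
 assume "c ~= d"
 hence "c-\<^sub>La d ~= 0\<^sub>La" using LR.diff_eq_zero_iff[OF assms(1,2)] by simp
 moreover have cd: "c-\<^sub>La d\<in>|La|" using assms by simp
 ultimately obtain w where w: "w:Hom R La E" "w (c-\<^sub>La d) ~= 0\<^sub>E"
  using E_cogenerator[OF L_Rmodule cd _ L_small] by blast
 have "w c = w d" using fun_cong[OF assms(3)[OF w(1)], of "\<one>\<^bsub>La\<^esub>"] assms(1,2) by simp
 thus False
  using w(2) hom_minus[OF L_Rmodule E_module w(1) assms(1,2)] hom_cl[OF w(1) assms(1)]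
   hom_cl[OF w(1) assms(2)] by (simp add: E.diff_eq_zero_iff)
qed

text \<open>A system of homomorphisms exhibiting \<open>J\<close> as a direct summand of a finite power of \<open>D\<Lambda>\<close>.\<close>

definition DL_basis :: "('a, 'm) module => 's set => ('s => ('a => 'u) => 'm) => ('s => 'm => 'a => 'u) => bool"
 where "DL_basis J S a b <-> lmod La J & finite S & (ALL s:S. a s:Hom La DL J) &
  (ALL s:S. b s:Hom La J DL) & (ALL x:|J|. x = (\<Oplus>\<^bsub>J\<^esub>s\<in>S. a s (b s x)))"

text \<open>The functionals vanishing at \<open>x\<close> form an \<open>R\<close>-submodule of the
  dual of \<open>M\<close>, and that dual is finitely generated. If its generators vanish at
  \<open>x\<close>, all functionals do, and \<open>x\<close> is 0 because \<open>E\<close>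
  cogenerates.\<close>

lemma DL_separates:
 assumes "fg_module La M"
 obtains S where "finite S" "S <= Hom R (rmod M) E"
  "!!x. x\<in>|M| ==> ALL s:S. to_DL M s x = 0\<^sub>DL ==> x = 0\<^sub>M"
proof -
 have M: "lmod La M" using assms by (simp add: fg_module_def)
 interpret M: left_module La M by fact
 note rM = left_module_rmod[OF M]
 let ?b = "module_dual R (rmod M) E"
 let ?c = "Hom R (rmod M) E"
 obtain S where S: "finite S" "generates R ?b S ?c"
  using dual_fg[OF rmod_fg[OF assms]] by (auto simp: fg_module_iff)
 have SH: "S <= ?c" using S(2) by (simp add: generates_def)
 have "x = 0\<^sub>M" if x: "x\<in>|M|" and 0: "ALL s:S. to_DL M s x = 0\<^sub>DL" for x
 proof (rule ccontr)
  assume "x ~= 0\<^sub>M"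
  then obtain f where f: "f\<in>?c" "f x ~= 0\<^sub>E"
   using E_cogenerator[OF rM, of x] x fg_small[OF assms] by auto
  let ?a = "\<lambda>f\<in>?c. f x"
  have "s x = 0\<^sub>E" if s: "s\<in>S" for s
  proof -
   have "to_DL M s x \<one>\<^bsub>La\<^esub> = 0\<^sub>E" using bspec[OF 0 s] by simp
   thus ?thesis using x by (simp add: to_DL_def M.smult_one)
  qed
  hence "S <= {f\<in>|?b|. ?a f\<in>{0\<^sub>E}}"
   using SH by auto
  moreover have "submodule {f\<in>|?b|. ?a f\<in>{0\<^sub>E}} R ?b"
   by (rule submodule_vimage[OF left_module_dual[OF rM E_module] E_module eval_hom[OF rM E_module] E.submodule_zero]) (simp add: x)
  ultimately have "?c <= {f\<in>|?b|. ?a f\<in>{0\<^sub>E}}"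
   using S(2) unfolding generates_def by blast
  thus False using f by auto
 qed
 thus ?thesis using that S(1) SH by blast
qed

lemma DL_embedding:
 assumes "fg_module La M"
 obtains S :: "('m => 'u) set" and u where "finite S" "u:Hom La (M :: ('a, 'm) module) (pow_module S DL)"
  "inj_on u |M|"
proof -
 have M: "lmod La M" using assms by (simp add: fg_module_def)
 obtain S where S: "finite S" "S <= Hom R (rmod M) E"
  "!!x. x\<in>|M| ==> ALL s:S. to_DL M s x = 0\<^sub>DL ==> x = 0\<^sub>M"
  by (rule DL_separates[OF assms]) blast
 let ?u = "\<lambda>x\<in>|M|. \<lambda>s\<in>S. to_DL M s x"
 have u: "?u:Hom La M (pow_module S DL)"
  by (rule hom_to_pow[OF M]) (use S(2) to_DL_hom[OF M] in blast)
 moreover have "inj_on ?u |M|"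
  unfolding inj_on_hom_iff[OF M left_module_pow[OF DL_module] u]
 proof (intro ballI impI)
  fix x assume x: "x\<in>|M|" "?u x = 0\<^sub>(pow_module S DL)"
  have "to_DL M s x = 0\<^sub>DL" if "s\<in>S" for s
  proof -
   have "(\<lambda>s\<in>S. to_DL M s x) = (\<lambda>s\<in>S. 0\<^sub>DL)" using x(2) unfolding restrict_apply'[OF x(1)] pow_module_simps .
   from fun_cong[OF this, of s] show ?thesis using that by (simp only: restrict_apply')
  qed
  thus "x = 0\<^sub>M" using S(3)[OF x(1)] by blast
 qed
 ultimately show ?thesis using that S(1) by blast
qed

lemma pow_DL_small: "finite S ==> |pow_module S DL|\<lesssim>(UNIV :: 'u set)"
 using funcset_lepoll_UNIV[OF infinite_univ _ DL_small] by simp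

text \<open>The system consists of the coordinates of the embedding \<open>u\<close> and of the
  restrictions of the retraction \<open>h\<close> to the single coordinates.\<close>

lemma DL_basis_of_retract:
 assumes J: "lmod La J" and S: "finite S" and u: "u:Hom La J (pow_module S DL)"
  and h: "h:Hom La (pow_module S DL) J" "ALL x:|J|. h (u x) = x"
 shows "EX a b. DL_basis J S a b"
proof -
 interpret J: left_module La J by fact
 define a where "a t = compose |DL| h (\<lambda>x\<in>|DL|. \<lambda>s\<in>S. if s = t then x else 0\<^sub>DL)" for t
 define b where "b t = compose |J| (\<lambda>x\<in>S \<rightarrow>\<^sub>E |DL|. x t) u" for t
 have a: "a t:Hom La DL J" if "t\<in>S" for t
  unfolding a_def by (rule compose_hom[OF DL_module pow_module_homs(2)[OF DL_module that] h(1)])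
 have b: "b t:Hom La J DL" if "t\<in>S" for t
  unfolding b_def by (rule compose_hom[OF J u(1) pow_module_homs(1)[OF DL_module that]])
 have id: "x = (\<Oplus>\<^bsub>J\<^esub>t\<in>S. a t (b t x))" if x: "x\<in>|J|" for x
 proof -
  have ux: "u x\<in>S \<rightarrow>\<^sub>E |DL|" using hom_cl[OF u(1) x] by (simp only: pow_module_simps)
  have "x = h (u x)" using h(2) x by simp
  also have "... = (\<Oplus>\<^bsub>J\<^esub>t\<in>S. h (\<lambda>s\<in>S. if s = t then u x t else 0\<^sub>DL))"
   by (rule hom_from_pow_decomp[OF DL_module J S h(1) ux])
  also have "... = (\<Oplus>\<^bsub>J\<^esub>t\<in>S. a t (b t x))"
  proof (rule J.M.finsum_cong')
   show "(%t. a t (b t x))\<in>S \<rightarrow> |J|"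
    by (rule Pi_I) (rule hom_cl[OF a hom_cl[OF b x]])
   fix t assume t: "t\<in>S"
   have ut: "u x t\<in>|DL|" by (rule PiE_const[OF ux t])
   have "b t x = u x t" unfolding b_def compose_eq[OF x] by (rule restrict_apply'[OF ux])
   thus "h (\<lambda>s\<in>S. if s = t then u x t else 0\<^sub>DL) = a t (b t x)"
    unfolding a_def by (simp only: compose_eq[OF ut] restrict_apply'[OF ut])
  qed simp
  finally show ?thesis .
 qed
 have "DL_basis J S a b" unfolding DL_basis_def by (intro conjI ballI J S) (erule a b id)+
 thus ?thesis by blast
qed

text \<open>An injective module is a retract of every small module containing it, in particular of
  the power of D(\<open>La\<close>) into which \<open>DL_embedding\<close> puts it.\<close>

lemma ex_DL_basis:
 fixes J :: "('a, 'u) module"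
 assumes "fg_module La J" "injm La J"
 shows "\<exists>(S :: ('u => 'u) set) a b. DL_basis J S a b"
proof -
 have J: "lmod La J" using assms by (simp add: fg_module_def)
 obtain S :: "('u => 'u) set" and u where S: "finite S" and u: "u:Hom La J (pow_module S DL)" "inj_on u |J|"
  by (rule DL_embedding[OF assms(1)])
 from injective_extend[OF assms(2) J left_module_pow[OF DL_module] u id_hom[OF J] fg_small[OF assms(1)] pow_DL_small[OF S]]
 obtain h where "h:Hom La (pow_module S DL) J" "ALL x:|J|. h (u x) = (\<lambda>x\<in>|J|. x) x"
  by (rule bexE)
 hence "EX a b. DL_basis J S a b" by (intro DL_basis_of_retract[OF J S u(1)]) simp_all
 thus ?thesis by (rule exI)
qed

lemma DL_basisD:
 assumes "DL_basis J S a b"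
 shows "lmod La J" "finite S" "s\<in>S ==> a s:Hom La DL J" "s\<in>S ==> b s:Hom La J DL"
  "x\<in>|J| ==> (\<Oplus>\<^bsub>J\<^esub>s\<in>S. a s (b s x)) = x"
 using assms unfolding DL_basis_def by simp_all

lemma DL_basis_injective:
 fixes J :: "('a, 'u) module"
 assumes "DL_basis J S a b"
 shows "injm La J"
 unfolding injective_module_def
proof (intro conjI allI impI; (elim conjE)?)
 note D = DL_basisD[OF assms]
 show "lmod La J" by (rule D)
 fix A B :: "('a, 'u) module" and f g
 assume h: "lmod La A" "lmod La B" "f:Hom La A B" "inj_on f |A|" "g:Hom La A J"
 interpret J: left_module La J by (rule D)
 have sm: "|A|\<lesssim>(UNIV :: 'u set)" "|B|\<lesssim>(UNIV :: 'u set)" by (auto intro: subset_imp_lepoll)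
 have "EX k:Hom La B DL. ALL x:|A|. k (f x) = b s (g x)" if s: "s\<in>S" for s
 proof -
  obtain k where "k:Hom La B DL" "!!x. x\<in>|A| ==> k (f x) = compose |A| (b s) g x"
   by (rule DL_extend[OF h(1-4) compose_hom[OF h(1,5) D(4)[OF s]] sm]) blast
  thus ?thesis by (intro bexI[of _ k]) (auto simp: compose_eq)
 qed
 then obtain k where k: "!!s. s\<in>S ==> k s:Hom La B DL" "!!s x. s\<in>S ==> x\<in>|A| ==> k s (f x) = b s (g x)"
  by metis
 let ?h = "\<lambda>y\<in>|B|. \<Oplus>\<^bsub>J\<^esub>s\<in>S. compose |B| (a s) (k s) y"
 have "?h:Hom La B J"
  by (rule sum_hom[OF h(2) D(1,2) compose_hom[OF h(2) k(1) D(3)]])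
 moreover have "?h (f x) = g x" if x: "x\<in>|A|" for x
 proof -
  have fx: "f x\<in>|B|" and gx: "g x\<in>|J|" using hom_cl[OF h(3) x] hom_cl[OF h(5) x] .
  have "?h (f x) = (\<Oplus>\<^bsub>J\<^esub>s\<in>S. compose |B| (a s) (k s) (f x))" using fx by simp
  also have "... = (\<Oplus>\<^bsub>J\<^esub>s\<in>S. a s (b s (g x)))"
   by (rule J.M.finsum_cong')
    (use k(2) x fx gx hom_cl[OF D(3)] hom_cl[OF D(4)] in \<open>auto simp: compose_eq\<close>)
  finally show ?thesis using D(5)[OF gx] by simp
 qed
 ultimately show "EX h:Hom La B J. ALL x:|A|. h (f x) = g x" by blast
qed

lemma ex_pow_copy:
 assumes "finite S"
 obtains F :: "('a, 'u) module" and f g where "module_iso La (pow_module S DL) F f g" "injm La F" "fg_module La F"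
proof -
 note P = left_module_pow[OF DL_module, of S]
 obtain F :: "('a, 'u) module" and f g where I: "module_iso La (pow_module S DL) F f g"
  using ex_module_copy[OF P pow_DL_small[OF assms]] by blast
 note D = module_isoD[OF I]
 have fg: "fg_module La F" by (rule fg_image[OF noetherian_fg[OF noetherian_pow[OF DL_noetherian assms]] D(2,3,9)])
 obtain a b where "DL_basis F S a b" using DL_basis_of_retract[OF D(2) assms D(4,3)] D(6) by blast
 from DL_basis_injective[OF this] show ?thesis using that I fg by blast
qed

lemma fg_injective_embedding:
 fixes M :: "('a, 'm) module"
 assumes "fg_module La M"
 obtains F :: "('a, 'u) module" and u where "injm La F" "fg_module La F" "u:Hom La M F" "inj_on u |M|"
proof -
 have M: "lmod La M" using assms by (simp add: fg_module_def)
 obtain S :: "('m => 'u) set" and u where S: "finite S" and u: "u:Hom La M (pow_module S DL)" "inj_on u |M|"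
  by (rule DL_embedding[OF assms])
 obtain F :: "('a, 'u) module" and f g where F: "module_iso La (pow_module S DL) F f g" "injm La F" "fg_module La F"
  by (rule ex_pow_copy[OF S])
 note D = module_isoD[OF F(1)]
 have "compose |M| f u:Hom La M F" by (rule compose_hom[OF M u(1) D(3)])
 moreover have "inj_on (compose |M| f u) |M|"
 proof (rule inj_onI)
  fix x y assume xy: "x\<in>|M|" "y\<in>|M|" "compose |M| f u x = compose |M| f u y"
  hence "f (u x) = f (u y)" by (simp add: compose_eq)
  hence "u x = u y" by (rule inj_onD[OF D(7)]) (intro hom_cl[OF u(1)] xy(1,2))+
  thus "x = y" by (rule inj_onD[OF u(2)]) (rule xy)+
 qed
 ultimately show ?thesis using that F by blast
qed

text \<open>A maximal essential extension inside a finitely generated injective module is a direct summand of it.\<close>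

lemma ex_injective_envelope:
 fixes M :: "('a, 'm) module"
 assumes "fg_module La M"
 obtains I :: "('a, 'u) module" and j where "injective_envelope La M I j" "fg_module La I"
proof -
 have M: "lmod La M" using assms by (simp add: fg_module_def)
 obtain F :: "('a, 'u) module" and u where F: "injm La F" "fg_module La F" "u:Hom La M F" "inj_on u |M|"
  by (rule fg_injective_embedding[OF assms])
 have Fm: "lmod La F" using F(2) by (simp add: fg_module_def)
 interpret F: left_module La F by fact
 note noeth = fg_noetherian[OF F(2)]
 let ?M = "u ` |M|"
 note uM = submodule_image[OF M Fm F(3) left_module.submodule_carrier[OF M]]
 define ess where "ess = {N. submodule N La F & ?M <= N & (ALL L. submodule L La F & L <= N & L \<inter> ?M = {0\<^sub>F} --> L = {0\<^sub>F})}"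
 have "?M\<in>ess" unfolding ess_def using uM by (auto simp: inf.absorb1)
 hence "EX N:ess. ALL L:ess. N <= L --> L = N" by (rule noetherian_maximal[OF noeth]) (simp add: ess_def)
 then obtain N where N: "N\<in>ess" "ALL L:ess. N <= L --> L = N" by (rule bexE)
 have Ns: "submodule N La F" and MN: "?M <= N"
  and Ness: "!!L. submodule L La F ==> L <= N ==> L \<inter> ?M = {0\<^sub>F} ==> L = {0\<^sub>F}"
  using N(1) by (auto simp: ess_def)
 note ND = F.submoduleD[OF Ns]
 \<comment> \<open>A maximal \<open>L\<close> among the submodules meeting \<open>N\<close> only in
   0 is taken, so that \<open>N\<close> embeds into the quotient of \<open>F\<close> by
   \<open>L\<close>.\<close>
 define comp where "comp = {L. submodule L La F & L \<inter> N = {0\<^sub>F}}"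
 have "{0\<^sub>F}\<in>comp" using F.submodule_zero ND(3) by (auto simp: comp_def)
 have "EX L:comp. ALL K:comp. L <= K --> K = L"
  by (rule noetherian_maximal[OF noeth \<open>{0\<^sub>F} \<in> comp\<close>]) (simp add: comp_def)
 then obtain L where L: "L\<in>comp" "ALL K:comp. L <= K --> K = L" by (rule bexE)
 have Ls: "submodule L La F" and LN: "L \<inter> N = {0\<^sub>F}" using L(1) by (auto simp: comp_def)
 note LD = F.submoduleD[OF Ls]
 note Q = left_module_quot[OF Fm Ls]
 let ?Q = "quot_module F L" and ?v = "\<lambda>x\<in>|F|. L +>\<^bsub>F\<^esub> x"
 note Qfg = fg_image[OF F(2) Q(1-3)]
 have v0: "?v x = 0\<^sub>?Q <-> x\<in>L" if "x\<in>|F|" for x using Q(4)[OF that] that by simp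
 note k = restrict_hom[OF Fm Q(2) Ns]
 note lmN = F.sub_left_module[OF Ns]
 have kinj: "inj_on (restrict ?v N) |F(|carrier := N|)|"
  unfolding inj_on_hom_iff[OF lmN Q(1) k]
 proof (intro ballI impI)
  fix x assume "x\<in>|F(|carrier := N|)|" "restrict ?v N x = 0\<^sub>?Q"
  hence x: "x\<in>N" "?v x = 0\<^sub>?Q" by auto
  hence "x\<in>L" using v0[OF ND(2)[OF x(1)]] by blast
  hence "x\<in>L \<inter> N" using x(1) by blast
  thus "x = \<zero>\<^bsub>F(|carrier := N|)\<^esub>" unfolding LN by simp
 qed
 let ?b = "\<lambda>x\<in>N. x"
 \<comment> \<open>Extending the inverse of the embedding of \<open>N\<close> into the quotient
   gives an endomorphism \<open>?w\<close> of \<open>F\<close> that is the identity on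
   \<open>N\<close> and 0 on \<open>L\<close>; it turns out to be a projection onto
   \<open>N\<close>.\<close>
 have "EX h:Hom La ?Q F. ALL x:|F(|carrier := N|)|. h (restrict ?v N x) = ?b x"
  by (rule injective_extend[OF F(1) lmN Q(1) k kinj F.incl_hom[OF Ns]]) (auto intro: subset_imp_lepoll fg_small[OF Qfg])
 then obtain z where z': "z:Hom La ?Q F"
  "ALL x:|F(|carrier := N|)|. z (restrict ?v N x) = ?b x" by (rule bexE)
 have z: "z (?v x) = x" if "x\<in>N" for x
 proof -
  have "z (restrict ?v N x) = ?b x" by (rule bspec[OF z'(2)]) (simp add: that)
  thus ?thesis using that by (simp only: restrict_apply')
 qed
 let ?w = "compose |F| z ?v"
 note w = compose_hom[OF Fm Q(2) z'(1)]
 have wN: "?w x = x" if "x\<in>N" for x unfolding compose_eq[OF ND(2)[OF that]] by (rule z[OF that])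
 have wL: "?w x = 0\<^sub>F" if x: "x\<in>L" for x
 proof -
  have "?v x = 0\<^sub>?Q" using v0[OF LD(2)[OF x]] x by blast
  thus ?thesis unfolding compose_eq[OF LD(2)[OF x]] using hom_zero[OF Q(1) Fm z'(1)] by (simp only:)
 qed
 \<comment> \<open>The preimage of \<open>K\<close> under \<open>?w\<close> contains
   \<open>L\<close> and meets \<open>N\<close> only in 0, so by maximality it equals
   \<open>L\<close>; then \<open>K\<close> is the image of \<open>L\<close>, which is 0. Hence
   \<open>N\<close> is essential in the image of \<open>?w\<close>, and maximality of
   \<open>N\<close> makes the two equal.\<close>
 have key: "K = {0\<^sub>F}" if K: "submodule K La F" "K \<inter> N = {0\<^sub>F}" "K <= ?w ` |F|" for K
 proof -
  let ?P = "{x\<in>|F|. ?w x\<in>K}"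
  note P = submodule_vimage[OF Fm Fm w K(1)]
  note K0 = F.submoduleD[OF K(1)]
  have "?P \<inter> N <= {0\<^sub>F}"
  proof
   fix x assume x: "x\<in>?P \<inter> N"
   hence "?w x\<in>K" "x\<in>N" by blast+
   hence "x\<in>K \<inter> N" using wN[of x] by simp
   thus "x\<in>{0\<^sub>F}" using K(2) by blast
  qed
  hence "?P \<inter> N = {0\<^sub>F}" using F.submoduleD(3)[OF P] ND(3) by blast
  hence "?P\<in>comp" using P by (simp add: comp_def)
  moreover have "L <= ?P"
  proof
   fix x assume "x\<in>L"
   thus "x\<in>?P" using wL[of x] K0 LD(2)[of x] by simp
  qed
  ultimately have PL: "?P = L" using L(2) by blast
  have "K <= {0\<^sub>F}"
  proof
   fix y assume y: "y\<in>K"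
   then obtain x where x: "x\<in>|F|" "y = ?w x" using K(3) by blast
   hence "x\<in>?P" using y by blast
   hence "x\<in>L" unfolding PL .
   thus "y\<in>{0\<^sub>F}" using wL x(2) by simp
  qed
  thus ?thesis using K0 by blast
 qed
 let ?T = "?w ` |F|"
 note T = submodule_image[OF Fm Fm w F.submodule_carrier]
 have NT: "N <= ?T"
 proof
  fix x assume x: "x\<in>N"
  show "x\<in>?T" using wN[OF x, symmetric] ND(2)[OF x] by (rule image_eqI)
 qed
 have "?T\<in>ess"
  unfolding ess_def
 proof (intro CollectI conjI allI impI; (elim conjE)?)
  show "submodule ?T La F" by (rule T)
  show "?M <= ?T" using MN NT by blast
  fix K assume K: "submodule K La F" "K <= ?T" "K \<inter> ?M = {0\<^sub>F}"
  have KN: "submodule (K \<inter> N) La F"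
   by (rule F.submoduleI) (use F.submoduleD[OF K(1)] ND in auto)
  have "(K \<inter> N) \<inter> ?M = {0\<^sub>F}" using K(3) MN F.submoduleD(3)[OF KN] by blast
  hence "K \<inter> N = {0\<^sub>F}" using Ness[OF KN] by blast
  thus "K = {0\<^sub>F}" using key[OF K(1) _ K(2)] by blast
 qed
 hence TN: "?T = N" using N(2) NT by blast
 let ?a = "F(|carrier := N|)"
 have r: "?w:Hom La F ?a" using TN by (intro hom_into_sub[OF w]) simp
 have inj: "injm La ?a"
 proof (rule injective_retract[OF F(1) lmN F.incl_hom[OF Ns] r])
  show "?w (?b x) = x" if "x\<in>|F(|carrier := N|)|" for x
  proof -
   have "x\<in>N" using that by simp
   thus ?thesis using wN[of x] by (simp only: restrict_apply')
  qed
 qed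
 have "injective_envelope La M ?a u"
  unfolding injective_envelope_def essential_submodule_def
 proof (intro conjI allI impI; (elim conjE)?)
  show "u:Hom La M ?a" by (rule hom_into_sub[OF F(3) MN])
  show "submodule ?M La ?a" using F.submodule_sub_iff[OF Ns] uM MN by blast
  fix K assume "submodule K La ?a" "K \<inter> ?M = {\<zero>\<^bsub>F(|carrier := N|)\<^esub>}"
  thus "K = {\<zero>\<^bsub>F(|carrier := N|)\<^esub>}" using F.submodule_sub_iff[OF Ns] Ness[of K] by simp
 qed (use inj F(4) in auto)
 moreover have "fg_module La ?a" using noeth Ns by (simp add: noetherian_module_def)
 ultimately show ?thesis by (rule that)
qed

text \<open>The envelopes in a resolution chosen by \<open>SOME\<close> are arbitrary, so finite
  generation is proved for every envelope: by essentiality it embeds into the finitely generated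
  injective \<open>F\<close>.\<close>

lemma injective_envelope_fg:
 fixes M :: "('a, 'm) module" and I :: "('a, 'u) module"
 assumes "fg_module La M" "injective_envelope La M I j"
 shows "fg_module La I"
proof -
 have M: "lmod La M" using assms by (simp add: fg_module_def)
 have I: "lmod La I" "j:Hom La M I" "inj_on j |M|"
  using assms(2) by (auto simp: injective_envelope_def injective_module_def)
 obtain F :: "('a, 'u) module" and u where F: "injm La F" "fg_module La F" "u:Hom La M F" "inj_on u |M|"
  by (rule fg_injective_embedding[OF assms(1)])
 have Fm: "lmod La F" using F(2) by (simp add: fg_module_def)
 have "|I|\<lesssim>(UNIV :: 'u set)" by (simp add: subset_imp_lepoll)
 from injective_extend[OF F(1) M I F(3) fg_small[OF assms(1)] this]
 obtain h where h: "h:Hom La I F" "ALL x:|M|. h (j x) = u x" by (rule bexE)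
 have "inj_on h |I|"
 proof (rule envelope_mono[OF M Fm assms(2) h(1)])
  fix x assume "x\<in>|M|" "h (j x) = 0\<^sub>F"
  thus "x = 0\<^sub>M" using h(2) F(4) inj_on_hom_iff[OF M Fm F(3)] by simp
 qed
 thus ?thesis using noetherian_mono[OF fg_noetherian[OF F(2)] I(1) h(1)] noetherian_fg by blast
qed

text \<open>The cokernel is copied back into the universe, so that the construction can be iterated
  and compared with modules there.\<close>

lemma ex_cosyzygy:
 fixes M :: "('a, 'u) module"
 assumes "fg_module La M"
 shows "\<exists>(F :: ('a, 'u) module) u (F' :: ('a, 'u) module) p. injm La F & fg_module La F & fg_module La F' & ses La M u F p F'"
proof -
 have M: "lmod La M" using assms by (simp add: fg_module_def)
 obtain F :: "('a, 'u) module" and u where F: "injm La F" "fg_module La F" "u:Hom La M F" "inj_on u |M|"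
  by (rule fg_injective_embedding[OF assms])
 have Fm: "lmod La F" using F(2) by (simp add: fg_module_def)
 note uM = submodule_image[OF M Fm F(3) left_module.submodule_carrier[OF M]]
 note Q = left_module_quot[OF Fm uM]
 let ?a = "quot_module F (u ` |M| )"
 note Qfg = fg_image[OF F(2) Q(1-3)]
 obtain F' :: "('a, 'u) module" and f g where I: "module_iso La ?a F' f g"
  using ex_module_copy[OF Q(1) fg_small[OF Qfg]] by blast
 note D = module_isoD[OF I]
 let ?w = "\<lambda>x\<in>|F|. u ` |M| +>\<^bsub>F\<^esub> x"
 let ?p = "compose |F| f ?w"
 note p = compose_hom[OF Fm Q(2) D(3)]
 have im: "?p ` |F| = |F'|"
  unfolding D(9)[symmetric] Q(3)[symmetric] image_image by (rule image_cong[OF refl]) (simp add: compose_eq)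
 have key: "?p y = 0\<^sub>F' <-> y\<in>u ` |M|" if y: "y\<in>|F|" for y
 proof -
  have "f (?w y) = f 0\<^sub>?a <-> ?w y = 0\<^sub>?a"
   by (rule inj_on_eq_iff[OF D(7) hom_cl[OF Q(2) y]]) (rule left_module.submoduleD(3)[OF Q(1) left_module.submodule_carrier[OF Q(1)]])
  thus ?thesis using Q(4)[OF y] y hom_zero[OF Q(1) D(2,3)] by (simp add: compose_eq)
 qed
 have "{y\<in>|F|. ?p y = 0\<^sub>F'} = {y\<in>|F|. y\<in>u ` |M| }"
  by (rule Collect_cong) (simp only: key cong: conj_cong)
 also have "... = u ` |M|" using left_module.submoduleD(1)[OF Fm uM] by blast
 finally have "ses La M u F ?p F'"
  unfolding ses_def a_exact_at_def a_kernel_def' by (intro conjI M Fm D(2) F(3,4) p im) simp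
 thus ?thesis using F(1,2) fg_image[OF F(2) D(2) p im]
  by blast
qed

lemma ex_minimal_injective_resolution:
 fixes A :: "('a, 'm) module"
 assumes "fg_module La A"
 shows "\<exists>j (I :: nat => ('a, 'u) module) f. minimal_injective_resolution La A j I f"
proof -
 have A: "lmod La A" using assms by (simp add: fg_module_def)
 obtain I0 :: "('a, 'u) module" and j where I0: "injective_envelope La A I0 j" "fg_module La I0"
  by (rule ex_injective_envelope[OF assms])
 have j: "j:Hom La A I0" "injm La I0" using I0(1) by (auto simp: injective_envelope_def)
 have I0m: "lmod La I0" using I0(2) by (simp add: fg_module_def)
 \<comment> \<open>The state of the recursion is an injective module together with the submodule
   that the next differential must have as kernel.\<close>
 define ok where "ok = (\<lambda>(P :: ('a, 'u) module, Z). fg_module La P & injm La P & submodule Z La P)"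
 define step where "step = (\<lambda>(P :: ('a, 'u) module, Z) (P' :: ('a, 'u) module, Z').
  EX d:Hom La P P'. a_kernel P P' d = Z & Z' = d ` |P| & essential_submodule La Z' P')"
 have "EX f. ALL n. (ok (f n) & (n = 0 --> f n = (I0, j ` |A| ))) & step (f n) (f (Suc n))"
 proof (rule dependent_nat_choice)
  have "submodule (j ` |A| ) La I0"
   by (rule submodule_image[OF A I0m j(1) left_module.submodule_carrier[OF A]])
  thus "EX x. ok x & (0 = (0::nat) --> x = (I0, j ` |A| ))"
   using I0(2) j(2) by (auto simp: ok_def)
 next
  fix x and n :: nat
  assume x: "ok x & (n = 0 --> x = (I0, j ` |A| ))"
  obtain P Z where PZ: "x = (P, Z)" by (cases x)
  have P: "fg_module La P" "injm La P" "submodule Z La P" using x by (auto simp: ok_def PZ)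
  have Pm: "lmod La P" using P(1) by (simp add: fg_module_def)
  note Q = left_module_quot[OF Pm P(3)]
  let ?a = "quot_module P Z"
  have "fg_module La ?a" by (rule fg_image[OF P(1) Q(1-3)])
  then obtain P' :: "('a, 'u) module" and k where P': "injective_envelope La ?a P' k" "fg_module La P'"
   by (rule ex_injective_envelope)
  have k: "injm La P'" "k:Hom La ?a P'" "inj_on k |?a|"
   "essential_submodule La (k ` |?a| ) P'" using P'(1) by (auto simp: injective_envelope_def)
  have P'm: "lmod La P'" using P'(2) by (simp add: fg_module_def)
  let ?w = "\<lambda>x\<in>|P|. Z +>\<^bsub>P\<^esub> x"
  let ?d = "compose |P| k ?w"
  note d = compose_hom[OF Pm Q(2) k(2)]
  have dim: "?d ` |P| = k ` |?a|"
   unfolding Q(3)[symmetric] image_image by (rule image_cong[OF refl]) (simp add: compose_eq)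
  have "a_kernel P P' ?d = Z"
  proof -
   have "?d y = 0\<^sub>P' <-> y\<in>Z" if y: "y\<in>|P|" for y
   proof -
    note yq = hom_cl[OF Q(2) y]
    have "k (?w y) = 0\<^sub>P' <-> ?w y = 0\<^sub>?a"
     using inj_on_hom_iff[OF Q(1) P'm k(2)] k(3) yq hom_zero[OF Q(1) P'm k(2)] by metis
    thus ?thesis using Q(4)[OF y] y by (simp add: compose_eq)
   qed
   thus ?thesis using left_module.submoduleD(1)[OF Pm P(3)] unfolding a_kernel_def' by blast
  qed
  hence "step x (P', ?d ` |P| )"
   using d k(4) dim unfolding step_def PZ prod.case by (intro bexI[of _ ?d] conjI) simp_all
  moreover have "ok (P', ?d ` |P| )"
   using P'(2) k(1) submodule_image[OF Pm P'm d left_module.submodule_carrier[OF Pm]] by (simp add: ok_def)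
  ultimately show "EX y. (ok y & (Suc n = 0 --> y = (I0, j ` |A| ))) & step x y" by blast
 qed
 then obtain x where x: "ALL n. (ok (x n) & (n = 0 --> x n = (I0, j ` |A| ))) & step (x n) (x (Suc n))"
  by (rule exE)
 define P where "P n = fst (x n)" for n
 have "EX d:Hom La (P n) (P (Suc n)). a_kernel (P n) (P (Suc n)) d = snd (x n) &
   snd (x (Suc n)) = d ` |P n| & essential_submodule La (snd (x (Suc n))) (P (Suc n))" for n
  using x[rule_format, of n] by (simp add: step_def P_def split: prod.splits)
 hence "ALL n. EX d. d:Hom La (P n) (P (Suc n)) & a_kernel (P n) (P (Suc n)) d = snd (x n) &
   snd (x (Suc n)) = d ` |P n| & essential_submodule La (snd (x (Suc n))) (P (Suc n))"
  unfolding Bex_def by (rule allI)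
 then obtain d where D: "ALL n. d n:Hom La (P n) (P (Suc n)) & a_kernel (P n) (P (Suc n)) (d n) = snd (x n) &
   snd (x (Suc n)) = d n ` |P n| & essential_submodule La (snd (x (Suc n))) (P (Suc n))"
  by (rule choice[THEN exE])
 note d = D[rule_format, THEN conjunct1] D[rule_format, THEN conjunct2, THEN conjunct1]
  D[rule_format, THEN conjunct2, THEN conjunct2, THEN conjunct1] D[rule_format, THEN conjunct2, THEN conjunct2, THEN conjunct2]
 have inj: "injm La (P n)" for n using x[rule_format, of n] by (simp add: ok_def P_def split: prod.splits)
 have x0: "P 0 = I0" "snd (x 0) = j ` |A|" using x[rule_format, of 0] by (simp_all add: P_def)
 have "minimal_injective_resolution La A j P d"
  unfolding minimal_injective_resolution_def a_exact_at_def
 proof (intro conjI allI)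
  show "injective_envelope La A (P 0) j" unfolding x0(1) by (rule I0(1))
  show "j ` |A| = a_kernel (P 0) (P 1) (d 0)" using d(2)[of 0] x0(2) by simp
  show "d n ` |P n| = a_kernel (P (Suc n)) (P (Suc (Suc n))) (d (Suc n))" for n
   using d(2)[of "Suc n"] d(3)[of n] by simp
  show "essential_submodule La (d n ` |P n| ) (P (Suc n))" for n using d(4)[of n] d(3)[of n] by simp
 qed (fact inj d(1))+
 thus ?thesis by blast
qed

text \<open>Each term is an envelope of the image of its finitely generated predecessor, by
  minimality.\<close>

lemma minimal_injective_resolution_fg:
 fixes A :: "('a, 'm) module" and I :: "nat => ('a, 'u) module"
 assumes "fg_module La A" "minimal_injective_resolution La A j I f"
 shows "fg_module La (I n)"
proof (induction n)
 case 0
 show ?case using injective_envelope_fg[OF assms(1)] assms(2) by (auto simp: minimal_injective_resolution_def)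
next
 case (Suc n)
 have inj: "injm La (I k)" for k using assms(2) by (simp add: minimal_injective_resolution_def)
 have Im: "lmod La (I k)" for k using inj[of k] by (simp add: injective_module_def)
 have f: "f n:Hom La (I n) (I (Suc n))" and es: "essential_submodule La (f n ` |I n| ) (I (Suc n))"
  using assms(2) by (auto simp: minimal_injective_resolution_def)
 have sub: "submodule (f n ` |I n| ) La (I (Suc n))" using es by (simp add: essential_submodule_def)
 let ?N = "(I (Suc n))(|carrier := f n ` |I n| |)"
 have N: "lmod La ?N" by (rule left_module.sub_left_module[OF Im sub])
 have "f n:Hom La (I n) ?N" by (rule hom_into_sub[OF f]) simp
 hence "fg_module La ?N" using fg_image[OF Suc N] by simp
 moreover have "injective_envelope La ?N (I (Suc n)) (\<lambda>x\<in>f n ` |I n|. x)"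
  unfolding injective_envelope_def using inj left_module.incl_hom[OF Im sub] es by (simp add: inj_on_def)
 ultimately show ?case by (rule injective_envelope_fg)
qed

end

section \<open>Baer's criterion and injective modules that are not finitely generated\<close>

text \<open>Partial homomorphisms are represented by their graphs, submodules of the product, so
  that Zorn's lemma can work with inclusion and with unions of chains. By linearity,
  single-valuedness has to be required at 0 only.\<close>

lemma graph_function:
 assumes "lmod R B" "lmod R J" "submodule G R (prod_module B J)"
  and single: "ALL y. (0\<^sub>B, y)\<in>G --> y = 0\<^sub>J"
 shows "submodule (fst ` G) R B" "EX h:Hom R (B(|carrier := fst ` G|)) J. ALL z:G. h (fst z) = snd z"
proof -
 interpret B: left_module R B by fact
 note P = left_module_prod[OF assms(1,2)]
 interpret P: left_module R "prod_module B J" by (rule P)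
 note GD = P.submoduleD[OF assms(3)]
 have Gc: "z\<in>|B|\<times>|J|" if "z\<in>G" for z using GD(2)[OF that] by simp
 let ?G = "(prod_module B J)(|carrier := G|)"
 note G = P.sub_left_module[OF assms(3)]
 have f: "restrict fst G:Hom R ?G B" "restrict snd G:Hom R ?G J"
  using module_homI[of ?G fst B R] module_homI[of ?G snd J R] G Gc by auto
 have im: "restrict fst G ` |?G| = fst ` G" by simp
 show S: "submodule (fst ` G) R B"
  using submodule_image[OF G assms(1) f(1) left_module.submodule_carrier[OF G]] by (simp only: im)
 let ?a = "B(|carrier := fst ` G|)"
 have f': "restrict fst G:Hom R ?G ?a"
  by (rule hom_into_sub[OF f(1)]) (simp only: im)
 have "EX g:Hom R ?a J. ALL x:|?G|. g (restrict fst G x) = restrict snd G x"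
 proof (rule factor_surj[OF G B.sub_left_module[OF S] assms(2) f' _ f(2)])
  fix x assume x: "x\<in>|?G|" "restrict fst G x = \<zero>\<^bsub>B(|carrier := fst ` G|)\<^esub>"
  moreover obtain a b where "x = (a, b)" by (cases x)
  ultimately show "restrict snd G x = 0\<^sub>J" using single by simp
 qed simp
 then obtain g where g: "g:Hom R ?a J" "ALL x:|?G|. g (restrict fst G x) = restrict snd G x"
  by (rule bexE)
 have "g (fst z) = snd z" if "z\<in>G" for z using bspec[OF g(2), of z] that by simp
 thus "EX h:Hom R ?a J. ALL z:G. h (fst z) = snd z" using g(1) by (intro bexI[of _ g] ballI)
qed

text \<open>A graph is enlarged by the image of a module \<open>K\<close> mapping to both factors;
  the hypothesis \<open>single\<close> expresses that the two partial maps are compatible where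
  their domains overlap.\<close>

lemma graph_extend:
 assumes "lmod R B" "lmod R J" "lmod R K" "submodule G R (prod_module B J)"
  and u: "u:Hom R K B" and w: "w:Hom R K J"
  and single: "ALL x y k. (x, y)\<in>G & k\<in>|K| & x+\<^sub>B u k = 0\<^sub>B --> y+\<^sub>J w k = 0\<^sub>J"
 defines "G' \<equiv> {(x+\<^sub>B u k, y+\<^sub>J w k) | x y k. (x, y)\<in>G & k\<in>|K| }"
 shows "submodule G' R (prod_module B J)" "ALL y. (0\<^sub>B, y)\<in>G' --> y = 0\<^sub>J" "G <= G'"
  "k\<in>|K| ==> (u k, w k)\<in>G'"
proof -
 interpret B: left_module R B by fact
 interpret J: left_module R J by fact
 interpret K: left_module R K by fact
 note P = left_module_prod[OF assms(1,2)]
 let ?a = "prod_module B J"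
 interpret P: left_module R "?a" by (rule P)
 note GD = P.submoduleD[OF assms(4)]
 have Gc: "x\<in>|B|" "y\<in>|J|" if "(x, y)\<in>G" for x y using GD(2)[OF that] by simp_all
 let ?G = "?a(|carrier := G|)"
 note G = P.sub_left_module[OF assms(4)]
 let ?f = "\<lambda>z\<in>|?G|\<times>|K|. (\<lambda>x\<in>G. x) (fst z)+\<^sub>?a (\<lambda>k\<in>|K|. (u k, w k)) (snd z)"
 have f: "?f:Hom R (prod_module ?G K) ?a"
  by (rule hom_from_prod[OF P G assms(3) P.incl_hom[OF assms(4)] hom_to_prod[OF assms(3,1,2) u w]])
 have "?f ` |prod_module ?G K| = G'"
 proof
  show "?f ` |prod_module ?G K| <= G'"
  proof (rule image_subsetI)
   fix z assume "z\<in>|prod_module ?G K|"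
   then obtain x y k where z: "z = ((x, y), k)" "(x, y)\<in>G" "k\<in>|K|" by auto
   hence "?f z = (x+\<^sub>B u k, y+\<^sub>J w k)" by simp
   thus "?f z\<in>G'" unfolding G'_def using z(2,3) by blast
  qed
  show "G' <= ?f ` |prod_module ?G K|"
  proof
   fix z assume "z\<in>G'"
   then obtain x y k where z: "(x, y)\<in>G" "k\<in>|K|" "z = (x+\<^sub>B u k, y+\<^sub>J w k)" by (auto simp: G'_def)
   hence "z = ?f ((x, y), k)" by simp
   thus "z\<in>?f ` |prod_module ?G K|" by (rule image_eqI) (simp add: z)
  qed
 qed
 thus "submodule G' R ?a"
  using submodule_image[OF left_module_prod[OF G assms(3)] P f left_module.submodule_carrier[OF left_module_prod[OF G assms(3)]]]
  by (simp only:)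
 show "ALL y. (0\<^sub>B, y)\<in>G' --> y = 0\<^sub>J"
 proof (intro allI impI)
  fix y assume y: "(0\<^sub>B, y)\<in>G'"
  obtain x y' k where h: "(x, y')\<in>G" "k\<in>|K|" "(0\<^sub>B, y) = (x+\<^sub>B u k, y'+\<^sub>J w k)"
   using y unfolding G'_def by blast
  have e: "0\<^sub>B = x+\<^sub>B u k" by (rule Pair_inject[OF h(3)])
  have "y = y'+\<^sub>J w k" by (rule Pair_inject[OF h(3)])
  also have "... = 0\<^sub>J" by (rule single[rule_format, of x y' k]) (intro conjI h e[symmetric])
  finally show "y = 0\<^sub>J" .
 qed
 have z: "u 0\<^sub>K = 0\<^sub>B" "w 0\<^sub>K = 0\<^sub>J"
  using hom_zero[OF assms(3,1) u] hom_zero[OF assms(3,2) w] .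
 have G'I: "(x+\<^sub>B u k, y+\<^sub>J w k)\<in>G'" if "(x, y)\<in>G" "k\<in>|K|" for x y k
  unfolding G'_def using that by blast
 show "G <= G'"
 proof (rule subrelI)
  fix x y assume xy: "(x, y)\<in>G"
  show "(x, y)\<in>G'" using G'I[OF xy K.M.zero_closed] Gc[OF xy] unfolding z by simp
 qed
 show "(u k, w k)\<in>G'" if k: "k\<in>|K|"
  using G'I[OF GD(3)[unfolded prod_module_simps] k] hom_cl[OF u k] hom_cl[OF w k] by simp
qed

text \<open>Baer's criterion. A maximal graph above the given map has full domain: for
  \<open>b\<close> outside it, the coefficients moving \<open>b\<close> into the domain form a left
  ideal, whose induced map to \<open>J\<close> is multiplication into some element \<open>v\<close>,
  and \<open>b\<close> can be sent to \<open>v\<close>.\<close>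

lemma injective_of_Baer:
 fixes J :: "('a, 'u) module"
 assumes J: "lmod R J"
  and ext: "!!I r. submodule I R (reg R) ==> r:Hom R ((reg R)(|carrier := I|)) J ==>
   EX u:|J|. ALL a:I. r a = a*\<^sub>J u"
 shows "injm R J"
 unfolding injective_module_def
proof (intro conjI allI impI J; elim conjE)
 fix A B :: "('a, 'u) module" and f g
 assume A: "lmod R A" and B: "lmod R B" and f: "f:Hom R A B" "inj_on f |A|"
  and g: "g:Hom R A J"
 interpret A: left_module R A by fact
 interpret B: left_module R B by fact
 interpret J: left_module R J by fact
 note reg = left_module_regular[OF A.R.ring_axioms]
 note P = left_module_prod[OF B J]
 interpret P: left_module R "prod_module B J" by (rule P)
 let ?G0 = "(\<lambda>x\<in>|A|. (f x, g x)) ` |A|"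
 let ?a = "prod_module B J"
 have G0: "submodule ?G0 R ?a"
  by (rule submodule_image[OF A P hom_to_prod[OF A B J f(1) g] A.submodule_carrier])
 let ?C = "{G. submodule G R ?a & ?G0 <= G & (ALL y. (0\<^sub>B, y)\<in>G --> y = 0\<^sub>J)}"
 have "EX G:?C. ALL H:?C. G <= H --> H = G"
 proof (rule subset_Zorn_nonempty)
  have "y = 0\<^sub>J" if y: "(0\<^sub>B, y)\<in>?G0" for y
  proof -
   obtain x where x: "x\<in>|A|" "0\<^sub>B = f x" "y = g x" using y by auto
   hence "x = 0\<^sub>A" using f(2) inj_on_hom_iff[OF A B f(1)] by simp
   thus ?thesis using x(3) hom_zero[OF A J g] by simp
  qed
  hence "?G0\<in>?C" using G0 by blast
  thus "?C ~= {}" by blast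
  fix C assume C: "C ~= {}" "subset.chain ?C C"
  have CC: "G\<in>?C" if "G\<in>C" for G using C(2) that unfolding subset_chain_def by blast
  have "submodule (\<Union>C) R ?a"
   by (rule P.submodule_chain_Union[OF C(1)]) (use C(2) in \<open>unfold subset_chain_def, blast+\<close>)
  moreover have "?G0 <= \<Union>C" using C(1) CC by blast
  moreover have "ALL y. (0\<^sub>B, y)\<in>\<Union>C --> y = 0\<^sub>J" using CC by blast
  ultimately show "\<Union>C\<in>?C" by blast
 qed
 then obtain G where G: "G\<in>?C" and max: "ALL H:?C. G <= H --> H = G" by (rule bexE)
 have Gs: "submodule G R ?a" and G0G: "?G0 <= G" and G1: "ALL y. (0\<^sub>B, y)\<in>G --> y = 0\<^sub>J"
  using G by blast+
 note D = graph_function(1)[OF B J Gs G1]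
 let ?c = "B(|carrier := fst ` G|)"
 obtain h where h: "h:Hom R ?c J" "ALL z:G. h (fst z) = snd z"
  using graph_function(2)[OF B J Gs G1] by (rule bexE)
 have "fst ` G = |B|"
 proof (rule ccontr)
  assume "fst ` G ~= |B|"
  then obtain b where b: "b\<in>|B|" "b\<notin>fst ` G" using B.submoduleD(1)[OF D] by blast
  let ?o = "\<lambda>a\<in>|R|. a*\<^sub>B b"
  note o = B.orbit_hom[OF b(1)]
  define I where "I = {a\<in>|reg R|. ?o a\<in>fst ` G}"
  let ?b = "reg R"
  have I: "submodule I R ?b" unfolding I_def by (rule submodule_vimage[OF reg B o D])
  have oI: "restrict ?o I:Hom R (?b(|carrier := I|)) ?c"
   by (rule hom_into_sub[OF restrict_hom[OF reg o I]]) (auto simp: I_def)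
  note lmI = left_module.sub_left_module[OF reg I]
  from ext[OF I compose_hom[OF lmI oI h(1)]]
  obtain v where v: "v\<in>|J|" "ALL a:I. compose |?b(|carrier := I|)| h (restrict ?o I) a = a*\<^sub>J v"
   by blast
  have IR: "a\<in>|R|" if "a\<in>I" for a using that by (simp add: I_def)
  have v': "h (a*\<^sub>B b) = a*\<^sub>J v" if "a\<in>I" for a
   using v(2)[rule_format, OF that] that IR[OF that] by (simp add: compose_def)
  let ?w = "\<lambda>a\<in>|R|. a*\<^sub>J v"
  define G' where "G' = {(x+\<^sub>B ?o k, y+\<^sub>J ?w k) | x y k. (x, y)\<in>G & k\<in>|reg R| }"
  have cond: "ALL x y k. (x, y)\<in>G & k\<in>|reg R| & x+\<^sub>B ?o k = 0\<^sub>B --> y+\<^sub>J ?w k = 0\<^sub>J"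
  proof (intro allI impI; elim conjE)
   fix x y k assume xy: "(x, y)\<in>G" "k\<in>|reg R|" "x+\<^sub>B ?o k = 0\<^sub>B"
   have k: "k\<in>|R|" using xy(2) by simp
   have xD: "x\<in>fst ` G" using xy(1) by (rule image_eqI[rotated]) simp
   have c: "x\<in>|B|" "y\<in>|J|" using P.submoduleD(2)[OF Gs xy(1)] by simp_all
   have kb: "k*\<^sub>B b\<in>|B|" using k b(1) by simp
   have "k*\<^sub>B b = -\<^sub>B x"
    using xy(3) k c(1) kb by (metis B.M.a_comm B.M.minus_equality restrict_apply')
   hence kbD: "k*\<^sub>B b\<in>fst ` G" using B.submoduleD(5)[OF D xD] by simp
   hence kI: "k\<in>I" using k by (simp add: I_def)
   have "h (x+\<^sub>B k*\<^sub>B b) = h x+\<^sub>J h (k*\<^sub>B b)"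
    using hom_add[OF h(1), of x "k*\<^sub>B b"] xD kbD by simp
   moreover have "x+\<^sub>B k*\<^sub>B b = 0\<^sub>B" using xy(3) k by simp
   moreover have "h 0\<^sub>B = 0\<^sub>J" using hom_zero[OF B.sub_left_module[OF D] J h(1)] by simp
   moreover have "h x = y" using bspec[OF h(2) xy(1)] by simp
   ultimately show "y+\<^sub>J ?w k = 0\<^sub>J" using v'[OF kI] k by simp
  qed
  note E = graph_extend[OF B J reg Gs o J.orbit_hom[OF v(1)] cond, folded G'_def]
  have "?G0 <= G'" using G0G E(3) by (rule subset_trans)
  hence "G'\<in>?C" using E(1,2) by blast
  hence GG: "G' = G" using max E(3) by blast
  have "(?o \<one>\<^bsub>R\<^esub>, ?w \<one>\<^bsub>R\<^esub>)\<in>G'" by (rule E(4)) simp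
  hence "?o \<one>\<^bsub>R\<^esub>\<in>fst ` G" unfolding GG by (rule image_eqI[rotated]) simp
  thus False using b by (simp add: B.smult_one)
 qed
 hence hB: "h:Hom R B J" using h(1) by simp
 have "h (f x) = g x" if x: "x\<in>|A|" for x
 proof -
  have "(\<lambda>x\<in>|A|. (f x, g x)) x\<in>?G0" using x by (rule imageI)
  hence "(f x, g x)\<in>G" using G0G x by auto
  thus ?thesis using bspec[OF h(2)] by fastforce
 qed
 thus "EX h:Hom R B J. ALL x:|A|. h (f x) = g x" using hB by blast
qed

lemma injective_of_sum:
 fixes J D K :: "('a, 'u) module"
 assumes "injm R D" "injm R K" "lmod R J"
  and s: "s:Hom R J D" "r:Hom R D J" and t: "t:Hom R J K" "q:Hom R K J"
  and id: "!!x. x\<in>|J| ==> r (s x)+\<^sub>J q (t x) = x"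
 shows "injm R J"
 unfolding injective_module_def
proof (intro conjI allI impI assms(3); elim conjE)
 fix A B :: "('a, 'u) module" and f g
 assume h: "lmod R A" "lmod R B" "f:Hom R A B" "inj_on f |A|" "g:Hom R A J"
 obtain k where k: "k:Hom R B D" "!!x. x\<in>|A| ==> k (f x) = compose |A| s g x"
  by (rule injectiveD[OF assms(1) h(1-4) compose_hom[OF h(1,5) s(1)]]) blast
 obtain l where l: "l:Hom R B K" "!!x. x\<in>|A| ==> l (f x) = compose |A| t g x"
  by (rule injectiveD[OF assms(2) h(1-4) compose_hom[OF h(1,5) t(1)]]) blast
 let ?h = "\<lambda>x\<in>|B|. compose |B| r k x+\<^sub>J compose |B| q l x"
 have "?h:Hom R B J"
  by (rule add_hom[OF h(2) assms(3) compose_hom[OF h(2) k(1) s(2)] compose_hom[OF h(2) l(1) t(2)]])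
 moreover have "?h (f x) = g x" if "x\<in>|A|" for x
  using that k(2) l(2) id hom_cl[OF h(3)] hom_cl[OF h(5)] by (simp add: compose_eq)
 ultimately show "EX h:Hom R B J. ALL x:|A|. h (f x) = g x" by blast
qed

lemma injective_zero_module:
 assumes "lmod R M"
 shows "injm R (M(|carrier := {0\<^sub>M}|))"
 unfolding injective_module_def
proof (intro conjI allI impI; (elim conjE)?)
 interpret M: left_module R M by fact
 note Z = M.sub_left_module[OF M.submodule_zero]
 show "lmod R (M(|carrier := {0\<^sub>M}|))" by (rule Z)
 fix A B :: "('a, 'c) module" and f g
 assume h: "lmod R A" "lmod R B" "f:Hom R A B" "inj_on f |A|"
  "g:Hom R A (M(|carrier := {0\<^sub>M}|))"
 show "EX h:Hom R B (M(|carrier := {0\<^sub>M}|)). ALL x:|A|. h (f x) = g x"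
  using zero_hom[OF h(2) Z] hom_cl[OF h(3)] hom_cl[OF h(5)]
  by (intro bexI[of _ "\<lambda>x\<in>|B|. 0\<^sub>M"]) auto
qed

context artin_alg
begin

text \<open>A homomorphism from a left ideal sends the finitely many generators of the ideal into a
  single member of the chain, where it already extends to the ring. Baer's criterion then yields
  injectivity of the union.\<close>

lemma injective_chain_Union:
 fixes M :: "('a, 'u) module"
 assumes "lmod La M" "C ~= {}"
  and sub: "!!D. D\<in>C ==> submodule D La M" and tot: "!!D D'. D\<in>C ==> D'\<in>C ==> D <= D' \<or> D' <= D"
  and inj: "!!D. D\<in>C ==> injm La (M(|carrier := D|))"
 shows "injm La (M(|carrier := \<Union>C|))"
proof -
 interpret M: left_module La M by fact
 note reg = left_module_regular[OF L_ring]
 note U = M.submodule_chain_Union[OF assms(2) sub tot]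
 note lmU = M.sub_left_module[OF U]
 show ?thesis
 proof (rule injective_of_Baer[OF lmU])
  fix I w
  let ?a = "(reg La)(|carrier := I|)"
  assume I: "submodule I La (reg La)" and w: "w:Hom La ?a (M(|carrier := \<Union>C|))"
  note lmI = left_module.sub_left_module[OF reg I]
  have "fg_module La ?a" using L_noetherian I by (simp add: noetherian_module_def)
  then obtain S where S: "finite S" "generates La ?a S I" by (auto simp: fg_module_iff)
  have "w ` S <= \<Union>C" using S(2) hom_cl[OF w] by (auto simp: generates_def)
  from finite_subset_chain_Union[OF finite_imageI[OF S(1)] this assms(2) tot]
  obtain D where D: "D\<in>C" "w ` S <= D" by (rule bexE)
  have DU: "submodule D La (M(|carrier := \<Union>C|))" using M.submodule_sub_iff[OF U] sub[OF D(1)] D(1) by blast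
  have "S <= {x\<in>|(reg La)(|carrier := I|)|. w x\<in>D}" using S(2) D(2) by (auto simp: generates_def)
  hence ID: "I <= {x\<in>|(reg La)(|carrier := I|)|. w x\<in>D}"
   using S(2) submodule_vimage[OF lmI lmU w DU] unfolding generates_def by blast
  have "w:Hom La ?a (M(|carrier := D|))"
   using hom_into_sub[OF w, of D] ID by auto
  moreover have "|(reg La)(|carrier := I|)|\<lesssim>(UNIV :: 'u set)"
   using lepoll_trans[OF subset_imp_lepoll L_small] left_module.submoduleD(1)[OF reg I] by simp
  moreover have "inj_on (\<lambda>x\<in>I. x) |(reg La)(|carrier := I|)|" by (simp add: inj_on_def)
  ultimately obtain h where h: "h:Hom La (reg La) (M(|carrier := D|))"
   "ALL x:|(reg La)(|carrier := I|)|. h ((\<lambda>x\<in>I. x) x) = w x"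
   using injective_extend[OF inj[OF D(1)] lmI reg left_module.incl_hom[OF reg I], of w] L_small by auto
  have h1: "h \<one>\<^bsub>La\<^esub>\<in>D" using hom_cl[OF h(1), of "\<one>\<^bsub>La\<^esub>"] by simp
  have "w a = a*\<^sub>M h \<one>\<^bsub>La\<^esub>" if a: "a\<in>I" for a
  proof -
   have aL: "a\<in>|La|" using left_module.submoduleD(2)[OF reg I a] by simp
   thus ?thesis using h(2) a hom_smult[OF h(1) aL, of "\<one>\<^bsub>La\<^esub>"] by simp
  qed
  thus "EX u:|M(|carrier := \<Union>C|)|. ALL a:I. w a = a\<odot>\<^bsub>M(|carrier := \<Union>C|)\<^esub> u"
   using h1 D(1) by auto
 qed
qed

text \<open>A maximal lift, defined on an injective submodule, is defined everywhere: otherwise a complement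
 contains the injective envelope of a cyclic module, to which the lift extends.\<close>

lemma injective_lift:
 fixes J F M :: "('a, 'u) module"
 assumes F: "lmod La F" and M: "lmod La M" and p: "p:Hom La F M"
  and fgl: "!!(K :: ('a, 'u) module) g. fg_module La K ==> injm La K ==> g:Hom La K M ==>
   EX h:Hom La K F. ALL x:|K|. p (h x) = g x"
  and J: "injm La J" and g: "g:Hom La J M"
 shows "EX h:Hom La J F. ALL x:|J|. p (h x) = g x"
proof -
 have Jm: "lmod La J" using J by (simp add: injective_module_def)
 interpret J: left_module La J by fact
 interpret F: left_module La F by fact
 note P = left_module_prod[OF Jm F]
 interpret P: left_module La "prod_module J F" by (rule P)
 \<comment> \<open>The Zorn family consists of graphs of partial lifts whose domain is injective;
   this injectivity provides the complement needed to enlarge a proper domain.\<close>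
 define ok where "ok G <-> submodule G La (prod_module J F) & (ALL y. (0\<^sub>J, y)\<in>G --> y = 0\<^sub>F) &
  (ALL z:G. p (snd z) = g (fst z)) & injm La (J(|carrier := fst ` G|))" for G
 have okI: "ok G" if "submodule G La (prod_module J F)" "ALL y. (0\<^sub>J, y)\<in>G --> y = 0\<^sub>F"
  "ALL z:G. p (snd z) = g (fst z)" "injm La (J(|carrier := fst ` G|))" for G
  unfolding ok_def by (intro conjI that)
 note okD' = iffD1[OF ok_def]
 note okD = conjunct1[OF okD'] conjunct1[OF conjunct2[OF okD']] conjunct1[OF conjunct2[OF conjunct2[OF okD']]]
  conjunct2[OF conjunct2[OF conjunct2[OF okD']]]
 let ?C = "Collect ok"
 have "EX G:?C. ALL H:?C. G <= H --> H = G"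
 proof (rule subset_Zorn_nonempty)
  have "{(0\<^sub>J, 0\<^sub>F)}\<in>?C"
   using P.submodule_zero hom_zero[OF F M p] hom_zero[OF Jm M g] injective_zero_module[OF Jm] by (simp add: ok_def)
  thus "?C ~= {}" by blast
  fix C assume C: "C ~= {}" "subset.chain ?C C"
  have CC: "ok G" if "G\<in>C" for G using C(2) that unfolding subset_chain_def by blast
  have tot: "G <= H \<or> H <= G" if "G\<in>C" "H\<in>C" for G H using C(2) that unfolding subset_chain_def by blast
  have "submodule (\<Union>C) La (prod_module J F)"
   by (rule P.submodule_chain_Union[OF C(1) okD(1)[OF CC] tot])
  moreover have "ALL y. (0\<^sub>J, y)\<in>\<Union>C --> y = 0\<^sub>F" using okD(2)[OF CC] by blast
  moreover have "ALL z:\<Union>C. p (snd z) = g (fst z)" by (intro ballI, elim UnionE) (rule bspec[OF okD(3)[OF CC]])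
  moreover have "injm La (J(|carrier := fst ` \<Union>C|))"
  proof -
   have "injm La (J(|carrier := \<Union>((`) fst ` C)|))"
   proof (rule injective_chain_Union[OF Jm])
    show "(`) fst ` C ~= {}" using C(1) by blast
    fix D assume "D\<in>(`) fst ` C"
    then obtain G where G: "G\<in>C" "D = fst ` G" by blast
    show "submodule D La J" unfolding G(2) by (rule graph_function(1)[OF Jm F okD(1,2)[OF CC[OF G(1)]]])
    show "injm La (J(|carrier := D|))" using okD(4)[OF CC[OF G(1)]] G(2) by simp
    fix D' assume "D'\<in>(`) fst ` C"
    then obtain G' where G': "G'\<in>C" "D' = fst ` G'" by blast
    show "D <= D' \<or> D' <= D" using tot[OF G(1) G'(1)] G(2) G'(2) by (blast intro: image_mono)
   qed
   moreover have "\<Union>((`) fst ` C) = fst ` \<Union>C" by (rule image_Union[symmetric])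
   ultimately show ?thesis by (simp only:)
  qed
  ultimately show "\<Union>C\<in>?C" by (intro CollectI okI)
 qed
 then obtain G where G: "ok G" and max: "ALL H. ok H --> G <= H --> H = G" by auto
 note Gs = okD(1)[OF G] and G1 = okD(2)[OF G] and Gp = bspec[OF okD(3)[OF G]] and Gi = okD(4)[OF G]
 let ?D = "fst ` G"
 note D = graph_function(1)[OF Jm F Gs G1]
 note DD = J.submoduleD[OF D]
 note lmD = J.sub_left_module[OF D]
 obtain h where h: "h:Hom La (J(|carrier := ?D|)) F" "ALL z:G. h (fst z) = snd z"
  using graph_function(2)[OF Jm F Gs G1] by (rule bexE)
 have iD: "inj_on (\<lambda>x\<in>?D. x) |J(|carrier := ?D|)|" by (simp add: inj_on_def)
 obtain l where l: "l:Hom La J (J(|carrier := ?D|))"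
  "!!x. x\<in>|J(|carrier := ?D|)| ==> l ((\<lambda>x\<in>?D. x) x) = (\<lambda>x\<in>|J(|carrier := ?D|)|. x) x"
  by (rule injectiveD[OF Gi lmD Jm J.incl_hom[OF D] iD id_hom[OF lmD]]) blast
 have lid: "l x = x" if "x\<in>?D" for x using l(2)[of x] that by simp
 have lD: "l x\<in>?D" if "x\<in>|J|" for x using hom_cl[OF l(1) that] by simp
 note lJ = hom_from_sub[OF l(1) DD(1)]
 note lc = hom_cl[OF lJ]
 let ?q = "\<lambda>x\<in>|J|. (\<lambda>x\<in>|J|. x) x-\<^sub>J l x"
 have q: "?q:Hom La J J" by (rule minus_hom[OF Jm Jm id_hom[OF Jm] lJ])
 have qeq: "?q x = x-\<^sub>J l x" if "x\<in>|J|" for x using that by simp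
 \<comment> \<open>The kernel of the projection \<open>l\<close> complements the domain; being a
   retract of \<open>J\<close>, it is injective as well.\<close>
 define C where "C = a_kernel J J l"
 have Cs: "submodule C La J" unfolding C_def by (rule submodule_kernel[OF Jm Jm lJ])
 note CD = J.submoduleD[OF Cs]
 note lmC = J.sub_left_module[OF Cs]
 have C0: "l x = 0\<^sub>J" if "x\<in>C" for x using that by (simp add: C_def a_kernel_def')
 have qC: "?q x\<in>C" if x: "x\<in>|J|" for x
 proof -
  have "l (?q x) = l x-\<^sub>J l (l x)"
   unfolding qeq[OF x] by (rule hom_minus[OF Jm Jm lJ x lc[OF x]])
  also have "... = 0\<^sub>J" using lid[OF lD[OF x]] lc[OF x] by (simp add: J.diff_eq_zero_iff)
  finally have "l (?q x) = 0\<^sub>J" .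
  thus ?thesis using hom_cl[OF q x] unfolding C_def a_kernel_def' by (intro CollectI conjI)
 qed
 have qC': "?q:Hom La J (J(|carrier := C|))" by (rule hom_into_sub[OF q]) (use qC in blast)
 have Ci: "injm La (J(|carrier := C|))"
 proof (rule injective_retract[OF J lmC J.incl_hom[OF Cs] qC'])
  fix x assume "x\<in>|J(|carrier := C|)|"
  hence xC: "x\<in>C" by simp
  have xJ: "x\<in>|J|" by (rule CD(2)[OF xC])
  have "x-\<^sub>J 0\<^sub>J = x" using J.add_diff_cancel(3)[OF xJ J.M.zero_closed] xJ by simp
  thus "?q ((\<lambda>x\<in>C. x) x) = x" using qeq[OF xJ] C0[OF xC] xC by (simp only: restrict_apply')
 qed
 have "?D = |J|"
 proof (rule ccontr)
  assume "?D ~= |J|"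
  then obtain x where x: "x\<in>|J|" "x\<notin>?D" using DD(1) by blast
  define c where "c = ?q x"
  have cC: "c\<in>C" unfolding c_def by (rule qC[OF x(1)])
  have cJ: "c\<in>|J|" by (rule CD(2)[OF cC])
  have c0: "c ~= 0\<^sub>J"
  proof
   assume "c = 0\<^sub>J"
   hence "x = l x" unfolding c_def qeq[OF x(1)] by (rule iffD1[OF J.diff_eq_zero_iff[OF x(1) lc[OF x(1)]]])
   hence "l x = x" by (rule sym)
   thus False using x(2) lD[OF x(1)] by simp
  qed
  note reg = left_module_regular[OF L_ring]
  define L where "L = (\<lambda>a\<in>|La|. a*\<^sub>J c) ` |reg La|"
  note o = J.orbit_hom[OF cJ]
  have Ls: "submodule L La J" unfolding L_def by (rule submodule_image[OF reg Jm o left_module.submodule_carrier[OF reg]])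
  note lmL = J.sub_left_module[OF Ls]
  have oL: "(\<lambda>a\<in>|La|. a*\<^sub>J c):Hom La (reg La) (J(|carrier := L|))"
   by (rule hom_into_sub[OF o]) (simp add: L_def)
  have Lfg: "fg_module La (J(|carrier := L|))"
   by (rule fg_image[OF fg_regular lmL oL]) (simp add: L_def)
  have LC: "L <= C" unfolding L_def using CD(7)[OF _ cC] by auto
  have cL: "c\<in>L" unfolding L_def using cJ by (intro image_eqI[where x = "\<one>\<^bsub>La\<^esub>"]) (auto simp: J.smult_one)
  \<comment> \<open>The envelope of the cyclic module on \<open>c\<close> is finitely generated, and
    it embeds into \<open>C\<close>: the inclusion extends to it, and the extension is injective by
    essentiality. The hypothesis on finitely generated modules therefore lifts \<open>g\<close> on
    it.\<close>
  obtain K :: "('a, 'u) module" and k where K: "injective_envelope La (J(|carrier := L|)) K k" "fg_module La K"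
   by (rule ex_injective_envelope[OF Lfg])
  have Ki: "injm La K" and k: "k:Hom La (J(|carrier := L|)) K" "inj_on k |J(|carrier := L|)|"
   using K(1) by (auto simp: injective_envelope_def)
  have Km: "lmod La K" using K(2) by (simp add: fg_module_def)
  have iL: "(\<lambda>x\<in>L. x):Hom La (J(|carrier := L|)) (J(|carrier := C|))"
   by (rule hom_into_sub[OF J.incl_hom[OF Ls]]) (use LC in auto)
  obtain u where u: "u:Hom La K (J(|carrier := C|))"
   "!!x. x\<in>|J(|carrier := L|)| ==> u (k x) = (\<lambda>x\<in>L. x) x"
   by (rule injectiveD[OF Ci lmL Km k iL]) blast
  note uJ = hom_from_sub[OF u(1) CD(1)]
  have uC: "u y\<in>C" if "y\<in>|K|" for y using hom_cl[OF u(1) that] by simp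
  have uinj: "inj_on u |K|"
   by (rule envelope_mono[OF lmL lmC K(1) u(1)]) (use u(2) in auto)
  obtain w where w: "w:Hom La K F" "ALL y:|K|. p (w y) = compose |K| g u y"
   using fgl[OF K(2) Ki compose_hom[OF Km uJ g]] by (rule bexE)
  define G' where "G' = {(x+\<^sub>J u y, z+\<^sub>F w y) | x z y. (x, z)\<in>G & y\<in>|K| }"
  \<comment> \<open>Applying \<open>l\<close> separates the domain from its complement, so the old
    and the new partial lift overlap only in 0.\<close>
  have sep: "x = 0\<^sub>J & u y = 0\<^sub>J" if xy: "x\<in>?D" "y\<in>|K|" "x+\<^sub>J u y = 0\<^sub>J" for x y
  proof -
   have xJ: "x\<in>|J|" and uyJ: "u y\<in>|J|" using DD(2)[OF xy(1)] CD(2)[OF uC[OF xy(2)]] .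
   have "0\<^sub>J = l (x+\<^sub>J u y)" unfolding xy(3) using hom_zero[OF Jm Jm lJ] by simp
   also have "... = x+\<^sub>J 0\<^sub>J" using hom_add[OF lJ xJ uyJ] lid[OF xy(1)] C0[OF uC[OF xy(2)]] by simp
   finally have "x = 0\<^sub>J" using xJ by simp
   thus ?thesis using xy(3) uyJ by simp
  qed
  have cond: "ALL x z y. (x, z)\<in>G & y\<in>|K| & x+\<^sub>J u y = 0\<^sub>J --> z+\<^sub>F w y = 0\<^sub>F"
  proof (intro allI impI; elim conjE)
   fix x z y assume xz: "(x, z)\<in>G" "y\<in>|K|" "x+\<^sub>J u y = 0\<^sub>J"
   have "x\<in>?D" using xz(1) by (rule image_eqI[rotated]) simp
   hence s: "x = 0\<^sub>J" "u y = 0\<^sub>J" using sep xz by blast+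
   have "y = 0\<^sub>K" using uinj s(2) xz(2) inj_on_hom_iff[OF Km Jm uJ] by blast
   hence "w y = 0\<^sub>F" using hom_zero[OF Km F w(1)] by simp
   moreover have "z = 0\<^sub>F" using G1 xz(1) s(1) by simp
   ultimately show "z+\<^sub>F w y = 0\<^sub>F" by simp
  qed
  note Ex = graph_extend[OF Jm F Km Gs uJ w(1) cond, folded G'_def]
  note D' = graph_function(1)[OF Jm F Ex(1,2)]
  let ?D' = "fst ` G'"
  note lmD' = J.sub_left_module[OF D']
  have D'E: "EX a:?D. EX y:|K|. x = a+\<^sub>J u y" if "x\<in>?D'" for x
   using that by (force simp: G'_def)
  have DD': "?D <= ?D'" using Ex(3) by (rule image_mono)
  have uD': "u y\<in>?D'" if "y\<in>|K|" for y using Ex(4)[OF that] by (rule image_eqI[rotated]) simp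
  have "injm La (J(|carrier := ?D'|))"
  proof -
   note s = restrict_hom[OF Jm l(1) D']
   have r: "(\<lambda>x\<in>?D. x):Hom La (J(|carrier := ?D|)) (J(|carrier := ?D'|))"
    by (rule hom_into_sub[OF J.incl_hom[OF D]]) (use DD' in auto)
   have v: "u:Hom La K (J(|carrier := ?D'|))" by (rule hom_into_sub[OF uJ]) (use uD' in blast)
   note qr = restrict_hom[OF Jm q D']
   have qu: "restrict ?q ?D' x\<in>u ` |K|" if x: "x\<in>|J(|carrier := ?D'|)|" for x
   proof -
    have xD': "x\<in>?D'" using x by simp
    obtain a y where ay: "a\<in>?D" "y\<in>|K|" "x = a+\<^sub>J u y" using D'E[OF xD'] by blast
    have c: "a\<in>|J|" "u y\<in>|J|" using DD(2)[OF ay(1)] CD(2)[OF uC[OF ay(2)]] .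
    have "l x = a" unfolding ay(3) using hom_add[OF lJ c] lid[OF ay(1)] C0[OF uC[OF ay(2)]] c(1) by simp
    hence "?q x = u y" using qeq[of x] c ay(3) by simp
    hence "restrict ?q ?D' x = u y" using xD' by (simp only: restrict_apply')
    thus ?thesis using ay(2) by (rule image_eqI)
   qed
   obtain t where t: "t:Hom La (J(|carrier := ?D'|)) K"
    "ALL x:|J(|carrier := ?D'|)|. u (t x) = restrict ?q ?D' x"
    using factor_mono[OF Km lmD' uJ uinj qr qu] by (rule bexE)
   show ?thesis
   proof (rule injective_of_sum[OF Gi Ki lmD' s r t(1) v])
    fix x assume x: "x\<in>|J(|carrier := ?D'|)|"
    hence xD': "x\<in>?D'" by simp
    have xJ: "x\<in>|J|" by (rule J.submoduleD(2)[OF D' xD'])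
    have 1: "u (t x) = x-\<^sub>J l x" using bspec[OF t(2) x] xD' qeq[OF xJ] by (simp only: restrict_apply')
    have 2: "(\<lambda>x\<in>?D. x) (restrict l ?D' x) = l x" using xD' lD[OF xJ] by (simp only: restrict_apply')
    show "(\<lambda>x\<in>?D. x) (restrict l ?D' x)\<oplus>\<^bsub>J(|carrier := ?D'|)\<^esub> u (t x) = x"
     unfolding 1 2 using xJ lc[OF xJ] by simp
   qed
  qed
  moreover have "ALL z:G'. p (snd z) = g (fst z)"
  proof
   fix z assume z: "z\<in>G'"
   obtain x y b where xy: "(x, b)\<in>G" "y\<in>|K|" "z = (x+\<^sub>J u y, b+\<^sub>F w y)" using z by (auto simp: G'_def)
   have c: "x\<in>|J|" "b\<in>|F|" using P.submoduleD(2)[OF Gs xy(1)] by simp_all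
   have "p (b+\<^sub>F w y) = g x+\<^sub>M g (u y)"
    using hom_add[OF p c(2) hom_cl[OF w(1) xy(2)]] Gp[OF xy(1)] bspec[OF w(2) xy(2)] xy(2) by (simp add: compose_eq)
   thus "p (snd z) = g (fst z)" using xy(3) hom_add[OF g c(1) hom_cl[OF uJ xy(2)]] by simp
  qed
  ultimately have "ok G'" by (intro okI Ex(1,2))
  hence GG: "G' = G" using max Ex(3) by simp
  have kc: "k c\<in>|K|" using hom_cl[OF k(1), of c] cL by simp
  have "u (k c) = c" using u(2)[of c] cL by simp
  hence "c\<in>?D" using uD'[OF kc] GG by simp
  hence "l c = c" by (rule lid)
  thus False using C0[OF cC] c0 by simp
 qed
 hence hJ: "h:Hom La J F" using h(1) by simp
 have "p (h x) = g x" if x: "x\<in>|J|" for x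
 proof -
  have "x\<in>fst ` G" using x \<open>?D = carrier J\<close> by simp
  then obtain z where z: "z\<in>G" "x = fst z" by blast
  thus ?thesis using bspec[OF h(2) z(1)] Gp[OF z(1)] by simp
 qed
 thus ?thesis using hJ by blast
qed

text \<open>Vanishing against \<open>J\<close> amounts to lifting maps from \<open>J\<close> along a
  cosyzygy of \<open>M\<close>, and \<open>injective_lift\<close> reduces such lifts to finitely
  generated injective modules.\<close>

lemma ext1_zero_injective:
 fixes J M :: "('a, 'u) module"
 assumes "fg_module La M" "injm La J"
  and "!!K :: ('a, 'u) module. fg_module La K ==> injm La K ==> ext1_zero La K M"
 shows "ext1_zero La J M"
proof -
 obtain F :: "('a, 'u) module" and u and F' :: "('a, 'u) module" and p where F: "injm La F" "fg_module La F" "ses La M u F p F'"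
  using ex_cosyzygy[OF assms(1)] by (elim exE conjE)
 note S = sesD[OF F(3)]
 have Jm: "lmod La J" using assms(2) by (simp add: injective_module_def)
 show ?thesis
 proof (rule ext1_zero_of_injective[OF F(1,3) Jm])
  fix g assume g: "g:Hom La J F'"
  show "EX h:Hom La J F. ALL x:|J|. p (h x) = g x"
  proof (rule injective_lift[OF S(2,3,5) _ assms(2) g])
   fix K :: "('a, 'u) module" and g
   assume K: "fg_module La K" "injm La K" "g:Hom La K F'"
   have "lmod La K" using K(1) by (simp add: fg_module_def)
   from ext1_zero_lift[OF assms(3)[OF K(1,2)] F(3) K(3) this infinite_univ]
   show "EX h:Hom La K F. ALL x:|K|. p (h x) = g x" .
  qed
 qed
qed

end

section \<open>Approximations by injective modules\<close>

context artin_alg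
begin

abbreviation HD :: "('a, 'm) module => ('a, ('a => 'u) => 'm) module" where "HD \<equiv> Hom_dual R La E"

lemma HD_simps [simp]:
 "|HD M| = Hom La DL M" "0\<^sub>(HD M) = (\<lambda>x\<in>Hom R La E. 0\<^sub>M)"
 "f+\<^sub>(HD M) g = (\<lambda>x\<in>Hom R La E. f x+\<^sub>M g x)"
 "a*\<^sub>(HD M) f = (\<lambda>x\<in>Hom R La E. f (a*\<^sub>DR x))"
 by (simp_all add: Hom_dual_def)

lemma HD_module:
 assumes "lmod La M"
 shows "lmod La (HD M)"
 unfolding Hom_dual_def
proof (rule left_module_hom_module[OF DL_module assms L_ring])
 fix b c x assume h: "b\<in>|La|" "c\<in>|La|" "x\<in>|DL|"
 show "(b+\<^sub>La c)*\<^sub>DR x = b*\<^sub>DR x+\<^sub>DL c*\<^sub>DR x"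
  using h hom_add[of x R La E] by (auto simp: L.l_distr intro!: restrict_ext)
 show "(b\<otimes>\<^sub>La c)*\<^sub>DR x = c*\<^sub>DR (b*\<^sub>DR x)" using h by (auto simp: L.m_assoc intro!: restrict_ext)
next
 fix x assume x: "x\<in>|DL|"
 hence "(\<lambda>y\<in>|La|. x y) = x" by (auto simp: module_hom_def PiE_def extensional_restrict)
 thus "\<one>\<^bsub>La\<^esub> *\<^sub>DR x = x" by (simp cong: restrict_cong)
next
 fix b assume "b\<in>|La|"
 from DR_smult_hom[OF this] show "(\<lambda>x\<in>|DL|. b*\<^sub>DR x):Hom La DL DL" by (simp only: DL_simps)
qed

text \<open>The image of \<open>R\<close> in \<open>La\<close> is central, so both actions of such a
  scalar on D(\<open>La\<close>) agree.\<close>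

lemma DR_scalar:
 assumes "r\<in>|R|" "f:Hom R La E"
 shows "(r*\<^sub>La \<one>\<^bsub>La\<^esub>)*\<^sub>DR f = (r*\<^sub>La \<one>\<^bsub>La\<^esub>)*\<^sub>DL f"
 using assms by (auto simp: scalar_mult intro!: restrict_ext)

text \<open>A homomorphism on D(\<open>La\<close>) is determined by its values at finitely many
  generators. These evaluations are \<open>R\<close>-linear and embed Hom(D(\<open>La\<close>),
  \<open>M\<close>) into a finite power of \<open>M\<close>, which is noetherian over
  \<open>R\<close>.\<close>

lemma HD_fg:
 fixes M :: "('a, 'm) module"
 assumes "fg_module La M"
 shows "fg_module La (HD M)"
proof -
 have M: "lmod La M" using assms by (simp add: fg_module_def)
 interpret M: left_module La M by fact
 note H = HD_module[OF M]
 obtain T where T: "finite T" "generates La DL T |DL|" using DL_fg by (auto simp: fg_module_iff)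
 have TD: "t\<in>|DL|" if "t\<in>T" for t using T(2) that by (auto simp: generates_def simp del: DL_simps)
 let ?ev = "%t. \<lambda>f\<in>|rmod (HD M)|. f t"
 let ?b = "rmod (HD M)"
 let ?c = "rmod M"
 have ev: "?ev t:Hom R ?b ?c" if "t\<in>T" for t
 proof (rule module_homI[OF _ _ _ left_module_rmod[OF H]])
  have t: "t\<in>|DL|" "t:Hom R La E" using TD[OF that] by simp_all
  fix f assume f: "f\<in>|rmod (HD M)|"
  thus "f t\<in>|rmod M|" using hom_cl t by fastforce
  show "(f+\<^sub>?b g) t = f t+\<^sub>?c g t" for g using t(2) by simp
  fix r assume r: "r\<in>|R|"
  have "(r*\<^sub>?b f) t = f ((r*\<^sub>La \<one>\<^bsub>La\<^esub>)*\<^sub>DR t)"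
   using t(2) by (simp only: rmod_simps HD_simps restrict_apply')
  also have "... = r*\<^sub>?c f t"
   unfolding DR_scalar[OF r t(2)] using hom_smult[OF _ scalar_closed[OF r] t(1), of f] f
   by (simp only: rmod_simps HD_simps)
  finally show "(r*\<^sub>?b f) t = r*\<^sub>?c f t" .
 qed
 let ?a = "\<lambda>f\<in>|rmod (HD M)|. \<lambda>t\<in>T. ?ev t f"
 have u: "?a:Hom R ?b (pow_module T ?c)"
  by (rule hom_to_pow[OF left_module_rmod[OF H]]) (rule ev)
 have "inj_on ?a |rmod (HD M)|"
  unfolding inj_on_hom_iff[OF left_module_rmod[OF H] left_module_pow[OF left_module_rmod[OF M]] u]
 proof (intro ballI impI)
  fix f assume f: "f\<in>|rmod (HD M)|"
   and 0: "?a f = 0\<^sub>(pow_module T ?c)"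
  have fh: "f:Hom La DL M" using f by simp
  have "f t = 0\<^sub>M" if t: "t\<in>T" for t
  proof -
   have "(\<lambda>t\<in>T. ?ev t f) t = (\<lambda>t\<in>T. 0\<^sub>M) t" using 0 f by (simp only: restrict_apply' pow_module_simps rmod_simps)
   thus ?thesis using t f by (simp only: restrict_apply')
  qed
  hence "T <= {x\<in>|DL|. f x\<in>{0\<^sub>M}}" using TD by blast
  hence "|DL| <= {x\<in>|DL|. f x\<in>{0\<^sub>M}}"
   using T(2) submodule_vimage[OF DL_module M fh M.submodule_zero] unfolding generates_def by blast
  hence f0: "f x = 0\<^sub>M" if "x\<in>|DL|" for x using that by blast
  have "f = (\<lambda>x\<in>|DL|. 0\<^sub>M)"
   by (rule hom_eqI[OF fh zero_hom[OF DL_module M]]) (simp only: restrict_apply' f0)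
  thus "f = 0\<^sub>?b" by simp
 qed
 from noetherian_mono[OF noetherian_pow[OF noetherian_of_fg[OF artinian_noetherian[OF artinian] rmod_fg[OF assms]] T(1)]
   left_module_rmod[OF H] u this]
 show ?thesis by (intro fg_of_rmod[OF H] noetherian_fg)
qed

text \<open>Generators of Hom(D(\<open>La\<close>), \<open>M\<close>) over \<open>La\<close> are
  assembled into one map from a power of D(\<open>La\<close>). The homomorphisms that factor through
  it form a \<open>La\<close>-submodule, since a scalar acts by precomposition with an endomorphism
  of \<open>DL\<close>, and this submodule contains the generators.\<close>

lemma ex_DL_cover:
 fixes M :: "('a, 'u) module"
 assumes "fg_module La M"
 shows "\<exists>(F :: ('a, 'u) module) p. injm La F & fg_module La F & p:Hom La F M &
  (ALL f:Hom La DL M. EX h:Hom La DL F. ALL x:|DL|. p (h x) = f x)"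
proof -
 have M: "lmod La M" using assms by (simp add: fg_module_def)
 interpret H: left_module La "HD M" by (rule HD_module[OF M])
 let ?b = "Hom La DL M"
 obtain T where T: "finite T" "generates La (HD M) T ?b"
  using HD_fg[OF assms] by (auto simp: fg_module_iff)
 have TH: "t\<in>?b" if "t\<in>T" for t using T(2) that by (auto simp: generates_def)
 obtain F :: "('a, 'u) module" and f g where F: "module_iso La (pow_module T DL) F f g" "injm La F" "fg_module La F"
  by (rule ex_pow_copy[OF T(1)])
 note D = module_isoD[OF F(1)]
 let ?s = "\<lambda>y\<in>T \<rightarrow>\<^sub>E |DL|. \<Oplus>\<^bsub>M\<^esub>t\<in>T. t (y t)"
 note s = hom_from_pow[OF DL_module M T(1) TH]
 let ?p = "compose |F| ?s g"
 have p: "?p:Hom La F M" by (rule compose_hom[OF D(2,4) s])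
 let ?c = "Hom La DL F"
 define L where "L = {f\<in>?b. EX h:?c. ALL x:|DL|. ?p (h x) = f x}"
 have LI: "f\<in>L" if "f\<in>?b" "h\<in>?c" "!!x. x\<in>|DL| ==> ?p (h x) = f x" for f h
  using that unfolding L_def by blast
 have LE: "EX h. h\<in>?c & (ALL x:|DL|. ?p (h x) = f x)" "f\<in>?b" if "f\<in>L" for f
  using that unfolding L_def by blast+
 have "submodule L La (HD M)"
 proof (rule H.submoduleI)
  show "L <= |HD M|" unfolding HD_simps L_def by blast
  have "(\<lambda>x\<in>|DL|. 0\<^sub>M)\<in>L"
   by (rule LI[OF zero_hom[OF DL_module M] zero_hom[OF DL_module D(2)]])
    (use hom_zero[OF D(2) M p] in \<open>simp only: restrict_apply'\<close>)
  thus "0\<^sub>(HD M)\<in>L" by (simp only: HD_simps DL_simps)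
 next
  fix a b assume ab: "a\<in>L" "b\<in>L"
  obtain h k where h: "h\<in>?c" "ALL x:|DL|. ?p (h x) = a x"
   and k: "k\<in>?c" "ALL x:|DL|. ?p (k x) = b x" using LE(1)[OF ab(1)] LE(1)[OF ab(2)] by (elim exE conjE)
  let ?d = "\<lambda>x\<in>|DL|. a x+\<^sub>M b x"
  have "?d\<in>L"
  proof (rule LI[OF add_hom[OF DL_module M LE(2)[OF ab(1)] LE(2)[OF ab(2)]] add_hom[OF DL_module D(2) h(1) k(1)]])
   fix x assume x: "x\<in>|DL|"
   show "?p ((\<lambda>x\<in>|DL|. h x+\<^sub>F k x) x) = ?d x"
    unfolding restrict_apply'[OF x] hom_add[OF p hom_cl[OF h(1) x] hom_cl[OF k(1) x]]
     bspec[OF h(2) x] bspec[OF k(2) x] ..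
  qed
  thus "a+\<^sub>(HD M) b\<in>L" by (simp only: HD_simps DL_simps)
 next
  fix r a assume ra: "r\<in>|La|" "a\<in>L"
  obtain h where h: "h\<in>?c" "ALL x:|DL|. ?p (h x) = a x" using LE(1)[OF ra(2)] by (elim exE conjE)
  note d = DR_smult_hom[OF ra(1), folded DL_simps(1)]
  let ?a = "\<lambda>f\<in>|DL|. r*\<^sub>DR f"
  have c: "compose |DL| a ?a\<in>L"
  proof (rule LI[OF compose_hom[OF DL_module d LE(2)[OF ra(2)]] compose_hom[OF DL_module d h(1)]])
   fix x assume x: "x\<in>|DL|"
   show "?p (compose |DL| h ?a x) = compose |DL| a ?a x"
    unfolding compose_eq[OF x] by (rule bspec[OF h(2) hom_cl[OF d x]])
  qed
  have "compose |DL| a ?a = r*\<^sub>(HD M) a"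
   unfolding compose_def HD_simps(4) DL_simps(1) by (rule restrict_ext) (simp only: restrict_apply')
  thus "r*\<^sub>(HD M) a\<in>L" using c by (simp only:)
 qed
 moreover have "T <= L"
 proof
  fix t assume t: "t\<in>T"
  let ?i = "\<lambda>x\<in>|DL|. \<lambda>s\<in>T. if s = t then x else 0\<^sub>DL"
  note i = pow_module_homs(2)[OF DL_module t]
  show "t\<in>L"
  proof (rule LI[OF TH[OF t] compose_hom[OF DL_module i D(3)]])
   fix x assume x: "x\<in>|DL|"
   interpret M: left_module La M by (rule M)
   have ix: "?i x\<in>T \<rightarrow>\<^sub>E |DL|" using hom_cl[OF i x] by (simp only: pow_module_simps)
   have "?p (compose |DL| f ?i x) = ?s (?i x)"
    using D(5)[OF hom_cl[OF i x]] D(11)[OF hom_cl[OF i x]] by (simp only: compose_eq[OF x] compose_eq)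
   also have "... = (\<Oplus>\<^bsub>M\<^esub>s\<in>T. s (?i x s))" by (rule restrict_apply'[OF ix])
   also have "... = (\<Oplus>\<^bsub>M\<^esub>s\<in>T. if t = s then t x else 0\<^sub>M)"
   proof (rule M.M.finsum_cong')
    show "(%s. if t = s then t x else 0\<^sub>M)\<in>T \<rightarrow> |M|" using hom_cl[OF TH[OF t] x] by auto
    show "s (?i x s) = (if t = s then t x else 0\<^sub>M)" if "s\<in>T" for s
     using hom_zero[OF DL_module M TH[OF that]] that x by (auto simp del: DL_simps)
   qed simp
   also have "... = t x" by (rule M.M.finsum_singleton[OF t T(1)]) (use hom_cl[OF TH[OF t] x] in auto)
   finally show "?p (compose |DL| f ?i x) = t x" .
  qed
 qed
 ultimately have "?b <= L" using T(2) unfolding generates_def by blast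
 thus ?thesis using F(2,3) p unfolding L_def by blast
qed

text \<open>Every homomorphism from an injective module lifts, since finitely generated injective modules are
 direct summands of powers of \<open>D\<Lambda>\<close>.\<close>

lemma ex_injective_cover:
 fixes M :: "('a, 'u) module"
 assumes "fg_module La M"
 shows "\<exists>(F :: ('a, 'u) module) p. injm La F & fg_module La F & p:Hom La F M &
  (ALL f:Hom La DL M. f ` |DL| <= p ` |F| ) &
  (\<forall>(J :: ('a, 'u) module) g. injm La J & g:Hom La J M -->
   (EX h:Hom La J F. ALL x:|J|. p (h x) = g x))"
proof -
 have M: "lmod La M" using assms by (simp add: fg_module_def)
 interpret M: left_module La M by fact
 obtain F :: "('a, 'u) module" and p where F: "injm La F" "fg_module La F" and p: "p:Hom La F M"
  and l: "ALL f:Hom La DL M. EX h:Hom La DL F. ALL x:|DL|. p (h x) = f x"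
  using ex_DL_cover[OF assms] by (elim exE conjE)
 have Fm: "lmod La F" using F(2) by (simp add: fg_module_def)
 have fgl: "EX h:Hom La J F. ALL x:|J|. p (h x) = g x"
  if J: "fg_module La J" "injm La J" and g: "g:Hom La J M" for J :: "('a, 'u) module" and g
 proof -
  obtain S :: "('u => 'u) set" and a b where ab: "DL_basis J S a b" using ex_DL_basis[OF J] by (elim exE)
  note D = DL_basisD[OF ab]
  have "ALL s. EX h. s\<in>S --> h:Hom La DL F & (ALL x:|DL|. p (h x) = compose |DL| g (a s) x)"
   using bspec[OF l compose_hom[OF DL_module D(3) g]] by blast
  then obtain h where "ALL s. s\<in>S --> h s:Hom La DL F & (ALL x:|DL|. p (h s x) = compose |DL| g (a s) x)"
   by (rule choice[THEN exE])
  hence h: "s\<in>S ==> h s:Hom La DL F" "s\<in>S ==> x\<in>|DL| ==> p (h s x) = g (a s x)" for s x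
   by (auto simp: compose_eq simp del: DL_simps)
  let ?h = "\<lambda>x\<in>|J|. \<Oplus>\<^bsub>F\<^esub>s\<in>S. compose |J| (h s) (b s) x"
  have "?h:Hom La J F" by (rule sum_hom[OF D(1) Fm D(2) compose_hom[OF D(1,4) h(1)]])
  moreover have "p (?h x) = g x" if x: "x\<in>|J|" for x
  proof -
   have b: "b s x\<in>|DL|" if "s\<in>S" for s by (rule hom_cl[OF D(4)[OF that] x])
   have ab: "a s (b s x)\<in>|J|" if "s\<in>S" for s by (rule hom_cl[OF D(3)[OF that] b[OF that]])
   have hb: "h s (b s x)\<in>|F|" if "s\<in>S" for s by (rule hom_cl[OF h(1)[OF that] b[OF that]])
   have "p (?h x) = p (\<Oplus>\<^bsub>F\<^esub>s\<in>S. compose |J| (h s) (b s) x)" by (simp only: restrict_apply'[OF x])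
   also have "... = (\<Oplus>\<^bsub>M\<^esub>s\<in>S. p (compose |J| (h s) (b s) x))"
    by (rule hom_finsum[OF Fm M p D(2)]) (use hb in \<open>simp add: compose_eq[OF x]\<close>)
   also have "... = (\<Oplus>\<^bsub>M\<^esub>s\<in>S. g (a s (b s x)))"
    by (rule M.M.finsum_cong') (use hom_cl[OF g ab] h(2)[OF _ b] in \<open>auto simp: compose_eq[OF x]\<close>)
   also have "... = g (\<Oplus>\<^bsub>J\<^esub>s\<in>S. a s (b s x))" by (rule hom_finsum[OF D(1) M g D(2), symmetric]) (use ab in blast)
   finally show ?thesis unfolding D(5)[OF x] .
  qed
  ultimately show ?thesis by blast
 qed
 have "EX h:Hom La J F. ALL x:|J|. p (h x) = g x"
  if "injm La J" "g:Hom La J M" for J :: "('a, 'u) module" and g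
  by (rule injective_lift[OF Fm M p _ that]) (rule fgl)
 moreover have "f ` |DL| <= p ` |F|" if f: "f:Hom La DL M" for f
 proof
  fix y assume "y\<in>f ` |DL|"
  then obtain x where x: "x\<in>|DL|" "y = f x" by blast
  obtain h where h: "h:Hom La DL F" "ALL x:|DL|. p (h x) = f x" using bspec[OF l f] by (rule bexE)
  show "y\<in>p ` |F|" using bspec[OF h(2) x(1), symmetric] unfolding x(2) by (rule image_eqI) (rule hom_cl[OF h(1) x(1)])
 qed
 ultimately show ?thesis using F p by blast
qed

end

section \<open>Gorenstein injective modules through short exact sequences\<close>

text \<open>A class of modules from which injective resolutions and coresolutions can be spliced that stay exact
 under \<open>Hom(J, -)\<close> for injective \<open>J\<close>.  The predicate \<open>Q\<close> is a size condition.\<close>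

definition biresolving :: "('a, 'x) ring_scheme => (('a, 'u) module => bool) => ('a, 'u) module set => bool"
 where "biresolving R Q C <-> (ALL M:C. Q M &
  (\<forall>J :: ('a, 'u) module. injm R J --> ext1_zero R J M) &
  (\<exists>i (I :: ('a, 'u) module) p M'. injm R I & Q I & ses R M i I p M' & M'\<in>C) &
  (\<exists>M' j (F :: ('a, 'u) module) q. injm R F & Q F & ses R M' j F q M & M'\<in>C))"

lemma biresolvingD:
 fixes C :: "('a, 'u) module set"
 assumes "biresolving R Q C" "M\<in>C"
 shows "Q M" "injm R (J :: ('a, 'u) module) ==> ext1_zero R J M"
  "\<exists>i (I :: ('a, 'u) module) p M'. injm R I & Q I & ses R M i I p M' & M'\<in>C"
  "\<exists>M' j (F :: ('a, 'u) module) q. injm R F & Q F & ses R M' j F q M & M'\<in>C"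
 using bspec[OF assms(1)[unfolded biresolving_def] assms(2)] by simp_all

text \<open>The class consists of the cycles \<open>Z k\<close> of the complex, and \<open>N\<close>
  is \<open>Z 0\<close>. Exactness under Hom from an injective module says that maps to
  \<open>Z (k + 1)\<close> lift to \<open>I k\<close>, which is \<open>ext1_zero\<close> for
  \<open>Z k\<close>.\<close>

lemma Gorenstein_injective_biresolving:
 fixes M :: "('a, 'u) module"
 assumes "Gorenstein_injective R M"
 shows "\<exists>C (N :: ('a, 'u) module) f. biresolving R (lmod R) C & N\<in>C & f:Hom R M N & bij_betw f |M| |N|"
proof -
 obtain I :: "int => ('a, 'u) module" and d where inj: "ALL k. injm R (I k)"
  and d: "ALL k. d k:Hom R (I k) (I (k + 1))"
  and ex: "ALL k. a_exact_at (I k) (d k) (I (k + 1)) (d (k + 1)) (I (k + 2))"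
  and hex: "\<forall>(E :: ('a, 'u) module) k. injm R E -->
    exact_at (hom_group R E (I k)) (compose |E| (d k)) (hom_group R E (I (k + 1)))
     (compose |E| (d (k + 1))) (hom_group R E (I (k + 2)))"
  and iso: "module_isomorphic R M ((I 0)(|carrier := d (- 1) ` |I (- 1)| |))"
  using assms unfolding Gorenstein_injective_def by (elim conjE exE)
 have Im: "lmod R (I k)" for k using inj by (simp add: injective_module_def)
 define Z where "Z k = (I k)(|carrier := d (k - 1) ` |I (k - 1)| |)" for k
 have d': "d (k - 1):Hom R (I (k - 1)) (I k)" for k using d[rule_format, of "k - 1"] by simp
 have sub: "submodule (d (k - 1) ` |I (k - 1)| ) R (I k)" for k
  by (rule submodule_image[OF Im Im d' left_module.submodule_carrier[OF Im]])
 have ker: "d (k - 1) ` |I (k - 1)| = {x\<in>|I k|. d k x = 0\<^sub>(I (k + 1))}" for k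
 proof -
  have "k - 1 + 1 = k" "k - 1 + 2 = k + 1" by simp_all
  thus ?thesis using ex[rule_format, of "k - 1"] unfolding a_exact_at_def a_kernel_def' by (simp only:)
 qed
 have Zm: "lmod R (Z k)" for k unfolding Z_def by (rule left_module.sub_left_module[OF Im sub])
 have dZ: "d k:Hom R (I k) (Z (k + 1))" for k
  unfolding Z_def by (rule hom_into_sub[OF d[rule_format]]) simp
 have s: "ses R (Z k) (\<lambda>x\<in>|Z k|. x) (I k) (d k) (Z (k + 1))" for k
 proof (rule sesI[OF Zm Im Zm _ dZ])
  show "(\<lambda>x\<in>|Z k|. x):Hom R (Z k) (I k)"
   using left_module.incl_hom[OF Im sub] by (simp add: Z_def)
  show "EX x:|Z k|. y = (\<lambda>x\<in>|Z k|. x) x" if "y\<in>|I k|" "d k y = 0\<^sub>(Z (k + 1))" for y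
   using that ker[of k] by (intro bexI[of _ y]) (simp_all add: Z_def)
 qed (use ker[of k] in \<open>simp_all add: Z_def inj_on_def\<close>)
 have e: "ext1_zero R J (Z k)" if J: "injm R J" for J :: "('a, 'u) module" and k
 proof -
  have Jm: "lmod R J" using J by (simp add: injective_module_def)
  show ?thesis
  proof (rule ext1_zero_of_injective[OF _ s Jm])
   show "injm R (I k)" using inj ..
   fix g assume g: "g:Hom R J (Z (k + 1))"
   have gc: "g x\<in>d k ` |I k|" if "x\<in>|J|" for x using hom_cl[OF g that] by (simp add: Z_def)
   have gI: "g:Hom R J (I (k + 1))"
    by (rule hom_from_sub[OF g[unfolded Z_def] left_module.submoduleD(1)[OF Im sub]])
   have "d (k + 1) (g x) = 0\<^sub>(I (k + 2))" if "x\<in>|J|" for x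
    using gc[OF that] ker[of "k + 1"] by (simp add: add.assoc)
   hence "compose |J| (d (k + 1)) g = \<one>\<^bsub>hom_group R J (I (k + 2))\<^esub>"
    by (auto simp: hom_group_def compose_def intro!: restrict_ext)
   hence "g\<in>kernel (hom_group R J (I (k + 1))) (hom_group R J (I (k + 2))) (compose |J| (d (k + 1)))"
    using gI by (simp add: kernel_def hom_group_def)
   hence "g\<in>compose |J| (d k) ` |hom_group R J (I k)|"
    using hex J unfolding exact_at_def by blast
   then obtain h where "h:Hom R J (I k)" "g = compose |J| (d k) h" by (auto simp: hom_group_def)
   thus "EX h:Hom R J (I k). ALL x:|J|. d k (h x) = g x" by (auto simp: compose_eq)
  qed
 qed
 have "biresolving R (lmod R) (range Z)"
  unfolding biresolving_def
 proof (intro ballI conjI)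
  fix N assume "N\<in>range Z"
  then obtain k where k: "N = Z k" by blast
  show "lmod R N" "\<forall>J :: ('a, 'u) module. injm R J --> ext1_zero R J N" using k Zm e by auto
  show "\<exists>i (I :: ('a, 'u) module) p M'. injm R I & lmod R I & ses R N i I p M' & M'\<in>range Z"
   using s[of k] inj Im k by blast
  show "\<exists>M' j (F :: ('a, 'u) module) q. injm R F & lmod R F & ses R M' j F q N & M'\<in>range Z"
  proof -
   have "ses R (Z (k - 1)) (\<lambda>x\<in>|Z (k - 1)|. x) (I (k - 1)) (d (k - 1)) N" using s[of "k - 1"] k by simp
   thus ?thesis using inj Im by blast
  qed
 qed
 moreover have Z0: "Z 0 = (I 0)(|carrier := d (- 1) ` |I (- 1)| |)" by (simp add: Z_def)
 obtain f where "f:Hom R M (Z 0)" "bij_betw f |M| |Z 0|"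
  using iso unfolding module_isomorphic_def Z0[symmetric] by (rule bexE)
 ultimately show ?thesis by blast
qed

text \<open>One cosyzygy and one syzygy inside the class are chosen for every member; iterating them
  from \<open>M\<close> gives short exact sequences that are spliced at the \<open>Z k\<close>.
  Exactness under Hom from \<open>E\<close> is lifting by \<open>ext1_zero\<close>, exactness under
  Hom into \<open>E\<close> comes from injectivity of \<open>E\<close>.\<close>

lemma Gorenstein_injective_of_biresolving:
 fixes C :: "('a, 'u) module set"
 assumes C: "biresolving R Q C" "M\<in>C" and inf: "infinite (UNIV :: 'u set)"
 shows "Gorenstein_injective R M"
proof -
 have "ALL N. EX N'. N\<in>C --> N'\<in>C & (\<exists>i (I :: ('a, 'u) module) p. injm R I & ses R N i I p N')"
  using biresolvingD(3)[OF C(1)] by blast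
 then obtain up where up: "ALL N. N\<in>C --> up N\<in>C & (\<exists>i (I :: ('a, 'u) module) p. injm R I & ses R N i I p (up N))"
  by (rule choice[THEN exE])
 have "ALL N. EX N'. N\<in>C --> N'\<in>C & (\<exists>i (I :: ('a, 'u) module) p. injm R I & ses R N' i I p N)"
  using biresolvingD(4)[OF C(1)] by blast
 then obtain dn where dn: "ALL N. N\<in>C --> dn N\<in>C & (\<exists>i (I :: ('a, 'u) module) p. injm R I & ses R (dn N) i I p N)"
  by (rule choice[THEN exE])
 \<comment> \<open>Nonnegative indices iterate cosyzygies and negative ones syzygies, so that
   \<open>Z 0 = M\<close> is embedded by \<open>i 0\<close> as the image of
   \<open>d (- 1)\<close>.\<close>
 define Z where "Z k = (if k \<ge> 0 then (up ^^ nat k) M else (dn ^^ nat (- k)) M)" for k :: int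
 have upC: "(up ^^ n) M\<in>C" and dnC: "(dn ^^ n) M\<in>C" for n using C(2) up dn by (induction n) auto
 have ZC: "Z k\<in>C" for k using upC dnC by (simp add: Z_def)
 have "\<exists>i (I :: ('a, 'u) module) p. injm R I & ses R (Z k) i I p (Z (k + 1))" for k
 proof (cases "k \<ge> 0")
  case True
  hence "Z (k + 1) = up (Z k)" by (simp add: Z_def nat_add_distrib)
  thus ?thesis using up ZC by simp
 next
  case False
  hence "nat (- k) = Suc (nat (- (k + 1)))" by simp
  hence "Z k = dn (Z (k + 1))" using False by (cases "k = - 1") (simp_all add: Z_def)
  thus ?thesis using dn ZC by simp
 qed
 hence "ALL k. EX t. case t of (i, I :: ('a, 'u) module, p) => injm R I & ses R (Z k) i I p (Z (k + 1))" by simp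
 then obtain t where t: "ALL k. case t k of (i, I :: ('a, 'u) module, p) => injm R I & ses R (Z k) i I p (Z (k + 1))"
  by (rule choice[THEN exE])
 define i where "i k = fst (t k)" for k
 define I where "I k = fst (snd (t k))" for k
 define p where "p k = snd (snd (t k))" for k
 have inj: "injm R (I k)" and s: "ses R (Z k) (i k) (I k) (p k) (Z (k + 1))" for k
  using t[rule_format, of k] by (simp_all add: i_def I_def p_def split: prod.splits)
 note S = sesD[OF s]
 have s': "ses R (Z (k + 1)) (i (k + 1)) (I (k + 1)) (p (k + 1)) (Z (k + 2))" for k using s[of "k + 1"] by (simp add: add.assoc)
 note S' = sesD[OF s']
 define d where "d k = compose |I k| (i (k + 1)) (p k)" for k
 have d: "d k:Hom R (I k) (I (k + 1))" for k unfolding d_def by (rule compose_hom[OF S(2) S(5) S'(4)])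
 have dx: "d k x = i (k + 1) (p k x)" if "x\<in>|I k|" for k x unfolding d_def by (rule compose_eq[OF that])
 have pc: "p k x\<in>|Z (k + 1)|" if "x\<in>|I k|" for k x by (rule hom_cl[OF S(5) that])
 have im: "d k ` |I k| = i (k + 1) ` |Z (k + 1)|" for k
  unfolding S(7)[symmetric] image_image by (rule image_cong[OF refl dx])
 have d0: "d k x = 0\<^sub>(I (k + 1)) <-> p k x = 0\<^sub>(Z (k + 1))" if "x\<in>|I k|" for k x
  unfolding dx[OF that] using inj_on_hom_iff[OF S'(1,2,4)] S'(6) pc[OF that] hom_zero[OF S'(1,2,4)] by metis
 have d0': "d (k + 1) x = 0\<^sub>(I (k + 2)) <-> x\<in>i (k + 1) ` |Z (k + 1)|" if "x\<in>|I (k + 1)|" for k x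
  using d0[OF that] that unfolding S'(8) by (simp add: add.assoc)
 have kern: "h\<in>kernel (hom_group R A B) (hom_group R A' B') f <-> h:Hom R A B & f h = (\<lambda>x\<in>|A'|. 0\<^sub>B')"
  for h f and A B A' B' :: "('a, 'u) module" by (simp add: kernel_def hom_group_def)
 show ?thesis
  unfolding Gorenstein_injective_def
 proof (intro conjI exI allI impI)
  show "lmod R M" using S(1)[of 0] by (simp add: Z_def)
  fix k
  show "injm R (I k)" by (rule inj)
  show "d k:Hom R (I k) (I (k + 1))" by (rule d)
  let ?b = "d (k + 1)"
  show "a_exact_at (I k) (d k) (I (k + 1)) ?b (I (k + 2))"
   unfolding a_exact_at_def a_kernel_def' im using d0'[of _ k] hom_cl[OF S'(4)] by blast
  fix E :: "('a, 'u) module" assume E: "injm R E"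
  have Em: "lmod R E" using E by (simp add: injective_module_def)
  let ?a = "kernel (hom_group R E (I (k + 1))) (hom_group R E (I (k + 2))) (compose |E| ?b)"
  show "exact_at (hom_group R E (I k)) (compose |E| (d k)) (hom_group R E (I (k + 1)))
     (compose |E| ?b) (hom_group R E (I (k + 2)))"
   unfolding exact_at_def
  proof (intro equalityI subsetI)
   fix f assume "f\<in>compose |E| (d k) ` |hom_group R E (I k)|"
   then obtain h where h: "h:Hom R E (I k)" "f = compose |E| (d k) h" by (auto simp: hom_group_def)
   have "compose |E| ?b f = (\<lambda>x\<in>|E|. 0\<^sub>(I (k + 2)))"
    unfolding compose_def
   proof (rule restrict_ext)
    fix x assume x: "x\<in>|E|"
    have "d k (h x)\<in>i (k + 1) ` |Z (k + 1)|" unfolding im[symmetric] by (rule imageI) (rule hom_cl[OF h(1) x])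
    thus "d (k + 1) (f x) = 0\<^sub>(I (k + 2))"
     unfolding h(2) compose_eq[OF x] d0'[OF hom_cl[OF d hom_cl[OF h(1) x]]] .
   qed
   thus "f\<in>?a"
    unfolding kern h(2) using compose_hom[OF Em h(1) d] by blast
  next
   fix f assume "f\<in>?a"
   hence f: "f:Hom R E (I (k + 1))" "compose |E| ?b f = (\<lambda>x\<in>|E|. 0\<^sub>(I (k + 2)))" unfolding kern by blast+
   have "f x\<in>i (k + 1) ` |Z (k + 1)|" if x: "x\<in>|E|" for x
    using fun_cong[OF f(2), of x] unfolding compose_eq[OF x] restrict_apply'[OF x] d0'[OF hom_cl[OF f(1) x]] .
   from factor_mono[OF S'(1) Em S'(4,6) f(1) this]
   obtain g where g: "g:Hom R E (Z (k + 1))" "ALL x:|E|. i (k + 1) (g x) = f x" by (rule bexE)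
   from ext1_zero_lift[OF biresolvingD(2)[OF C(1) ZC E] s g(1) Em inf]
   obtain h where h: "h:Hom R E (I k)" "ALL x:|E|. p k (h x) = g x" by (rule bexE)
   have "f = compose |E| (d k) h"
   proof (rule hom_eqI[OF f(1) compose_hom[OF Em h(1) d]])
    fix x assume x: "x\<in>|E|"
    show "f x = compose |E| (d k) h x"
     unfolding compose_eq[OF x] dx[OF hom_cl[OF h(1) x]] bspec[OF h(2) x] bspec[OF g(2) x] ..
   qed
   thus "f\<in>compose |E| (d k) ` |hom_group R E (I k)|" using h(1) by (auto simp: hom_group_def)
  qed
  let ?c = "kernel (hom_group R (I (k + 1)) E) (hom_group R (I k) E) (%g. compose |I k| g (d k))"
  show "exact_at (hom_group R (I (k + 2)) E) (%g. compose |I (k + 1)| g ?b)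
     (hom_group R (I (k + 1)) E) (%g. compose |I k| g (d k)) (hom_group R (I k) E)"
   unfolding exact_at_def
  proof (intro equalityI subsetI)
   fix f assume "f\<in>(%g. compose |I (k + 1)| g ?b) ` |hom_group R (I (k + 2)) E|"
   then obtain h where h: "h:Hom R (I (k + 2)) E" "f = compose |I (k + 1)| h ?b" by (auto simp: hom_group_def)
   have d1: "d (k + 1):Hom R (I (k + 1)) (I (k + 2))" using d[of "k + 1"] by (simp add: add.assoc)
   have "compose |I k| f (d k) = (\<lambda>x\<in>|I k|. 0\<^sub>E)"
    unfolding compose_def
   proof (rule restrict_ext)
    fix x assume x: "x\<in>|I k|"
    note dk = hom_cl[OF d x]
    have "d (k + 1) (d k x) = 0\<^sub>(I (k + 2))" unfolding d0'[OF dk] im[symmetric] using x by (rule imageI)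
    thus "f (d k x) = 0\<^sub>E" unfolding h(2) compose_eq[OF dk] using hom_zero[OF S(2)[of "k + 2"] Em h(1)] by simp
   qed
   thus "f\<in>?c"
    unfolding kern h(2) using compose_hom[OF S(2) d1 h(1)] by blast
  next
   fix f assume "f\<in>?c"
   hence f: "f:Hom R (I (k + 1)) E" "compose |I k| f (d k) = (\<lambda>x\<in>|I k|. 0\<^sub>E)" unfolding kern by blast+
   have "f x = 0\<^sub>E" if x: "x\<in>|I (k + 1)|" "p (k + 1) x = 0\<^sub>(Z (k + 2))" for x
   proof -
    have "x\<in>d k ` |I k|" unfolding im S'(8) using x by blast
    then obtain y where y: "y\<in>|I k|" "x = d k y" by blast
    show ?thesis using fun_cong[OF f(2), of y] unfolding compose_eq[OF y(1)] restrict_apply'[OF y(1)] y(2) .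
   qed
   from factor_surj[OF S'(2,3) Em S'(5,7) f(1) this]
   obtain g where g: "g:Hom R (Z (k + 2)) E" "ALL x:|I (k + 1)|. g (p (k + 1) x) = f x" by (rule bexE)
   obtain h where h: "h:Hom R (I (k + 2)) E" "!!x. x\<in>|Z (k + 2)| ==> h (i (k + 2) x) = g x"
    by (rule injectiveD[OF E S(1,2,4,6) g(1)]) blast
   have d1: "d (k + 1):Hom R (I (k + 1)) (I (k + 2))" using d[of "k + 1"] by (simp add: add.assoc)
   have "f = compose |I (k + 1)| h ?b"
   proof (rule hom_eqI[OF f(1) compose_hom[OF S(2) d1 h(1)]])
    fix x assume x: "x\<in>|I (k + 1)|"
    have "d (k + 1) x = i (k + 2) (p (k + 1) x)" using dx[OF x] by (simp add: add.assoc)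
    thus "f x = compose |I (k + 1)| h ?b x"
     unfolding compose_eq[OF x] using h(2)[OF hom_cl[OF S'(5) x]] bspec[OF g(2) x] by simp
   qed
   thus "f\<in>(%g. compose |I (k + 1)| g ?b) ` |hom_group R (I (k + 2)) E|"
    using h(1) by (auto simp: hom_group_def)
  qed
 next
  have Z0: "Z 0 = M" by (simp add: Z_def)
  have i0: "i 0 ` |M| = d (- 1) ` |I (- 1)|" using im[of "- 1"] Z0 by simp
  have "i 0:Hom R M ((I 0)(|carrier := d (- 1) ` |I (- 1)| |))"
   by (rule hom_into_sub) (use S(4)[of 0] Z0 i0 in auto)
  moreover have "bij_betw (i 0) |M| (d (- 1) ` |I (- 1)| )"
   using S(6)[of 0] Z0 i0 by (simp add: bij_betw_def)
  ultimately show "module_isomorphic R M ((I 0)(|carrier := d (- 1) ` |I (- 1)| |))"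
   unfolding module_isomorphic_def by auto
 qed
qed

context artin_alg
begin

text \<open>Modules that are direct summands, up to an injective summand, of modules in a biresolving class.\<close>

definition stable_retract :: "('a, 'u) module => bool"
 where "stable_retract M <-> fg_module La M &
  (\<exists>C (G :: ('a, 'u) module) a b (J :: ('a, 'u) module) a' b'. biresolving La (lmod La) C & G\<in>C & injm La J &
   a:Hom La M G & b:Hom La G M & a':Hom La M J & b':Hom La J M &
   (ALL x:|M|. b (a x)+\<^sub>M b' (a' x) = x))"

lemma stable_retractI:
 fixes M G J :: "('a, 'u) module"
 assumes "fg_module La M" "biresolving La (lmod La) C" "G\<in>C" "injm La J"
  "a:Hom La M G" "b:Hom La G M" "a':Hom La M J" "b':Hom La J M"
  "!!x. x\<in>|M| ==> b (a x)+\<^sub>M b' (a' x) = x"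
 shows "stable_retract M"
 unfolding stable_retract_def by (intro conjI exI ballI; (rule assms | assumption))

text \<open>A map into \<open>M\<close> splits into a part through \<open>G\<close> and a part
  through \<open>J\<close>; each part extends, and the extensions add up.\<close>

lemma stable_retract_ext1_zero:
 fixes M G J K :: "('a, 'u) module"
 assumes M: "lmod La M" and G: "ext1_zero La K G" and J: "injm La J"
  and h: "a:Hom La M G" "b:Hom La G M" "a':Hom La M J" "b':Hom La J M"
  and id: "!!x. x\<in>|M| ==> b (a x)+\<^sub>M b' (a' x) = x"
 shows "ext1_zero La K M"
 unfolding ext1_zero_def
proof (intro allI impI ballI)
 fix A B :: "('a, 'u) module" and i p f
 assume s: "ses La A i B p K" and f: "f:Hom La A M"
 note S = sesD[OF s]
 obtain g where g: "g:Hom La B G" "!!x. x\<in>|A| ==> g (i x) = compose |A| a f x"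
  by (rule ext1_zeroD[OF G s compose_hom[OF S(1) f h(1)]]) blast
 obtain k where k: "k:Hom La B J" "!!x. x\<in>|A| ==> k (i x) = compose |A| a' f x"
  by (rule injectiveD[OF J S(1,2,4,6) compose_hom[OF S(1) f h(3)]]) blast
 let ?e = "\<lambda>x\<in>|B|. compose |B| b g x+\<^sub>M compose |B| b' k x"
 have "?e:Hom La B M" by (rule add_hom[OF S(2) M compose_hom[OF S(2) g(1) h(2)] compose_hom[OF S(2) k(1) h(4)]])
 moreover have "?e (i x) = f x" if x: "x\<in>|A|" for x
  unfolding restrict_apply'[OF hom_cl[OF S(4) x]] compose_eq[OF hom_cl[OF S(4) x]]
   g(2)[OF x] k(2)[OF x] compose_eq[OF x] by (rule id[OF hom_cl[OF f x]])
 ultimately show "EX g:Hom La B M. ALL x:|A|. g (i x) = f x" by blast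
qed

text \<open>The maps \<open>a\<close> and \<open>b\<close> induce \<open>c\<close> and
  \<open>d\<close> between the cosyzygies. The defect \<open>v w + i b' u - 1\<close> on
  \<open>I\<close> vanishes on \<open>M\<close> and thus equals \<open>z p\<close>; applying
  \<open>p\<close> gives \<open>d c - p z = 1\<close> on \<open>M'\<close>, with \<open>I\<close> as
  the new injective summand.\<close>

lemma stable_retract_cosyzygy:
 fixes M :: "('a, 'u) module"
 assumes "stable_retract M"
 shows "\<exists>i (I :: ('a, 'u) module) p M'. injm La I & fg_module La I & ses La M i I p M' & stable_retract M'"
proof -
 obtain C and G :: "('a, 'u) module" and a b and J :: "('a, 'u) module" and a' b' where fg: "fg_module La M" and C: "biresolving La (lmod La) C" "G\<in>C"
  and J: "injm La J" and h: "a:Hom La M G" "b:Hom La G M" "a':Hom La M J" "b':Hom La J M"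
  and id: "ALL x:|M|. b (a x)+\<^sub>M b' (a' x) = x"
  using assms unfolding stable_retract_def by (elim conjE exE)
 obtain I :: "('a, 'u) module" and i and M' :: "('a, 'u) module" and p where I: "injm La I" "fg_module La I" "fg_module La M'"
  and s: "ses La M i I p M'" using ex_cosyzygy[OF fg] by (elim conjE exE)
 obtain j and L :: "('a, 'u) module" and q and G' :: "('a, 'u) module" where L: "injm La L" and t: "ses La G j L q G'" and G': "G'\<in>C"
  using biresolvingD(3)[OF C] by (elim conjE exE)
 note S = sesD[OF s] and T = sesD[OF t]
 interpret I: left_module La I by (rule S)
 interpret M': left_module La M' by (rule S)
 have Jm: "lmod La J" using J by (simp add: injective_module_def)
 obtain w where w: "w:Hom La I L" "!!x. x\<in>|M| ==> w (i x) = compose |M| j a x"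
  by (rule injectiveD[OF L S(1,2,4,6) compose_hom[OF S(1) h(1) T(4)]]) blast
 obtain v where v: "v:Hom La L I" "!!x. x\<in>|G| ==> v (j x) = compose |G| i b x"
  by (rule injectiveD[OF I(1) T(1,2,4,6) compose_hom[OF T(1) h(2) S(4)]]) blast
 obtain u where u: "u:Hom La I J" "!!x. x\<in>|M| ==> u (i x) = a' x"
  by (rule injectiveD[OF J S(1,2,4,6) h(3)]) blast
 note cl = hom_cl
 let ?g = "\<lambda>x\<in>|I|. (\<lambda>x\<in>|I|. compose |I| v w x+\<^sub>I compose |I| (compose |J| i b') u x) x
  -\<^sub>I (\<lambda>x\<in>|I|. x) x"
 have g: "?g:Hom La I I"
  by (rule minus_hom[OF S(2) S(2) add_hom[OF S(2) S(2) compose_hom[OF S(2) w(1) v(1)]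
    compose_hom[OF S(2) u(1) compose_hom[OF Jm h(4) S(4)]]] id_hom[OF S(2)]])
 have geq: "?g x = (v (w x)+\<^sub>I i (b' (u x)))-\<^sub>I x" if "x\<in>|I|" for x
  unfolding restrict_apply'[OF that] compose_eq[OF that] compose_eq[OF cl[OF u(1) that]] ..
 have "?g x = 0\<^sub>I" if x: "x\<in>|I|" "p x = 0\<^sub>M'" for x
 proof -
  obtain y where y: "y\<in>|M|" "x = i y" using S(10)[OF x] by blast
  have "v (w x) = i (b (a y))"
   unfolding y(2) w(2)[OF y(1)] compose_eq[OF y(1)] v(2)[OF cl[OF h(1) y(1)]] compose_eq[OF cl[OF h(1) y(1)]] ..
  moreover have "u x = a' y" unfolding y(2) by (rule u(2)[OF y(1)])
  ultimately have "v (w x)+\<^sub>I i (b' (u x)) = i (b (a y)+\<^sub>M b' (a' y))"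
   using hom_add[OF S(4) cl[OF h(2) cl[OF h(1) y(1)]] cl[OF h(4) cl[OF h(3) y(1)]]] by simp
  hence "v (w x)+\<^sub>I i (b' (u x)) = x" unfolding bspec[OF id y(1)] y(2) .
  thus ?thesis unfolding geq[OF x(1)] using I.diff_eq_zero_iff[OF x(1) x(1)] by simp
 qed
 from factor_surj[OF S(2,3,2,5,7) g this]
 obtain z where z: "z:Hom La M' I" "ALL x:|I|. z (p x) = ?g x" by (rule bexE)
 have "compose |I| q w x = 0\<^sub>G'" if x: "x\<in>|I|" "p x = 0\<^sub>M'" for x
 proof -
  obtain y where y: "y\<in>|M|" "x = i y" using S(10)[OF x] by blast
  show ?thesis unfolding compose_eq[OF x(1)] unfolding y(2) w(2)[OF y(1)] compose_eq[OF y(1)] by (rule T(9)[OF cl[OF h(1) y(1)]])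
 qed
 from factor_surj[OF S(2,3) T(3) S(5,7) compose_hom[OF S(2) w(1) T(5)] this]
 obtain c where c: "c:Hom La M' G'" "ALL x:|I|. c (p x) = compose |I| q w x" by (rule bexE)
 have "compose |L| p v x = 0\<^sub>M'" if x: "x\<in>|L|" "q x = 0\<^sub>G'" for x
 proof -
  obtain y where y: "y\<in>|G|" "x = j y" using T(10)[OF x] by blast
  show ?thesis unfolding compose_eq[OF x(1)] unfolding y(2) v(2)[OF y(1)] compose_eq[OF y(1)] by (rule S(9)[OF cl[OF h(2) y(1)]])
 qed
 from factor_surj[OF T(2,3) S(3) T(5,7) compose_hom[OF T(2) v(1) S(5)] this]
 obtain d where d: "d:Hom La G' M'" "ALL x:|L|. d (q x) = compose |L| p v x" by (rule bexE)
 have "stable_retract M'"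
 proof (rule stable_retractI[OF I(3) C(1) G' I(1) c(1) d(1) z(1) neg_hom[OF S(2,3,5)]])
  fix y assume "y\<in>|M'|"
  then obtain x where x: "x\<in>|I|" "y = p x" unfolding S(7)[symmetric] by blast
  have 1: "d (c y) = p (v (w x))"
   unfolding x(2) bspec[OF c(2) x(1)] compose_eq[OF x(1)] bspec[OF d(2) cl[OF w(1) x(1)]] compose_eq[OF cl[OF w(1) x(1)]] ..
  have m: "v (w x)\<in>|I|" "b' (u x)\<in>|M|" using cl[OF v(1) cl[OF w(1) x(1)]] cl[OF h(4) cl[OF u(1) x(1)]] .
  have s: "?g x\<in>|I|" by (rule cl[OF g x(1)])
  have "p (?g x) = (p (v (w x))+\<^sub>M' 0\<^sub>M')-\<^sub>M' p x"
   unfolding geq[OF x(1)] using hom_minus[OF S(2,3,5) I.M.a_closed[OF m(1) cl[OF S(4) m(2)]] x(1)]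
    hom_add[OF S(5) m(1) cl[OF S(4) m(2)]] S(9)[OF m(2)] by simp
  hence 2: "p (?g x) = p (v (w x))-\<^sub>M' y" using cl[OF S(5) m(1)] x(2) by simp
  have 3: "(\<lambda>x\<in>|I|. -\<^sub>M' p x) (z y) = -\<^sub>M' p (?g x)"
   unfolding x(2) bspec[OF z(2) x(1)] by (rule restrict_apply'[OF s])
  have "d (c y)+\<^sub>M' (\<lambda>x\<in>|I|. -\<^sub>M' p x) (z y) = p (v (w x))-\<^sub>M' (p (v (w x))-\<^sub>M' y)"
   unfolding 3 1 2 M'.M.minus_eq ..
  also have "... = y" using cl[OF S(5) m(1)] cl[OF S(5) x(1)] unfolding x(2)
   by (simp add: M'.M.minus_eq M'.M.minus_add M'.M.a_assoc[symmetric] M'.M.r_neg)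
  finally show "d (c y)+\<^sub>M' (\<lambda>x\<in>|I|. -\<^sub>M' p x) (z y) = y" .
 qed
 thus ?thesis using I(1,2) s by blast
qed

text \<open>Dual to the cosyzygy case, with lifts in place of extensions: maps from injective
  modules lift along the cover \<open>q\<close>, and \<open>a q\<close> lifts to \<open>L\<close>
  because Ext^1 of \<open>F\<close> and \<open>G'\<close> vanishes. The defect
  \<open>w v + u a' q - 1\<close> has values in the kernel \<open>K\<close>, whence
  \<open>d c - z j = 1\<close> there.\<close>

lemma stable_retract_syzygy:
 fixes M :: "('a, 'u) module"
 assumes "stable_retract M"
 shows "\<exists>M' j (F :: ('a, 'u) module) q. injm La F & fg_module La F & ses La M' j F q M & stable_retract M'"
proof -
 obtain C and G :: "('a, 'u) module" and a b and J :: "('a, 'u) module" and a' b' where fg: "fg_module La M" and C: "biresolving La (lmod La) C" "G\<in>C"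
  and J: "injm La J" and h: "a:Hom La M G" "b:Hom La G M" "a':Hom La M J" "b':Hom La J M"
  and id: "ALL x:|M|. b (a x)+\<^sub>M b' (a' x) = x"
  using assms unfolding stable_retract_def by (elim conjE exE)
 have M: "lmod La M" using fg by (simp add: fg_module_def)
 have Jm: "lmod La J" using J by (simp add: injective_module_def)
 obtain F :: "('a, 'u) module" and q where F: "injm La F" "fg_module La F" and q: "q:Hom La F M"
  and lift: "\<forall>(J :: ('a, 'u) module) g. injm La J & g:Hom La J M -->
   (EX h:Hom La J F. ALL x:|J|. q (h x) = g x)"
  using ex_injective_cover[OF fg] by (elim conjE exE)
 obtain G' :: "('a, 'u) module" and k and L :: "('a, 'u) module" and r where L: "injm La L" and t: "ses La G' k L r G" and G': "G'\<in>C"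
  using biresolvingD(4)[OF C] by (elim conjE exE)
 note T = sesD[OF t] and cl = hom_cl
 have Fm: "lmod La F" using F(2) by (simp add: fg_module_def)
 interpret M: left_module La M by (rule M)
 interpret F: left_module La F by (rule Fm)
 from ext1_zero_lift[OF biresolvingD(2)[OF C(1) G' F(1)] t compose_hom[OF Fm q h(1)] Fm infinite_univ]
 obtain v where v: "v:Hom La F L" "ALL x:|F|. r (v x) = compose |F| a q x" by (rule bexE)
 from lift[rule_format, OF conjI, OF L compose_hom[OF T(2,5) h(2)]]
 obtain w where w: "w:Hom La L F" "ALL x:|L|. q (w x) = compose |L| b r x" by (rule bexE)
 from lift[rule_format, OF conjI, OF J h(4)]
 obtain u where u: "u:Hom La J F" "ALL x:|J|. q (u x) = b' x" by (rule bexE)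
 \<comment> \<open>\<open>b\<close> and \<open>b'\<close> jointly cover \<open>M\<close>. Since
   \<open>b\<close> composed with the surjection \<open>r\<close> factors through \<open>q\<close>,
   and so does \<open>b'\<close>, the cover \<open>q\<close> is onto.\<close>
 have surj: "q ` |F| = |M|"
 proof
  show "q ` |F| <= |M|" using cl[OF q] by blast
  show "|M| <= q ` |F|"
  proof
   fix x assume x: "x\<in>|M|"
   obtain l where l: "l\<in>|L|" "r l = a x" using cl[OF h(1) x] unfolding T(7)[symmetric] by auto
   have m: "w l\<in>|F|" "u (a' x)\<in>|F|" using cl[OF w(1) l(1)] cl[OF u(1) cl[OF h(3) x]] .
   have "q (w l+\<^sub>F u (a' x)) = x"
    unfolding hom_add[OF q m] bspec[OF w(2) l(1)] compose_eq[OF l(1)] l(2) bspec[OF u(2) cl[OF h(3) x]] by (rule bspec[OF id x])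
   thus "x\<in>q ` |F|" using F.M.a_closed[OF m] by (intro image_eqI[of _ _ "w l+\<^sub>F u (a' x)"]) simp_all
  qed
 qed
 define K where "K = F(|carrier := a_kernel F M q|)"
 define j where "j = (\<lambda>x\<in>a_kernel F M q. x)"
 have s: "ses La K j F q M" unfolding K_def j_def by (rule ses_kernel[OF Fm M q surj])
 note S = sesD[OF s]
 have Kfg: "fg_module La K" using fg_noetherian[OF F(2)] submodule_kernel[OF Fm M q] by (simp add: noetherian_module_def K_def)
 let ?g = "\<lambda>x\<in>|F|. (\<lambda>x\<in>|F|. compose |F| w v x+\<^sub>F compose |F| u (compose |F| a' q) x) x
  -\<^sub>F (\<lambda>x\<in>|F|. x) x"
 have g: "?g:Hom La F F"
  by (rule minus_hom[OF Fm Fm add_hom[OF Fm Fm compose_hom[OF Fm v(1) w(1)]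
    compose_hom[OF Fm compose_hom[OF Fm q h(3)] u(1)]] id_hom[OF Fm]])
 have geq: "?g x = (w (v x)+\<^sub>F u (a' (q x)))-\<^sub>F x" if "x\<in>|F|" for x
  unfolding restrict_apply'[OF that] compose_eq[OF that] ..
 have "?g x\<in>j ` |K|" if x: "x\<in>|F|" for x
 proof -
  have c: "a' (q x)\<in>|J|" "v x\<in>|L|" using cl[OF h(3) cl[OF q x]] cl[OF v(1) x] .
  have m: "w (v x)\<in>|F|" "u (a' (q x))\<in>|F|" using cl[OF w(1) c(2)] cl[OF u(1) c(1)] .
  have "q (w (v x)+\<^sub>F u (a' (q x))) = b (a (q x))+\<^sub>M b' (a' (q x))"
   unfolding hom_add[OF q m] bspec[OF w(2) c(2)] compose_eq[OF c(2)] bspec[OF v(2) x] compose_eq[OF x] bspec[OF u(2) c(1)] ..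
  hence "q (?g x) = q x-\<^sub>M q x"
   unfolding geq[OF x] hom_minus[OF Fm M q F.M.a_closed[OF m] x] bspec[OF id cl[OF q x]] by simp
  hence "q (?g x) = 0\<^sub>M" using M.diff_eq_zero_iff[OF cl[OF q x] cl[OF q x]] by simp
  thus ?thesis unfolding S(8) using cl[OF g x] by blast
 qed
 from factor_mono[OF S(1,2,4,6) g this]
 obtain z where z: "z:Hom La F K" "ALL x:|F|. j (z x) = ?g x" by (rule bexE)
 have "compose |K| v j x\<in>k ` |G'|" if x: "x\<in>|K|" for x
  unfolding T(8) compose_eq[OF x]
 proof (intro CollectI conjI)
  show "v (j x)\<in>|L|" by (rule cl[OF v(1) cl[OF S(4) x]])
  show "r (v (j x)) = 0\<^sub>G"
   unfolding bspec[OF v(2) cl[OF S(4) x]] compose_eq[OF cl[OF S(4) x]] S(9)[OF x] by (rule hom_zero[OF M T(3) h(1)])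
 qed
 from factor_mono[OF T(1) S(1) T(4,6) compose_hom[OF S(1,4) v(1)] this]
 obtain c where c: "c:Hom La K G'" "ALL x:|K|. k (c x) = compose |K| v j x" by (rule bexE)
 have "compose |G'| w k x\<in>j ` |K|" if x: "x\<in>|G'|" for x
  unfolding S(8) compose_eq[OF x]
 proof (intro CollectI conjI)
  show "w (k x)\<in>|F|" by (rule cl[OF w(1) cl[OF T(4) x]])
  show "q (w (k x)) = 0\<^sub>M"
   unfolding bspec[OF w(2) cl[OF T(4) x]] compose_eq[OF cl[OF T(4) x]] T(9)[OF x] by (rule hom_zero[OF T(3) M h(2)])
 qed
 from factor_mono[OF S(1) T(1) S(4,6) compose_hom[OF T(1,4) w(1)] this]
 obtain d where d: "d:Hom La G' K" "ALL x:|G'|. j (d x) = compose |G'| w k x" by (rule bexE)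
 have "stable_retract K"
 proof (rule stable_retractI[OF Kfg C(1) G' F(1) c(1) d(1) S(4) neg_hom[OF Fm S(1) z(1)]])
  interpret K: left_module La K by (rule S)
  fix x assume x: "x\<in>|K|"
  let ?y = "j x"
  have y: "?y\<in>|F|" by (rule cl[OF S(4) x])
  have m: "w (v ?y)\<in>|F|" "d (c x)\<in>|K|" "z ?y\<in>|K|"
   using cl[OF w(1) cl[OF v(1) y]] cl[OF d(1) cl[OF c(1) x]] cl[OF z(1) y] .
  have 1: "j (d (c x)) = w (v ?y)"
   unfolding bspec[OF d(2) cl[OF c(1) x]] compose_eq[OF cl[OF c(1) x]] bspec[OF c(2) x] compose_eq[OF x] ..
  have "u (a' (q ?y)) = 0\<^sub>F" unfolding S(9)[OF x] using hom_zero[OF M Jm h(3)] hom_zero[OF Jm Fm u(1)] by simp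
  hence 2: "j (z ?y) = w (v ?y)-\<^sub>F ?y" unfolding bspec[OF z(2) y] geq[OF y] using m(1) by simp
  have "j (d (c x)-\<^sub>K z ?y) = w (v ?y)-\<^sub>F (w (v ?y)-\<^sub>F ?y)"
   unfolding hom_minus[OF S(1,2,4) m(2,3)] 1 2 ..
  also have "... = ?y" using m(1) y by (simp add: F.M.minus_eq F.M.minus_add F.M.a_assoc[symmetric] F.M.r_neg)
  finally have "d (c x)-\<^sub>K z ?y = x" by (rule inj_onD[OF S(6)]) (use m(2,3) x in simp_all)
  thus "d (c x)+\<^sub>K (\<lambda>x\<in>|F|. -\<^sub>K z x) (j x) = x" unfolding restrict_apply'[OF y] a_minus_def .
 qed
 thus ?thesis using F s by blast
qed

text \<open>The required class is that of all stable retracts. The isomorphism of \<open>M\<close>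
  with a cycle makes \<open>M\<close> a stable retract, with zero contribution from an arbitrary
  injective \<open>J\<close>.\<close>

lemma GI_iff_biresolving:
 fixes M :: "('a, 'u) module"
 shows "M\<in>GI La <-> (EX C. biresolving La (fg_module La) C & M\<in>C)"
proof
 assume "M\<in>GI La"
 hence M: "fg_module La M" "Gorenstein_injective La M" by (auto simp: GI_def fg_modules_def)
 have Mm: "lmod La M" using M(1) by (simp add: fg_module_def)
 obtain C and N :: "('a, 'u) module" and f where N: "biresolving La (lmod La) C" "N\<in>C" "f:Hom La M N" "bij_betw f |M| |N|"
  using Gorenstein_injective_biresolving[OF M(2)] by (elim conjE exE)
 have Nm: "lmod La N" by (rule biresolvingD(1)[OF N(1,2)])
 obtain g where "module_iso La M N f g" using module_iso_of_bij[OF Mm Nm N(3)] N(4) by (auto simp: bij_betw_def)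
 note D = module_isoD[OF this]
 obtain J :: "('a, 'u) module" where J: "injm La J" using biresolvingD(3)[OF N(1,2)] by blast
 have Jm: "lmod La J" using J by (simp add: injective_module_def)
 interpret M: left_module La M by (rule Mm)
 have "stable_retract M"
 proof (rule stable_retractI[OF M(1) N(1,2) J D(3,4) zero_hom[OF Mm Jm] zero_hom[OF Jm Mm]])
  fix x assume x: "x\<in>|M|"
  interpret J: left_module La J by (rule Jm)
  show "g (f x)+\<^sub>M (\<lambda>x\<in>|J|. 0\<^sub>M) ((\<lambda>x\<in>|M|. 0\<^sub>J) x) = x" using D(5)[OF x] x by simp
 qed
 moreover have "biresolving La (fg_module La) {M. stable_retract M}"
  unfolding biresolving_def mem_Collect_eq
 proof (intro ballI conjI allI impI stable_retract_cosyzygy stable_retract_syzygy)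
  fix M :: "('a, 'u) module" assume M: "M\<in>{M. stable_retract M}"
  thus "stable_retract M" "stable_retract M" "fg_module La M" by (simp_all add: stable_retract_def)
  fix K :: "('a, 'u) module" assume K: "injm La K"
  obtain C and G :: "('a, 'u) module" and a b and J :: "('a, 'u) module" and a' b' where fg: "fg_module La M" and C: "biresolving La (lmod La) C" "G\<in>C"
   and J: "injm La J" and h: "a:Hom La M G" "b:Hom La G M" "a':Hom La M J" "b':Hom La J M"
   and id: "ALL x:|M|. b (a x)+\<^sub>M b' (a' x) = x"
   using M unfolding stable_retract_def by (elim CollectE conjE exE)
  have "lmod La M" using fg by (simp add: fg_module_def)
  thus "ext1_zero La K M" by (rule stable_retract_ext1_zero[OF _ biresolvingD(2)[OF C K] J h]) (rule bspec[OF id])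
 qed
 ultimately show "EX C. biresolving La (fg_module La) C & M\<in>C" by blast
next
 assume "EX C. biresolving La (fg_module La) C & M\<in>C"
 then obtain C where C: "biresolving La (fg_module La) C" "M\<in>C" by blast
 show "M\<in>GI La"
  using biresolvingD(1)[OF C] Gorenstein_injective_of_biresolving[OF C infinite_univ] by (simp add: GI_def fg_modules_def)
qed

end

section \<open>The orthogonal classes of the Gorenstein injective modules\<close>

context artin_alg
begin

lemma fg_left_module: "fg_module La M ==> lmod La M"
 by (simp add: fg_module_def)

lemma mem_left_orthogonal:
 fixes M :: "('a, 'u) module"
 shows "M\<in>left_orthogonal La D <-> fg_module La M & (ALL N:D. ext_zero La M N)"
 by (auto simp: left_orthogonal_def fg_modules_def ext_zero_def)

lemma mem_right_orthogonal:
 fixes M :: "('a, 'u) module"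
 shows "M\<in>right_orthogonal La D <-> fg_module La M & (ALL N:D. ext_zero La N M)"
 by (auto simp: right_orthogonal_def fg_modules_def ext_zero_def)

lemma fg_ext_zero_shift:
 fixes M N J N' :: "('a, 'u) module"
 assumes "fg_module La M" "injm La J" "ses La N j J q N'"
 shows "ext_zero La M N <-> ext1_zero La M N & ext_zero La M N'"
 by (rule ext_zero_shift[OF fg_left_module[OF assms(1)] ex_proj_res[OF assms(1)] assms(2,3) infinite_univ])

lemma ext_zero_ext1_zero:
 fixes M N :: "('a, 'u) module"
 assumes "fg_module La M" "fg_module La N" "ext_zero La M N"
 shows "ext1_zero La M N"
proof -
 obtain F :: "('a, 'u) module" and u and F' :: "('a, 'u) module" and p where F: "injm La F" "ses La N u F p F'"
  using ex_cosyzygy[OF assms(2)] by blast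
 show ?thesis using fg_ext_zero_shift[OF assms(1) F] assms(3) by simp
qed

text \<open>The class itself supplies the cosyzygies demanded by
  \<open>ext_zero_coinduct\<close>.\<close>

lemma ext_zero_biresolving:
 fixes M N :: "('a, 'u) module"
 assumes "fg_module La M" "biresolving La Q C" "N\<in>C" "ALL N:C. ext1_zero La M N"
 shows "ext_zero La M N"
proof (rule ext_zero_coinduct[where C = "%N. N\<in>C", OF fg_left_module[OF assms(1)] ex_proj_res[OF assms(1)] infinite_univ assms(3)])
 fix N assume N: "N\<in>C"
 thus "ext1_zero La M N & (\<exists>(J :: ('a, 'u) module) j q N'. injm La J & ses La N j J q N' & N'\<in>C)"
  using biresolvingD(3)[OF assms(2) N] assms(4) by blast
qed

lemma injective_left_orthogonal:
 fixes J :: "('a, 'u) module"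
 assumes "fg_module La J" "injm La J"
 shows "J\<in>left_orthogonal La (GI La)"
 unfolding mem_left_orthogonal
proof (intro conjI ballI assms(1))
 fix N :: "('a, 'u) module" assume "N\<in>GI La"
 then obtain C where C: "biresolving La (fg_module La) C" "N\<in>C" unfolding GI_iff_biresolving by blast
 show "ext_zero La J N"
  by (rule ext_zero_biresolving[OF assms(1) C]) (intro ballI biresolvingD(2)[OF C(1) _ assms(2)])
qed

text \<open>A map from \<open>M\<close> to a member \<open>G\<close> of a biresolving class lifts to
  \<open>F\<close>, because the kernel \<open>G'\<close> is again Gorenstein injective, and the lift
  extends to \<open>I\<close> because \<open>F\<close> is injective. So every map from
  \<open>M\<close> to \<open>G\<close> extends to \<open>I\<close>, and Ext^1 of \<open>M'\<close>
  and \<open>G\<close> vanishes since that of \<open>I\<close> and \<open>G\<close> does.\<close>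

lemma cosyzygy_left_orthogonal:
 fixes M I M' :: "('a, 'u) module"
 assumes M: "M\<in>left_orthogonal La (GI La)" and I: "injm La I" "fg_module La I" and s: "ses La M i I p M'"
 shows "M'\<in>left_orthogonal La (GI La)"
 unfolding mem_left_orthogonal
proof (intro conjI ballI)
 note S = sesD[OF s]
 have fg: "fg_module La M" using M by (simp add: mem_left_orthogonal)
 show fg': "fg_module La M'" by (rule fg_image[OF I(2) S(3,5,7)])
 fix N :: "('a, 'u) module" assume "N\<in>GI La"
 then obtain C where C: "biresolving La (fg_module La) C" "N\<in>C" unfolding GI_iff_biresolving by blast
 have "ext1_zero La M' G" if G: "G\<in>C" for G
 proof -
  obtain j and J :: "('a, 'u) module" and q and Q :: "('a, 'u) module" where J: "injm La J" "ses La G j J q Q"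
   using biresolvingD(3)[OF C(1) G] by blast
  obtain G' :: "('a, 'u) module" and k and F :: "('a, 'u) module" and r where F: "injm La F" "ses La G' k F r G" and G': "G'\<in>C"
   using biresolvingD(4)[OF C(1) G] by blast
  note T = sesD[OF F(2)]
  have "G'\<in>GI La" unfolding GI_iff_biresolving using C(1) G' by blast
  hence e: "ext1_zero La M G'"
   using M ext_zero_ext1_zero[OF fg biresolvingD(1)[OF C(1) G']] by (simp add: mem_left_orthogonal)
  show ?thesis
  proof (rule ext1_zero_quotient[OF s biresolvingD(2)[OF C(1) G I(1)] J _ infinite_univ])
   fix f assume f: "f:Hom La M G"
   from ext1_zero_lift[OF e F(2) f S(1) infinite_univ]
   obtain h where h: "h:Hom La M F" "ALL x:|M|. r (h x) = f x" by (rule bexE)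
   obtain g where g: "g:Hom La I F" "!!x. x\<in>|M| ==> g (i x) = h x"
    by (rule injectiveD[OF F(1) S(1,2,4,6) h(1)]) blast
   have "compose |I| r g (i x) = f x" if x: "x\<in>|M|" for x
    unfolding compose_eq[OF hom_cl[OF S(4) x]] g(2)[OF x] by (rule bspec[OF h(2) x])
   thus "EX g:Hom La I G. ALL x:|M|. g (i x) = f x"
    by (intro bexI[OF _ compose_hom[OF S(2) g(1) T(5)]] ballI)
  qed
 qed
 thus "ext_zero La M' N" by (intro ext_zero_biresolving[OF fg' C] ballI)
qed

text \<open>The trace of D(\<open>La\<close>) in \<open>A\<close> is all of \<open>A\<close>,
  phrased without forming the sum of the images.\<close>

definition DL_generated :: "('a, 'm) module => bool"
 where "DL_generated A <->
  (ALL N. submodule N La A & (ALL f:Hom La DL A. f ` |DL| <= N) --> N = |A| )"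

text \<open>Generation by D(\<open>La\<close>) makes the cover \<open>F\<close> surjective, and its
  kernel \<open>K\<close> has to be orthogonal. For \<open>L\<close> left orthogonal, a map from
  \<open>L\<close> to \<open>A\<close> extends to \<open>I\<close>, as the cosyzygy
  \<open>L'\<close> is again left orthogonal, and then lifts to \<open>F\<close>. Hence Ext^1 of
  \<open>L\<close> and \<open>K\<close> vanishes, and the higher groups are those of
  \<open>L\<close> and \<open>A\<close> one degree lower.\<close>

lemma biresolving_double_orthogonal:
 defines "Y \<equiv> right_orthogonal La (left_orthogonal La (GI La :: ('a, 'u) module set))"
 assumes gen: "ALL A:Y. DL_generated A"
 shows "biresolving La (fg_module La) Y"
 unfolding biresolving_def
proof (intro ballI conjI)
 fix A assume A: "A\<in>Y"
 thus fg: "fg_module La A" by (simp add: Y_def mem_right_orthogonal)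
 have perp: "ext_zero La L A" if "L\<in>left_orthogonal La (GI La)" for L
  using A that by (simp add: Y_def mem_right_orthogonal)
 have fgL: "fg_module La L" if "L\<in>left_orthogonal La (GI La)" for L :: "('a, 'u) module"
  using that by (simp add: mem_left_orthogonal)
 have perp1: "ext1_zero La L A" if "L\<in>left_orthogonal La (GI La)" for L
  by (rule ext_zero_ext1_zero[OF fgL[OF that] fg perp[OF that]])
 show "\<forall>J :: ('a, 'u) module. injm La J --> ext1_zero La J A"
 proof (intro allI impI)
  fix J :: "('a, 'u) module" assume "injm La J"
  thus "ext1_zero La J A" by (rule ext1_zero_injective[OF fg]) (rule perp1[OF injective_left_orthogonal])
 qed
 show "\<exists>i (I :: ('a, 'u) module) p M'. injm La I & fg_module La I & ses La A i I p M' & M'\<in>Y"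
 proof -
  obtain I :: "('a, 'u) module" and i and A' :: "('a, 'u) module" and p where I: "injm La I" "fg_module La I" "fg_module La A'"
   and s: "ses La A i I p A'" using ex_cosyzygy[OF fg] by (elim conjE exE)
  have "ext_zero La L A'" if "L\<in>left_orthogonal La (GI La)" for L
   using fg_ext_zero_shift[OF fgL[OF that] I(1) s] perp[OF that] by blast
  hence "A'\<in>Y" using I(3) by (simp add: Y_def mem_right_orthogonal)
  thus ?thesis using I(1,2) s by blast
 qed
 show "\<exists>K j (F :: ('a, 'u) module) q. injm La F & fg_module La F & ses La K j F q A & K\<in>Y"
 proof -
  note Am = fg_left_module[OF fg]
  obtain F :: "('a, 'u) module" and q where F: "injm La F" "fg_module La F" and q: "q:Hom La F A"
   and cov: "ALL f:Hom La DL A. f ` |DL| <= q ` |F|"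
   and lift: "\<forall>(J :: ('a, 'u) module) g. injm La J & g:Hom La J A -->
    (EX h:Hom La J F. ALL x:|J|. q (h x) = g x)"
   using ex_injective_cover[OF fg] by (elim conjE exE)
  note Fm = fg_left_module[OF F(2)]
  have "submodule (q ` |F| ) La A" by (rule submodule_image[OF Fm Am q left_module.submodule_carrier[OF Fm]])
  from bspec[OF gen A, unfolded DL_generated_def, THEN spec, THEN mp, OF conjI, OF this cov]
  have surj: "q ` |F| = |A|" .
  define K where "K = F(|carrier := a_kernel F A q|)"
  define j where "j = (\<lambda>x\<in>a_kernel F A q. x)"
  have s: "ses La K j F q A" unfolding K_def j_def by (rule ses_kernel[OF Fm Am q surj])
  have Kfg: "fg_module La K" using fg_noetherian[OF F(2)] submodule_kernel[OF Fm Am q] by (simp add: noetherian_module_def K_def)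
  have "ext_zero La L K" if L: "L\<in>left_orthogonal La (GI La)" for L
  proof -
   obtain I :: "('a, 'u) module" and i and L' :: "('a, 'u) module" and p where I: "injm La I" "fg_module La I"
    and t: "ses La L i I p L'" using ex_cosyzygy[OF fgL[OF L]] by (elim conjE exE)
   note T = sesD[OF t]
   have e: "ext1_zero La L' A" by (rule perp1[OF cosyzygy_left_orthogonal[OF L I t]])
   have "ext1_zero La L K"
   proof (rule ext1_zero_of_injective[OF F(1) s T(1)])
    fix f assume f: "f:Hom La L A"
    obtain g where g: "g:Hom La I A" "!!x. x\<in>|L| ==> g (i x) = f x"
     by (rule ext1_zeroD[OF e t f]) blast
    from lift[rule_format, OF conjI, OF I(1) g(1)]
    obtain h where h: "h:Hom La I F" "ALL x:|I|. q (h x) = g x" by (rule bexE)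
    have "q (compose |L| h i x) = f x" if x: "x\<in>|L|" for x
     unfolding compose_eq[OF x] bspec[OF h(2) hom_cl[OF T(4) x]] by (rule g(2)[OF x])
    thus "EX h:Hom La L F. ALL x:|L|. q (h x) = f x"
     by (intro bexI[OF _ compose_hom[OF T(1,4) h(1)]] ballI)
   qed
   thus ?thesis using fg_ext_zero_shift[OF fgL[OF L] F(1) s] perp[OF L] by blast
  qed
  hence "K\<in>Y" using Kfg by (simp add: Y_def mem_right_orthogonal)
  thus ?thesis using F s by blast
 qed
qed

lemma GI_subset_double_orthogonal: "GI La <= right_orthogonal La (left_orthogonal La (GI La :: ('a, 'u) module set))"
proof
 fix M :: "('a, 'u) module" assume "M\<in>GI La"
 hence "fg_module La M" by (simp add: GI_def fg_modules_def)
 thus "M\<in>right_orthogonal La (left_orthogonal La (GI La))"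
  unfolding mem_right_orthogonal Ball_def mem_left_orthogonal using \<open>M \<in> GI La\<close> by blast
qed

end

section \<open>Tensor products with \<open>D\<Lambda>\<close>\<close>

text \<open>What \<open>tensor_map\<close> does on representatives in the free abelian group. Tensor
  computations are carried out on such representatives modulo relations, not on cosets.\<close>

definition Tmap :: "('m => 'm2) => ('n\<times>'m \<Rightarrow>\<^sub>0 int) => ('n\<times>'m2 \<Rightarrow>\<^sub>0 int)"
 where "Tmap g = frag_extend (%(x, y). frag_of (x, g y))"

lemma Tmap_simps [simp]: "Tmap g (frag_of (x, y)) = frag_of (x, g y)" "Tmap g 0 = 0"
 "Tmap g (u - v) = Tmap g u - Tmap g v" "Tmap g (u + v) = Tmap g u + Tmap g v"
 by (simp_all add: Tmap_def frag_extend_diff frag_extend_add)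

context artin_alg
begin

declare DR_simps(2-4) [simp del]

definition TG :: "('a, 'm) module => (('a => 'u)\<times>'m \<Rightarrow>\<^sub>0 int) monoid"
 where "TG M = free_Abelian_group (Hom R La E\<times>|M| )"

definition TF :: "('a, 'm) module => (('a => 'u)\<times>'m \<Rightarrow>\<^sub>0 int) set"
 where "TF M = {u. Poly_Mapping.keys u <= Hom R La E\<times>|M| }"

abbreviation TK :: "('a, 'm) module => (('a => 'u) \<times> 'm \<Rightarrow>\<^sub>0 int) set"
 where "TK M \<equiv> tensor_kernel La DR M"

lemma TG_simps [simp]: "|TG M| = TF M" "\<one>\<^bsub>TG M\<^esub> = 0" "u\<otimes>\<^sub>(TG M) v = u + v"
 "u\<in>TF M ==> inv\<^bsub>TG M\<^esub> u = - u"
 and TG_comm_group: "comm_group (TG M)" and TG_group: "group (TG M)"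
 by (auto simp: TG_def TF_def abelian_free_Abelian_group)

lemma tensor_TG: "tensor La DR M = TG M Mod TK M" "TK M = generate (TG M) (tensor_relations La DR M)"
 "tensor_map La DR N g U = (\<Union>u\<in>U. TK N #>\<^bsub>TG N\<^esub> Tmap g u)"
 by (simp_all add: tensor_def tensor_kernel_def tensor_map_def TG_def Tmap_def)

lemma TF_induct [consumes 1, case_names zero one diff]:
 assumes "u\<in>TF M" "P 0" "!!x y. x:Hom R La E ==> y\<in>|M| ==> P (frag_of (x, y))"
  and "!!u v. u\<in>TF M ==> v\<in>TF M ==> P u ==> P v ==> P (u - v)"
 shows "P u"
 by (rule free_Abelian_group_induct[of u "Hom R La E\<times>|M|" P]) (use assms in \<open>auto simp: TF_def\<close>)

lemma TF_closed [intro, simp]: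
 "u\<in>TF M ==> v\<in>TF M ==> u - v\<in>TF M" "u\<in>TF M ==> v\<in>TF M ==> u + v\<in>TF M"
 "u\<in>TF M ==> - u\<in>TF M" "0\<in>TF M"
 "x:Hom R La E ==> y\<in>|M| ==> frag_of (x, y)\<in>TF M"
 using keys_diff[of u v] Poly_Mapping.keys_add[of u v] by (auto simp: TF_def)

lemma DR_add_closed: "x:Hom R La E ==> x':Hom R La E ==> x+\<^sub>DR x':Hom R La E"
 unfolding DR_simps by (rule add_hom[OF L_Rmodule E_module])

context
 fixes M :: "('a, 'm) module"
 assumes M: "lmod La M"
begin

lemma TK_relations: "tensor_relations La DR M <= TF M"
proof -
 interpret M: left_module La M by (rule M)
 show ?thesis
  unfolding tensor_relations_def by (auto intro!: TF_closed DR_add_closed DR_smult_closed)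
qed

lemma TK_subgroup: "subgroup (TK M) (TG M)"
 unfolding tensor_TG(2) by (rule group.generate_is_subgroup[OF TG_group]) (simp add: TK_relations)

lemma TK_closed: "u\<in>TK M ==> u\<in>TF M" "0\<in>TK M"
 "u\<in>TK M ==> v\<in>TK M ==> u + v\<in>TK M" "u\<in>TK M ==> - u\<in>TK M"
 "u\<in>TK M ==> v\<in>TK M ==> u - v\<in>TK M"
proof -
 note S = TK_subgroup
 show c: "u\<in>TK M ==> u\<in>TF M" for u using subsetD[OF subgroup.subset[OF S], of u] by simp
 show "0\<in>TK M" using subgroup.one_closed[OF S] by simp
 show add: "u + v\<in>TK M" if "u\<in>TK M" "v\<in>TK M" for u v using subgroup.m_closed[OF S that] by simp
 show neg: "- u\<in>TK M" if "u\<in>TK M" for u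
  using subgroup.m_inv_closed[OF S that] unfolding TG_simps(4)[OF c[OF that]] .
 show "u - v\<in>TK M" if "u\<in>TK M" "v\<in>TK M" using add[OF that(1) neg[OF that(2)]] by simp
qed

lemma TK_rel:
 "x:Hom R La E ==> x':Hom R La E ==> y\<in>|M| ==>
  frag_of (x+\<^sub>DR x', y) - frag_of (x, y) - frag_of (x', y)\<in>TK M"
 "x:Hom R La E ==> y\<in>|M| ==> y'\<in>|M| ==>
  frag_of (x, y+\<^sub>M y') - frag_of (x, y) - frag_of (x, y')\<in>TK M"
 "a\<in>|La| ==> x:Hom R La E ==> y\<in>|M| ==>
  frag_of (a*\<^sub>DR x, y) - frag_of (x, a*\<^sub>M y)\<in>TK M"
proof -
 have r: "r\<in>tensor_relations La DR M ==> r\<in>TK M" for r unfolding tensor_TG(2) by (rule generate.incl)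
 show "x:Hom R La E ==> x':Hom R La E ==> y\<in>|M| ==>
  frag_of (x+\<^sub>DR x', y) - frag_of (x, y) - frag_of (x', y)\<in>TK M"
  by (rule r) (unfold tensor_relations_def DR_simps(1), blast)
 show "x:Hom R La E ==> y\<in>|M| ==> y'\<in>|M| ==>
  frag_of (x, y+\<^sub>M y') - frag_of (x, y) - frag_of (x, y')\<in>TK M"
  by (rule r) (unfold tensor_relations_def DR_simps(1), blast)
 show "a\<in>|La| ==> x:Hom R La E ==> y\<in>|M| ==>
  frag_of (a*\<^sub>DR x, y) - frag_of (x, a*\<^sub>M y)\<in>TK M"
  by (rule r) (unfold tensor_relations_def DR_simps(1), blast)
qed

lemma comm_group_tensor: "comm_group (tensor La DR M)"
 unfolding tensor_TG(1) by (rule comm_group.abelian_FactGroup[OF TG_comm_group TK_subgroup])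

lemma coset_eq: "TK M #>\<^bsub>TG M\<^esub> u = TK M #>\<^bsub>TG M\<^esub> v <-> u - v\<in>TK M"
proof
 assume "TK M #>\<^bsub>TG M\<^esub> u = TK M #>\<^bsub>TG M\<^esub> v"
 moreover have "0 + u\<in>TK M #>\<^bsub>TG M\<^esub> u" using TK_closed(2) unfolding r_coset_def by force
 ultimately obtain k where "k\<in>TK M" "u = k + v" unfolding r_coset_def by auto
 thus "u - v\<in>TK M" by simp
next
 have *: "TK M #>\<^bsub>TG M\<^esub> u <= TK M #>\<^bsub>TG M\<^esub> v" if "u - v\<in>TK M" for u v
 proof
  fix w assume "w\<in>TK M #>\<^bsub>TG M\<^esub> u"
  then obtain k where k: "k\<in>TK M" "w = k + u" unfolding r_coset_def by auto
  hence "w = (k + (u - v)) + v" by simp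
  thus "w\<in>TK M #>\<^bsub>TG M\<^esub> v" unfolding r_coset_def using TK_closed(3)[OF k(1) that] by fastforce
 qed
 assume "u - v\<in>TK M"
 thus "TK M #>\<^bsub>TG M\<^esub> u = TK M #>\<^bsub>TG M\<^esub> v" using *[of u v] *[of v u] TK_closed(4)[of "u - v"] by simp
qed

end

text \<open>Closure under differences covers the inverse and product cases of
  \<open>generate\<close>. Since relations exist, 0 is the difference of a relation with
  itself.\<close>

lemma TK_induct [consumes 2, case_names rel diff]:
 assumes M: "lmod La M" and "u\<in>TK M" and rel: "!!r. r\<in>tensor_relations La DR M ==> P r"
  and diff: "!!u v. u\<in>TF M ==> v\<in>TF M ==> P u ==> P v ==> P (u - v)"
 shows "P u"
proof -
 have "P 0"
 proof -
  have "0\<^sub>M\<in>|M|" by (rule left_module.submoduleD(3)[OF M left_module.submodule_carrier[OF M]])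
  moreover have "(\<lambda>x\<in>|La|. 0\<^sub>E):Hom R La E" by (rule zero_hom[OF L_Rmodule E_module])
  ultimately have "EX r. r\<in>tensor_relations La DR M" unfolding tensor_relations_def by auto
  then obtain r where r: "r\<in>tensor_relations La DR M" ..
  hence "r\<in>TF M" using TK_relations[OF M] by (rule subsetD[rotated])
  from diff[OF this this rel[OF r] rel[OF r]] show ?thesis by simp
 qed
 have "u\<in>TF M & P u" using assms(2) unfolding tensor_TG(2)
 proof (induction rule: generate.induct)
  case one
  thus ?case using \<open>P 0\<close> by simp
 next
  case (incl h)
  thus ?case using rel TK_relations[OF M] by blast
 next
  case (inv h)
  hence h: "h\<in>TF M" "P h" using rel TK_relations[OF M] by blast+
  thus ?case using diff[OF TF_closed(4) h(1) \<open>P 0\<close> h(2)] by simp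
 next
  case (eng h1 h2)
  hence "P (h1 - (0 - h2))" by (intro diff TF_closed \<open>P 0\<close>) simp_all
  thus ?case using eng by simp
 qed
 thus ?thesis ..
qed

lemma tensor_carrier: "|tensor La DR M| = (%u. TK M #>\<^bsub>TG M\<^esub> u) ` TF M"
 by (simp add: tensor_TG(1) carrier_FactGroup)

lemma tensor_mult:
 assumes "lmod La M" "u\<in>TF M" "v\<in>TF M"
 shows "(TK M #>\<^bsub>TG M\<^esub> u)\<otimes>\<^sub>(tensor La DR M) (TK M #>\<^bsub>TG M\<^esub> v) = TK M #>\<^bsub>TG M\<^esub> (u + v)"
proof -
 interpret comm_group "TG M" by (rule TG_comm_group)
 have "TK M \<lhd> TG M" by (rule subgroup_imp_normal[OF TK_subgroup[OF assms(1)]])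
 from normal.rcos_sum[OF this, of u v] assms show ?thesis unfolding tensor_TG(1) by simp
qed

lemma Tmap_closed:
 assumes "g:Hom La M N" "u\<in>TF M"
 shows "Tmap g u\<in>TF N"
 using assms(2) by (induction rule: TF_induct) (auto intro: hom_cl[OF assms(1)])

lemma Tmap_comp:
 assumes "ALL y:|M|. h y = g (f y)" "u\<in>TF M"
 shows "Tmap h u = Tmap g (Tmap f u)"
 using assms(2) by (induction rule: TF_induct) (simp_all add: assms(1))

lemma Tmap_TK:
 assumes "lmod La M" "lmod La N" "g:Hom La M N" "u\<in>TK M"
 shows "Tmap g u\<in>TK N"
 using assms(1,4)
proof (induction rule: TK_induct)
 case (rel r)
 note g = hom_cl[OF assms(3)]
 from rel consider (1) x x' y where "r = frag_of (x+\<^sub>DR x', y) - frag_of (x, y) - frag_of (x', y)" "x\<in>|DR|" "x'\<in>|DR|" "y\<in>|M|"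
  | (2) x y y' where "r = frag_of (x, y+\<^sub>M y') - frag_of (x, y) - frag_of (x, y')" "x\<in>|DR|" "y\<in>|M|" "y'\<in>|M|"
  | (3) a x y where "r = frag_of (a*\<^sub>DR x, y) - frag_of (x, a*\<^sub>M y)" "a\<in>|La|" "x\<in>|DR|" "y\<in>|M|"
  unfolding tensor_relations_def by blast
 thus ?case
 proof cases
  case 1
  thus ?thesis using TK_rel(1)[OF assms(2), of x x' "g y"] g by simp
 next
  case 2
  thus ?thesis using TK_rel(2)[OF assms(2), of x "g y" "g y'"] g hom_add[OF assms(3)] by simp
 next
  case 3
  thus ?thesis using TK_rel(3)[OF assms(2), of a x "g y"] g hom_smult[OF assms(3)] by simp
 qed
next
 case (diff u v)
 thus ?case using TK_closed(5)[OF assms(2)] by simp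
qed

lemma tensor_map_coset:
 assumes "lmod La M" "lmod La N" "g:Hom La M N"
 shows "tensor_map La DR N g (TK M #>\<^bsub>TG M\<^esub> u) = TK N #>\<^bsub>TG N\<^esub> Tmap g u"
proof -
 have "TK N #>\<^bsub>TG N\<^esub> Tmap g w = TK N #>\<^bsub>TG N\<^esub> Tmap g u" if w: "w\<in>TK M #>\<^bsub>TG M\<^esub> u" for w
 proof -
  obtain k where "k\<in>TK M" "w = k + u" using w unfolding r_coset_def by auto
  thus ?thesis using coset_eq[OF assms(2), of "Tmap g w" "Tmap g u"] Tmap_TK[OF assms] by simp
 qed
 moreover have "TK M #>\<^bsub>TG M\<^esub> u ~= {}" using TK_closed(2)[OF assms(1)] unfolding r_coset_def by blast
 ultimately show ?thesis unfolding tensor_TG(3) by (simp cong: SUP_cong)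
qed

lemma tensor_map_hom:
 assumes "lmod La M" "lmod La N" "g:Hom La M N"
 shows "tensor_map La DR N g\<in>hom (tensor La DR M) (tensor La DR N)"
proof (rule homI)
 note tm = tensor_map_coset[OF assms]
 fix c assume "c\<in>|tensor La DR M|"
 then obtain u where u: "u\<in>TF M" "c = TK M #>\<^bsub>TG M\<^esub> u" unfolding tensor_carrier by blast
 show "tensor_map La DR N g c\<in>|tensor La DR N|"
  unfolding u(2) tm tensor_carrier by (rule imageI) (rule Tmap_closed[OF assms(3) u(1)])
 fix d assume "d\<in>|tensor La DR M|"
 then obtain v where v: "v\<in>TF M" "d = TK M #>\<^bsub>TG M\<^esub> v" unfolding tensor_carrier by blast
 show "tensor_map La DR N g (c\<otimes>\<^sub>(tensor La DR M) d) = tensor_map La DR N g c\<otimes>\<^sub>(tensor La DR N) tensor_map La DR N g d"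
  unfolding u(2) v(2) tensor_mult[OF assms(1) u(1) v(1)] tm tensor_mult[OF assms(2) Tmap_closed[OF assms(3) u(1)] Tmap_closed[OF assms(3) v(1)]] Tmap_simps ..
qed

text \<open>Elements of the tensor groups are cosets of \<open>TK\<close>, so kernel and image of
  the tensored maps can be described by representatives. Tor is used below in this form
  only.\<close>

lemma tensor_homology_iff:
 assumes m: "lmod La A" "lmod La B" "lmod La C" and f: "f:Hom La A B" and g: "g:Hom La B C"
  and gf: "!!x. x\<in>|A| ==> g (f x) = 0\<^sub>C"
 shows "trivial_group (homology (tensor La DR A) (tensor_map La DR B f) (tensor La DR B) (tensor_map La DR C g) (tensor La DR C)) <->
  (ALL u:TF B. Tmap g u\<in>TK C --> (EX v:TF A. u - Tmap f v\<in>TK B))"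
proof -
 interpret C: left_module La C by (rule m)
 note one = TK_closed(2)[OF m(3)]
 let ?d = "tensor La DR C"
 have C1: "TK C #>\<^bsub>TG C\<^esub> u = \<one>\<^bsub>?d\<^esub> <-> u\<in>TK C" for u
 proof -
  have "\<one>\<^bsub>?d\<^esub> = TK C #>\<^bsub>TG C\<^esub> 0" by (simp add: tensor_TG(1) r_coset_def)
  thus ?thesis using coset_eq[OF m(3), of u 0] by simp
 qed
 have z: "Tmap g (Tmap f v)\<in>TK C" if "v\<in>TF A" for v
  using that
 proof (induction rule: TF_induct)
  case (one x y)
  have "frag_of (x, 0\<^sub>C+\<^sub>C 0\<^sub>C) - frag_of (x, 0\<^sub>C) - frag_of (x, 0\<^sub>C)\<in>TK C"
   by (rule TK_rel(2)[OF m(3) one(1)]) simp_all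
  from TK_closed(4)[OF m(3) this] show ?case using gf[OF one(2)] by simp
 qed (use TK_closed[OF m(3)] in auto)
 let ?a = "%u. TK B #>\<^bsub>TG B\<^esub> u"
 let ?b = "%v. TK B #>\<^bsub>TG B\<^esub> Tmap f v"
 let ?e = "tensor_map La DR C g"
 let ?f = "tensor La DR B"
 let ?g = "tensor La DR A"
 have "trivial_group (homology ?g (tensor_map La DR B f) ?f ?e ?d) <->
  exact_at ?g (tensor_map La DR B f) ?f ?e ?d"
 proof (rule trivial_homology_iff[OF _ comm_group_tensor[OF m(2)] _ tensor_map_hom[OF m(1,2) f] tensor_map_hom[OF m(2,3) g]])
  show "group ?g" "group ?d" using comm_group_tensor m(1,3) by (auto simp: comm_group_def)
  fix c assume "c\<in>|tensor La DR A|"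
  then obtain v where v: "v\<in>TF A" "c = TK A #>\<^bsub>TG A\<^esub> v" unfolding tensor_carrier by blast
  show "tensor_map La DR C g (tensor_map La DR B f c) = \<one>\<^bsub>?d\<^esub>"
   unfolding v(2) tensor_map_coset[OF m(1,2) f] tensor_map_coset[OF m(2,3) g] C1 by (rule z[OF v(1)])
 qed
 also have "... <-> ?b ` TF A = ?a ` {u\<in>TF B. Tmap g u\<in>TK C}"
 proof -
  have "kernel ?f ?d ?e =
    ?a ` {u\<in>TF B. tensor_map La DR C g (TK B #>\<^bsub>TG B\<^esub> u) = \<one>\<^bsub>?d\<^esub>}"
   unfolding kernel_def tensor_carrier by blast
  also have "... = ?a ` {u\<in>TF B. Tmap g u\<in>TK C}"
   unfolding tensor_map_coset[OF m(2,3) g] C1 ..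
  finally have "kernel ?f ?d ?e = ?a ` {u\<in>TF B. Tmap g u\<in>TK C}" .
  thus ?thesis unfolding exact_at_def tensor_carrier image_image tensor_map_coset[OF m(1,2) f] by simp
 qed
 also have "... <-> (ALL u:TF B. Tmap g u\<in>TK C --> (EX v:TF A. u - Tmap f v\<in>TK B))"
 proof
  assume eq: "?b ` TF A = ?a ` {u\<in>TF B. Tmap g u\<in>TK C}"
  show "ALL u:TF B. Tmap g u\<in>TK C --> (EX v:TF A. u - Tmap f v\<in>TK B)"
  proof (intro ballI impI)
   fix u assume "u\<in>TF B" "Tmap g u\<in>TK C"
   hence "TK B #>\<^bsub>TG B\<^esub> u\<in>?b ` TF A" unfolding eq by (intro imageI CollectI conjI)
   thus "EX v:TF A. u - Tmap f v\<in>TK B" using coset_eq[OF m(2)] by (elim imageE) (rule bexI, simp_all only:)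
  qed
 next
  assume h: "ALL u:TF B. Tmap g u\<in>TK C --> (EX v:TF A. u - Tmap f v\<in>TK B)"
  show "?b ` TF A = ?a ` {u\<in>TF B. Tmap g u\<in>TK C}"
  proof (intro equalityI image_subsetI)
   fix v assume v: "v\<in>TF A"
   show "TK B #>\<^bsub>TG B\<^esub> Tmap f v\<in>?a ` {u\<in>TF B. Tmap g u\<in>TK C}"
    using Tmap_closed[OF f v] z[OF v] by (intro imageI CollectI conjI)
  next
   fix u assume "u\<in>{u\<in>TF B. Tmap g u\<in>TK C}"
   then obtain v where v: "v\<in>TF A" "u - Tmap f v\<in>TK B" using h by blast
   show "TK B #>\<^bsub>TG B\<^esub> u\<in>?b ` TF A"
    using v unfolding coset_eq[OF m(2), symmetric] by (rule image_eqI[rotated])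
  qed
 qed
 finally show ?thesis .
qed

text \<open>Additivity in the homomorphism holds only modulo relations, by distributivity in the
  second factor.\<close>

lemma Tmap_add:
 assumes "lmod La N" "f:Hom La M N" "g:Hom La M N"
  and "ALL y:|M|. h y = f y+\<^sub>N g y" "u\<in>TF M"
 shows "Tmap h u - Tmap f u - Tmap g u\<in>TK N"
 using assms(5)
proof (induction rule: TF_induct)
 case (diff u v)
 have "Tmap h (u - v) - Tmap f (u - v) - Tmap g (u - v) = (Tmap h u - Tmap f u - Tmap g u) - (Tmap h v - Tmap f v - Tmap g v)" by simp
 thus ?case using TK_closed(5)[OF assms(1) diff(3,4)] by (simp only:)
qed (use TK_closed(2)[OF assms(1)] TK_rel(2)[OF assms(1) _ hom_cl[OF assms(2)] hom_cl[OF assms(3)]] assms(4) in auto)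

lemma frag_of_zero:
 assumes "lmod La N"
 shows "y\<in>|N| ==> frag_of (0\<^sub>DR, y)\<in>TK N"
proof -
 assume y: "y\<in>|N|"
 have z: "0\<^sub>DR:Hom R La E" unfolding DR_simps by (rule zero_hom[OF L_Rmodule E_module])
 have "0\<^sub>DR+\<^sub>DR 0\<^sub>DR = 0\<^sub>DR" unfolding DR_simps by (auto intro!: restrict_ext)
 hence "- frag_of (0\<^sub>DR, y)\<in>TK N" using TK_rel(1)[OF assms z z y] by simp
 from TK_closed(4)[OF assms this] show ?thesis by simp
qed


section \<open>Hom(D(Lambda), J) as a projective module and the evaluation isomorphism\<close>

lemma DR_l_distr:
 assumes "b\<in>|La|" "c\<in>|La|" "x:Hom R La E"
 shows "(b+\<^sub>La c)*\<^sub>DR x = b*\<^sub>DR x+\<^sub>DL c*\<^sub>DR x"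
 using assms hom_add[of x R La E] by (auto simp: DR_simps L.l_distr intro!: restrict_ext)

lemma DR_assoc:
 assumes "b\<in>|La|" "c\<in>|La|"
 shows "(b\<otimes>\<^sub>La c)*\<^sub>DR x = c*\<^sub>DR (b*\<^sub>DR x)"
 using assms by (auto simp: DR_simps L.m_assoc intro!: restrict_ext)

lemma HD_finsum:
 assumes "lmod La J" "finite S" "f\<in>S \<rightarrow> Hom La DL J" "x:Hom R La E"
 shows "(\<Oplus>\<^bsub>HD J\<^esub>s\<in>S. f s) x = (\<Oplus>\<^bsub>J\<^esub>s\<in>S. f s x)"
proof -
 interpret J: left_module La J by (rule assms)
 interpret H: left_module La "HD J" by (rule HD_module[OF assms(1)])
 have c: "f s x\<in>|J|" if "s\<in>S" for s
  using hom_cl[of "f s" La DL J x] assms(3,4) that by (auto simp: Pi_iff)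
 show ?thesis using assms(2,3) c
 proof (induction S rule: finite_induct)
  case empty
  thus ?case using assms(4) by simp
 next
  case (insert s S)
  hence "(\<Oplus>\<^bsub>HD J\<^esub>t\<in>insert s S. f t) = f s+\<^sub>(HD J) (\<Oplus>\<^bsub>HD J\<^esub>t\<in>S. f t)"
   by (intro H.M.finsum_insert) auto
  thus ?case using insert assms(4) J.M.finsum_insert[OF insert(1,2), of "%t. f t x"] by simp
 qed
qed

text \<open>The composite of \<open>w\<close> with \<open>b s\<close> is an endomorphism of
  D(\<open>La\<close>), hence the right action of a unique element of \<open>La\<close>; this
  element is the coordinate \<open>l s w\<close>, and uniqueness makes it linear in
  \<open>w\<close>. Thus Hom(D(\<open>La\<close>), -) turns summands of powers of
  D(\<open>La\<close>) into summands of powers of \<open>La\<close>.\<close>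

lemma HD_dual_basis:
 assumes "DL_basis J S a b"
 shows "EX l. dual_basis La (HD J) S a l &
  (ALL s:S. ALL w:Hom La DL J. ALL x:Hom R La E. b s (w x) = l s w*\<^sub>DR x)"
proof -
 note D = DL_basisD[OF assms]
 interpret J: left_module La J by (rule D)
 note H = HD_module[OF D(1)]
 let ?b = "Hom R La E"
 define l where "l s = (\<lambda>w\<in>|HD J|. SOME c. c\<in>|La| & (ALL x:?b. b s (w x) = c*\<^sub>DR x))" for s
 let ?c = "Hom La DL J"
 have l: "l s w\<in>|La| & (ALL x:?b. b s (w x) = l s w*\<^sub>DR x)"
  if s: "s\<in>S" and w: "w\<in>?c" for s w
 proof -
  have ex: "EX c. c\<in>|La| & (ALL x:?b. b s (w x) = c*\<^sub>DR x)"
  proof (rule DL_endomorphism[OF compose_hom[OF DL_module w D(4)[OF s]]])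
   fix c assume c: "c\<in>|La|" "!!x. x\<in>?b ==> compose |DL| (b s) w x = c*\<^sub>DR x"
   have "b s (w x) = c*\<^sub>DR x" if "x\<in>?b" for x using c(2)[OF that] that by (simp add: compose_eq)
   thus ?thesis using c(1) by blast
  qed
  have eq: "l s w = (SOME c. c\<in>|La| & (ALL x:?b. b s (w x) = c*\<^sub>DR x))"
   unfolding l_def HD_simps(1) by (rule restrict_apply'[OF w])
  show ?thesis unfolding eq by (rule someI_ex[OF ex])
 qed
 note lc = conjunct1[OF l] and lx = bspec[OF conjunct2[OF l], symmetric]
 let ?a = "HD J"
 let ?d = "reg La"
 have lH: "l s:Hom La ?a ?d" if s: "s\<in>S" for s
 proof -
  have "restrict (l s) |HD J|:Hom La ?a ?d"
  proof (rule module_homI[OF _ _ _ H])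
   fix w assume "w\<in>|HD J|"
   hence w: "w\<in>?c" "w\<in>|HD J|" by simp_all
   show "l s w\<in>|reg La|" using lc[OF s w(1)] by simp
   have wx: "w x\<in>|J|" if "x\<in>?b" for x using hom_cl[OF w(1), of x] that by simp
   interpret H: left_module La "HD J" by (rule H)
   show "l s (w+\<^sub>?a v) = l s w+\<^sub>?d l s v" if "v\<in>|HD J|" for v
   proof -
    have v: "v\<in>?c" using that by simp
    have sum: "w+\<^sub>?a v\<in>?c" using H.M.a_closed[OF w(2) that] by simp
    have "l s (w+\<^sub>?a v) = l s w+\<^sub>La l s v"
    proof (rule DL_faithful[OF lc[OF s sum] L.add.m_closed[OF lc[OF s w(1)] lc[OF s v]]])
     fix x assume x: "x\<in>?b"
     have vx: "v x\<in>|J|" using hom_cl[OF v, of x] x by simp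
     have "l s (w+\<^sub>?a v)*\<^sub>DR x = b s (w x+\<^sub>J v x)" unfolding lx[OF s sum x] using x by simp
     also have "... = b s (w x)+\<^sub>DL b s (v x)" by (rule hom_add[OF D(4)[OF s] wx[OF x] vx])
     finally show "l s (w+\<^sub>?a v)*\<^sub>DR x = (l s w+\<^sub>La l s v)*\<^sub>DR x"
      unfolding DR_l_distr[OF lc[OF s w(1)] lc[OF s v] x] lx[OF s w(1) x] lx[OF s v x] .
    qed
    thus ?thesis by simp
   qed
   show "l s (r*\<^sub>?a w) = r*\<^sub>?d l s w" if r: "r\<in>|La|" for r
   proof -
    have sm: "r*\<^sub>?a w\<in>?c" using H.smult_closed[OF r w(2)] by (simp only: HD_simps)
    have "l s (r*\<^sub>?a w) = r\<otimes>\<^sub>La l s w"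
    proof (rule DL_faithful[OF lc[OF s sm] L.m_closed[OF r lc[OF s w(1)]]])
     fix x assume x: "x\<in>?b"
     have "l s (r*\<^sub>?a w)*\<^sub>DR x = b s (w (r*\<^sub>DR x))" unfolding lx[OF s sm x] using x by (simp only: HD_simps restrict_apply')
     thus "l s (r*\<^sub>?a w)*\<^sub>DR x = (r\<otimes>\<^sub>La l s w)*\<^sub>DR x"
      unfolding DR_assoc[OF r lc[OF s w(1)]] lx[OF s w(1) DR_smult_closed[OF r x]] .
    qed
    thus ?thesis by simp
   qed
  qed
  moreover have "restrict (l s) |HD J| = l s" unfolding l_def by (rule restrict_ext) (simp only: restrict_apply')
  ultimately show ?thesis by (simp only:)
 qed
 have "w = (\<Oplus>\<^bsub>HD J\<^esub>s\<in>S. l s w*\<^sub>?a a s)" if w: "w\<in>?c" for w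
 proof (rule hom_eqI[OF w])
  interpret H: left_module La "HD J" by (rule H)
  have c: "(%s. l s w*\<^sub>?a a s)\<in>S \<rightarrow> |HD J|"
   by (rule Pi_I) (intro H.smult_closed lc[OF _ w], simp_all only: HD_simps(1) D(3))
  thus "(\<Oplus>\<^bsub>HD J\<^esub>s\<in>S. l s w*\<^sub>?a a s)\<in>?c" using H.M.finsum_closed[OF c] by (simp only: HD_simps(1))
  fix x assume "x\<in>|DL|"
  hence x: "x\<in>?b" by simp
  have wx: "w x\<in>|J|" using hom_cl[OF w, of x] x by simp
  have "(\<Oplus>\<^bsub>HD J\<^esub>s\<in>S. l s w*\<^sub>?a a s) x = (\<Oplus>\<^bsub>J\<^esub>s\<in>S. (l s w*\<^sub>?a a s) x)"
   by (rule HD_finsum[OF D(1,2) c[unfolded HD_simps(1)] x])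
  also have "... = (\<Oplus>\<^bsub>J\<^esub>s\<in>S. a s (b s (w x)))"
  proof (rule J.M.finsum_cong')
   show "(%s. a s (b s (w x)))\<in>S \<rightarrow> |J|"
    by (rule Pi_I) (rule hom_cl[OF D(3) hom_cl[OF D(4) wx]])
   show "(l s w*\<^sub>?a a s) x = a s (b s (w x))" if "s\<in>S" for s
    using lx[OF that w x] x by (simp only: HD_simps restrict_apply')
  qed simp
  finally show "w x = (\<Oplus>\<^bsub>HD J\<^esub>s\<in>S. l s w*\<^sub>?a a s) x" using D(5)[OF wx] by simp
 qed
 hence "dual_basis La ?a S a l"
  unfolding dual_basis_def HD_simps(1) by (intro conjI ballI Pi_I H D(2,3) lH)
 thus ?thesis using l by blast
qed

text \<open>The evaluation from the tensor product of D(\<open>La\<close>) and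
  Hom(D(\<open>La\<close>), \<open>J\<close>) to \<open>J\<close>. It is obtained on the free group
  from the universal property; that it kills the relations is \<open>ev_TK\<close>.\<close>

definition ev :: "('a, 'm) module => (('a => 'u)\<times>(('a => 'u) => 'm) \<Rightarrow>\<^sub>0 int) => 'm"
 where "ev J = (SOME e. e\<in>hom (TG (HD J)) (add_monoid J) &
  (ALL x:Hom R La E. ALL \<phi>:Hom La DL J. e (frag_of (x, \<phi>)) = \<phi> x))"

lemma ev:
 assumes "lmod La J"
 shows "u\<in>TF (HD J) ==> ev J u\<in>|J|"
  "u\<in>TF (HD J) ==> v\<in>TF (HD J) ==> ev J (u + v) = ev J u+\<^sub>J ev J v"
  "u\<in>TF (HD J) ==> v\<in>TF (HD J) ==> ev J (u - v) = ev J u-\<^sub>J ev J v"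
  "x:Hom R La E ==> w:Hom La DL J ==> ev J (frag_of (x, w)) = w x"
  "ev J 0 = 0\<^sub>J"
proof -
 interpret J: left_module La J by (rule assms)
 let ?a = "Hom R La E"
 have im: "(%(x, w). w x) ` (?a\<times>|HD J| ) <= |add_monoid J|"
  using hom_cl[of _ La DL J] by fastforce
 let ?b = "HD J"
 have "EX e. e\<in>hom (TG ?b) (add_monoid J) & (ALL x:?a. ALL w:Hom La DL J. e (frag_of (x, w)) = w x)"
 proof (rule comm_group.free_Abelian_group_universal[OF J.M.a_comm_group im])
  fix h assume h: "h\<in>hom (free_Abelian_group (?a\<times>|HD J| )) (add_monoid J)"
   "!!z. z\<in>?a\<times>|HD J| ==> h (frag_of z) = (case z of (x, w) => w x)"
  show ?thesis using h(1) h(2)[of "(_, _)"] unfolding TG_def by (intro exI[of _ h]) simp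
 qed
 from someI_ex[OF this, folded ev_def] have e: "ev J\<in>hom (TG ?b) (add_monoid J)"
  "ALL x:?a. ALL w:Hom La DL J. ev J (frag_of (x, w)) = w x" by auto
 interpret e: group_hom "TG ?b" "add_monoid J" "ev J"
  using e(1) TG_group J.M.a_group by (simp add: group_hom_def group_hom_axioms_def)
 show c: "ev J u\<in>|J|" if "u\<in>TF ?b" for u using e.hom_closed[of u] that by simp
 show a: "ev J (u + v) = ev J u+\<^sub>J ev J v" if "u\<in>TF ?b" "v\<in>TF ?b" for u v
  using e.hom_mult[of u v] that by simp
 show "ev J (frag_of (x, w)) = w x" if "x\<in>?a" "w:Hom La DL J" using e(2) that by blast
 show "ev J 0 = 0\<^sub>J" using e.hom_one by simp
 assume uv: "u\<in>TF ?b" "v\<in>TF ?b"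
 have "ev J u = ev J (u - v)+\<^sub>J ev J v" using a[of "u - v" v] uv by simp
 thus "ev J (u - v) = ev J u-\<^sub>J ev J v" using J.add_diff_cancel(3)[of "ev J (u - v)" "ev J v"] c uv by simp
qed

lemma ev_TK:
 assumes J: "lmod La J" and "u\<in>TK (HD J)"
 shows "ev J u = 0\<^sub>J"
 using HD_module[OF J] assms(2)
proof (induction rule: TK_induct)
 case (diff u v)
 interpret J: left_module La J by (rule J)
 show ?case unfolding ev(3)[OF J diff(1,2)] diff(3,4) by (simp add: J.diff_eq_zero_iff)
next
 case (rel r)
 interpret J: left_module La J by (rule J)
 interpret H: left_module La "HD J" by (rule HD_module[OF J])
 let ?a = "Hom La DL J"
 let ?b = "Hom R La E"
 have w: "w x\<in>|J|" if "x\<in>?b" "w\<in>?a" for x w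
  using hom_cl[OF that(2), of x] that(1) by simp
 from rel consider (1) x x' w where "r = frag_of (x+\<^sub>DR x', w) - frag_of (x, w) - frag_of (x', w)" "x\<in>|DR|" "x'\<in>|DR|" "w\<in>|HD J|"
  | (2) x w z where "r = frag_of (x, w+\<^sub>(HD J) z) - frag_of (x, w) - frag_of (x, z)" "x\<in>|DR|" "w\<in>|HD J|" "z\<in>|HD J|"
  | (3) a x w where "r = frag_of (a*\<^sub>DR x, w) - frag_of (x, a*\<^sub>(HD J) w)" "a\<in>|La|" "x\<in>|DR|" "w\<in>|HD J|"
  unfolding tensor_relations_def by blast
 thus ?case
 proof cases
  case 1
  hence h: "x\<in>?b" "x'\<in>?b" "w\<in>?a" by simp_all
  have "ev J r = w (x+\<^sub>DR x')-\<^sub>J w x-\<^sub>J w x'"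
   unfolding 1(1) using h DR_add_closed[OF h(1,2)] by (simp add: ev[OF J])
  moreover have "w (x+\<^sub>DR x') = w x+\<^sub>J w x'"
   using hom_add[OF h(3), of x x'] h(1,2) by (simp add: DR_simps)
  ultimately show ?thesis using w[OF h(1,3)] w[OF h(2,3)] by (simp add: J.diff_eq_zero_iff)
 next
  case 2
  hence h: "x\<in>?b" "w\<in>?a" "z\<in>?a" by simp_all
  have s: "w+\<^sub>(HD J) z\<in>?a" using H.M.a_closed[OF 2(3,4)] by (simp only: HD_simps)
  have "ev J r = (w+\<^sub>(HD J) z) x-\<^sub>J w x-\<^sub>J z x"
   unfolding 2(1) using h s by (simp add: ev[OF J] del: HD_simps(3))
  thus ?thesis using h(1) w[OF h(1,2)] w[OF h(1,3)] by (simp add: J.diff_eq_zero_iff)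
 next
  case 3
  hence h: "x\<in>?b" "w\<in>?a" by simp_all
  have s: "a*\<^sub>(HD J) w\<in>?a" using H.smult_closed[OF 3(2,4)] by (simp only: HD_simps)
  have "ev J r = w (a*\<^sub>DR x)-\<^sub>J (a*\<^sub>(HD J) w) x"
   unfolding 3(1) using h s DR_smult_closed[OF 3(2) h(1)] by (simp add: ev[OF J] del: HD_simps(4))
  thus ?thesis using h(1) w[OF DR_smult_closed[OF 3(2) h(1)] h(2)] by (simp add: J.diff_eq_zero_iff)
 qed
qed

definition HDm :: "('a, 'm) module => ('m => 'n) => (('a => 'u) => 'm) => ('a => 'u) => 'n"
 where "HDm J g = (\<lambda>\<phi>\<in>Hom La DL J. compose |DL| g \<phi>)"

lemma HDm_apply: "w:Hom La DL J ==> x:Hom R La E ==> HDm J g w x = g (w x)"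
 by (simp add: HDm_def compose_def)

lemma HDm_closed: "g:Hom La J J' ==> w:Hom La DL J ==> HDm J g w:Hom La DL J'"
 unfolding HDm_def by (simp only: restrict_apply') (rule compose_hom[OF DL_module])

lemma HDm_hom:
 assumes "lmod La J" "lmod La J'" "g:Hom La J J'"
 shows "HDm J g:Hom La (HD J) (HD J')"
proof -
 interpret H: left_module La "HD J" by (rule HD_module[OF assms(1)])
 interpret H': left_module La "HD J'" by (rule HD_module[OF assms(2)])
 have cl: "HDm J g w\<in>|HD J'|" if "w\<in>|HD J|" for w using HDm_closed[OF assms(3)] that by simp
 let ?a = "Hom R La E"
 have app: "HDm J g w x = g (w x)" if "w\<in>|HD J|" "x\<in>?a" for w x using HDm_apply that by simp
 have eqI: "w = v" if "w\<in>|HD J'|" "v\<in>|HD J'|" "!!x. x\<in>?a ==> w x = v x" for w v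
  by (rule hom_eqI[of _ La DL J' _ J']) (use that in simp_all)
 have "restrict (HDm J g) |HD J|:Hom La (HD J) (HD J')"
 proof (rule module_homI[OF cl _ _ HD_module[OF assms(1)]])
  fix w assume w: "w\<in>|HD J|"
  have c: "w x\<in>|J|" if "x\<in>?a" "w\<in>|HD J|" for x w
   using hom_cl[of w La DL J x] that by simp
  show "HDm J g (w+\<^sub>(HD J) v) = HDm J g w+\<^sub>(HD J') HDm J g v" if v: "v\<in>|HD J|" for v
  proof (rule eqI[OF cl[OF H.M.a_closed[OF w v]] H'.M.a_closed[OF cl[OF w] cl[OF v]]])
   fix x assume x: "x\<in>?a"
   show "HDm J g (w+\<^sub>(HD J) v) x = (HDm J g w+\<^sub>(HD J') HDm J g v) x"
    unfolding app[OF H.M.a_closed[OF w v] x] unfolding HD_simps(3) restrict_apply'[OF x] app[OF w x] app[OF v x]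
    by (rule hom_add[OF assms(3) c[OF x w] c[OF x v]])
  qed
  show "HDm J g (r*\<^sub>(HD J) w) = r*\<^sub>(HD J') HDm J g w" if r: "r\<in>|La|" for r
  proof (rule eqI[OF cl[OF H.smult_closed[OF r w]] H'.smult_closed[OF r cl[OF w]]])
   fix x assume x: "x\<in>?a"
   show "HDm J g (r*\<^sub>(HD J) w) x = (r*\<^sub>(HD J') HDm J g w) x"
    unfolding app[OF H.smult_closed[OF r w] x] unfolding HD_simps(4) restrict_apply'[OF x] app[OF w DR_smult_closed[OF r x]] ..
  qed
 qed
 thus ?thesis by (simp add: HDm_def)
qed

lemma ev_natural:
 assumes "lmod La J" "lmod La J'" "g:Hom La J J'" "u\<in>TF (HD J)"
 shows "ev J' (Tmap (HDm J g) u) = g (ev J u)"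
 using assms(4)
proof (induction rule: TF_induct)
 case zero
 thus ?case using ev(5)[OF assms(1)] ev(5)[OF assms(2)] hom_zero[OF assms(1-3)] by simp
next
 case (one x w)
 hence "w:Hom La DL J" by simp
 thus ?case using one ev(4)[OF assms(1)] ev(4)[OF assms(2)] HDm_closed[OF assms(3)] HDm_apply by simp
next
 case (diff u v)
 note c = Tmap_closed[OF HDm_hom[OF assms(1-3)]]
 show ?case unfolding Tmap_simps ev(3)[OF assms(2) c[OF diff(1)] c[OF diff(2)]] ev(3)[OF assms(1) diff(1,2)] diff(3,4)
  by (rule hom_minus[OF assms(1-3) ev(1)[OF assms(1) diff(1)] ev(1)[OF assms(1) diff(2)], symmetric])
qed

text \<open>Evaluating tensors whose second factors take values in \<open>N\<close> cannot leave
  \<open>N\<close>; this is how generation of a module by D(\<open>La\<close>) is detected.\<close>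

lemma ev_submodule:
 assumes "lmod La J" "submodule N La J" "w:Hom La M (HD J)" "u\<in>TF M"
  and N: "ALL y:|M|. w y ` |DL| <= N"
 shows "ev J (Tmap w u)\<in>N"
 using assms(4)
proof (induction rule: TF_induct)
 case zero
 thus ?case using ev(5)[OF assms(1)] left_module.submoduleD(3)[OF assms(1,2)] by simp
next
 case (one x y)
 have "w y:Hom La DL J" using hom_cl[OF assms(3) one(2)] by simp
 thus ?case using N one ev(4)[OF assms(1)] by auto
next
 case (diff u v)
 thus ?case unfolding Tmap_simps ev(3)[OF assms(1) Tmap_closed[OF assms(3) diff(1)] Tmap_closed[OF assms(3) diff(2)]] by (intro left_module.submoduleD(6)[OF assms(1,2)])
qed

lemma TK_sum:
 assumes "lmod La M" "finite S" "ALL s:S. f s\<in>TK M"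
 shows "(\<Sum>s\<in>S. f s)\<in>TK M"
 using assms(2,3) by (induction S rule: finite_induct) (auto intro: TK_closed(2,3)[OF assms(1)])

lemma TK_finsum:
 assumes "lmod La M" "finite S" "f\<in>S \<rightarrow> |M|" "x:Hom R La E"
 shows "frag_of (x, \<Oplus>\<^bsub>M\<^esub>s\<in>S. f s) - (\<Sum>s\<in>S. frag_of (x, f s))\<in>TK M"
 using assms(2,3)
proof (induction S rule: finite_induct)
 interpret M: left_module La M by (rule assms)
 case empty
 have "frag_of (x, 0\<^sub>M+\<^sub>M 0\<^sub>M) - frag_of (x, 0\<^sub>M) - frag_of (x, 0\<^sub>M)\<in>TK M"
  by (rule TK_rel(2)[OF assms(1,4)]) simp_all
 from TK_closed(4)[OF assms(1) this] show ?case by simp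
next
 interpret M: left_module La M by (rule assms)
 case (insert s S)
 let ?a = "\<Oplus>\<^bsub>M\<^esub>t\<in>S. f t"
 have e: "(\<Oplus>\<^bsub>M\<^esub>t\<in>insert s S. f t) = f s+\<^sub>M ?a" using insert by (intro M.M.finsum_insert) auto
 have "frag_of (x, f s+\<^sub>M ?a) - frag_of (x, f s) - frag_of (x, \<Oplus>\<^bsub>M\<^esub>t\<in>S. f t)\<in>TK M"
  using insert by (intro TK_rel(2)[OF assms(1,4)] M.M.finsum_closed) auto
 from TK_closed(3)[OF assms(1) this insert(3)] insert show ?case unfolding e by (simp add: algebra_simps)
qed

text \<open>The inverse sends \<open>y\<close> to \<open>h y\<close>, the sum of the tensors of
  \<open>b s y\<close> with \<open>a s\<close>. It is additive only modulo relations
  (\<open>hd\<close>), and \<open>key\<close> shows that every \<open>u\<close> is congruent to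
  \<open>h (ev J u)\<close>, by expanding the second factor in the dual basis and moving the
  coefficients across.\<close>

lemma ev_iso:
 assumes J: "DL_basis J S a b"
 shows "u\<in>TF (HD J) ==> ev J u = 0\<^sub>J ==> u\<in>TK (HD J)" "y\<in>|J| ==> EX u:TF (HD J). ev J u = y"
proof -
 note D = DL_basisD[OF J]
 note H = HD_module[OF D(1)]
 interpret J: left_module La J by (rule D)
 interpret H: left_module La "HD J" by (rule H)
 define h where "h y = (\<Sum>s\<in>S. frag_of (b s y, a s))" for y
 have b: "b s y:Hom R La E" if "s\<in>S" "y\<in>|J|" for s y using hom_cl[OF D(4)[OF that(1)] that(2)] by simp
 have aH: "a s\<in>|HD J|" if "s\<in>S" for s using D(3)[OF that] by simp
 obtain l where l: "dual_basis La (HD J) S a l"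
  and lx: "ALL s:S. ALL w:Hom La DL J. ALL x:Hom R La E. b s (w x) = l s w*\<^sub>DR x"
  using HD_dual_basis[OF J] by (elim exE conjE)
 have lc: "l s w\<in>|La|" if "s\<in>S" "w:Hom La DL J" for s w
 proof -
  have "l s:Hom La (HD J) (reg La)" using l that(1) by (simp add: dual_basis_def)
  from hom_cl[OF this, of w] show ?thesis using that(2) by simp
 qed
 have h0: "h 0\<^sub>J\<in>TK (HD J)"
  unfolding h_def
 proof (intro TK_sum[OF H D(2)] ballI)
  fix s assume s: "s\<in>S"
  have "b s 0\<^sub>J = 0\<^sub>DR" using hom_zero[OF D(1) DL_module D(4)[OF s]] by (simp add: DR_simps)
  thus "frag_of (b s 0\<^sub>J, a s)\<in>TK (HD J)" using frag_of_zero[OF H aH[OF s]] by (simp only:)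
 qed
 have hd: "h y - h (y-\<^sub>J z) - h z\<in>TK (HD J)" if yz: "y\<in>|J|" "z\<in>|J|" for y z
  unfolding h_def sum_subtractf[symmetric]
 proof (intro TK_sum[OF H D(2)] ballI)
  fix s assume s: "s\<in>S"
  have d: "y-\<^sub>J z\<in>|J|" using yz by simp
  have "b s y = b s (y-\<^sub>J z)+\<^sub>DL b s z" using hom_add[OF D(4)[OF s] d yz(2)] yz by (simp del: DL_simps)
  hence "b s y = b s (y-\<^sub>J z)+\<^sub>DR b s z" by (simp add: DR_simps)
  thus "frag_of (b s y, a s) - frag_of (b s (y-\<^sub>J z), a s) - frag_of (b s z, a s)\<in>TK (HD J)"
   using TK_rel(1)[OF H b[OF s d] b[OF s yz(2)] aH[OF s]] by (simp only:)
 qed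
 have key: "u - h (ev J u)\<in>TK (HD J)" if "u\<in>TF (HD J)" for u
  using that
 proof (induction rule: TF_induct)
  case zero
  thus ?case using TK_closed(4)[OF H h0] ev(5)[OF D(1)] by simp
 next
  case (diff u v)
  have "u - v - h (ev J (u - v)) = (u - h (ev J u)) - (v - h (ev J v)) + (h (ev J u) - h (ev J u-\<^sub>J ev J v) - h (ev J v))"
   unfolding ev(3)[OF D(1) diff(1,2)] by simp
  thus ?case using TK_closed(3)[OF H TK_closed(5)[OF H diff(3,4)] hd[OF ev(1)[OF D(1) diff(1)] ev(1)[OF D(1) diff(2)]]] by (simp only:)
 next
  case (one x w)
  hence w: "w:Hom La DL J" by simp
  have c: "(%s. l s w*\<^sub>(HD J) a s)\<in>S \<rightarrow> |HD J|" by (rule Pi_I) (rule H.smult_closed[OF lc[OF _ w] aH])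
  have e: "w = (\<Oplus>\<^bsub>HD J\<^esub>s\<in>S. l s w*\<^sub>(HD J) a s)" using l w unfolding dual_basis_def HD_simps(1) by blast
  have 1: "frag_of (x, w) - (\<Sum>s\<in>S. frag_of (x, l s w*\<^sub>(HD J) a s))\<in>TK (HD J)"
   using TK_finsum[OF H D(2) c one(1)] by (simp only: e[symmetric])
  have "(\<Sum>s\<in>S. frag_of (b s (w x), a s) - frag_of (x, l s w*\<^sub>(HD J) a s))\<in>TK (HD J)"
  proof (intro TK_sum[OF H D(2)] ballI)
   fix s assume s: "s\<in>S"
   have "b s (w x) = l s w*\<^sub>DR x" using lx s w one(1) by blast
   thus "frag_of (b s (w x), a s) - frag_of (x, l s w*\<^sub>(HD J) a s)\<in>TK (HD J)"
    using TK_rel(3)[OF H lc[OF s w] one(1) aH[OF s]] by (simp only:)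
  qed
  from TK_closed(5)[OF H 1 this] show ?case
   unfolding ev(4)[OF D(1) one(1) w] h_def sum_subtractf by simp
 qed
 show "u\<in>TK (HD J)" if "u\<in>TF (HD J)" "ev J u = 0\<^sub>J"
  using TK_closed(3)[OF H key[OF that(1), unfolded that(2)] h0] by simp
 assume y: "y\<in>|J|"
 have "finite T ==> T <= S ==> (\<Sum>s\<in>T. frag_of (b s y, a s))\<in>TF (HD J) & ev J (\<Sum>s\<in>T. frag_of (b s y, a s)) = (\<Oplus>\<^bsub>J\<^esub>s\<in>T. a s (b s y))" for T
 proof (induction T rule: finite_induct)
  case empty
  thus ?case using ev(5)[OF D(1)] by simp
 next
  case (insert s T)
  have t: "frag_of (b s y, a s)\<in>TF (HD J)" "ev J (frag_of (b s y, a s)) = a s (b s y)"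
   using insert(4) ev(4)[OF D(1) b[OF _ y] D(3), of s] b[OF _ y, of s] aH[of s] by auto
  have cc: "a s (b s y)\<in>|J|" if "s\<in>S" for s by (rule hom_cl[OF D(3)[OF that] hom_cl[OF D(4)[OF that] y]])
  have "(\<Oplus>\<^bsub>J\<^esub>t\<in>insert s T. a t (b t y)) = a s (b s y)+\<^sub>J (\<Oplus>\<^bsub>J\<^esub>t\<in>T. a t (b t y))"
   using insert(1,2,4) cc by (intro J.M.finsum_insert) auto
  thus ?case using insert t ev(2)[OF D(1) t(1)] by simp
 qed
 from this[OF D(2) subset_refl] show "EX u:TF (HD J). ev J u = y" unfolding D(5)[OF y] by blast
qed

end

section \<open>Comparison of resolutions\<close>

text \<open>The comparison theorem. Lifting is assumed for maps with values in an image, in place of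
  projectivity, because the two complexes have different element types and obtain their lifts from
  different sources.\<close>

lemma chain_map_ex:
 fixes U :: "nat => ('a, 'm) module" and Y :: "nat => ('a, 'n) module"
 assumes U: "ALL n. lmod R (U n)" "ALL n. dU n:Hom R (U (Suc n)) (U n)"
  and Y: "ALL n. lmod R (Y n)"
  and f0: "f0:Hom R (U 0) (Y 0)" "ALL x:|U (Suc 0)|. f0 (dU 0 x)\<in>dY 0 ` |Y (Suc 0)|"
  and dd: "ALL n. ALL x:|U (Suc (Suc n))|. dU n (dU (Suc n) x) = 0\<^sub>(U n)"
  and ex: "ALL n. ALL y:|Y (Suc n)|. dY n y = 0\<^sub>(Y n) --> y\<in>dY (Suc n) ` |Y (Suc (Suc n))|"
  and lift: "ALL n m g. g:Hom R (U n) (Y m) & (ALL x:|U n|. g x\<in>dY m ` |Y (Suc m)| ) -->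
   (EX h:Hom R (U n) (Y (Suc m)). ALL x:|U n|. dY m (h x) = g x)"
 shows "EX f. f 0 = f0 & (ALL n. f n:Hom R (U n) (Y n)) &
  (ALL n. ALL x:|U (Suc n)|. dY n (f (Suc n) x) = f n (dU n x))"
proof -
 have "EX f. ALL n. (f n:Hom R (U n) (Y n) & (ALL x:|U (Suc n)|. f n (dU n x)\<in>dY n ` |Y (Suc n)| ) &
   (n = 0 --> f n = f0)) & (ALL x:|U (Suc n)|. dY n (f (Suc n) x) = f n (dU n x))"
 proof (rule dependent_nat_choice)
  show "EX f. f:Hom R (U 0) (Y 0) & (ALL x:|U (Suc 0)|. f (dU 0 x)\<in>dY 0 ` |Y (Suc 0)| ) & (0 = (0::nat) --> f = f0)"
   using f0 by blast
  fix f n assume f: "f:Hom R (U n) (Y n) & (ALL x:|U (Suc n)|. f (dU n x)\<in>dY n ` |Y (Suc n)| ) & (n = 0 --> f = f0)"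
  let ?g = "compose |U (Suc n)| f (dU n)"
  have fh: "f:Hom R (U n) (Y n)" using f by (rule conjunct1)
  have g: "?g:Hom R (U (Suc n)) (Y n)" by (rule compose_hom[OF U(1)[rule_format] U(2)[rule_format] fh])
  have "ALL x:|U (Suc n)|. ?g x\<in>dY n ` |Y (Suc n)|" using f by (simp add: compose_eq)
  from lift[rule_format, OF conjI, OF g this]
  obtain h where h: "h:Hom R (U (Suc n)) (Y (Suc n))" "ALL x:|U (Suc n)|. dY n (h x) = ?g x" by (rule bexE)
  let ?a = "Suc (Suc n)"
  have "h (dU (Suc n) x)\<in>dY (Suc n) ` |Y ?a|" if x: "x\<in>|U ?a|" for x
  proof (rule ex[rule_format])
   have dx: "dU (Suc n) x\<in>|U (Suc n)|" by (rule hom_cl[OF U(2)[rule_format] x])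
   show "h (dU (Suc n) x)\<in>|Y (Suc n)|" by (rule hom_cl[OF h(1) dx])
   show "dY n (h (dU (Suc n) x)) = 0\<^sub>(Y n)"
    unfolding bspec[OF h(2) dx] compose_eq[OF dx] dd[rule_format, OF x]
    by (rule hom_zero[OF U(1)[rule_format] Y[rule_format] fh])
  qed
  thus "EX f'. (f':Hom R (U (Suc n)) (Y (Suc n)) &
    (ALL x:|U ?a|. f' (dU (Suc n) x)\<in>dY (Suc n) ` |Y ?a| ) & (Suc n = 0 --> f' = f0)) &
    (ALL x:|U (Suc n)|. dY n (f' x) = f (dU n x))"
   using h by (intro exI[of _ h]) (simp add: compose_eq)
 qed
 then obtain f where "ALL n. (f n:Hom R (U n) (Y n) & (ALL x:|U (Suc n)|. f n (dU n x)\<in>dY n ` |Y (Suc n)| ) &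
   (n = 0 --> f n = f0)) & (ALL x:|U (Suc n)|. dY n (f (Suc n) x) = f n (dU n x))" by (rule exE)
 thus ?thesis by (intro exI[of _ f]) simp
qed

text \<open>\<open>\<phi>\<close> is a chain map with boundary values in degree 0; in the
  application it is the difference of a composite of comparison maps and the identity. The homotopy
  starts from a lift of \<open>\<phi> 0\<close>, and its equation is recorded in positive degrees,
  where Tor is computed.\<close>

lemma homotopy_ex:
 fixes U :: "nat => ('a, 'm) module"
 assumes U: "ALL n. lmod R (U n)" "ALL n. d n:Hom R (U (Suc n)) (U n)"
  and dd: "ALL n. ALL x:|U (Suc (Suc n))|. d n (d (Suc n) x) = 0\<^sub>(U n)"
  and ex: "ALL n. ALL y:|U (Suc n)|. d n y = 0\<^sub>(U n) --> y\<in>d (Suc n) ` |U (Suc (Suc n))|"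
  and lift: "ALL n m g. g:Hom R (U n) (U m) & (ALL x:|U n|. g x\<in>d m ` |U (Suc m)| ) -->
   (EX h:Hom R (U n) (U (Suc m)). ALL x:|U n|. d m (h x) = g x)"
  and \<phi>: "ALL n. \<phi> n:Hom R (U n) (U n)" "ALL x:|U 0|. \<phi> 0 x\<in>d 0 ` |U (Suc 0)|"
   "ALL n. ALL x:|U (Suc n)|. d n (\<phi> (Suc n) x) = \<phi> n (d n x)"
 shows "EX h. (ALL n. h n:Hom R (U n) (U (Suc n))) &
  (ALL n. ALL x:|U (Suc n)|. d (Suc n) (h (Suc n) x) = \<phi> (Suc n) x-\<^sub>(U (Suc n)) h n (d n x))"
proof -
 have "EX h. ALL n. (h n:Hom R (U n) (U (Suc n)) & (ALL x:|U (Suc n)|. d n (h n (d n x)) = d n (\<phi> (Suc n) x))) &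
   (ALL x:|U (Suc n)|. d (Suc n) (h (Suc n) x) = \<phi> (Suc n) x-\<^sub>(U (Suc n)) h n (d n x))"
 proof (rule dependent_nat_choice)
  from lift[rule_format, OF conjI, OF \<phi>(1)[rule_format] \<phi>(2)]
  obtain h where h: "h:Hom R (U 0) (U (Suc 0))" "ALL x:|U 0|. d 0 (h x) = \<phi> 0 x" by (rule bexE)
  have "d 0 (h (d 0 x)) = d 0 (\<phi> (Suc 0) x)" if x: "x\<in>|U (Suc 0)|" for x
   unfolding bspec[OF h(2) hom_cl[OF U(2)[rule_format] x]] using \<phi>(3) x by simp
  thus "EX h. h:Hom R (U 0) (U (Suc 0)) & (ALL x:|U (Suc 0)|. d 0 (h (d 0 x)) = d 0 (\<phi> (Suc 0) x))"
   using h(1) by (intro exI[of _ h] conjI ballI)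
 next
  fix h n assume h: "h:Hom R (U n) (U (Suc n)) & (ALL x:|U (Suc n)|. d n (h (d n x)) = d n (\<phi> (Suc n) x))"
  note hh = conjunct1[OF h] and hd = bspec[OF conjunct2[OF h]]
  note lm = U(1)[rule_format] and dh = U(2)[rule_format] and ph = \<phi>(1)[rule_format]
  let ?g = "\<lambda>x\<in>|U (Suc n)|. \<phi> (Suc n) x-\<^sub>(U (Suc n)) compose |U (Suc n)| h (d n) x"
  have g: "?g:Hom R (U (Suc n)) (U (Suc n))" by (rule minus_hom[OF lm lm ph compose_hom[OF lm dh hh]])
  have geq: "?g x = \<phi> (Suc n) x-\<^sub>(U (Suc n)) h (d n x)" if "x\<in>|U (Suc n)|" for x
   unfolding restrict_apply'[OF that] compose_eq[OF that] ..
  let ?a = "Suc (Suc n)"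
  have "ALL x:|U (Suc n)|. ?g x\<in>d (Suc n) ` |U ?a|"
  proof (intro ballI ex[rule_format] hom_cl[OF g])
   fix x assume x: "x\<in>|U (Suc n)|"
   have c: "\<phi> (Suc n) x\<in>|U (Suc n)|" "h (d n x)\<in>|U (Suc n)|"
    using hom_cl[OF ph x] hom_cl[OF hh hom_cl[OF dh x]] .
   show "d n (?g x) = 0\<^sub>(U n)"
    unfolding geq[OF x] hom_minus[OF lm lm dh c] hd[OF x]
    using left_module.diff_eq_zero_iff[OF lm hom_cl[OF dh c(1)] hom_cl[OF dh c(1)]] by simp
  qed
  from lift[rule_format, OF conjI, OF g this]
  obtain k where k: "k:Hom R (U (Suc n)) (U ?a)" "ALL x:|U (Suc n)|. d (Suc n) (k x) = ?g x" by (rule bexE)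
  have k2: "d (Suc n) (k x) = \<phi> (Suc n) x-\<^sub>(U (Suc n)) h (d n x)" if "x\<in>|U (Suc n)|" for x
   unfolding bspec[OF k(2) that] by (rule geq[OF that])
  have "d (Suc n) (k (d (Suc n) x)) = d (Suc n) (\<phi> ?a x)" if x: "x\<in>|U ?a|" for x
  proof -
   interpret abelian_group "U (Suc n)" using lm[of "Suc n"] by (simp add: left_module_def)
   have dx: "d (Suc n) x\<in>|U (Suc n)|" by (rule hom_cl[OF dh x])
   show ?thesis unfolding k2[OF dx] dd[rule_format, OF x] hom_zero[OF lm lm hh]
    using \<phi>(3) x hom_cl[OF ph dx] by (simp add: minus_eq)
  qed
  thus "EX k. (k:Hom R (U (Suc n)) (U ?a) &
    (ALL x:|U ?a|. d (Suc n) (k (d (Suc n) x)) = d (Suc n) (\<phi> ?a x))) &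
    (ALL x:|U (Suc n)|. d (Suc n) (k x) = \<phi> (Suc n) x-\<^sub>(U (Suc n)) h (d n x))"
   using k(1) k2 by (intro exI[of _ k] conjI ballI)
 qed
 then obtain h where "ALL n. (h n:Hom R (U n) (U (Suc n)) & (ALL x:|U (Suc n)|. d n (h n (d n x)) = d n (\<phi> (Suc n) x))) &
   (ALL x:|U (Suc n)|. d (Suc n) (h (Suc n) x) = \<phi> (Suc n) x-\<^sub>(U (Suc n)) h n (d n x))" by (rule exE)
 thus ?thesis by (intro exI[of _ h]) simp
qed

lemma projective_resolutionD:
 assumes "projective_resolution R C P d w"
 shows "ALL n. lmod R (P n)" "projective_module R (P n)" "ALL n. d n:Hom R (P (Suc n)) (P n)"
  "w:Hom R (P 0) C" "w ` |P 0| = |C|"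
  "d 0 ` |P (Suc 0)| = {x\<in>|P 0|. w x = 0\<^sub>C}"
  "d (Suc n) ` |P (Suc (Suc n))| = {x\<in>|P (Suc n)|. d n x = 0\<^sub>(P n)}"
proof -
 show "ALL n. lmod R (P n)" using assms by (simp add: projective_resolution_def projective_module_def)
qed (use assms in \<open>simp_all add: projective_resolution_def a_exact_at_def a_kernel_def'\<close>)

context artin_alg
begin

text \<open>Restricting the target of \<open>p\<close> to its image makes \<open>p\<close>
  surjective there; this yields the lifting hypotheses of the comparison lemmas.\<close>

lemma projective_lift_image:
 fixes P :: "('a, 'u) module"
 assumes "projective_module La P" "lmod La A" "lmod La B" "|A|\<lesssim>(UNIV :: 'u set)"
  and p: "p:Hom La A B" and g: "g:Hom La P B" "ALL x:|P|. g x\<in>p ` |A|"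
 shows "EX h:Hom La P A. ALL x:|P|. p (h x) = g x"
proof -
 let ?B = "B(|carrier := p ` |A| |)"
 note sub = submodule_image[OF assms(2,3) p left_module.submodule_carrier[OF assms(2)]]
 have "|?B|\<lesssim>(UNIV :: 'u set)" using lepoll_trans[OF image_lepoll assms(4)] by simp
 thus ?thesis
  by (intro projective_lift[OF assms(1,2) left_module.sub_left_module[OF assms(3) sub] hom_into_sub[OF p subset_refl] _ hom_into_sub[OF g(1)] assms(4)])
   (use g(2) in auto)
qed

text \<open>\<open>HD J\<close> does not have elements of type \<open>'u\<close>, so its lifts come
  from the dual basis.\<close>

lemma HD_lift_image:
 assumes J: "DL_basis J S a b" and "lmod La A" "lmod La B"
  and p: "p:Hom La A B" and g: "g:Hom La (HD J) B" "ALL x:|HD J|. g x\<in>p ` |A|"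
 shows "EX h:Hom La (HD J) A. ALL x:|HD J|. p (h x) = g x"
proof -
 note sub = submodule_image[OF assms(2,3) p left_module.submodule_carrier[OF assms(2)]]
 obtain l where "dual_basis La (HD J) S a l" using HD_dual_basis[OF J] by (elim exE conjE)
 thus ?thesis
  by (rule dual_basis_lift[OF _ assms(2) left_module.sub_left_module[OF assms(3) sub] hom_into_sub[OF p subset_refl] _ hom_into_sub[OF g(1)]])
   (use g(2) in auto)
qed

lemma Tmap_id:
 assumes "ALL y:|M|. h y = y" "u\<in>TF M"
 shows "Tmap h u = u"
 using assms(2) by (induction rule: TF_induct) (simp_all add: assms(1))

lemma Tmap_square:
 assumes "ALL y:|M|. g' (f y) = g (f' y)" "u\<in>TF M"
 shows "Tmap g' (Tmap f u) = Tmap g (Tmap f' u)"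
 using Tmap_comp[of M "%y. g' (f y)" g' f u] Tmap_comp[of M "%y. g' (f y)" g f' u] assms by simp

text \<open>Exactness of \<open>D\<Lambda> \<otimes> Q\<close> passes to \<open>D\<Lambda> \<otimes> P\<close> along a homotopy \<open>g f - 1 = d h + h d\<close>.\<close>

lemma tensor_exact_transfer:
 assumes P: "lmod La P0" "lmod La P1" "lmod La P2" and Q: "lmod La Q0" "lmod La Q1" "lmod La Q2"
  and d: "d0:Hom La P1 P0" "d1:Hom La P2 P1" and e: "e0:Hom La Q1 Q0" "e1:Hom La Q2 Q1"
  and f: "f0:Hom La P0 Q0" "f1:Hom La P1 Q1" "ALL x:|P1|. e0 (f1 x) = f0 (d0 x)"
  and g: "g1:Hom La Q1 P1" "g2:Hom La Q2 P2" "ALL x:|Q2|. d1 (g2 x) = g1 (e1 x)"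
  and h: "h0:Hom La P0 P1" "h1:Hom La P1 P2"
   "ALL x:|P1|. g1 (f1 x) = (d1 (h1 x)+\<^sub>P1 h0 (d0 x))+\<^sub>P1 x"
  and ex: "ALL u:TF Q1. Tmap e0 u\<in>TK Q0 --> (EX v:TF Q2. u - Tmap e1 v\<in>TK Q1)"
  and u: "u\<in>TF P1" "Tmap d0 u\<in>TK P0"
 shows "EX v:TF P2. u - Tmap d1 v\<in>TK P1"
proof -
 let ?w = "Tmap f1 u"
 note w = Tmap_closed[OF f(2) u(1)]
 have "Tmap e0 ?w = Tmap f0 (Tmap d0 u)" by (rule Tmap_square[of P1 e0 f1 f0 d0, OF f(3) u(1)])
 hence "Tmap e0 ?w\<in>TK Q0" using Tmap_TK[OF P(1) Q(1) f(1) u(2)] by simp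
 from ex[rule_format, OF w this] obtain v where v: "v\<in>TF Q2" "?w - Tmap e1 v\<in>TK Q1" by (rule bexE)
 have 1: "Tmap g1 ?w - Tmap d1 (Tmap g2 v)\<in>TK P1"
  using Tmap_TK[OF Q(2) P(2) g(1) v(2)] Tmap_square[of Q2 d1 g2 g1 e1, OF g(3) v(1)] by simp
 let ?dh = "compose |P1| d1 h1" and ?hd = "compose |P1| h0 d0"
 let ?s = "\<lambda>x\<in>|P1|. ?dh x+\<^sub>P1 ?hd x"
 have dh: "?dh:Hom La P1 P1" and hd: "?hd:Hom La P1 P1" by (rule compose_hom[OF P(2) h(2) d(2)] compose_hom[OF P(2) d(1) h(1)])+
 note s = add_hom[OF P(2,2) dh hd]
 let ?b = "Tmap (\<lambda>x\<in>|P1|. x) u"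
 have 2: "Tmap (%x. g1 (f1 x)) u - Tmap ?s u - ?b\<in>TK P1"
  by (rule Tmap_add[OF P(2) s id_hom[OF P(2)] _ u(1)]) (use h(3) in \<open>simp add: compose_eq\<close>)
 let ?a = "Tmap ?hd u"
 have 3: "Tmap ?s u - Tmap ?dh u - ?a\<in>TK P1"
  by (rule Tmap_add[OF P(2) dh hd _ u(1)]) simp
 have "?a = Tmap h0 (Tmap d0 u)" by (rule Tmap_comp[OF _ u(1)]) (simp add: compose_eq)
 hence 4: "?a\<in>TK P1" using Tmap_TK[OF P(1,2) h(1) u(2)] by simp
 have 5: "Tmap (%x. g1 (f1 x)) u = Tmap g1 ?w" by (rule Tmap_comp[OF _ u(1)]) simp
 have 6: "Tmap ?dh u = Tmap d1 (Tmap h1 u)" by (rule Tmap_comp[OF _ u(1)]) (simp add: compose_eq)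
 have 7: "?b = u" by (rule Tmap_id[OF _ u(1)]) simp
 have "u - Tmap d1 (Tmap g2 v - Tmap h1 u) = (Tmap g1 ?w - Tmap d1 (Tmap g2 v)) - (Tmap g1 ?w - Tmap ?s u - u) - (Tmap ?s u - Tmap ?dh u - ?a) - ?a"
  unfolding Tmap_simps 6 by simp
 also have "...\<in>TK P1" by (rule TK_closed(5)[OF P(2) TK_closed(5)[OF P(2) TK_closed(5)[OF P(2) 1 2[unfolded 5 7]] 3] 4])
 finally show ?thesis by (rule bexI) (intro TF_closed(1) Tmap_closed[OF g(2) v(1)] Tmap_closed[OF h(2) u(1)])
qed

end

section \<open>Cotorsionfree modules\<close>

lemma (in left_module) diff_diff_cancel:
 assumes "a\<in>|M|" "b\<in>|M|" "c\<in>|M|"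
 shows "(((a-\<^sub>M b)-\<^sub>M c)+\<^sub>M b)+\<^sub>M c = a"
proof -
 have d: "a-\<^sub>M b\<in>|M|" "(a-\<^sub>M b)-\<^sub>M c\<in>|M|" using assms by simp_all
 have "(((a-\<^sub>M b)-\<^sub>M c)+\<^sub>M b)+\<^sub>M c = (((a-\<^sub>M b)-\<^sub>M c)+\<^sub>M c)+\<^sub>M b"
  using d assms by (simp only: M.a_assoc M.a_comm[of b c])
 thus ?thesis using add_diff_cancel(2)[OF assms(3) d(1)] add_diff_cancel(2)[OF assms(2,1)] by simp
qed

context artin_alg
begin

text \<open>The start of the chosen minimal injective resolution, as far as it determines
  \<open>cTr\<close>. Minimality enters through the finite generation of the terms.\<close>

lemma cTr_presentation:
 fixes A :: "('a, 'u) module"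
 assumes "fg_module La A"
 shows "\<exists>i (I :: nat => ('a, 'u) module) f. (ALL n. fg_module La (I n) & injm La (I n)) &
  i:Hom La A (I 0) & inj_on i |A| & f:Hom La (I 0) (I 1) &
  i ` |A| = {x\<in>|I 0|. f x = 0\<^sub>(I 1)} &
  cTr R La E A = quot_module (HD (I 1)) (HDm (I 0) f ` |HD (I 0)| )"
proof -
 obtain i and I :: "nat => ('a, 'u) module" and f where t: "chosen_min_inj_res La A = (i, I, f)"
  by (cases "chosen_min_inj_res La A :: ('u => 'u)\<times>(nat => ('a, 'u) module)\<times>(nat => 'u => 'u)")
 have "EX t. case t of (i, I :: nat => ('a, 'u) module, f) => minimal_injective_resolution La A i I f"
  using ex_minimal_injective_resolution[OF assms] by simp
 from someI_ex[OF this] have m: "minimal_injective_resolution La A i I f"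
  using t by (simp add: chosen_min_inj_res_def)
 have "compose |DL| (f 0) ` |HD (I 0)| = HDm (I 0) (f 0) ` |HD (I 0)|"
  by (rule image_cong[OF refl]) (simp add: HDm_def)
 hence "cTr R La E A = quot_module (HD (I 1)) (HDm (I 0) (f 0) ` |HD (I 0)| )" by (simp add: cTr_def t)
 thus ?thesis using m minimal_injective_resolution_fg[OF assms m]
  unfolding minimal_injective_resolution_def injective_envelope_def a_exact_at_def a_kernel_def'
  by (intro exI[of _ i] exI[of _ I] exI[of _ "f 0"]) simp
qed

text \<open>Replaces the chosen projective resolution by one that is known explicitly, with Tor in
  the form of \<open>tensor_homology_iff\<close>. Degrees are written \<open>Suc n\<close> to
  resolve the subtraction in the definition of \<open>Tor\<close>.\<close>

lemma Tor_resolution: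
 fixes M :: "('a, 'm) module"
 assumes "fg_module La M"
 shows "\<exists>(P :: nat => ('a, 'u) module) d w. projective_resolution La M P d w &
  (ALL n. trivial_group (Tor La (Suc n) DR M :: (('a => 'u)\<times>'u \<Rightarrow>\<^sub>0 int) set set monoid) <->
   (ALL u:TF (P (Suc n)). Tmap (d n) u\<in>TK (P n) --> (EX v:TF (P (Suc (Suc n))). u - Tmap (d (Suc n)) v\<in>TK (P (Suc n)))))"
proof -
 obtain P :: "nat => ('a, 'u) module" and d w where t: "chosen_proj_res La M = (P, d, w)"
  by (cases "chosen_proj_res La M :: (nat => ('a, 'u) module)\<times>(nat => 'u => 'u)\<times>('u => 'm)")
 have "EX t. case t of (P :: nat => ('a, 'u) module, d, w) => projective_resolution La M P d w"
  using ex_proj_res[OF assms] by simp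
 from someI_ex[OF this] have p: "projective_resolution La M P d w" using t by (simp add: chosen_proj_res_def)
 note D = projective_resolutionD[OF p]
 have dd: "d n (d (Suc n) x) = 0\<^sub>(P n)" if "x\<in>|P (Suc (Suc n))|" for n x
  using D(7)[of n] imageI[OF that, of "d (Suc n)"] by simp
 have "trivial_group (Tor La (Suc n) DR M :: (('a => 'u)\<times>'u \<Rightarrow>\<^sub>0 int) set set monoid) <->
   (ALL u:TF (P (Suc n)). Tmap (d n) u\<in>TK (P n) --> (EX v:TF (P (Suc (Suc n))). u - Tmap (d (Suc n)) v\<in>TK (P (Suc n))))" for n
  using tensor_homology_iff[OF D(1)[rule_format, of "Suc (Suc n)"] D(1)[rule_format, of "Suc n"] D(1)[rule_format, of n]
   D(3)[rule_format, of "Suc n"] D(3)[rule_format, of n] dd]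
  by (simp add: Tor_def t)
 thus ?thesis using p by blast
qed

text \<open>Left exactness of Hom(D(\<open>La\<close>), -): a map killed by composition with
  \<open>f\<close> has its values in the kernel of \<open>f\<close>, which is the image of
  \<open>A\<close>.\<close>

lemma HD_values:
 assumes A: "lmod La A" "lmod La J" and i: "i:Hom La A J" "inj_on i |A|" "i ` |A| = {x\<in>|J|. f x = 0\<^sub>J'}"
  and w: "w:Hom La DL J" "HDm J f w = 0\<^sub>(HD J')"
 shows "EX v:Hom La DL A. ALL x:|DL|. i (v x) = w x"
proof (rule factor_mono[OF A(1) DL_module i(1,2) w(1)])
 fix x assume x: "x\<in>|DL|"
 hence "f (w x) = 0\<^sub>J'" using HDm_apply[OF w(1), of x f] w(2) by simp
 thus "w x\<in>i ` |A|" unfolding i(3) using hom_cl[OF w(1) x] by blast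
qed

text \<open>With \<open>Q\<^sub>0 = Hom(D\<Lambda>, I\<^sup>1)\<close> and \<open>Q\<^sub>1 = Hom(D\<Lambda>, I\<^sup>0)\<close> an element of \<open>A\<close> is a cycle in
 \<open>I\<^sup>0 = D\<Lambda> \<otimes> Q\<^sub>1\<close>; comparing with a resolution of the cotranspose, it comes from
 the kernel \<open>Hom(D\<Lambda>, A)\<close> of \<open>Q\<^sub>1 \<rightarrow> Q\<^sub>0\<close>.\<close>

lemma cotorsionfree_DL_generated:
 fixes A :: "('a, 'u) module"
 assumes A: "fg_module La A" "cotorsionfree R La E 1 A"
 shows "DL_generated A"
proof -
 note Am = fg_left_module[OF A(1)]
 obtain i and I :: "nat => ('a, 'u) module" and f where I: "ALL n. fg_module La (I n) & injm La (I n)"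
  and i: "i:Hom La A (I 0)" "inj_on i |A|" and f: "f:Hom La (I 0) (I 1)"
  and ker: "i ` |A| = {x\<in>|I 0|. f x = 0\<^sub>(I 1)}"
  and C: "cTr R La E A = quot_module (HD (I 1)) (HDm (I 0) f ` |HD (I 0)| )"
  using cTr_presentation[OF A(1)] by (elim exE conjE)
 have Im: "lmod La (I n)" for n using I fg_left_module by blast
 note Q = HD_module[OF Im]
 obtain S0 :: "('u => 'u) set" and a0 b0 where B0: "DL_basis (I 0) S0 a0 b0" using ex_DL_basis[of "I 0"] I by blast
 obtain S1 :: "('u => 'u) set" and a1 b1 where B1: "DL_basis (I 1) S1 a1 b1" using ex_DL_basis[of "I 1"] I by blast
 have small: "|HD (I n)|\<lesssim>(UNIV :: 'u set)" for n using I fg_small[OF HD_fg] by blast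
 let ?w = "HDm (I 0) f"
 let ?B = "?w ` |HD (I 0)|" and ?C = "cTr R La E A"
 note w = HDm_hom[OF Im Im f]
 note B = submodule_image[OF Q Q w left_module.submodule_carrier[OF Q]]
 note quot = left_module_quot[OF Q B, folded C]
 let ?t = "\<lambda>x\<in>|HD (I 1)|. ?B +>\<^bsub>HD (I 1)\<^esub> x"
 have t0: "?t x = 0\<^sub>?C <-> x\<in>?B" if "x\<in>|HD (I 1)|" for x using quot(4)[OF that] unfolding restrict_apply'[OF that] .
 have "fg_module La (HD (I 1))" using I HD_fg by blast
 from fg_image[OF this quot(1-3)] have Cfg: "fg_module La ?C" .
 obtain P :: "nat => ('a, 'u) module" and d l where P: "projective_resolution La ?C P d l"
  and Tor: "ALL n. trivial_group (Tor La (Suc n) DR ?C :: (('a => 'u)\<times>'u \<Rightarrow>\<^sub>0 int) set set monoid) <->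
   (ALL u:TF (P (Suc n)). Tmap (d n) u\<in>TK (P n) --> (EX v:TF (P (Suc (Suc n))). u - Tmap (d (Suc n)) v\<in>TK (P (Suc n))))"
  using Tor_resolution[OF Cfg] by (elim exE conjE)
 let ?a = "Suc 0"
 have tor: "EX v:TF (P (Suc ?a)). u - Tmap (d ?a) v\<in>TK (P ?a)" if "u\<in>TF (P ?a)" "Tmap (d 0) u\<in>TK (P 0)" for u
  using Tor[rule_format, of 0] A(2) that by (simp add: cotorsionfree_def)
 note D = projective_resolutionD[OF P]
 note Pm = D(1)[rule_format] and d = D(3)[rule_format] and cl = hom_cl
 interpret Q0: left_module La "HD (I 1)" by (rule Q)
 interpret Q1: left_module La "HD (I 0)" by (rule Q)
 interpret C: left_module La ?C by (rule quot)
 have ld: "l (d 0 x) = 0\<^sub>?C" if "x\<in>|P ?a|" for x using D(6) imageI[OF that, of "d 0"] by simp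
 have tw: "?t (?w x) = 0\<^sub>?C" if "x\<in>|HD (I 0)|" for x using t0[OF cl[OF w that]] that by blast
 have "ALL x:|HD (I 1)|. ?t x\<in>l ` |P 0|" unfolding D(5) by (intro ballI cl[OF quot(2)])
 \<comment> \<open>Comparison maps in degrees 0 and 1 between the presentation of \<open>cTr\<close>
   by \<open>HD (I 0)\<close> and \<open>HD (I 1)\<close> and the chosen resolution:
   \<open>f0\<close> and \<open>f1\<close> lead into \<open>P\<close>, \<open>g0\<close> and
   \<open>g1\<close> back.\<close>
 from HD_lift_image[OF B1 Pm quot(1) D(4) quot(2) this]
 obtain f0 where f0: "f0:Hom La (HD (I 1)) (P 0)" "ALL x:|HD (I 1)|. l (f0 x) = ?t x" by (rule bexE)
 have "ALL x:|P 0|. l x\<in>?t ` |HD (I 1)|" unfolding quot(3) by (intro ballI cl[OF D(4)])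
 from projective_lift_image[OF D(2) Q quot(1) small quot(2) D(4) this]
 obtain g0 where g0: "g0:Hom La (P 0) (HD (I 1))" "ALL x:|P 0|. ?t (g0 x) = l x" by (rule bexE)
 have "ALL x:|HD (I 0)|. compose |HD (I 0)| f0 ?w x\<in>d 0 ` |P ?a|"
  unfolding D(6)
 proof (intro ballI CollectI conjI)
  fix x assume x: "x\<in>|HD (I 0)|"
  show "compose |HD (I 0)| f0 ?w x\<in>|P 0|" by (rule cl[OF compose_hom[OF Q w f0(1)] x])
  show "l (compose |HD (I 0)| f0 ?w x) = 0\<^sub>?C"
   unfolding compose_eq[OF x] bspec[OF f0(2) cl[OF w x]] by (rule tw[OF x])
 qed
 from HD_lift_image[OF B0 Pm Pm d compose_hom[OF Q w f0(1)] this]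
 obtain f1 where f1: "f1:Hom La (HD (I 0)) (P ?a)" "ALL x:|HD (I 0)|. d 0 (f1 x) = compose |HD (I 0)| f0 ?w x" by (rule bexE)
 have "ALL x:|P ?a|. compose |P ?a| g0 (d 0) x\<in>?B"
 proof
  fix x assume x: "x\<in>|P ?a|"
  have "?t (g0 (d 0 x)) = 0\<^sub>?C" unfolding bspec[OF g0(2) cl[OF d x]] by (rule ld[OF x])
  thus "compose |P ?a| g0 (d 0) x\<in>?B" unfolding compose_eq[OF x] t0[OF cl[OF g0(1) cl[OF d x]]] .
 qed
 from projective_lift_image[OF D(2) Q Q small w compose_hom[OF Pm d g0(1)] this]
 obtain g1 where g1: "g1:Hom La (P ?a) (HD (I 0))" "ALL x:|P ?a|. ?w (g1 x) = compose |P ?a| g0 (d 0) x" by (rule bexE)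
 \<comment> \<open>The defect of \<open>g0 f0\<close> from the identity dies in \<open>cTr\<close>,
   so it factors as \<open>?w h0\<close>.\<close>
 let ?e = "\<lambda>x\<in>|HD (I 1)|. compose |HD (I 1)| g0 f0 x-\<^sub>(HD (I 1)) (\<lambda>x\<in>|HD (I 1)|. x) x"
 have e: "?e:Hom La (HD (I 1)) (HD (I 1))" by (rule minus_hom[OF Q Q compose_hom[OF Q f0(1) g0(1)] id_hom[OF Q]])
 have eeq: "?e x = g0 (f0 x)-\<^sub>(HD (I 1)) x" if "x\<in>|HD (I 1)|" for x unfolding restrict_apply'[OF that] compose_eq[OF that] ..
 have "ALL x:|HD (I 1)|. ?e x\<in>?B"
 proof
  fix x assume x: "x\<in>|HD (I 1)|"
  note c = cl[OF g0(1) cl[OF f0(1) x]]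
  have "?t (g0 (f0 x)-\<^sub>(HD (I 1)) x) = ?t (g0 (f0 x))-\<^sub>?C ?t x" by (rule hom_minus[OF Q quot(1,2) c x])
  also have "?t (g0 (f0 x)) = ?t x" unfolding bspec[OF g0(2) cl[OF f0(1) x]] by (rule bspec[OF f0(2) x])
  also have "?t x-\<^sub>?C ?t x = 0\<^sub>?C" using C.diff_eq_zero_iff[OF cl[OF quot(2) x] cl[OF quot(2) x]] by (rule iffD2) (rule refl)
  finally show "?e x\<in>?B" unfolding eeq[OF x] t0[OF Q0.M.minus_closed[OF c x]] .
 qed
 from HD_lift_image[OF B1 Q Q w e this]
 obtain h0 where h0: "h0:Hom La (HD (I 1)) (HD (I 0))" "ALL x:|HD (I 1)|. ?w (h0 x) = ?e x" by (rule bexE)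
 \<comment> \<open>The defect of \<open>g1 f1\<close> from the identity, corrected by
   \<open>h0 ?w\<close>, is a map \<open>?z\<close> into the kernel of \<open>?w\<close>. As the
   presentation ends here, there is no further homotopy to absorb \<open>?z\<close>; it suffices
   that the maps in its image take values in the image of \<open>A\<close>.\<close>
 let ?gf = "compose |HD (I 0)| g1 f1" and ?h = "compose |HD (I 0)| h0 ?w"
 let ?z = "\<lambda>x\<in>|HD (I 0)|. (\<lambda>x\<in>|HD (I 0)|. ?gf x-\<^sub>(HD (I 0)) ?h x) x-\<^sub>(HD (I 0)) (\<lambda>x\<in>|HD (I 0)|. x) x"
 let ?b = "Hom La (HD (I 0)) (HD (I 0))"
 have gf: "?gf\<in>?b" and h: "?h\<in>?b"
  by (rule compose_hom[OF Q f1(1) g1(1)] compose_hom[OF Q w h0(1)])+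
 have z: "?z\<in>?b" by (rule minus_hom[OF Q Q minus_hom[OF Q Q gf h] id_hom[OF Q]])
 have zeq: "?z x = (?gf x-\<^sub>(HD (I 0)) ?h x)-\<^sub>(HD (I 0)) x" if "x\<in>|HD (I 0)|" for x unfolding restrict_apply'[OF that] ..
 let ?k = "\<lambda>x\<in>|HD (I 0)|. ?z x+\<^sub>(HD (I 0)) ?h x"
 note k = add_hom[OF Q Q z h]
 have gfk: "?gf x = ?k x+\<^sub>(HD (I 0)) (\<lambda>x\<in>|HD (I 0)|. x) x" if x: "x\<in>|HD (I 0)|" for x
  unfolding restrict_apply'[OF x, of "%x. ?z x+\<^sub>(HD (I 0)) ?h x"] restrict_apply'[OF x, of "%x. x"] zeq[OF x]
  by (rule Q1.diff_diff_cancel[OF cl[OF gf x] cl[OF h x] x, symmetric])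
 have wz: "?w (?z x) = 0\<^sub>(HD (I 1))" if x: "x\<in>|HD (I 0)|" for x
 proof -
  note dx = cl[OF w x]
  note g = cl[OF g0(1) cl[OF f0(1) dx]]
  have "?w (?z x) = (?w (?gf x)-\<^sub>(HD (I 1)) ?w (?h x))-\<^sub>(HD (I 1)) ?w x"
   unfolding zeq[OF x] hom_minus[OF Q Q w Q1.M.minus_closed[OF cl[OF gf x] cl[OF h x]] x] hom_minus[OF Q Q w cl[OF gf x] cl[OF h x]] ..
  also have "?w (?gf x) = g0 (f0 (?w x))"
   unfolding compose_eq[OF x] bspec[OF g1(2) cl[OF f1(1) x]] compose_eq[OF cl[OF f1(1) x]] bspec[OF f1(2) x] ..
  also have "?w (?h x) = g0 (f0 (?w x))-\<^sub>(HD (I 1)) ?w x" unfolding compose_eq[OF x] bspec[OF h0(2) dx] by (rule eeq[OF dx])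
  also have "g0 (f0 (?w x))-\<^sub>(HD (I 1)) (g0 (f0 (?w x))-\<^sub>(HD (I 1)) ?w x) = ?w x"
   using g dx by (simp only: Q0.M.minus_eq Q0.M.minus_add Q0.M.minus_minus Q0.M.a_inv_closed Q0.M.a_assoc[symmetric] Q0.M.r_neg Q0.M.l_zero)
  also have "?w x-\<^sub>(HD (I 1)) ?w x = 0\<^sub>(HD (I 1))" using Q0.diff_eq_zero_iff[OF dx dx] by (rule iffD2) (rule refl)
  finally show ?thesis .
 qed
 show ?thesis
  unfolding DL_generated_def
 proof (intro allI impI; elim conjE)
  fix N assume N: "submodule N La A" "ALL m:Hom La DL A. m ` |DL| <= N"
  note iN = submodule_image[OF Am Im i(1) N(1)]
  have val: "m ` |DL| <= i ` N" if "m:Hom La DL (I 0)" "?w m = 0\<^sub>(HD (I 1))" for m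
  proof -
   from HD_values[OF Am Im i ker that]
   obtain b where b: "b:Hom La DL A" "ALL x:|DL|. i (b x) = m x" by (rule bexE)
   show ?thesis
   proof (rule image_subsetI)
    fix x assume x: "x\<in>|DL|"
    have "b x\<in>N" using N(2) b(1) x by blast
    thus "m x\<in>i ` N" unfolding bspec[OF b(2) x, symmetric] by (rule imageI)
   qed
  qed
  have "x\<in>N" if x: "x\<in>|A|" for x
  proof -
   \<comment> \<open>An element of \<open>A\<close>, seen in \<open>I 0\<close>, is the value of
     some tensor \<open>u\<close>; since \<open>f\<close> kills it, the image of \<open>u\<close>
     over \<open>HD (I 1)\<close> is a relation.\<close>
   obtain u where u: "u\<in>TF (HD (I 0))" "ev (I 0) u = i x" using ev_iso(2)[OF B0 cl[OF i(1) x]] by (rule bexE)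
   have "f (i x) = 0\<^sub>(I 1)" using ker x by blast
   hence "Tmap ?w u\<in>TK (HD (I 1))"
    using ev_natural[OF Im Im f u(1)] u(2) by (intro ev_iso(1)[OF B1 Tmap_closed[OF w u(1)]]) simp
   note wu = this
   have "Tmap (d 0) (Tmap f1 u) = Tmap f0 (Tmap ?w u)"
    by (rule Tmap_square[of "HD (I 0)" "d 0" f1 f0 ?w, OF _ u(1)]) (use f1(2) in \<open>simp add: compose_eq\<close>)
   hence "Tmap (d 0) (Tmap f1 u)\<in>TK (P 0)" using Tmap_TK[OF Q Pm f0(1) wu] by simp
   \<comment> \<open>Here cotorsionfreeness enters: the cycle \<open>Tmap f1 u\<close> is a boundary
     up to relations.\<close>
   from tor[OF Tmap_closed[OF f1(1) u(1)] this]
   obtain v where v: "v\<in>TF (P (Suc ?a))" "Tmap f1 u - Tmap (d ?a) v\<in>TK (P ?a)" by (rule bexE)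
   let ?gd = "compose |P (Suc ?a)| g1 (d ?a)"
   note gd = compose_hom[OF Pm d g1(1)]
   have "Tmap ?gf u = Tmap g1 (Tmap f1 u)" by (rule Tmap_comp[OF _ u(1)]) (simp add: compose_eq)
   moreover have "Tmap ?gd v = Tmap g1 (Tmap (d ?a) v)" by (rule Tmap_comp[OF _ v(1)]) (simp add: compose_eq)
   ultimately have 1: "Tmap ?gf u - Tmap ?gd v\<in>TK (HD (I 0))" using Tmap_TK[OF Pm Q g1(1) v(2)] by simp
   have 2: "Tmap ?gf u - Tmap ?k u - u\<in>TK (HD (I 0))"
    using Tmap_add[OF Q k id_hom[OF Q] _ u(1), of ?gf] gfk Tmap_id[OF _ u(1), of "\<lambda>x\<in>|HD (I 0)|. x"] by simp
   have 3: "Tmap ?k u - Tmap ?z u - Tmap ?h u\<in>TK (HD (I 0))" by (rule Tmap_add[OF Q z h _ u(1)], rule ballI, rule restrict_apply')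
   have "Tmap ?h u = Tmap h0 (Tmap ?w u)" by (rule Tmap_comp[OF _ u(1)]) (simp add: compose_eq)
   hence 4: "Tmap ?h u\<in>TK (HD (I 0))" using Tmap_TK[OF Q Q h0(1) wu] by simp
   \<comment> \<open>Modulo relations \<open>u\<close> equals \<open>?r\<close>, both parts of which
     have their second factors in the kernel of \<open>?w\<close>, that is, in
     Hom(D(\<open>La\<close>), \<open>A\<close>).\<close>
   let ?r = "Tmap ?gd v - Tmap ?z u"
   have gdv: "Tmap ?gd v\<in>TF (HD (I 0))" and zu: "Tmap ?z u\<in>TF (HD (I 0))" by (rule Tmap_closed[OF gd v(1)] Tmap_closed[OF z u(1)])+
   have "u - ?r = (Tmap ?gf u - Tmap ?gd v) - (Tmap ?gf u - Tmap ?k u - u) - (Tmap ?k u - Tmap ?z u - Tmap ?h u) - Tmap ?h u"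
    by (simp only: algebra_simps)
   also have "...\<in>TK (HD (I 0))" by (rule TK_closed(5)[OF Q TK_closed(5)[OF Q TK_closed(5)[OF Q 1 2] 3] 4])
   finally have "ev (I 0) (u - ?r) = 0\<^sub>(I 0)" by (rule ev_TK[OF Im])
   hence "i x-\<^sub>(I 0) ev (I 0) ?r = 0\<^sub>(I 0)" unfolding ev(3)[OF Im u(1) TF_closed(1)[OF gdv zu]] u(2) .
   hence "i x = ev (I 0) ?r" using left_module.diff_eq_zero_iff[OF Im cl[OF i(1) x] ev(1)[OF Im TF_closed(1)[OF gdv zu]]] by (rule iffD1[rotated])
   also have "...\<in>i ` N"
    unfolding ev(3)[OF Im gdv zu]
   proof (rule left_module.submoduleD(6)[OF Im iN])
    show "ev (I 0) (Tmap ?gd v)\<in>i ` N"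
    proof (rule ev_submodule[OF Im iN gd v(1)], rule ballI)
     fix y assume y: "y\<in>|P (Suc ?a)|"
     note dy = cl[OF d y]
     have "d 0 (d ?a y) = 0\<^sub>(P 0)" using D(7)[of 0] imageI[OF y, of "d ?a"] by simp
     hence "?w (?gd y) = 0\<^sub>(HD (I 1))"
      unfolding compose_eq[OF y] bspec[OF g1(2) dy] compose_eq[OF dy] using hom_zero[OF Pm Q g0(1)] by simp
     thus "?gd y ` |DL| <= i ` N" by (intro val) (use cl[OF gd y] in \<open>simp only: HD_simps(1)\<close>)
    qed
    show "ev (I 0) (Tmap ?z u)\<in>i ` N"
    proof (rule ev_submodule[OF Im iN z u(1)], rule ballI)
     fix y assume y: "y\<in>|HD (I 0)|"
     show "?z y ` |DL| <= i ` N" by (rule val[OF _ wz[OF y]]) (use cl[OF z y] in \<open>simp only: HD_simps(1)\<close>)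
    qed
   qed
   finally obtain y where "y\<in>N" "i x = i y" by blast
   thus "x\<in>N" using inj_onD[OF i(2)] x left_module.submoduleD(2)[OF Am N(1)] by blast
  qed
  thus "N = |A|" using left_module.submoduleD(1)[OF Am N(1)] by blast
 qed
qed


section \<open>From biresolving classes to the vanishing of all Tor groups\<close>

lemma DL_lift:
 fixes M N F :: "('a, 'u) module"
 assumes s: "ses La N j F q M" and e: "\<forall>J :: ('a, 'u) module. injm La J --> ext1_zero La J N"
  and w: "w:Hom La DL M"
 shows "EX v:Hom La DL F. ALL x:|DL|. q (v x) = w x"
proof -
 \<comment> \<open>\<open>ext1_zero\<close> concerns modules over \<open>'u\<close>, so
   D(\<open>La\<close>) is replaced by an isomorphic copy there, which is injective by a basis with
   a single index.\<close>
 obtain D' :: "('a, 'u) module" and f g where I: "module_iso La DL D' f g" using ex_module_copy[OF DL_module DL_small] by blast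
 note D = module_isoD[OF I]
 interpret D': left_module La D' by (rule D)
 have "DL_basis D' {()} (%_. f) (%_. g)"
  unfolding DL_basis_def using D(2,3,4) D(6)[symmetric] D(6) by simp
 hence "ext1_zero La D' N" using e DL_basis_injective by blast
 from ext1_zero_lift[OF this s compose_hom[OF D(2,4) w] D(2) infinite_univ]
 obtain h where h: "h:Hom La D' F" "ALL y:|D'|. q (h y) = compose |D'| w g y" by (rule bexE)
 have "q (compose |DL| h f x) = w x" if x: "x\<in>|DL|" for x
  unfolding compose_eq[OF x] bspec[OF h(2) D(11)[OF x]] compose_eq[OF D(11)[OF x]] D(5)[OF x] ..
 thus ?thesis by (intro bexI[OF _ compose_hom[OF DL_module D(3) h(1)]] ballI)
qed

text \<open>The complex \<open>\<dots> \<rightarrow> I\<^sub>1 \<rightarrow> I\<^sub>0 \<rightarrow> I\<^sup>0 \<rightarrow> I\<^sup>1\<close>, numbered from the right, with its cycles.\<close>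

definition cycle_complex :: "(nat => ('a, 'u) module) => (nat => 'u => 'u) => (nat => ('a, 'u) module) => (nat => 'u => 'u) => (nat => 'u => 'u) => bool"
 where "cycle_complex J d Z k q <->
  (ALL n. fg_module La (J n) & injm La (J n)) & (ALL n. d n:Hom La (J (Suc n)) (J n)) &
  (ALL n. lmod La (Z n) & k n:Hom La (Z n) (J (Suc n)) & inj_on (k n) |Z n| &
   k n ` |Z n| = {x\<in>|J (Suc n)|. d n x = 0\<^sub>(J n)} &
   q n:Hom La (J (Suc (Suc n))) (Z n) & q n ` |J (Suc (Suc n))| = |Z n| &
   (ALL w:Hom La DL (Z n). EX v:Hom La DL (J (Suc (Suc n))). ALL x:|DL|. q n (v x) = w x) &
   d (Suc n) = compose |J (Suc (Suc n))| (k n) (q n))"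

text \<open>The start of the minimal resolution is kept, since \<open>cTr\<close> is defined by it,
  and is continued to the left by syzygies of \<open>A\<close> inside the class. The two parts are
  joined at \<open>A\<close>, whose given embedding becomes \<open>k 0\<close>.\<close>

lemma biresolving_complex:
 fixes A :: "('a, 'u) module" and I :: "nat => ('a, 'u) module"
 assumes C: "biresolving La (fg_module La) C" "A\<in>C"
  and I: "ALL n. fg_module La (I n) & injm La (I n)"
  and i: "i:Hom La A (I 0)" "inj_on i |A|" and f: "f:Hom La (I 0) (I 1)"
  and ker: "i ` |A| = {x\<in>|I 0|. f x = 0\<^sub>(I 1)}"
 shows "EX J d Z k q. J 0 = I 1 & J (Suc 0) = I 0 & d 0 = f & cycle_complex J d Z k q"
proof -
 have "ALL N. EX t. N\<in>C --> (case t of (N', j, F :: ('a, 'u) module, q) =>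
   injm La F & fg_module La F & ses La N' j F q N & N'\<in>C)"
  using biresolvingD(4)[OF C(1)] by simp
 then obtain T where T: "ALL N. N\<in>C --> (case T N of (N', j, F :: ('a, 'u) module, q) =>
   injm La F & fg_module La F & ses La N' j F q N & N'\<in>C)" by (rule choice[THEN exE])
 define Z where "Z n = ((%N. fst (T N)) ^^ n) A" for n
 define j where "j n = fst (snd (T (Z n)))" for n
 define F where "F n = fst (snd (snd (T (Z n))))" for n
 define q where "q n = snd (snd (snd (T (Z n))))" for n
 have ZS: "Z (Suc n) = fst (T (Z n))" for n by (simp add: Z_def)
 have ZC: "Z n\<in>C" for n
 proof (induction n)
  case 0
  thus ?case using C(2) by (simp add: Z_def)
 next
  case (Suc n)
  thus ?case using T[rule_format, OF Suc] unfolding ZS by (simp split: prod.splits)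
 qed
 have F: "injm La (F n)" "fg_module La (F n)" and s: "ses La (Z (Suc n)) (j n) (F n) (q n) (Z n)" for n
  using T[rule_format, OF ZC[of n]] unfolding ZS F_def j_def q_def by (simp_all split: prod.splits)
 note S = sesD[OF s]
 define J where "J n = (case n of 0 => I 1 | Suc m => (case m of 0 => I 0 | Suc l => F l))" for n
 define k where "k n = (case n of 0 => i | Suc m => j m)" for n
 define d where "d n = (case n of 0 => f | Suc m => compose |F m| (k m) (q m))" for n
 have J: "J 0 = I 1" "J (Suc 0) = I 0" "J (Suc (Suc n)) = F n" for n by (simp_all add: J_def)
 have Zm: "lmod La (Z n)" for n by (rule S(3))
 have k: "k n:Hom La (Z n) (J (Suc n))" "inj_on (k n) |Z n|" for n
  using i S(4,6) by (cases n; simp add: k_def J Z_def)+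
 have JI: "fg_module La (J n)" "injm La (J n)" for n
  using I F by (simp_all add: J_def split: nat.splits)
 have d: "d n:Hom La (J (Suc n)) (J n)" for n
 proof (cases n)
  case 0
  thus ?thesis using f by (simp add: d_def J)
 next
  case (Suc m)
  thus ?thesis using compose_hom[OF S(2,5) k(1), of m] by (simp add: d_def J)
 qed
 have kd: "k n ` |Z n| = {x\<in>|J (Suc n)|. d n x = 0\<^sub>(J n)}" for n
 proof (cases n)
  case 0
  thus ?thesis using ker by (simp add: k_def d_def J Z_def)
 next
  case (Suc m)
  note Jm = fg_left_module[OF JI(1)]
  have "k m (q m x) = 0\<^sub>(J (Suc m)) <-> q m x = 0\<^sub>(Z m)" if x: "x\<in>|F m|" for x
  proof
   assume "k m (q m x) = 0\<^sub>(J (Suc m))"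
   thus "q m x = 0\<^sub>(Z m)" using inj_on_hom_iff[OF Zm Jm k(1)] k(2) hom_cl[OF S(5) x] by simp
  qed (simp add: hom_zero[OF Zm Jm k(1)])
  hence "{x\<in>|F m|. d (Suc m) x = 0\<^sub>(J (Suc m))} = {x\<in>|F m|. q m x = 0\<^sub>(Z m)}"
   by (intro Collect_cong conj_cong refl) (simp add: d_def compose_eq)
  thus ?thesis using S(8)[of m] Suc by (simp add: k_def J)
 qed
 have l: "ALL w:Hom La DL (Z n). EX v:Hom La DL (F n). ALL x:|DL|. q n (v x) = w x" for n
  using biresolvingD(2)[OF C(1) ZC] by (intro ballI DL_lift[OF s]) simp_all
 have dS: "d (Suc n) = compose |F n| (k n) (q n)" "d 0 = f" for n by (simp_all add: d_def)
 show ?thesis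
  unfolding cycle_complex_def
  by (rule exI[of _ J], rule exI[of _ d], rule exI[of _ Z], rule exI[of _ k], rule exI[of _ q])
   (unfold J(3), intro conjI allI; rule J(1) J(2) dS JI Zm k kd S(5) S(7) l d)
qed

text \<open>Exactness of Hom(D(\<open>La\<close>), -) on the complex comes from lifting maps from
  D(\<open>La\<close>) along \<open>q n\<close>. For the tensored complex, evaluation leads back to
  the exact complex \<open>J\<close>: the preimage is found there and returned by
  \<open>ev_iso\<close>.\<close>

lemma HD_complex:
 assumes "cycle_complex J d Z k q"
 shows "w\<in>|HD (J (Suc (Suc n)))| ==> HDm (J (Suc n)) (d n) (HDm (J (Suc (Suc n))) (d (Suc n)) w) = 0\<^sub>(HD (J n))"
  "w\<in>|HD (J (Suc n))| ==> HDm (J (Suc n)) (d n) w = 0\<^sub>(HD (J n)) ==>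
   w\<in>HDm (J (Suc (Suc n))) (d (Suc n)) ` |HD (J (Suc (Suc n)))|"
  "u\<in>TF (HD (J (Suc n))) ==> Tmap (HDm (J (Suc n)) (d n)) u\<in>TK (HD (J n)) ==>
   EX v:TF (HD (J (Suc (Suc n)))). u - Tmap (HDm (J (Suc (Suc n))) (d (Suc n))) v\<in>TK (HD (J (Suc n)))"
proof -
 note A = assms[unfolded cycle_complex_def]
 note J = A[THEN conjunct1] and d = A[THEN conjunct2, THEN conjunct1] and Z = A[THEN conjunct2, THEN conjunct2]
 have Jm: "lmod La (J n)" for n using J fg_left_module by blast
 note Q = HD_module[OF Jm] and d' = d[rule_format]
 have Zn: "lmod La (Z n)" "k n:Hom La (Z n) (J (Suc n))" "inj_on (k n) |Z n|"
  "k n ` |Z n| = {x\<in>|J (Suc n)|. d n x = 0\<^sub>(J n)}"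
  "q n:Hom La (J (Suc (Suc n))) (Z n)" "q n ` |J (Suc (Suc n))| = |Z n|"
  "ALL w:Hom La DL (Z n). EX r:Hom La DL (J (Suc (Suc n))). ALL x:|DL|. q n (r x) = w x" for n
  using Z by simp_all
 have dq: "d (Suc n) x = k n (q n x)" if "x\<in>|J (Suc (Suc n))|" for n x using Z that by (simp add: compose_eq)
 note cl = hom_cl
 show "HDm (J (Suc n)) (d n) (HDm (J (Suc (Suc n))) (d (Suc n)) w) = 0\<^sub>(HD (J n))" if "w\<in>|HD (J (Suc (Suc n)))|" for n w
 proof -
  have w: "w:Hom La DL (J (Suc (Suc n)))" using that by simp
  note w' = HDm_closed[OF d' w]
  have "HDm (J (Suc n)) (d n) (HDm (J (Suc (Suc n))) (d (Suc n)) w) = (\<lambda>x\<in>|DL|. 0\<^sub>(J n))"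
  proof (rule hom_eqI[OF HDm_closed[OF d' w'] zero_hom[OF DL_module Jm]])
   fix x assume x: "x\<in>|DL|"
   hence x': "x:Hom R La E" by simp
   have "d n (d (Suc n) (w x)) = 0\<^sub>(J n)"
    unfolding dq[OF cl[OF w x]] using imageI[OF cl[OF Zn(5) cl[OF w x]], of "k n"] unfolding Zn(4) by blast
   thus "HDm (J (Suc n)) (d n) (HDm (J (Suc (Suc n))) (d (Suc n)) w) x = (\<lambda>x\<in>|DL|. 0\<^sub>(J n)) x"
    unfolding HDm_apply[OF w' x'] HDm_apply[OF w x'] restrict_apply'[OF x] .
  qed
  thus ?thesis by simp
 qed
 show "w\<in>HDm (J (Suc (Suc n))) (d (Suc n)) ` |HD (J (Suc (Suc n)))|"
  if "w\<in>|HD (J (Suc n))|" "HDm (J (Suc n)) (d n) w = 0\<^sub>(HD (J n))" for n w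
 proof -
  have w: "w:Hom La DL (J (Suc n))" using that(1) by simp
  from HD_values[OF Zn(1) Jm Zn(2-4) w that(2)]
  obtain r where r: "r:Hom La DL (Z n)" "ALL x:|DL|. k n (r x) = w x" by (rule bexE)
  from bspec[OF Zn(7) r(1)]
  obtain h where h: "h:Hom La DL (J (Suc (Suc n)))" "ALL x:|DL|. q n (h x) = r x" by (rule bexE)
  have "w = HDm (J (Suc (Suc n))) (d (Suc n)) h"
  proof (rule hom_eqI[OF w HDm_closed[OF d' h(1)]])
   fix x assume x: "x\<in>|DL|"
   hence x': "x:Hom R La E" by simp
   show "w x = HDm (J (Suc (Suc n))) (d (Suc n)) h x"
    unfolding HDm_apply[OF h(1) x'] dq[OF cl[OF h(1) x]] bspec[OF h(2) x] bspec[OF r(2) x] ..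
  qed
  with h(1) show ?thesis by simp
 qed
 assume u: "u\<in>TF (HD (J (Suc n)))" "Tmap (HDm (J (Suc n)) (d n)) u\<in>TK (HD (J n))"
 have basis: "\<exists>(S :: ('u => 'u) set) a b. DL_basis (J m) S a b" for m using ex_DL_basis J by blast
 obtain S :: "('u => 'u) set" and a b where B: "DL_basis (J (Suc n)) S a b" using basis[of "Suc n"] by (elim exE)
 obtain S' :: "('u => 'u) set" and a' b' where B': "DL_basis (J (Suc (Suc n))) S' a' b'" using basis[of "Suc (Suc n)"] by (elim exE)
 have "d n (ev (J (Suc n)) u) = 0\<^sub>(J n)" using ev_natural[OF Jm Jm d' u(1)] ev_TK[OF Jm u(2)] by simp
 hence "ev (J (Suc n)) u\<in>k n ` |Z n|" unfolding Zn(4) using ev(1)[OF Jm u(1)] by blast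
 then obtain z where z: "z\<in>|J (Suc (Suc n))|" "ev (J (Suc n)) u = k n (q n z)" unfolding Zn(6)[symmetric] by blast
 obtain v where v: "v\<in>TF (HD (J (Suc (Suc n))))" "ev (J (Suc (Suc n))) v = z" using ev_iso(2)[OF B' z(1)] by (rule bexE)
 let ?v = "Tmap (HDm (J (Suc (Suc n))) (d (Suc n))) v"
 have c: "?v\<in>TF (HD (J (Suc n)))" by (rule Tmap_closed[OF HDm_hom[OF Jm Jm d'] v(1)])
 have "ev (J (Suc n)) ?v = ev (J (Suc n)) u" unfolding ev_natural[OF Jm Jm d' v(1)] v(2) dq[OF z(1)] z(2) ..
 hence "ev (J (Suc n)) (u - ?v) = 0\<^sub>(J (Suc n))"
  unfolding ev(3)[OF Jm u(1) c] using left_module.diff_eq_zero_iff[OF Jm ev(1)[OF Jm u(1)] ev(1)[OF Jm c]] by simp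
 from ev_iso(1)[OF B TF_closed(1)[OF u(1) c] this]
 show "EX v:TF (HD (J (Suc (Suc n)))). u - Tmap (HDm (J (Suc (Suc n))) (d (Suc n))) v\<in>TK (HD (J (Suc n)))" using v(1) by (rule bexI)
qed

lemma (in left_module) sub_add_cancel:
 assumes "a\<in>|M|" "b\<in>|M|" "c\<in>|M|"
 shows "(((a-\<^sub>M c)-\<^sub>M b)+\<^sub>M b)+\<^sub>M c = a"
 using assms by simp

lemma biresolving_infinity_cotorsionfree:
 fixes A :: "('a, 'u) module"
 assumes bi: "biresolving La (fg_module La) C" "A\<in>C"
 shows "infinity_cotorsionfree R La E A"
proof -
 have fg: "fg_module La A" by (rule biresolvingD(1)[OF bi])
 obtain i and I :: "nat => ('a, 'u) module" and f where I: "ALL n. fg_module La (I n) & injm La (I n)"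
  and i: "i:Hom La A (I 0)" "inj_on i |A|" and f: "f:Hom La (I 0) (I 1)"
  and ker: "i ` |A| = {x\<in>|I 0|. f x = 0\<^sub>(I 1)}"
  and C: "cTr R La E A = quot_module (HD (I 1)) (HDm (I 0) f ` |HD (I 0)| )"
  using cTr_presentation[OF fg] by (elim exE conjE)
 obtain J d Z k q where J01: "J 0 = I 1" "J (Suc 0) = I 0" "d 0 = f" and Z: "cycle_complex J d Z k q"
  using biresolving_complex[OF bi I i f ker] by (elim exE conjE)
 note X = HD_complex[OF Z]
 note A = Z[unfolded cycle_complex_def]
 note J = A[THEN conjunct1] and d = A[THEN conjunct2, THEN conjunct1]
 have Jm: "lmod La (J n)" for n using J fg_left_module by blast
 define Q where "Q n = HD (J n)" for n
 define w where "w n = HDm (J (Suc n)) (d n)" for n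
 have Qm: "lmod La (Q n)" for n unfolding Q_def by (rule HD_module[OF Jm])
 have w: "w n:Hom La (Q (Suc n)) (Q n)" for n unfolding Q_def w_def by (rule HDm_hom[OF Jm Jm d[rule_format]])
 have ww: "w n (w (Suc n) x) = 0\<^sub>(Q n)" if "x\<in>|Q (Suc (Suc n))|" for n x
  using X(1) that unfolding Q_def w_def .
 have wex: "y\<in>w (Suc n) ` |Q (Suc (Suc n))|" if "y\<in>|Q (Suc n)|" "w n y = 0\<^sub>(Q n)" for n y
  using X(2) that unfolding Q_def w_def .
 have Qex: "ALL u:TF (Q (Suc n)). Tmap (w n) u\<in>TK (Q n) --> (EX v:TF (Q (Suc (Suc n))). u - Tmap (w (Suc n)) v\<in>TK (Q (Suc n)))" for n
  using X(3) unfolding Q_def w_def by (intro ballI impI)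
 have small: "|Q n|\<lesssim>(UNIV :: 'u set)" for n unfolding Q_def using J fg_small[OF HD_fg] by blast
 let ?C = "cTr R La E A" and ?B = "w 0 ` |Q (Suc 0)|"
 have C': "?C = quot_module (Q 0) ?B" unfolding C Q_def w_def J01 ..
 have "submodule ?B La (Q 0)" by (rule submodule_image[OF Qm Qm w left_module.submodule_carrier[OF Qm]])
 note quot = left_module_quot[OF Qm this, folded C']
 let ?r = "\<lambda>x\<in>|Q 0|. ?B +>\<^bsub>Q 0\<^esub> x"
 have r0: "?r x = 0\<^sub>?C <-> x\<in>?B" if "x\<in>|Q 0|" for x using quot(4)[OF that] unfolding restrict_apply'[OF that] .
 have "fg_module La (Q 0)" unfolding Q_def using J HD_fg by blast
 from fg_image[OF this quot(1-3)] have Cfg: "fg_module La ?C" .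
 obtain P :: "nat => ('a, 'u) module" and e z where P: "projective_resolution La ?C P e z"
  and Tor: "ALL n. trivial_group (Tor La (Suc n) DR ?C :: (('a => 'u)\<times>'u \<Rightarrow>\<^sub>0 int) set set monoid) <->
   (ALL u:TF (P (Suc n)). Tmap (e n) u\<in>TK (P n) --> (EX v:TF (P (Suc (Suc n))). u - Tmap (e (Suc n)) v\<in>TK (P (Suc n))))"
  using Tor_resolution[OF Cfg] by (elim exE conjE)
 note D = projective_resolutionD[OF P]
 note Pm = D(1)[rule_format] and e = D(3)[rule_format] and cl = hom_cl
 interpret C: left_module La ?C by (rule quot)
 have ee: "e n (e (Suc n) x) = 0\<^sub>(P n)" if "x\<in>|P (Suc (Suc n))|" for n x
  using D(7)[of n] imageI[OF that, of "e (Suc n)"] by simp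
 have eex: "y\<in>e (Suc n) ` |P (Suc (Suc n))|" if "y\<in>|P (Suc n)|" "e n y = 0\<^sub>(P n)" for n y
  unfolding D(7) using that by blast
 have ze: "z (e 0 x) = 0\<^sub>?C" if "x\<in>|P (Suc 0)|" for x using D(6) imageI[OF that, of "e 0"] by simp
 \<comment> \<open>Maps from \<open>P n\<close> lift by projectivity, maps from \<open>Q n\<close>
   by the dual basis of \<open>HD (J n)\<close>; this feeds the comparison lemma in both
   directions.\<close>
 have liftP: "EX h:Hom La (P n) (Q (Suc m)). ALL x:|P n|. w m (h x) = g x"
  if "g:Hom La (P n) (Q m)" "ALL x:|P n|. g x\<in>w m ` |Q (Suc m)|" for n m g
  by (rule projective_lift_image[OF D(2) Qm Qm small w that])
 have liftQ: "EX h:Hom La (Q n) (P (Suc m)). ALL x:|Q n|. e m (h x) = g x"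
  if "g:Hom La (Q n) (P m)" "ALL x:|Q n|. g x\<in>e m ` |P (Suc m)|" for n m g
 proof -
  obtain S :: "('u => 'u) set" and a b where "DL_basis (J n) S a b" using ex_DL_basis[of "J n"] J by blast
  from HD_lift_image[OF this Pm Pm e, folded Q_def, OF that] show ?thesis .
 qed
 have smallP: "|P n|\<lesssim>(UNIV :: 'u set)" for n by (simp add: subset_imp_lepoll)
 have liftPP: "EX h:Hom La (P n) (P (Suc m)). ALL x:|P n|. e m (h x) = g x"
  if "g:Hom La (P n) (P m)" "ALL x:|P n|. g x\<in>e m ` |P (Suc m)|" for n m g
  by (rule projective_lift_image[OF D(2) Pm Pm smallP e that])
 have "ALL x:|P 0|. z x\<in>?r ` |Q 0|" unfolding quot(3) by (intro ballI cl[OF D(4)])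
 from projective_lift_image[OF D(2) Qm quot(1) small quot(2) D(4) this]
 obtain f0 where f0: "f0:Hom La (P 0) (Q 0)" "ALL x:|P 0|. ?r (f0 x) = z x" by (rule bexE)
 have f0e: "ALL x:|P (Suc 0)|. f0 (e 0 x)\<in>?B"
 proof
  fix x assume x: "x\<in>|P (Suc 0)|"
  have "?r (f0 (e 0 x)) = 0\<^sub>?C" unfolding bspec[OF f0(2) cl[OF e x]] by (rule ze[OF x])
  thus "f0 (e 0 x)\<in>?B" unfolding r0[OF cl[OF f0(1) cl[OF e x]]] .
 qed
 have "EX F. F 0 = f0 & (ALL n. F n:Hom La (P n) (Q n)) & (ALL n. ALL x:|P (Suc n)|. w n (F (Suc n) x) = F n (e n x))"
  by (rule chain_map_ex[where U = P and Y = Q and dU = e and dY = w and ?f0.0 = f0])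
   (fact D(1) D(3) f0(1) f0e | intro allI ballI impI, (elim conjE)?, (rule Qm ee wex liftP; assumption?))+
 then obtain F where F: "F 0 = f0" "!!n. F n:Hom La (P n) (Q n)" "!!n. ALL x:|P (Suc n)|. w n (F (Suc n) x) = F n (e n x)"
  by blast
 obtain S :: "('u => 'u) set" and a b where B: "DL_basis (J 0) S a b" using ex_DL_basis[of "J 0"] J by blast
 have "ALL x:|Q 0|. ?r x\<in>z ` |P 0|" unfolding D(5) by (intro ballI cl[OF quot(2)])
 from HD_lift_image[OF B Pm quot(1) D(4), folded Q_def, OF quot(2) this]
 obtain g0 where g0: "g0:Hom La (Q 0) (P 0)" "ALL x:|Q 0|. z (g0 x) = ?r x" by (rule bexE)
 have g0w: "ALL x:|Q (Suc 0)|. g0 (w 0 x)\<in>e 0 ` |P (Suc 0)|"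
  unfolding D(6)
 proof (intro ballI CollectI conjI)
  fix x assume x: "x\<in>|Q (Suc 0)|"
  show "g0 (w 0 x)\<in>|P 0|" by (rule cl[OF g0(1) cl[OF w x]])
  show "z (g0 (w 0 x)) = 0\<^sub>?C" unfolding bspec[OF g0(2) cl[OF w x]] r0[OF cl[OF w x]] using x by (rule imageI)
 qed
 have "EX G. G 0 = g0 & (ALL n. G n:Hom La (Q n) (P n)) & (ALL n. ALL x:|Q (Suc n)|. e n (G (Suc n) x) = G n (w n x))"
  by (rule chain_map_ex[where U = Q and Y = P and dU = w and dY = e and ?f0.0 = g0])
   (fact D(1) g0(1) g0w | intro allI ballI impI, (elim conjE)?, (rule Qm w ww eex liftQ; assumption?))+
 then obtain G where G: "G 0 = g0" "!!n. G n:Hom La (Q n) (P n)" "!!n. ALL x:|Q (Suc n)|. e n (G (Suc n) x) = G n (w n x)"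
  by blast
 \<comment> \<open>Exactness is transferred from \<open>Q\<close> to \<open>P\<close>, so a homotopy
   to the identity is constructed for the composite on \<open>P\<close>.\<close>
 define \<phi> where "\<phi> n = (\<lambda>x\<in>|P n|. compose |P n| (G n) (F n) x-\<^sub>(P n) (\<lambda>x\<in>|P n|. x) x)" for n
 have \<phi>: "\<phi> n:Hom La (P n) (P n)" for n
  unfolding \<phi>_def by (rule minus_hom[OF Pm Pm compose_hom[OF Pm F(2) G(2)] id_hom[OF Pm]])
 have \<phi>eq: "\<phi> n x = G n (F n x)-\<^sub>(P n) x" if "x\<in>|P n|" for n x
  unfolding \<phi>_def restrict_apply'[OF that] compose_eq[OF that] ..
 have GF: "G n (F n x)\<in>|P n|" if "x\<in>|P n|" for n x by (rule cl[OF G(2) cl[OF F(2) that]])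
 have \<phi>0: "ALL x:|P 0|. \<phi> 0 x\<in>e 0 ` |P (Suc 0)|"
  unfolding D(6)
 proof (intro ballI CollectI conjI cl[OF \<phi>])
  fix x assume x: "x\<in>|P 0|"
  have "z (G 0 (F 0 x)) = z x" unfolding G(1) F(1) bspec[OF g0(2) cl[OF f0(1) x]] by (rule bspec[OF f0(2) x])
  thus "z (\<phi> 0 x) = 0\<^sub>?C"
   unfolding \<phi>eq[OF x] hom_minus[OF Pm quot(1) D(4) GF[OF x] x] using C.diff_eq_zero_iff[OF cl[OF D(4) x] cl[OF D(4) x]] by simp
 qed
 have \<phi>e: "e n (\<phi> (Suc n) x) = \<phi> n (e n x)" if x: "x\<in>|P (Suc n)|" for n x
  unfolding \<phi>eq[OF x] \<phi>eq[OF cl[OF e x]] hom_minus[OF Pm Pm e GF[OF x] x] bspec[OF G(3) cl[OF F(2) x]] bspec[OF F(3) x] ..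
 have "EX h. (ALL n. h n:Hom La (P n) (P (Suc n))) &
   (ALL n. ALL x:|P (Suc n)|. e (Suc n) (h (Suc n) x) = \<phi> (Suc n) x-\<^sub>(P (Suc n)) h n (e n x))"
  by (rule homotopy_ex[where U = P and d = e and \<phi> = \<phi>])
   (fact D(1) D(3) \<phi>0 | intro allI ballI impI, (elim conjE)?, (rule \<phi> ee eex liftPP \<phi>e; assumption?))+
 then obtain h where h: "!!n. h n:Hom La (P n) (P (Suc n))"
  "!!n. ALL x:|P (Suc n)|. e (Suc n) (h (Suc n) x) = \<phi> (Suc n) x-\<^sub>(P (Suc n)) h n (e n x)" by blast
 have hGF: "ALL x:|P (Suc n)|. G (Suc n) (F (Suc n) x) = (e (Suc n) (h (Suc n) x)+\<^sub>(P (Suc n)) h n (e n x))+\<^sub>(P (Suc n)) x" for n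
 proof
  fix x assume x: "x\<in>|P (Suc n)|"
  show "G (Suc n) (F (Suc n) x) = (e (Suc n) (h (Suc n) x)+\<^sub>(P (Suc n)) h n (e n x))+\<^sub>(P (Suc n)) x"
   unfolding bspec[OF h(2) x] \<phi>eq[OF x] by (rule left_module.sub_add_cancel[OF Pm GF[OF x] cl[OF h(1) cl[OF e x]] x, symmetric])
 qed
 have T: "trivial_group (Tor La (Suc n) DR ?C :: (('a => 'u)\<times>'u \<Rightarrow>\<^sub>0 int) set set monoid)" for n
  unfolding Tor[rule_format]
  by (intro ballI impI)
   (rule tensor_exact_transfer[where ?P0.0 = "P n" and ?P1.0 = "P (Suc n)" and ?P2.0 = "P (Suc (Suc n))" and ?Q0.0 = "Q n" and
     ?Q1.0 = "Q (Suc n)" and ?Q2.0 = "Q (Suc (Suc n))" and ?d0.0 = "e n" and ?d1.0 = "e (Suc n)" and ?e0.0 = "w n" and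
     ?e1.0 = "w (Suc n)" and ?f0.0 = "F n" and ?f1.0 = "F (Suc n)" and ?g1.0 = "G (Suc n)" and ?g2.0 = "G (Suc (Suc n))" and
     ?h0.0 = "h n" and ?h1.0 = "h (Suc n)", OF Pm Pm Pm Qm Qm Qm e e w w F(2) F(2) F(3) G(2) G(2) G(3) h(1) h(1) hGF Qex])
 show ?thesis
  unfolding infinity_cotorsionfree_def cotorsionfree_def
 proof (intro allI impI)
  fix n i :: nat assume "1 <= i & i <= n"
  thus "trivial_group (Tor La i DR ?C :: (('a => 'u)\<times>'u \<Rightarrow>\<^sub>0 int) set set monoid)" using T[of "i - 1"] by simp
 qed
qed

end

theorem theorem5p7:
 fixes R :: "('r, 'x) ring_scheme"
  and \<Lambda> :: "('r, 'a) module"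
  and E :: "('r, 'u) module"
  and \<G>\<I> :: "('a, 'u) module set"
 assumes "artin_algebra R \<Lambda>"
  and "infinite (UNIV :: 'u set)"
  and "carrier R \<lesssim> (UNIV :: 'u set)"
  and "\<exists>\<iota>. injective_envelope R (residue_module R) E \<iota>"
  and "\<G>\<I> = GI \<Lambda>"
 shows "(right_orthogonal \<Lambda> (left_orthogonal \<Lambda> \<G>\<I>) = \<G>\<I> \<longleftrightarrow>
      cotorsion_pair \<Lambda> (left_orthogonal \<Lambda> \<G>\<I>) \<G>\<I>) \<and>
     (right_orthogonal \<Lambda> (left_orthogonal \<Lambda> \<G>\<I>) = \<G>\<I> \<longleftrightarrow>
      (\<forall>A \<in> right_orthogonal \<Lambda> (left_orthogonal \<Lambda> \<G>\<I>). cotorsionfree R \<Lambda> E 1 A)) \<and>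
     ((\<forall>A \<in> right_orthogonal \<Lambda> (left_orthogonal \<Lambda> \<G>\<I>). cotorsionfree R \<Lambda> E 1 A) \<longleftrightarrow>
      (\<forall>A \<in> right_orthogonal \<Lambda> (left_orthogonal \<Lambda> \<G>\<I>). infinity_cotorsionfree R \<Lambda> E A))"
proof -
 obtain \<iota> where \<iota>: "injective_envelope R (residue_module R) E \<iota>" using assms(4) by blast
 interpret artin_alg R \<Lambda> E \<iota> using assms(1-3) \<iota> by (simp add: artin_alg_def)
 let ?Y = "right_orthogonal \<Lambda> (left_orthogonal \<Lambda> \<G>\<I>)"
 \<comment> \<open>The left half of a cotorsion pair holds by definition of the left orthogonal
   class, so only the condition on the right half remains.\<close>
 have pair: "?Y = \<G>\<I> \<longleftrightarrow> cotorsion_pair \<Lambda> (left_orthogonal \<Lambda> \<G>\<I>) \<G>\<I>"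
  unfolding cotorsion_pair_def assms(5) by (auto simp: left_orthogonal_def GI_def)
 have 21: "?Y = \<G>\<I>" if cf: "\<forall>A\<in>?Y. cotorsionfree R \<Lambda> E 1 A"
 proof
  show "\<G>\<I> \<subseteq> ?Y" unfolding assms(5) by (rule GI_subset_double_orthogonal)
  have "\<forall>A\<in>?Y. DL_generated A"
   using cf by (intro ballI cotorsionfree_DL_generated) (simp_all add: mem_right_orthogonal)
  \<comment> \<open>The double orthogonal class itself is the biresolving class that witnesses
    Gorenstein injectivity of its members.\<close>
  from biresolving_double_orthogonal[OF this[unfolded assms(5)]]
  show "?Y \<subseteq> \<G>\<I>" unfolding assms(5) using GI_iff_biresolving by blast
 qed
 have 13: "\<forall>A\<in>?Y. infinity_cotorsionfree R \<Lambda> E A" if "?Y = \<G>\<I>"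
  unfolding that unfolding assms(5) GI_iff_biresolving Ball_def using biresolving_infinity_cotorsionfree by blast
 have 32: "\<forall>A\<in>?Y. cotorsionfree R \<Lambda> E 1 A" if "\<forall>A\<in>?Y. infinity_cotorsionfree R \<Lambda> E A"
  using that by (simp add: infinity_cotorsionfree_def)
 show ?thesis using pair 21 13 32 by blast
qed

end
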